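(* For a field $K$ of characteristic $0$ let $M(K)=\max_X J(\operatorname{Aut}(X))$, where the maximum is taken over all smooth rational quadrics $X$ in $\mathbb{P}^3_K$. Then $$M(\mathbb{Q})=8,\quad M(\mathbb{R})=60,\quad M(\mathbb{Q}(i))=120,\quad M(\mathbb{Q}(\sqrt{-7}))=120,\quad M(\mathbb{C})=7200.$$
   Context: For a finite group $G$, the Jordan constant $J(G)$ is the smallest index of a normal abelian subgroup of $G$. An arbitrary group $\Gamma$ is called Jordan if $J(\Gamma)=\sup\{J(G) : G\subseteq\Gamma,\ |G|<\infty\}$ is finite, and then $J(\Gamma)$ is called the Jordan constant of $\Gamma$. $\operatorname{Aut}(X)$ is the group of automorphisms of $X$ as a variety over $K$. A quadric in $\mathbb{P}^3_K$ is a surface defined by a quadratic form over $K$; "rational" means rational over $K$ (birational to $\mathbb{P}^2_K$ over $K$); a smooth two-dimensional quadric is rational if and only if it contains a $K$-rational point. *)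

theory Defs
  imports
    "HOL-Algebra.Algebra"
    "HOL-Algebra.Algebraic_Closure_Type"
    "HOL-Analysis.Cartesian_Space"
    "HOL-Library.Extended_Nat"
    "HOL-Library.Numeral_Type"
    "HOL-Computational_Algebra.Fundamental_Theorem_Algebra"
begin

section \<open>Jordan constants\<close>

definition jordan_finite :: "('a, 'b) monoid_scheme \<Rightarrow> nat" where
  "jordan_finite G =
     (LEAST n. \<exists>N. normal N G \<and> comm_group (G\<lparr>carrier := N\<rparr>) \<and> n = card (rcosets\<^bsub>G\<^esub> N))"

text \<open>Values are in \<open>enat\<close>, so the supremum always exists; \<open>\<Gamma>\<close> is Jordan iff it is finite.\<close>

definition jordan_constant :: "('a, 'b) monoid_scheme \<Rightarrow> enat" where
  "jordan_constant \<Gamma> =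
     (SUP H \<in> {H. subgroup H \<Gamma> \<and> finite H}. enat (jordan_finite (\<Gamma>\<lparr>carrier := H\<rparr>)))"

section \<open>Varieties over a field\<close>

text \<open>
  The base field is a subfield \<open>K\<close> of an algebraically closed ambient field, which is the type
  \<open>'a\<close> (of characteristic zero for the fields considered here; it need not be algebraic over
  \<open>K\<close>, so that the complex numbers serve for all their subfields). A variety over \<open>K\<close> is
  identified with its set of points over the ambient field, and everything "over \<open>K\<close>" is
  expressed by polynomials with coefficients in \<open>K\<close>.

  A point of projective space is the set of all its vectors of homogeneous coordinates; the
  coordinates are indexed by \<open>'n\<close>, so the dimension is \<open>CARD('n) - 1\<close>.
\<close>

definition proj_point :: "'a::field ^ 'n \<Rightarrow> ('a ^ 'n) set" where
  "proj_point v = {c *s v | c. c \<noteq> 0}"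

definition proj_space :: "('a::field ^ 'n) set set" where
  "proj_space = {proj_point v | v. v \<noteq> 0}"

text \<open>
  Homogeneous polynomials of degree \<open>d\<close> over \<open>K\<close>, as polynomial functions on the ambient
  affine space (no information is lost, since an algebraically closed field is infinite).
\<close>

definition homog_polys :: "'a::field set \<Rightarrow> nat \<Rightarrow> ('a ^ 'n::finite \<Rightarrow> 'a) set" where
  "homog_polys K d =
     {\<lambda>x. \<Sum>m | (\<Sum>i\<in>UNIV. m i) = d. c m * (\<Prod>i\<in>UNIV. x $ i ^ m i) | c. range c \<subseteq> K}"

definition zariski_open_in :: "'a::field set \<Rightarrow> ('a ^ 'n::finite) set set \<Rightarrow> ('a ^ 'n) set set \<Rightarrow> bool" where
  "zariski_open_in K Z U \<longleftrightarrow>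
     (\<exists>S \<subseteq> (\<Union>d. homog_polys K d). U = {p \<in> Z. \<exists>G\<in>S. \<forall>v\<in>p. G v \<noteq> 0})"

text \<open>
  Morphisms over \<open>K\<close> between (locally closed) subsets of projective spaces: around every
  point the map is given by forms of one common degree with coefficients in \<open>K\<close>. The
  elements of \<open>\<Union>U\<close> are the homogeneous coordinate vectors of the points of \<open>U\<close>.
\<close>

definition regular_map ::
  "'a::field set \<Rightarrow> ('a ^ 'n::finite) set set \<Rightarrow> ('a ^ 'm) set set \<Rightarrow>
   (('a ^ 'n) set \<Rightarrow> ('a ^ 'm) set) \<Rightarrow> bool" where
  "regular_map K U V f \<longleftrightarrow> f \<in> U \<rightarrow> V \<and>
     (\<forall>v\<in>\<Union>U. \<exists>d F. (\<forall>i. (\<lambda>x. F x $ i) \<in> homog_polys K d) \<and> F v \<noteq> 0 \<and>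
        (\<forall>w\<in>\<Union>U. F w \<noteq> 0 \<longrightarrow> f (proj_point w) = proj_point (F w)))"

definition aut_group :: "'a::field set \<Rightarrow> ('a ^ 'n::finite) set set \<Rightarrow>
    (('a ^ 'n) set \<Rightarrow> ('a ^ 'n) set) monoid" where
  "aut_group K Z = (BijGroup Z)
     \<lparr>carrier := {f \<in> Bij Z. regular_map K Z Z f \<and> regular_map K Z Z (inv_into Z f)}\<rparr>"

text \<open>
  This is meant for irreducible \<open>Z\<close> and \<open>W\<close>, where nonempty open subsets are dense; smooth
  quadric surfaces and projective spaces are irreducible.
\<close>

definition birational_over ::
  "'a::field set \<Rightarrow> ('a ^ 'n::finite) set set \<Rightarrow> ('a ^ 'm::finite) set set \<Rightarrow> bool" where
  "birational_over K Z W \<longleftrightarrow>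
     (\<exists>U V f g. zariski_open_in K Z U \<and> U \<noteq> {} \<and> zariski_open_in K W V \<and> V \<noteq> {} \<and>
        regular_map K U V f \<and> regular_map K V U g \<and>
        (\<forall>p\<in>U. g (f p) = p) \<and> (\<forall>q\<in>V. f (g q) = q))"

definition rational_surface_over :: "'a::field set \<Rightarrow> ('a ^ 'n::finite) set set \<Rightarrow> bool" where
  "rational_surface_over K Z \<longleftrightarrow> birational_over K Z (proj_space :: ('a ^ 3) set set)"

section \<open>Quadrics\<close>

text \<open>The coefficient matrix of a quadratic form is not required to be symmetric.\<close>

definition quad_form :: "'a::field ^ 'n ^ 'n \<Rightarrow> 'a ^ 'n::finite \<Rightarrow> 'a" where
  "quad_form A x = (\<Sum>i\<in>UNIV. \<Sum>j\<in>UNIV. A $ i $ j * x $ i * x $ j)"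

definition quad_form_partial :: "'a::field ^ 'n ^ 'n \<Rightarrow> 'n::finite \<Rightarrow> 'a ^ 'n \<Rightarrow> 'a" where
  "quad_form_partial A k x = (\<Sum>j\<in>UNIV. (A $ k $ j + A $ j $ k) * x $ j)"

definition quadric :: "'a::field ^ 'n ^ 'n \<Rightarrow> ('a ^ 'n::finite) set set" where
  "quadric A = {proj_point v | v. v \<noteq> 0 \<and> quad_form A v = 0}"

text \<open>
  Smoothness is the Jacobian criterion at all points over the ambient algebraically closed
  field. The zero form is thereby excluded.
\<close>

definition smooth_quadric_surface :: "'a::field set \<Rightarrow> ('a ^ 4) set set \<Rightarrow> bool" where
  "smooth_quadric_surface K Z \<longleftrightarrow>
     (\<exists>A :: 'a ^ 4 ^ 4. (\<forall>i j. A $ i $ j \<in> K) \<and> Z = quadric A \<and>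
        (\<forall>v. v \<noteq> 0 \<and> quad_form A v = 0 \<longrightarrow> (\<exists>k. quad_form_partial A k v \<noteq> 0)))"

text \<open>
  \<open>is_max_jordan K m\<close> says that the maximum \<open>M(K)\<close> exists (so it is attained) and
  equals \<open>m\<close>.
\<close>

definition is_max_jordan :: "'a::{alg_closed_field, field_char_0} set \<Rightarrow> enat \<Rightarrow> bool" where
  "is_max_jordan K m \<longleftrightarrow>
     (\<exists>Z. smooth_quadric_surface K Z \<and> rational_surface_over K Z \<and>
        jordan_constant (aut_group K Z) = m) \<and>
     (\<forall>Z. smooth_quadric_surface K Z \<and> rational_surface_over K Z \<longrightarrow>
        jordan_constant (aut_group K Z) \<le> m)"

text \<open>The field \<open>\<rat>(\<alpha>)\<close>; in characteristic zero every subfield contains \<open>\<rat>\<close>.\<close>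

definition rat_adjoin :: "'a::field_char_0 \<Rightarrow> 'a set" where
  "rat_adjoin \<alpha> = generate_field ring_of_type_algebra (insert \<alpha> \<rat>)"

end

theory Submission
  imports Defs "HOL-Computational_Algebra.Polynomial_Factorial" "HOL-Computational_Algebra.Field_as_Ring"
begin

text \<open>
  A smooth quadric with a \<open>K\<close>-point is \<open>x\<^sub>1 x\<^sub>2 = x\<^sub>3\<^sup>2 - d x\<^sub>4\<^sup>2\<close> in suitable coordinates over \<open>K\<close>, so over
  \<open>\<complex>\<close> it is a product of two projective lines. A morphism from the product to a line is given by one pair
  of coprime bihomogeneous forms; comparing bidegrees shows that every automorphism is a pair of Moebius
  transformations, possibly followed by the exchange of the factors. The automorphism group over \<open>K\<close> thus lies
  in the wreath product of \<open>PGL\<^sub>2(\<complex>)\<close> with a group of order two, as the elements that preserve rationality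
  of points.

  Upper bounds come from counting fixed points of a finite Moebius group: it has an abelian normal subgroup of
  index at most two, or small order, and elements of order five require \<open>sqrt 5\<close> in the field. For \<open>K \<subseteq> \<real>\<close> and
  \<open>d < 0\<close> the second component of an automorphism is conjugate to the first, and an invariant Hermitian form
  provides an antipodal map that turns orientation reversing elements into Moebius transformations.

  Lower bounds come from the symmetric group of degree five acting on \<open>\<Sum> x\<^sub>i = \<Sum> x\<^sub>i\<^sup>2 = 0\<close>, a quadric with
  points over \<open>\<rat>(\<i>)\<close> and \<open>\<rat>(sqrt -7)\<close>. Over \<open>\<complex>\<close>, one of the two projections is injective on its subgroup of
  index at most two preserving the rulings; the image \<open>G\<close> has order at least 60 and no nontrivial abelian
  normal subgroup. Then \<open>G wr 2\<close> gives 7200 over \<open>\<complex>\<close>, the pairs of \<open>a \<in> G\<close> with its complex conjugate give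
  60 over \<open>\<real>\<close>, and \<open>S\<^sub>3 wr 2\<close> gives 8 over \<open>\<rat>\<close>.
\<close>

section \<open>Finite groups of bijections\<close>

text \<open>Whether \<open>\<delta>\<close>, a square root of \<open>d\<close>, lies in
  \<open>K\<close> decides the bound. If it does, both rulings are defined over \<open>K\<close>,
  and a finite group is assembled from two finite subgroups of PGL_2(K) and the exchange:
  \<open>2 * 60 * 60\<close> = 7200 at worst, \<open>2 * 6 * 6\<close> = 72 when \<open>K\<close>
  contains no square root of 5, and \<open>2 * 2 * 2\<close> = 8 over the reals, where finite
  Moebius groups are cyclic or dihedral. If it does not, an automorphism with one trivial component
  is trivial, so the part that preserves the rulings embeds into a single Moebius group; this bounds
  the order by \<open>2 * 60\<close> = 120 unless there are large abelian normal subgroups. Over the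
  rationals, \<open>d > 0\<close> is treated inside the reals, and for \<open>d < 0\<close> the
  field generated by \<open>\<delta>\<close> has no square root of 5.

  Galois descent is replaced by a test on points: a morphism over \<open>K\<close> maps points over
  \<open>L\<close> to points over \<open>L\<close>, for every field \<open>L\<close> between
  \<open>K\<close> and the complex numbers. Applied to three points of the diagonal, the test
  controls the coefficients of the Moebius maps.\<close>

abbreviation finv :: "('a \<Rightarrow> 'b) \<Rightarrow> 'b \<Rightarrow> 'a" where
  "finv f \<equiv> inv_into UNIV f"

definition fgrp :: "('a \<Rightarrow> 'a) set \<Rightarrow> bool" where
  "fgrp G \<longleftrightarrow> finite G \<and> id \<in> G \<and> (\<forall>f\<in>G. \<forall>g\<in>G. f \<circ> g \<in> G) \<and> (\<forall>f\<in>G. bij f)"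

definition normal_abelian :: "('a \<Rightarrow> 'a) set \<Rightarrow> ('a \<Rightarrow> 'a) set \<Rightarrow> bool" where
  "normal_abelian G N \<longleftrightarrow> N \<subseteq> G \<and> id \<in> N \<and> (\<forall>f\<in>N. \<forall>g\<in>N. f \<circ> g \<in> N \<and> f \<circ> g = g \<circ> f) \<and>
     (\<forall>g\<in>G. \<forall>n\<in>N. g \<circ> n \<circ> finv g \<in> N)"

text \<open>By Lagrange, \<open>card G \<le> k * card N\<close> says that \<open>N\<close> has index
  at most \<open>k\<close>; comparing orders spares the cosets in most arguments.\<close>

definition jordan_le :: "('a \<Rightarrow> 'a) set \<Rightarrow> nat \<Rightarrow> bool" where
  "jordan_le G k \<longleftrightarrow> (\<exists>N. normal_abelian G N \<and> card G \<le> k * card N)"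

lemma fgrpD:
  assumes "fgrp G"
  shows "finite G" "id \<in> G" "\<And>f g. f \<in> G \<Longrightarrow> g \<in> G \<Longrightarrow> f \<circ> g \<in> G" "\<And>f. f \<in> G \<Longrightarrow> bij f"
  using assms unfolding fgrp_def by auto

text \<open>Left multiplication by \<open>f\<close> is injective on the finite set \<open>G\<close>,
  hence onto, so some \<open>g\<close> in \<open>G\<close> is mapped to \<open>id\<close>.\<close>

lemma fgrp_inv:
  assumes "fgrp G" "f \<in> G"
  shows "finv f \<in> G"
proof -
  have b: "bij f" using fgrpD[OF assms(1)] assms(2) by auto
  have "inj_on (\<lambda>g. f \<circ> g) G"
    using b by (auto simp: inj_on_def fun_eq_iff bij_def inj_def)
  moreover have "(\<lambda>g. f \<circ> g) ` G \<subseteq> G" using fgrpD[OF assms(1)] assms(2) by auto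
  ultimately have "(\<lambda>g. f \<circ> g) ` G = G" using fgrpD(1)[OF assms(1)] endo_inj_surj by blast
  then obtain g where "g \<in> G" "f \<circ> g = id" using fgrpD(2)[OF assms(1)] by (metis imageE)
  then show ?thesis using b
    by (metis bij_is_inj comp_assoc comp_id id_comp inv_o_cancel)
qed

lemma inv_o_bij: "bij f \<Longrightarrow> finv f \<circ> f = id" "bij f \<Longrightarrow> f \<circ> finv f = id"
  by (auto simp: bij_def fun_eq_iff surj_f_inv_f)

lemma inv_apply_bij: "bij f \<Longrightarrow> finv f (f x) = x" "bij f \<Longrightarrow> f (finv f y) = y"
  by (auto simp: bij_def surj_f_inv_f)

lemma fgrp_subset:
  assumes "fgrp G" "H \<subseteq> G" "id \<in> H" "\<And>f g. f \<in> H \<Longrightarrow> g \<in> H \<Longrightarrow> f \<circ> g \<in> H"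
  shows "fgrp H"
  using assms unfolding fgrp_def by (auto intro: finite_subset)

lemma normal_abelianD:
  assumes "normal_abelian G N"
  shows "N \<subseteq> G" "id \<in> N" "\<And>f g. f \<in> N \<Longrightarrow> g \<in> N \<Longrightarrow> f \<circ> g \<in> N"
    "\<And>f g. f \<in> N \<Longrightarrow> g \<in> N \<Longrightarrow> f \<circ> g = g \<circ> f"
    "\<And>g n. g \<in> G \<Longrightarrow> n \<in> N \<Longrightarrow> g \<circ> n \<circ> finv g \<in> N"
  using assms unfolding normal_abelian_def by auto

lemma normal_abelian_fgrp: "fgrp G \<Longrightarrow> normal_abelian G N \<Longrightarrow> fgrp N"
  by (rule fgrp_subset) (auto dest: normal_abelianD)

text \<open>Left multiplication by \<open>finv f\<close> moves the fibre through \<open>f\<close>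
  injectively into \<open>N\<close>. This count and its exact form \<open>card_eq_fibres\<close>
  serve cosets, orbits and the exchange of two factors alike, according to the choice of
  \<open>\<phi>\<close>.\<close>

lemma card_le_fibres:
  assumes "fgrp G" "finite N" "\<And>f g. f \<in> G \<Longrightarrow> g \<in> G \<Longrightarrow> \<phi> f = \<phi> g \<Longrightarrow> finv f \<circ> g \<in> N"
  shows "card G \<le> card (\<phi> ` G) * card N"
proof -
  have fin: "finite G" using fgrpD assms by auto
  have "card {g\<in>G. \<phi> g = s} \<le> card N" if "s \<in> \<phi> ` G" for s
  proof -
    from that obtain f where f: "f \<in> G" "s = \<phi> f" by auto
    have "bij f" using f fgrpD[OF assms(1)] by auto
    then have "inj_on (\<lambda>g. finv f \<circ> g) {g\<in>G. \<phi> g = s}"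
      by (auto simp: inj_on_def fun_eq_iff) (metis inv_apply_bij(2))
    then show ?thesis
      by (rule card_inj_on_le) (use assms f in auto)
  qed
  then have "(\<Sum>s\<in>\<phi> ` G. card {g\<in>G. \<phi> g = s}) \<le> card (\<phi> ` G) * card N"
    using sum_bounded_above[of "\<phi> ` G" "\<lambda>s. card {g\<in>G. \<phi> g = s}" "card N"] by auto
  moreover have "card G = (\<Sum>s\<in>\<phi> ` G. card {g\<in>G. \<phi> g = s})"
    using sum.group[of G "\<phi> ` G" \<phi> "\<lambda>_. 1::nat"] fin by simp
  ultimately show ?thesis by simp
qed

lemma card_eq_fibres:
  assumes "fgrp G" "N \<subseteq> G" "\<And>f g. f \<in> G \<Longrightarrow> g \<in> G \<Longrightarrow> \<phi> f = \<phi> g \<longleftrightarrow> finv f \<circ> g \<in> N"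
  shows "card G = card (\<phi> ` G) * card N"
proof -
  have fin: "finite G" using fgrpD assms by auto
  have "card {g\<in>G. \<phi> g = s} = card N" if "s \<in> \<phi> ` G" for s
  proof -
    from that obtain f where f: "f \<in> G" "s = \<phi> f" by auto
    have b: "bij f" using f fgrpD[OF assms(1)] by auto
    have "bij_betw (\<lambda>g. finv f \<circ> g) {g\<in>G. \<phi> g = s} N"
    proof (rule bij_betw_imageI)
      show "inj_on (\<lambda>g. finv f \<circ> g) {g\<in>G. \<phi> g = s}"
        using b by (auto simp: inj_on_def fun_eq_iff) (metis inv_apply_bij(2))
      show "(\<lambda>g. finv f \<circ> g) ` {g\<in>G. \<phi> g = s} = N"
      proof
        show "(\<lambda>g. finv f \<circ> g) ` {g\<in>G. \<phi> g = s} \<subseteq> N"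
          using assms(3)[OF f(1)] f(2) by (metis (mono_tags, lifting) image_subsetI mem_Collect_eq)
        show "N \<subseteq> (\<lambda>g. finv f \<circ> g) ` {g\<in>G. \<phi> g = s}"
        proof
          fix n assume n: "n \<in> N"
          have e: "finv f \<circ> (f \<circ> n) = n" using b by (auto simp: fun_eq_iff inv_apply_bij)
          have "f \<circ> n \<in> G" using n assms f fgrpD[OF assms(1)] by auto
          then have "f \<circ> n \<in> {g\<in>G. \<phi> g = s}" using assms(3)[OF f(1), of "f \<circ> n"] e n f by auto
          then show "n \<in> (\<lambda>g. finv f \<circ> g) ` {g\<in>G. \<phi> g = s}" using e by (metis (no_types, lifting) imageI)
        qed
      qed
    qed
    then show ?thesis using bij_betw_same_card by blast
  qed
  then have "(\<Sum>s\<in>\<phi> ` G. card {g\<in>G. \<phi> g = s}) = card (\<phi> ` G) * card N" by simp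
  moreover have "card G = (\<Sum>s\<in>\<phi> ` G. card {g\<in>G. \<phi> g = s})"
    using sum.group[of G "\<phi> ` G" \<phi> "\<lambda>_. 1::nat"] fin by simp
  ultimately show ?thesis by simp
qed

lemma coset_eq_iff:
  assumes "fgrp G" "fgrp N" "N \<subseteq> G" "f \<in> G" "g \<in> G"
  shows "(\<circ>) f ` N = (\<circ>) g ` N \<longleftrightarrow> finv f \<circ> g \<in> N"
proof
  have b: "bij f" "bij g" using assms fgrpD[OF assms(1)] by auto
  assume "(\<circ>) f ` N = (\<circ>) g ` N"
  moreover have "g \<in> (\<circ>) g ` N" using fgrpD(2)[OF assms(2)] by (intro image_eqI[of _ _ id]) auto
  ultimately obtain n where n: "n \<in> N" "g = f \<circ> n" by auto
  then show "finv f \<circ> g \<in> N" using b by (simp add: o_assoc inv_o_bij)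
next
  have b: "bij f" "bij g" using assms fgrpD[OF assms(1)] by auto
  assume n: "finv f \<circ> g \<in> N"
  define n' where "n' = finv f \<circ> g"
  have g: "g = f \<circ> n'" unfolding n'_def using b by (simp add: o_assoc inv_o_bij)
  have n': "n' \<in> N" "finv n' \<in> N" "bij n'"
    using n fgrp_inv[OF assms(2)] fgrpD[OF assms(2)] n'_def by auto
  have f: "f = g \<circ> finv n'" unfolding g using n'(3) by (simp add: comp_assoc inv_o_bij)
  show "(\<circ>) f ` N = (\<circ>) g ` N"
  proof
    show "(\<circ>) f ` N \<subseteq> (\<circ>) g ` N"
    proof (rule subsetI)
      fix x assume "x \<in> (\<circ>) f ` N"
      then obtain m where m: "m \<in> N" "x = f \<circ> m" by auto
      then have "x = g \<circ> (finv n' \<circ> m)" by (subst m(2), subst f, simp add: comp_assoc)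
      moreover have "finv n' \<circ> m \<in> N" using n' m fgrpD[OF assms(2)] by auto
      ultimately show "x \<in> (\<circ>) g ` N" by auto
    qed
    show "(\<circ>) g ` N \<subseteq> (\<circ>) f ` N"
    proof
      fix x assume "x \<in> (\<circ>) g ` N"
      then obtain m where m: "m \<in> N" "x = g \<circ> m" by auto
      then have "x = f \<circ> (n' \<circ> m)" by (subst m(2), subst g, simp add: comp_assoc)
      moreover have "n' \<circ> m \<in> N" using n' m fgrpD[OF assms(2)] by auto
      ultimately show "x \<in> (\<circ>) f ` N" by auto
    qed
  qed
qed

text \<open>Returns from orders to numbers of cosets, which are what multiplies for products and
  carries over to preimages.\<close>

lemma card_cosets_le:
  assumes "fgrp G" "normal_abelian G N" "card G \<le> k * card N"
  shows "card ((\<lambda>f. (\<circ>) f ` N) ` G) \<le> k"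
proof -
  have N: "fgrp N" "N \<subseteq> G" using assms normal_abelian_fgrp normal_abelianD by blast+
  have "card G = card ((\<lambda>f. (\<circ>) f ` N) ` G) * card N"
    by (rule card_eq_fibres[OF assms(1) N(2)]) (erule (1) coset_eq_iff[OF assms(1) N])
  moreover have "card N > 0" using fgrpD[OF N(1)] by (auto simp: card_gt_0_iff)
  ultimately show ?thesis using assms(3) by simp
qed

section \<open>The Jordan index of a finite group of bijections\<close>

lemma jordan_le_mono: "jordan_le G k \<Longrightarrow> k \<le> l \<Longrightarrow> jordan_le G l"
  unfolding jordan_le_def by (meson le_trans mult_le_mono1)

lemma jordan_le_card:
  assumes "fgrp G"
  shows "jordan_le G (card G)"
proof -
  have "normal_abelian G {id}"
    unfolding normal_abelian_def using fgrpD[OF assms] by (simp add: inv_o_bij)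
  then show ?thesis unfolding jordan_le_def by (intro exI[of _ "{id}"]) simp
qed

lemma jordan_le_abelian:
  assumes "fgrp G" "\<And>f g. f \<in> G \<Longrightarrow> g \<in> G \<Longrightarrow> f \<circ> g = g \<circ> f"
  shows "jordan_le G 1"
proof -
  have "normal_abelian G G"
    unfolding normal_abelian_def
  proof (intro conjI ballI)
    fix f g assume "f \<in> G" "g \<in> G"
    then show "f \<circ> g = g \<circ> f" by (rule assms(2))
  qed (use fgrpD[OF assms(1)] fgrp_inv[OF assms(1)] in simp_all)
  then show ?thesis unfolding jordan_le_def by (intro exI[of _ G]) simp
qed

lemma hom_inv:
  assumes "fgrp E" "\<And>f g. f \<in> E \<Longrightarrow> g \<in> E \<Longrightarrow> \<phi> (f \<circ> g) = \<phi> f \<circ> \<phi> g" "\<And>f. f \<in> E \<Longrightarrow> bij (\<phi> f)" "f \<in> E"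
  shows "\<phi> id = id" "\<phi> (finv f) = finv (\<phi> f)"
proof -
  have "\<phi> id = \<phi> id \<circ> \<phi> id" using assms(2)[of id id] fgrpD[OF assms(1)] by simp
  then have "finv (\<phi> id) \<circ> \<phi> id = finv (\<phi> id) \<circ> (\<phi> id \<circ> \<phi> id)" by (rule arg_cong)
  moreover have "finv (\<phi> id) \<circ> \<phi> id = id"
    by (rule inv_o_bij(1)[OF assms(3)[OF fgrpD(2)[OF assms(1)]]])
  ultimately show 1: "\<phi> id = id" by (metis o_assoc id_comp)
  have "\<phi> f \<circ> \<phi> (finv f) = \<phi> (f \<circ> finv f)"
    using assms(2)[OF assms(4) fgrp_inv[OF assms(1,4)]] by (rule sym)
  also have "\<dots> = id" using inv_o_bij(2)[OF fgrpD(4)[OF assms(1,4)]] 1 by simp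
  finally have "finv (\<phi> f) \<circ> (\<phi> f \<circ> \<phi> (finv f)) = finv (\<phi> f)" by simp
  then show "\<phi> (finv f) = finv (\<phi> f)"
    using inv_o_bij(1)[OF assms(3)[OF assms(4)]] by (metis o_assoc id_comp)
qed

lemma fgrp_image:
  assumes "fgrp E" "\<And>f g. f \<in> E \<Longrightarrow> g \<in> E \<Longrightarrow> \<phi> (f \<circ> g) = \<phi> f \<circ> \<phi> g" "\<And>f. f \<in> E \<Longrightarrow> bij (\<phi> f)"
  shows "fgrp (\<phi> ` E)"
proof -
  have "\<phi> id = id" by (rule hom_inv(1)[of E \<phi> id, OF assms fgrpD(2)[OF assms(1)]])
  then have "id \<in> \<phi> ` E" using fgrpD(2)[OF assms(1)] by (metis imageI)
  moreover have "f \<circ> g \<in> \<phi> ` E" if fg: "f \<in> \<phi> ` E" "g \<in> \<phi> ` E" for f g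
  proof -
    from fg obtain f' g' where "f' \<in> E" "g' \<in> E" "f = \<phi> f'" "g = \<phi> g'" by auto
    then show ?thesis using assms(2)[of f' g'] fgrpD(3)[OF assms(1)] by (metis imageI)
  qed
  ultimately show ?thesis
    unfolding fgrp_def using assms(3) fgrpD(1)[OF assms(1)] by auto
qed

text \<open>The preimage of an abelian normal subgroup \<open>N'\<close> is normal, and
  \<open>comm\<close> makes it abelian although \<open>\<phi>\<close> may have a kernel. The index
  does not grow, since two elements whose images lie in one coset of \<open>N'\<close> differ by an
  element of the preimage.\<close>

lemma jordan_le_preimage:
  assumes E: "fgrp E" and hom: "\<And>f g. f \<in> E \<Longrightarrow> g \<in> E \<Longrightarrow> \<phi> (f \<circ> g) = \<phi> f \<circ> \<phi> g"
    and bij: "\<And>f. f \<in> E \<Longrightarrow> bij (\<phi> f)"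
    and J: "jordan_le (\<phi> ` E) k"
    and comm: "\<And>f g. f \<in> E \<Longrightarrow> g \<in> E \<Longrightarrow> \<phi> f \<circ> \<phi> g = \<phi> g \<circ> \<phi> f \<Longrightarrow> f \<circ> g = g \<circ> f"
  shows "jordan_le E k"
proof -
  obtain N' where N': "normal_abelian (\<phi> ` E) N'" "card (\<phi> ` E) \<le> k * card N'"
    using J unfolding jordan_le_def by auto
  have F': "fgrp (\<phi> ` E)" by (rule fgrp_image[of E \<phi>, OF E hom bij])
  define N where "N = {f\<in>E. \<phi> f \<in> N'}"
  note D = normal_abelianD[OF N'(1)]
  have nab: "normal_abelian E N"
    unfolding normal_abelian_def
  proof (intro conjI ballI)
    show "N \<subseteq> E" "id \<in> N"
      using D(2) hom_inv(1)[of E \<phi> id, OF E hom bij fgrpD(2)[OF E]] fgrpD(2)[OF E] by (auto simp: N_def)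
    fix f g assume "f \<in> N" "g \<in> N"
    then show "f \<circ> g \<in> N" "f \<circ> g = g \<circ> f"
      using D(3,4) fgrpD(3)[OF E] comm hom by (auto simp: N_def)
  next
    fix g n assume "g \<in> E" "n \<in> N"
    then show "g \<circ> n \<circ> finv g \<in> N"
      using D(5)[of "\<phi> g" "\<phi> n"] hom_inv(2)[of E \<phi> g, OF E hom bij] fgrpD(3)[OF E] hom fgrp_inv[OF E]
      by (simp add: N_def)
  qed
  have FN': "fgrp N'" by (rule normal_abelian_fgrp[OF F' N'(1)])
  have "card E \<le> card ((\<lambda>f. (\<circ>) (\<phi> f) ` N') ` E) * card N"
  proof (rule card_le_fibres[OF E])
    show "finite N" unfolding N_def using fgrpD[OF E] by auto
    fix f g assume fg: "f \<in> E" "g \<in> E" "(\<circ>) (\<phi> f) ` N' = (\<circ>) (\<phi> g) ` N'"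
    then have "finv (\<phi> f) \<circ> \<phi> g \<in> N'" using coset_eq_iff[OF F' FN' D(1)] by auto
    then show "finv f \<circ> g \<in> N"
      unfolding N_def using fg hom_inv[of E \<phi> f, OF E hom bij fg(1)] hom fgrp_inv[OF E] fgrpD[OF E] by auto
  qed
  moreover have "card ((\<lambda>f. (\<circ>) (\<phi> f) ` N') ` E) \<le> k"
    using card_cosets_le[OF F' N'] by (simp add: image_image)
  ultimately have "card E \<le> k * card N" by (meson le_trans mult_le_mono1)
  then show ?thesis using nab unfolding jordan_le_def by auto
qed

section \<open>Groups acting on a product\<close>

lemma map_prod_inject:
  "map_prod a b = map_prod a' b' \<longleftrightarrow> a = a' \<and> b = b'"
  by (auto simp: fun_eq_iff)

lemma bij_map_prodI: "bij a \<Longrightarrow> bij b \<Longrightarrow> bij (map_prod a b)"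
  by (simp add: bij_betw_def map_prod_inj_on map_prod_surj_on flip: UNIV_Times_UNIV)

lemma finv_map_prod:
  assumes "bij a" "bij b" shows "finv (map_prod a b) = map_prod (finv a) (finv b)"
  using assms by (intro inv_unique_comp) (auto simp: fun_eq_iff inv_apply_bij)

definition fst_part :: "('p \<times> 'q \<Rightarrow> 'p \<times> 'q) set \<Rightarrow> ('p \<Rightarrow> 'p) set" where
  "fst_part G = {a. \<exists>b. map_prod a b \<in> G}"

definition snd_part :: "('p \<times> 'q \<Rightarrow> 'p \<times> 'q) set \<Rightarrow> ('q \<Rightarrow> 'q) set" where
  "snd_part G = {b. \<exists>a. map_prod a b \<in> G}"

lemma bij_map_prodD:
  fixes a :: "'p \<Rightarrow> 'p" and b :: "'q \<Rightarrow> 'q"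
  assumes "bij (map_prod a b)" shows "bij a" "bij b"
proof -
  have i: "inj (map_prod a b)" and s: "surj (map_prod a b)" using assms by (auto simp: bij_def)
  show "bij a"
  proof (rule bijI)
    show "inj a"
    proof (rule injI)
      fix x y assume "a x = a y"
      then have "map_prod a b (x, undefined) = map_prod a b (y, undefined)" by simp
      then show "x = y" using i by (metis Pair_inject injD)
    qed
    show "surj a"
    proof (unfold surj_def, intro allI)
      fix y obtain z where "map_prod a b z = (y, undefined)" using s by (metis surjD)
      then show "\<exists>x. y = a x" by (cases z) auto
    qed
  qed
  show "bij b"
  proof (rule bijI)
    show "inj b"
    proof (rule injI)
      fix x y assume "b x = b y"
      then have "map_prod a b (undefined, x) = map_prod a b (undefined, y)" by simp
      then show "x = y" using i by (metis Pair_inject injD)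
    qed
    show "surj b"
    proof (unfold surj_def, intro allI)
      fix y obtain z where "map_prod a b z = (undefined, y)" using s by (metis surjD)
      then show "\<exists>x. y = b x" by (cases z) auto
    qed
  qed
qed

lemma fgrp_parts:
  fixes G :: "('p \<times> 'q \<Rightarrow> 'p \<times> 'q) set"
  assumes "fgrp G"
  shows "fgrp (fst_part G)" "fgrp (snd_part G)"
proof -
  note G = fgrpD[OF assms]
  have idm: "map_prod id id \<in> G" using G(2) by (simp add: map_prod.id)
  \<comment> \<open>Evaluation with an arbitrary second argument recovers the first component, so
    the projection is contained in an image of the finite set \<open>G\<close>.\<close>
  have "fst_part G \<subseteq> (\<lambda>g. \<lambda>p. fst (g (p, undefined))) ` G"
    unfolding fst_part_def by (force simp: image_iff fun_eq_iff)
  then have "finite (fst_part G)" using G(1) finite_surj by blast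
  moreover have "snd_part G \<subseteq> (\<lambda>g. \<lambda>p. snd (g (undefined, p))) ` G"
    unfolding snd_part_def by (force simp: image_iff fun_eq_iff)
  then have "finite (snd_part G)" using G(1) finite_surj by blast
  moreover have "a \<circ> a' \<in> fst_part G" if aa: "a \<in> fst_part G" "a' \<in> fst_part G" for a a'
    using aa G(3) unfolding fst_part_def by (auto simp: map_prod.comp[symmetric]) (metis map_prod.comp)
  moreover have "b \<circ> b' \<in> snd_part G" if bb: "b \<in> snd_part G" "b' \<in> snd_part G" for b b'
    using bb G(3) unfolding snd_part_def by (auto simp: map_prod.comp[symmetric]) (metis map_prod.comp)
  moreover have "id \<in> fst_part G" "id \<in> snd_part G" using idm by (auto simp: fst_part_def snd_part_def)
  moreover have "\<forall>a\<in>fst_part G. bij a" "\<forall>b\<in>snd_part G. bij b"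
    using G(4) bij_map_prodD unfolding fst_part_def snd_part_def by blast+
  ultimately show "fgrp (fst_part G)" "fgrp (snd_part G)" unfolding fgrp_def by blast+
qed

definition prod_sub :: "('p \<times> 'q \<Rightarrow> 'p \<times> 'q) set \<Rightarrow> ('p \<Rightarrow> 'p) set \<Rightarrow> ('q \<Rightarrow> 'q) set \<Rightarrow> ('p \<times> 'q \<Rightarrow> 'p \<times> 'q) set" where
  "prod_sub G A B = {map_prod a b | a b. a \<in> A \<and> b \<in> B \<and> map_prod a b \<in> G}"

text \<open>An element of \<open>G\<close> is located up to \<open>prod_sub G A B\<close> by the
  coset of its first component modulo \<open>A\<close> and that of its second modulo
  \<open>B\<close>; hence the indices multiply.\<close>

lemma prod_sub:
  fixes G :: "('p \<times> 'q \<Rightarrow> 'p \<times> 'q) set"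
  assumes G: "fgrp G" and pres: "\<And>g. g \<in> G \<Longrightarrow> \<exists>a b. g = map_prod a b"
    and A: "normal_abelian (fst_part G) A" "card (fst_part G) \<le> k * card A"
    and B: "normal_abelian (snd_part G) B" "card (snd_part G) \<le> l * card B"
  shows "normal_abelian G (prod_sub G A B)" "card G \<le> (k * l) * card (prod_sub G A B)"
proof -
  note P = fgrp_parts[OF G]
  note A' = normal_abelianD[OF A(1)] and B' = normal_abelianD[OF B(1)]
  show "normal_abelian G (prod_sub G A B)"
    unfolding normal_abelian_def
  proof (intro conjI ballI)
    show "prod_sub G A B \<subseteq> G" by (auto simp: prod_sub_def)
    show "id \<in> prod_sub G A B"
      using A'(2) B'(2) fgrpD(2)[OF G] unfolding prod_sub_def
      by (auto intro!: exI[of _ id] simp: map_prod.id)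
    fix f g assume "f \<in> prod_sub G A B" "g \<in> prod_sub G A B"
    then obtain a b a' b' where f: "f = map_prod a b" "a \<in> A" "b \<in> B" "f \<in> G"
      and g: "g = map_prod a' b'" "a' \<in> A" "b' \<in> B" "g \<in> G" unfolding prod_sub_def by auto
    have "f \<circ> g = map_prod (a \<circ> a') (b \<circ> b')" "f \<circ> g \<in> G"
      using f(1) g(1) fgrpD(3)[OF G f(4) g(4)] by (simp_all add: map_prod.comp)
    then show "f \<circ> g \<in> prod_sub G A B" using A'(3)[of a a'] B'(3)[of b b'] f g unfolding prod_sub_def by auto
    show "f \<circ> g = g \<circ> f" using A'(4)[of a a'] B'(4)[of b b'] f g by (simp add: map_prod.comp)
  next
    fix g n assume g: "g \<in> G" and "n \<in> prod_sub G A B"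
    then obtain a b where n: "n = map_prod a b" "a \<in> A" "b \<in> B" "n \<in> G" unfolding prod_sub_def by auto
    obtain a' b' where g': "g = map_prod a' b'" using pres[OF g] by auto
    have bj: "bij a'" "bij b'" using fgrpD(4)[OF G g] g' bij_map_prodD by auto
    have e: "g \<circ> n \<circ> finv g = map_prod (a' \<circ> a \<circ> finv a') (b' \<circ> b \<circ> finv b')"
      by (simp add: g' n finv_map_prod bj map_prod.comp)
    have "g \<circ> n \<circ> finv g \<in> G" using g n fgrp_inv[OF G] fgrpD(3)[OF G] by auto
    moreover have "a' \<in> fst_part G" "b' \<in> snd_part G" using g g' by (auto simp: fst_part_def snd_part_def)
    ultimately show "g \<circ> n \<circ> finv g \<in> prod_sub G A B"
      using A'(5)[of a' a] B'(5)[of b' b] n e unfolding prod_sub_def by auto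
  qed
  define f1 where "f1 g = (\<lambda>p. fst (g (p, undefined)))" for g :: "'p \<times> 'q \<Rightarrow> 'p \<times> 'q"
  define f2 where "f2 g = (\<lambda>p. snd (g (undefined, p)))" for g :: "'p \<times> 'q \<Rightarrow> 'p \<times> 'q"
  have f12: "f1 (map_prod a b) = a" "f2 (map_prod a b) = b" for a b by (auto simp: f1_def f2_def)
  define \<phi> where "\<phi> g = ((\<circ>) (f1 g) ` A, (\<circ>) (f2 g) ` B)" for g
  have FA: "fgrp A" "fgrp B" using normal_abelian_fgrp[OF P(1) A(1)] normal_abelian_fgrp[OF P(2) B(1)] by auto
  have "card G \<le> card (\<phi> ` G) * card (prod_sub G A B)"
  proof (rule card_le_fibres[OF G])
    have "prod_sub G A B \<subseteq> G" by (auto simp: prod_sub_def)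
    then show "finite (prod_sub G A B)" using fgrpD(1)[OF G] finite_subset by blast
    fix f g assume fg: "f \<in> G" "g \<in> G" "\<phi> f = \<phi> g"
    obtain a b a' b' where e: "f = map_prod a b" "g = map_prod a' b'" using pres fg by metis
    have bj: "bij a" "bij b" using fgrpD(4)[OF G fg(1)] e bij_map_prodD by auto
    have m: "a \<in> fst_part G" "a' \<in> fst_part G" "b \<in> snd_part G" "b' \<in> snd_part G"
      using fg e by (auto simp: fst_part_def snd_part_def)
    have "finv a \<circ> a' \<in> A" "finv b \<circ> b' \<in> B"
      using fg(3) coset_eq_iff[OF P(1) FA(1) A'(1) m(1,2)] coset_eq_iff[OF P(2) FA(2) B'(1) m(3,4)]
      by (auto simp: \<phi>_def e f12)
    moreover have "finv f \<circ> g = map_prod (finv a \<circ> a') (finv b \<circ> b')"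
      by (simp add: e finv_map_prod bj map_prod.comp)
    moreover have "finv f \<circ> g \<in> G" using fg fgrp_inv[OF G] fgrpD(3)[OF G] by auto
    ultimately show "finv f \<circ> g \<in> prod_sub G A B" unfolding prod_sub_def by auto
  qed
  moreover have "card (\<phi> ` G) \<le> k * l"
  proof -
    let ?S = "(\<lambda>f. (\<circ>) f ` A) ` fst_part G" and ?T = "(\<lambda>f. (\<circ>) f ` B) ` snd_part G"
    have "\<phi> ` G \<subseteq> ?S \<times> ?T"
    proof
      fix x assume "x \<in> \<phi> ` G"
      then obtain g where g: "g \<in> G" "x = \<phi> g" by auto
      from pres[OF g(1)] obtain a b where "g = map_prod a b" by auto
      then show "x \<in> ?S \<times> ?T" using g by (auto simp: \<phi>_def f12 fst_part_def snd_part_def)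
    qed
    then have "card (\<phi> ` G) \<le> card (?S \<times> ?T)"
      using fgrpD(1)[OF P(1)] fgrpD(1)[OF P(2)] by (intro card_mono) auto
    also have "\<dots> \<le> k * l"
      unfolding card_cartesian_product
      by (intro mult_le_mono card_cosets_le[OF P(1) A] card_cosets_le[OF P(2) B])
    finally show ?thesis .
  qed
  ultimately show "card G \<le> (k * l) * card (prod_sub G A B)" by (meson le_trans mult_le_mono1)
qed

definition preserving :: "('p \<times> 'p \<Rightarrow> 'p \<times> 'p) set \<Rightarrow> ('p \<times> 'p \<Rightarrow> 'p \<times> 'p) set" where
  "preserving G = {g\<in>G. \<exists>a b. g = map_prod a b}"

lemma fgrp_preserving: "fgrp G \<Longrightarrow> fgrp (preserving G)"
proof (rule fgrp_subset)
  assume G: "fgrp G"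
  show "preserving G \<subseteq> G" by (auto simp: preserving_def)
  show "id \<in> preserving G" using fgrpD(2)[OF G] unfolding preserving_def by (auto intro!: exI[of _ id])
  show "f \<circ> g \<in> preserving G" if "f \<in> preserving G" "g \<in> preserving G" for f g
  proof -
    from that obtain a b a' b' where e: "f = map_prod a b" "g = map_prod a' b'" "f \<in> G" "g \<in> G"
      by (auto simp: preserving_def)
    then have "f \<circ> g = map_prod (a \<circ> a') (b \<circ> b')" by (simp add: map_prod.comp)
    then show ?thesis using fgrpD(3)[OF G e(3,4)] unfolding preserving_def by blast
  qed
qed

text \<open>Two elements of the same type, both preserving or both exchanging the factors, differ by
  a preserving one, and there are only two types.\<close>

lemma card_le_preserving:
  assumes G: "fgrp G" and tp: "\<And>g. g \<in> G \<Longrightarrow> \<exists>a b. g = map_prod a b \<or> g = map_prod a b \<circ> prod.swap"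
  shows "card G \<le> 2 * card (preserving G)"
proof -
  have "card G \<le> card ((\<lambda>g. g \<in> preserving G) ` G) * card (preserving G)"
  proof (rule card_le_fibres[OF G])
    show "finite (preserving G)" using fgrp_preserving[OF G] fgrpD by auto
    fix f g assume fg: "f \<in> G" "g \<in> G" "(f \<in> preserving G) = (g \<in> preserving G)"
    have m: "finv f \<circ> g \<in> G" using fg fgrp_inv[OF G] fgrpD(3)[OF G] by auto
    show "finv f \<circ> g \<in> preserving G"
    proof (cases "f \<in> preserving G")
      case True
      then show ?thesis using fg fgrp_inv[OF fgrp_preserving[OF G]] fgrpD(3)[OF fgrp_preserving[OF G]] by auto
    next
      case False
      then obtain a b a' b' where e: "f = map_prod a b \<circ> prod.swap" "g = map_prod a' b' \<circ> prod.swap"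
        using tp[OF fg(1)] tp[OF fg(2)] fg by (auto simp: preserving_def)
      have "map_prod a b = f \<circ> prod.swap" using e by (simp add: comp_assoc)
      then have "bij (map_prod a b)" using fgrpD(4)[OF G fg(1)] by (simp add: bij_comp)
      then have bj: "bij a" "bij b" using bij_map_prodD by auto
      have "finv f = prod.swap \<circ> map_prod (finv a) (finv b)"
        using bj unfolding e by (intro inv_unique_comp) (auto simp: fun_eq_iff inv_apply_bij)
      then have "finv f \<circ> g = prod.swap \<circ> map_prod (finv a \<circ> a') (finv b \<circ> b') \<circ> prod.swap"
        by (auto simp: e fun_eq_iff)
      also have "\<dots> = map_prod (finv b \<circ> b') (finv a \<circ> a')" by (auto simp: fun_eq_iff)
      finally show ?thesis using m unfolding preserving_def by blast
    qed
  qed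
  also have "\<dots> \<le> card (UNIV :: bool set) * card (preserving G)"
    by (intro mult_le_mono1 card_mono) auto
  finally show ?thesis by simp
qed

text \<open>A swapping element \<open>h\<close> exchanges the two factors, so a normal abelian subgroup of the first
  one determines by conjugation with \<open>h\<close> one of the second, and their product is normalised by \<open>h\<close>.\<close>

lemma jordan_le_wreath:
  fixes G :: "('p \<times> 'p \<Rightarrow> 'p \<times> 'p) set"
  assumes G: "fgrp G"
    and tp: "\<And>g. g \<in> G \<Longrightarrow> \<exists>a b. g = map_prod a b \<or> g = map_prod a b \<circ> prod.swap"
    and J: "jordan_le (fst_part G) k" "jordan_le (snd_part G) k"
  shows "jordan_le G (2 * k * k)"
proof -
  let ?P = "preserving G"
  have P: "fgrp ?P" by (rule fgrp_preserving[OF G])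
  have parts: "fst_part ?P = fst_part G" "snd_part ?P = snd_part G"
    by (auto simp: fst_part_def snd_part_def preserving_def)
  obtain A where A: "normal_abelian (fst_part ?P) A" "card (fst_part ?P) \<le> k * card A"
    using J(1) unfolding jordan_le_def parts by auto
  note FP = fgrp_parts[OF P]
  have pr: "\<exists>a b. g = map_prod a b" if "g \<in> ?P" for g using that by (auto simp: preserving_def)
  show ?thesis
  proof (cases "?P = G")
    case True
    \<comment> \<open>Without an exchanging element the subgroups of the two factors can be chosen
      independently.\<close>
    obtain B where B: "normal_abelian (snd_part ?P) B" "card (snd_part ?P) \<le> k * card B"
      using J(2) unfolding jordan_le_def parts by auto
    have "jordan_le G (k * k)"
      using prod_sub[OF P pr A B] unfolding jordan_le_def True by auto
    then show ?thesis by (rule jordan_le_mono) simp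
  next
    case False
    then obtain h where h: "h \<in> G" "h \<notin> ?P" unfolding preserving_def by blast
    obtain a b where hab: "h = map_prod a b \<circ> prod.swap" using tp[OF h(1)] h by (auto simp: preserving_def)
    have "map_prod a b = h \<circ> prod.swap" using hab by (simp add: comp_assoc)
    then have "bij (map_prod a b)" using fgrpD(4)[OF G h(1)] by (simp add: bij_comp)
    then have bj: "bij a" "bij b" using bij_map_prodD by auto
    have bh: "bij h" using fgrpD(4)[OF G h(1)] .
    have hinv: "finv h = prod.swap \<circ> map_prod (finv a) (finv b)"
      using bj unfolding hab by (intro inv_unique_comp) (auto simp: fun_eq_iff inv_apply_bij)
    have hc: "h \<circ> map_prod x y \<circ> finv h = map_prod (a \<circ> y \<circ> finv a) (b \<circ> x \<circ> finv b)" for x y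
      by (auto simp: hinv fun_eq_iff) (auto simp: hab)
    have hc': "finv h \<circ> map_prod x y \<circ> h = map_prod (finv b \<circ> y \<circ> b) (finv a \<circ> x \<circ> a)" for x y
      by (auto simp: hinv fun_eq_iff) (auto simp: hab)
    have hP: "h \<circ> g \<circ> finv h \<in> ?P" "finv h \<circ> g \<circ> h \<in> ?P" if g: "g \<in> ?P" for g
    proof -
      from pr[OF g] obtain x y where "g = map_prod x y" by auto
      moreover have "g \<in> G" using g by (simp add: preserving_def)
      then have "h \<circ> g \<circ> finv h \<in> G" "finv h \<circ> g \<circ> h \<in> G"
        using h(1) fgrp_inv[OF G h(1)] fgrpD(3)[OF G] by simp_all
      ultimately show "h \<circ> g \<circ> finv h \<in> ?P" "finv h \<circ> g \<circ> h \<in> ?P"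
        using hc[of x y] hc'[of x y] unfolding preserving_def by blast+
    qed
    \<comment> \<open>Conjugation by \<open>h\<close> carries the first components to second
      components through \<open>c\<close>.\<close>
    define c where "c x = b \<circ> x \<circ> finv b" for x
    have injc: "inj c" using bj(2) unfolding c_def
      by (intro injI) (auto simp: fun_eq_iff, metis inv_apply_bij)
    have c_mult: "c x \<circ> c y = c (x \<circ> y)" for x y unfolding c_def using bj by (auto simp: fun_eq_iff inv_apply_bij)
    have c_id: "c id = id" unfolding c_def using bj by (auto simp: fun_eq_iff inv_apply_bij)
    have sp: "snd_part ?P = c ` fst_part ?P"
    proof
      show "snd_part ?P \<subseteq> c ` fst_part ?P"
      proof
        fix y assume "y \<in> snd_part ?P"
        then obtain x where "map_prod x y \<in> ?P" by (auto simp: snd_part_def)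
        then have "finv b \<circ> y \<circ> b \<in> fst_part ?P" using hP(2)[of "map_prod x y"] hc'[of x y]
          unfolding fst_part_def by auto
        moreover have "c (finv b \<circ> y \<circ> b) = y" unfolding c_def using bj by (auto simp: fun_eq_iff inv_apply_bij)
        ultimately show "y \<in> c ` fst_part ?P" by (metis imageI)
      qed
      show "c ` fst_part ?P \<subseteq> snd_part ?P"
      proof
        fix y assume "y \<in> c ` fst_part ?P"
        then obtain x z where "map_prod x z \<in> ?P" "y = c x" by (auto simp: fst_part_def)
        then show "y \<in> snd_part ?P" using hP(1)[of "map_prod x z"] hc[of x z] unfolding snd_part_def c_def by auto
      qed
    qed
    note A' = normal_abelianD[OF A(1)]
    have c_inv: "finv (c g) = c (finv g)" if "bij g" for g
      using that by (intro inv_unique_comp) (auto simp: c_mult inv_o_bij c_id)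
    have B: "normal_abelian (snd_part ?P) (c ` A)"
      unfolding normal_abelian_def sp
    proof (intro conjI ballI)
      show "c ` A \<subseteq> c ` fst_part ?P" "id \<in> c ` A" using A' c_id by (auto intro: rev_image_eqI)
      fix f g assume "f \<in> c ` A" "g \<in> c ` A"
      then show "f \<circ> g \<in> c ` A" "f \<circ> g = g \<circ> f" using A'(3,4) by (auto simp: c_mult)
    next
      fix g n assume "g \<in> c ` fst_part ?P" "n \<in> c ` A"
      then obtain g' n' where gn: "g' \<in> fst_part ?P" "n' \<in> A" "g = c g'" "n = c n'" by auto
      then have "g \<circ> n \<circ> finv g = c (g' \<circ> n' \<circ> finv g')"
        using fgrpD(4)[OF FP(1)] by (simp add: c_inv c_mult)
      then show "g \<circ> n \<circ> finv g \<in> c ` A" using A'(5) gn by auto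
    qed
    have cardB: "card (snd_part ?P) \<le> k * card (c ` A)"
      using A(2) unfolding sp by (simp add: card_image inj_on_subset[OF injc])
    let ?N = "prod_sub ?P A (c ` A)"
    have N: "normal_abelian ?P ?N" "card ?P \<le> (k * k) * card ?N"
      using prod_sub[OF P pr A B cardB] by auto
    note N' = normal_abelianD[OF N(1)]
    have hh: "h \<circ> h \<in> ?P"
    proof -
      have "h \<circ> h = map_prod (a \<circ> b) (b \<circ> a)" by (auto simp: hab fun_eq_iff)
      then show ?thesis using fgrpD(3)[OF G h(1) h(1)] unfolding preserving_def by blast
    qed
    have ab: "a \<circ> b \<in> fst_part ?P"
    proof -
      have "h \<circ> h = map_prod (a \<circ> b) (b \<circ> a)" by (auto simp: hab fun_eq_iff)
      then show ?thesis using hh unfolding fst_part_def by auto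
    qed
    have hN: "h \<circ> n \<circ> finv h \<in> ?N" if n: "n \<in> ?N" for n
    proof -
      obtain x y where e: "n = map_prod x (c y)" "x \<in> A" "y \<in> A" "n \<in> ?P"
        using n unfolding prod_sub_def by auto
      \<comment> \<open>Passing to the second factor and back with \<open>h\<close> amounts to
        conjugation by \<open>a \<circ> b\<close>, the first component of
        \<open>h \<circ> h\<close>; it lies in the first projection and therefore normalises
        \<open>A\<close>.\<close>
      have "a \<circ> c y \<circ> finv a = (a \<circ> b) \<circ> y \<circ> finv (a \<circ> b)"
        using bj by (simp add: c_def o_inv_distrib comp_assoc)
      then have "a \<circ> c y \<circ> finv a \<in> A" using A'(5)[OF ab e(3)] by metis
      moreover have "h \<circ> n \<circ> finv h = map_prod (a \<circ> c y \<circ> finv a) (c x)"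
        unfolding e(1) hc c_def by simp
      ultimately show ?thesis using hP(1)[OF e(4)] e(2) unfolding prod_sub_def by auto
    qed
    have "normal_abelian G ?N"
      unfolding normal_abelian_def
    proof (intro conjI ballI)
      show "?N \<subseteq> G" using N'(1) by (auto simp: preserving_def)
      show "id \<in> ?N" by (rule N'(2))
      fix f g assume "f \<in> ?N" "g \<in> ?N"
      then show "f \<circ> g \<in> ?N" "f \<circ> g = g \<circ> f" by (rule N'(3), rule N'(4))
    next
      fix g n assume g: "g \<in> G" and n: "n \<in> ?N"
      show "g \<circ> n \<circ> finv g \<in> ?N"
      proof (cases "g \<in> ?P")
        case True
        then show ?thesis by (rule N'(5)[OF _ n])
      next
        case False
        then obtain u v where guv: "g = map_prod u v \<circ> prod.swap" using tp[OF g] g by (auto simp: preserving_def)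
        define g' where "g' = g \<circ> finv h"
        have "g' = map_prod (u \<circ> finv a) (v \<circ> finv b)" by (auto simp: g'_def guv hinv fun_eq_iff)
        then have g': "g' \<in> ?P" using fgrpD(3)[OF G g fgrp_inv[OF G h(1)]] unfolding preserving_def g'_def by blast
        have bg: "bij g'" using fgrpD(4)[OF P g'] .
        have ge: "g = g' \<circ> h" unfolding g'_def using bh by (simp add: comp_assoc inv_o_bij)
        have "g \<circ> n \<circ> finv g = g' \<circ> (h \<circ> n \<circ> finv h) \<circ> finv g'"
          unfolding ge using bg bh by (simp add: o_inv_distrib comp_assoc)
        then show ?thesis using N'(5)[OF g' hN[OF n]] by metis
      qed
    qed
    moreover have "card G \<le> 2 * k * k * card ?N"
      using card_le_preserving[OF G tp] N(2) by simp
    ultimately show ?thesis unfolding jordan_le_def by auto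
  qed
qed

section \<open>Groups whose nontrivial elements have two fixed points\<close>

definition fix_pts :: "('p \<Rightarrow> 'p) \<Rightarrow> 'p set" where
  "fix_pts g = {p. g p = p}"

definition stab :: "('p \<Rightarrow> 'p) set \<Rightarrow> 'p \<Rightarrow> ('p \<Rightarrow> 'p) set" where
  "stab G p = {g\<in>G. g p = p}"

definition orb :: "('p \<Rightarrow> 'p) set \<Rightarrow> 'p \<Rightarrow> 'p set" where
  "orb G p = (\<lambda>g. g p) ` G"

section \<open>Orbits and stabilizers\<close>

lemma fgrp_stab: "fgrp G \<Longrightarrow> fgrp (stab G p)"
  by (rule fgrp_subset[of G]) (auto simp: stab_def fgrpD)

lemma orbit_stabilizer:
  assumes "fgrp G" shows "card (orb G p) * card (stab G p) = card G"
proof -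
  have "card G = card ((\<lambda>g. g p) ` G) * card (stab G p)"
  proof (rule card_eq_fibres[OF assms])
    fix f g assume fg: "f \<in> G" "g \<in> G"
    have b: "bij f" "finv f \<circ> g \<in> G"
      using fgrpD(4)[OF assms fg(1)] fgrpD(3)[OF assms fgrp_inv[OF assms fg(1)] fg(2)] by auto
    show "f p = g p \<longleftrightarrow> finv f \<circ> g \<in> stab G p"
      using b by (auto simp: stab_def) (metis inv_apply_bij(1), metis inv_apply_bij(2))
  qed (auto simp: stab_def)
  then show ?thesis by (simp add: orb_def)
qed

lemma orb_self: "fgrp G \<Longrightarrow> p \<in> orb G p"
  using fgrpD(2) unfolding orb_def by (metis id_apply imageI)

lemma orb_eq:
  assumes G: "fgrp G" and q: "q \<in> orb G p"
  shows "orb G q = orb G p"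
proof -
  obtain g where g: "g \<in> G" "q = g p" using q by (auto simp: orb_def)
  have p: "finv g q = p" using fgrpD(4)[OF G g(1)] g(2) by (simp add: inv_apply_bij)
  show ?thesis
  proof
    have "f q \<in> orb G p" if "f \<in> G" for f
      using fgrpD(3)[OF G that g(1)] g(2) unfolding orb_def by (metis comp_apply imageI)
    then show "orb G q \<subseteq> orb G p" unfolding orb_def[of G q] by auto
    have "f p \<in> orb G q" if "f \<in> G" for f
      using fgrpD(3)[OF G that fgrp_inv[OF G g(1)]] p unfolding orb_def by (metis comp_apply imageI)
    then show "orb G p \<subseteq> orb G q" unfolding orb_def[of G p] by auto
  qed
qed

lemma card_stab_orb: "fgrp G \<Longrightarrow> q \<in> orb G p \<Longrightarrow> card (stab G q) = card (stab G p)"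
  using orbit_stabilizer[of G p] orbit_stabilizer[of G q] orb_eq[of G q p]
    fgrpD(1)[of G] fgrpD(2)[of G]
  by (metis card_eq_0_iff empty_iff mult_is_0 nat_mult_eq_cancel1 neq0_conv)

lemma sorted_triple:
  fixes f :: "'a \<Rightarrow> nat"
  assumes "card S = 3"
  obtains a b c where "S = {a, b, c}" "a \<noteq> b" "a \<noteq> c" "b \<noteq> c" "f a \<le> f b" "f b \<le> f c"
proof -
  obtain x y z where S: "S = {x, y, z}" "x \<noteq> y" "x \<noteq> z" "y \<noteq> z"
    using assms by (auto simp: card_3_iff)
  consider "f x \<le> f y" "f y \<le> f z" | "f x \<le> f z" "f z \<le> f y" | "f y \<le> f x" "f x \<le> f z"
    | "f y \<le> f z" "f z \<le> f x" | "f z \<le> f x" "f x \<le> f y" | "f z \<le> f y" "f y \<le> f x"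
    by linarith
  then show ?thesis
  proof cases
    case 1 show ?thesis by (rule that[of x y z]) (use S 1 in auto)
  next
    case 2 show ?thesis by (rule that[of x z y]) (use S 2 in auto)
  next
    case 3 show ?thesis by (rule that[of y x z]) (use S 3 in auto)
  next
    case 4 show ?thesis by (rule that[of y z x]) (use S 4 in auto)
  next
    case 5 show ?thesis by (rule that[of z x y]) (use S 5 in auto)
  next
    case 6 show ?thesis by (rule that[of z y x]) (use S 6 in auto)
  qed
qed

text \<open>Divided by \<open>N\<close>, the hypothesis \<open>sum\<close> reads 1/n1 + 1/n2 + 1/n3
  = 1 + 2/N, where \<open>n1\<close>, \<open>n2\<close>, \<open>n3\<close> are stabilizer orders and
  \<open>c1\<close>, \<open>c2\<close>, \<open>c3\<close> the lengths of the orbits. The solutions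
  are the dihedral, tetrahedral, octahedral and icosahedral types; for the first, what matters is
  the orbit of length two.\<close>

lemma triangle_group_arith:
  fixes c1 c2 c3 n1 n2 n3 N :: nat
  assumes "c1 * n1 = N" "c2 * n2 = N" "c3 * n3 = N" "2 \<le> n1" "n1 \<le> n2" "n2 \<le> n3"
    and sum: "c1 + c2 + c3 = N + 2" and N: "N > 0"
  shows "n1 = 2 \<and> (n2 = 2 \<and> c3 = 2 \<or> n2 = 3 \<and> (n3 = 3 \<and> N = 12 \<or> n3 = 4 \<and> N = 24 \<or> n3 = 5 \<and> N = 60))"
proof -
  have le: "k * c \<le> N" if "c * n = N" "k \<le> n" for k c n :: nat
    using that by (metis mult.commute mult_le_mono1)
  have n1: "n1 = 2"
  proof (rule ccontr)
    assume "n1 \<noteq> 2"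
    then have "3 \<le> n1" "3 \<le> n2" "3 \<le> n3" using assms by linarith+
    then have "3 * c1 \<le> N" "3 * c2 \<le> N" "3 * c3 \<le> N"
      using le[OF assms(1)] le[OF assms(2)] le[OF assms(3)] by blast+
    then show False using sum by linarith
  qed
  have c1: "2 * c1 = N" using assms(1) n1 by simp
  have n2: "n2 \<le> 3"
  proof (rule ccontr)
    assume "\<not> n2 \<le> 3"
    then have "4 \<le> n2" "4 \<le> n3" using assms by linarith+
    then have "4 * c2 \<le> N" "4 * c3 \<le> N" using le[OF assms(2)] le[OF assms(3)] by blast+
    then show False using sum c1 by linarith
  qed
  show ?thesis
  proof (cases "n2 = 2")
    case True
    then show ?thesis using assms n1 c1 by auto
  next
    case False
    then have n23: "n2 = 3" using n2 assms n1 by auto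
    then have c2: "3 * c2 = N" using assms(2) by simp
    have c3: "6 * c3 = N + 12" using c1 c2 sum by linarith
    have "n3 \<le> 5"
    proof (rule ccontr)
      assume "\<not> n3 \<le> 5"
      then have "6 * c3 \<le> N" by (intro le[OF assms(3)]) simp
      then show False using c3 by linarith
    qed
    then consider "n3 = 3" | "n3 = 4" | "n3 = 5" using n23 assms(6) by linarith
    then show ?thesis using c3 assms(3) n1 n23 by cases auto
  qed
qed

lemma fgrp_pow:
  assumes "fgrp G" "g \<in> G" shows "g ^^ card G = id"
proof -
  let ?M = "\<lparr>carrier = G, monoid.mult = (\<circ>), one = id\<rparr>"
  interpret M: group ?M
  proof (rule groupI)
    fix x assume "x \<in> carrier ?M"
    then show "\<exists>y\<in>carrier ?M. y \<otimes>\<^bsub>?M\<^esub> x = \<one>\<^bsub>?M\<^esub>"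
      using fgrp_inv[OF assms(1)] fgrpD(4)[OF assms(1)]
      by (intro bexI[of _ "finv x"]) (auto simp: inv_o_bij)
  qed (use fgrpD[OF assms(1)] in \<open>auto simp: comp_assoc\<close>)
  have pow: "g [^]\<^bsub>?M\<^esub> (n::nat) = g ^^ n" for n
    by (induction n) (simp_all add: M.nat_pow_Suc funpow_Suc_right del: funpow.simps(2))
  show ?thesis using M.pow_order_eq_1[of g] assms(2) unfolding pow by (simp add: Coset.order_def)
qed

text \<open>The axioms hold for finite groups of Moebius transformations, and are all that the classification needs.\<close>

locale two_fix =
  fixes G :: "('p \<Rightarrow> 'p) set"
  assumes G: "fgrp G"
    and two: "\<And>g. g \<in> G \<Longrightarrow> g \<noteq> id \<Longrightarrow> card (fix_pts g) = 2"
    and comm: "\<And>g h p. g \<in> G \<Longrightarrow> h \<in> G \<Longrightarrow> g p = p \<Longrightarrow> h p = p \<Longrightarrow> g \<circ> h = h \<circ> g"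
begin

definition F where "F = {p. \<exists>g\<in>G. g \<noteq> id \<and> g p = p}"

lemma finite_fix: "g \<in> G \<Longrightarrow> g \<noteq> id \<Longrightarrow> finite (fix_pts g)"
  using two by (metis card.infinite zero_neq_numeral)

lemma finite_F: "finite F"
proof -
  have "F = (\<Union>g\<in>G - {id}. fix_pts g)" by (auto simp: F_def fix_pts_def)
  then show ?thesis using finite_fix fgrpD(1)[OF G] by auto
qed

lemma id_if_many_fix:
  assumes "g \<in> G" "A \<subseteq> fix_pts g" "finite A" "card A > 2"
  shows "g = id"
proof (rule ccontr)
  assume "g \<noteq> id"
  then have "card A \<le> 2" using two[OF assms(1)] card_mono[OF finite_fix[OF assms(1)] assms(2)] by auto
  then show False using assms by simp
qed

lemma two_le_stab: "p \<in> F \<Longrightarrow> 2 \<le> card (stab G p)"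
proof -
  assume "p \<in> F"
  then obtain g where "g \<in> G" "g \<noteq> id" "g p = p" by (auto simp: F_def)
  then have "{id, g} \<subseteq> stab G p" "card {id, g} = 2" using fgrpD(2)[OF G] by (auto simp: stab_def)
  moreover have "finite (stab G p)" using fgrpD(1)[OF fgrp_stab[OF G]] .
  ultimately show ?thesis by (metis card_mono)
qed

lemma F_orb: "p \<in> F \<Longrightarrow> orb G p \<subseteq> F"
proof
  fix q assume p: "p \<in> F" and q: "q \<in> orb G p"
  then have "2 \<le> card (stab G q)" using card_stab_orb[OF G q] two_le_stab by auto
  then have "\<not> stab G q \<subseteq> {id}" using card_mono[of "{id}" "stab G q"] by auto
  then show "q \<in> F" by (auto simp: F_def stab_def)
qed

text \<open>Counts the pairs of a nontrivial element and one of its two fixed points.\<close>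

lemma burnside: "(\<Sum>W\<in>orb G ` F. card G - card W) = 2 * (card G - 1)"
proof -
  have fin: "finite G" using fgrpD(1)[OF G] .
  let ?G = "G - {id}"
  have "(\<Sum>p\<in>F. card {g\<in>?G. g p = p}) = (\<Sum>g\<in>?G. card {p\<in>F. g p = p})"
    using sum.swap_restrict[of F ?G "\<lambda>_ _. 1::nat" "\<lambda>p g. g p = p"] finite_F fin by simp
  also have "\<dots> = (\<Sum>g\<in>?G. 2)"
  proof (rule sum.cong)
    fix g assume "g \<in> ?G"
    then have "{p\<in>F. g p = p} = fix_pts g" "card (fix_pts g) = 2" using two by (auto simp: F_def fix_pts_def)
    then show "card {p\<in>F. g p = p} = 2" by simp
  qed simp
  also have "\<dots> = 2 * (card G - 1)" using fgrpD(2)[OF G] fin by simp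
  finally have 1: "(\<Sum>p\<in>F. card {g\<in>?G. g p = p}) = 2 * (card G - 1)" .
  have st: "card {g\<in>?G. g p = p} = card (stab G p) - 1" for p
  proof -
    have "{g\<in>?G. g p = p} = stab G p - {id}" by (auto simp: stab_def)
    then show ?thesis using fgrpD(2)[OF G] by (simp add: stab_def)
  qed
  have "(\<Sum>p\<in>F. card (stab G p) - 1) = (\<Sum>W\<in>orb G ` F. \<Sum>p\<in>{p\<in>F. orb G p = W}. card (stab G p) - 1)"
    using sum.group[OF finite_F, of "orb G ` F" "orb G" "\<lambda>p. card (stab G p) - 1"] finite_F by simp
  also have "\<dots> = (\<Sum>W\<in>orb G ` F. card G - card W)"
  proof (rule sum.cong)
    fix W assume "W \<in> orb G ` F"
    then obtain p where p: "p \<in> F" "W = orb G p" by auto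
    have e: "{q\<in>F. orb G q = W} = W"
      using p F_orb[OF p(1)] orb_eq[OF G] orb_self[OF G] by auto
    have "(\<Sum>q\<in>W. card (stab G q) - 1) = (\<Sum>q\<in>W. card (stab G p) - 1)"
      using card_stab_orb[OF G] p by (intro sum.cong) auto
    also have "\<dots> = card G - card W"
      using orbit_stabilizer[OF G, of p] p(2) by (simp add: diff_mult_distrib2)
    finally show "(\<Sum>q\<in>{q\<in>F. orb G q = W}. card (stab G q) - 1) = card G - card W" unfolding e .
  qed simp
  finally show ?thesis using 1 st by simp
qed

text \<open>The stabilizer of a point of a two-element orbit has index two and fixes both points. It
  is abelian by \<open>comm\<close>, and normal because conjugation merely permutes these two
  points.\<close>

lemma index_two:
  assumes W: "card (orb G p) = 2"
  shows "jordan_le G 2"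
proof -
  let ?S = "stab G p"
  note S = fgrpD[OF fgrp_stab[OF G, of p]]
  have "normal_abelian G ?S"
    unfolding normal_abelian_def
  proof (intro conjI ballI)
    show "?S \<subseteq> G" by (auto simp: stab_def)
    show "id \<in> ?S" by (rule S(2))
    fix f g assume "f \<in> ?S" "g \<in> ?S"
    then show "f \<circ> g \<in> ?S" "f \<circ> g = g \<circ> f" using S(3) comm[of f g p] by (auto simp: stab_def)
  next
    fix g n assume g: "g \<in> G" and n: "n \<in> ?S"
    have nG: "n \<in> G" "n p = p" using n by (auto simp: stab_def)
    have inj: "inj n" using fgrpD(4)[OF G nG(1)] by (simp add: bij_def)
    obtain r where r: "orb G p = {p, r}" "r \<noteq> p"
      using W orb_self[OF G, of p] by (auto simp: card_2_iff doubleton_eq_iff)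
    have "n r \<in> orb G p" using r(1) orb_eq[OF G, of r p] nG(1) unfolding orb_def by blast
    then have "n r = r" using r nG(2) inj by (metis injD insertE singletonD)
    moreover have "finv g p \<in> orb G p" using fgrp_inv[OF G g] by (auto simp: orb_def)
    ultimately have "n (finv g p) = finv g p" using r nG by auto
    then have "(g \<circ> n \<circ> finv g) p = p" using fgrpD(4)[OF G g] by (simp add: inv_apply_bij)
    then show "g \<circ> n \<circ> finv g \<in> ?S"
      using g nG fgrp_inv[OF G g] fgrpD(3)[OF G] by (auto simp: stab_def)
  qed
  moreover have "card G \<le> 2 * card ?S" using orbit_stabilizer[OF G, of p] W by simp
  ultimately show ?thesis unfolding jordan_le_def by auto
qed

text \<open>An element that fixes one of the two fixed points of \<open>g\<close> commutes with
  \<open>g\<close>, so it permutes both and fixes the other as well. Hence the points with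
  nontrivial stabilizers come in pairs with a common stabilizer.\<close>

lemma stab_pair:
  assumes p: "p \<in> F"
  obtains r where "r \<noteq> p" "r \<in> F" "\<And>q. q \<in> F \<Longrightarrow> stab G q = stab G p \<longleftrightarrow> q = p \<or> q = r"
proof -
  obtain g where g: "g \<in> G" "g \<noteq> id" "g p = p" using p by (auto simp: F_def)
  obtain r where r: "fix_pts g = {p, r}" "r \<noteq> p"
  proof -
    obtain x y where xy: "fix_pts g = {x, y}" "x \<noteq> y" using two[OF g(1,2)] by (auto simp: card_2_iff)
    moreover have "p \<in> fix_pts g" using g(3) by (simp add: fix_pts_def)
    ultimately show ?thesis using that[of x] that[of y] by auto
  qed
  have gr: "g r = r" using r by (auto simp: fix_pts_def)
  have key: "h y = y" if h: "h \<in> G" "h x = x" and xy: "{p, r} = {x, y}" "x \<noteq> y" for h x y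
  proof -
    have gx: "g x = x" "g y = y" using xy g(3) gr by (auto simp: doubleton_eq_iff)
    have "g (h y) = h (g y)" using comm[OF g(1) h(1) gx(1) h(2)] by (metis comp_apply)
    then have "h y \<in> {x, y}" using gx r(1) xy by (auto simp: fix_pts_def)
    moreover have "h y \<noteq> x"
      using fgrpD(4)[OF G h(1)] h(2) xy(2) by (metis bij_def injD)
    ultimately show ?thesis by simp
  qed
  have pr: "stab G r = stab G p"
    unfolding stab_def using key[of _ p r] key[of _ r p] r(2) by (auto simp: insert_commute)
  show ?thesis
  proof (rule that[OF r(2)])
    show "r \<in> F" using g gr by (auto simp: F_def)
    fix q assume "q \<in> F"
    show "stab G q = stab G p \<longleftrightarrow> q = p \<or> q = r"
    proof
      assume "stab G q = stab G p"
      then have "g q = q" using g by (auto simp: stab_def)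
      then show "q = p \<or> q = r" using r(1) by (auto simp: fix_pts_def)
    qed (use pr in auto)
  qed
qed

text \<open>An orbit of six points falls into three pairs with common stabilizer; the kernel of the action
  on these pairs is an elementary abelian 2-group, since squares of its elements fix six points.\<close>

lemma six_orbit:
  assumes p0: "p0 \<in> F" and W: "card (orb G p0) = 6"
    and uniq: "\<And>q. q \<in> F \<Longrightarrow> card (stab G q) = card (stab G p0) \<Longrightarrow> q \<in> orb G p0"
  shows "jordan_le G 6"
proof -
  let ?W = "orb G p0"
  have OF: "?W \<subseteq> F" by (rule F_orb[OF p0])
  have finO: "finite ?W" using W by (metis card.infinite zero_neq_numeral)
  define pr where "pr p = {q\<in>?W. stab G q = stab G p}" for p
  have pr2: "card (pr p) = 2" if p: "p \<in> ?W" for p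
  proof -
    have pF: "p \<in> F" using OF p by auto
    obtain r where r: "r \<noteq> p" "r \<in> F" "\<And>q. q \<in> F \<Longrightarrow> stab G q = stab G p \<longleftrightarrow> q = p \<or> q = r"
      using stab_pair[OF pF] by blast
    have "stab G r = stab G p" using r by auto
    \<comment> \<open>The hypothesis \<open>uniq\<close> keeps the partner of \<open>p\<close> in
      the same orbit.\<close>
    then have "r \<in> ?W" using uniq[OF r(2)] card_stab_orb[OF G p] by auto
    then have "pr p = {p, r}" using r OF p unfolding pr_def by auto
    then show ?thesis using r(1) by simp
  qed
  define PP where "PP = pr ` ?W"
  have "card ?W = (\<Sum>A\<in>PP. card {q\<in>?W. pr q = A})"
    using sum.group[OF finO, of PP pr "\<lambda>_. 1::nat"] finO unfolding PP_def by simp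
  also have "\<dots> = (\<Sum>A\<in>PP. 2)"
  proof (rule sum.cong)
    fix A assume "A \<in> PP"
    then obtain p where p: "p \<in> ?W" "A = pr p" by (auto simp: PP_def)
    have "{q\<in>?W. pr q = A} = pr p" using p(1) unfolding p(2) pr_def by auto
    then show "card {q\<in>?W. pr q = A} = 2" using pr2[OF p(1)] by simp
  qed simp
  finally have cPP: "card PP = 3" using W by simp
  have finPP: "finite PP" using finO by (simp add: PP_def)
  have gO: "g p \<in> ?W" if "g \<in> G" "p \<in> ?W" for g p
    using that orb_eq[OF G that(2)] unfolding orb_def by blast
  have stab_conj: "h \<in> stab G (g p) \<longleftrightarrow> finv g \<circ> h \<circ> g \<in> stab G p" if g: "g \<in> G" and h: "h \<in> G" for g h p
  proof -
    have b: "bij g" using fgrpD(4)[OF G g] .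
    have "finv g \<circ> h \<circ> g \<in> G" using g h fgrp_inv[OF G g] fgrpD(3)[OF G] by auto
    then show ?thesis using h b by (auto simp: stab_def inv_apply_bij) (metis inv_apply_bij(2))
  qed
  have stab_g: "stab G (g p) = stab G (g q)" if "g \<in> G" "stab G p = stab G q" for g p q
  proof -
    have "h \<in> stab G (g p) \<longleftrightarrow> h \<in> stab G (g q)" for h
      using stab_conj[OF that(1), of h p] stab_conj[OF that(1), of h q] that(2)
      by (cases "h \<in> G") (simp_all, simp add: stab_def)
    then show ?thesis by blast
  qed
  have stab_g': "stab G (g p) = stab G (g q) \<longleftrightarrow> stab G p = stab G q" if g: "g \<in> G" for g p q
  proof
    assume "stab G (g p) = stab G (g q)"
    then have "stab G (finv g (g p)) = stab G (finv g (g q))" by (rule stab_g[OF fgrp_inv[OF G g]])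
    then show "stab G p = stab G q" using fgrpD(4)[OF G g] by (simp add: inv_apply_bij)
  qed (rule stab_g[OF g])
  have gpr: "g ` pr p = pr (g p)" if g: "g \<in> G" and p: "p \<in> ?W" for g p
  proof
    show "g ` pr p \<subseteq> pr (g p)" using gO[OF g] stab_g'[OF g] unfolding pr_def by auto
    show "pr (g p) \<subseteq> g ` pr p"
    proof
      fix q assume q: "q \<in> pr (g p)"
      have e: "q = g (finv g q)" using fgrpD(4)[OF G g] by (simp add: inv_apply_bij)
      have "finv g q \<in> ?W" using gO[OF fgrp_inv[OF G g]] q by (auto simp: pr_def)
      moreover have "stab G (finv g q) = stab G p" using q stab_g'[OF g, of "finv g q" p] e by (auto simp: pr_def)
      ultimately show "q \<in> g ` pr p" using e unfolding pr_def by blast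
    qed
  qed
  define N where "N = {g\<in>G. \<forall>A\<in>PP. g ` A = A}"
  have N_sq: "k \<circ> k = id" if k: "k \<in> N" for k
  proof (rule id_if_many_fix)
    have kG: "k \<in> G" using k by (simp add: N_def)
    show "k \<circ> k \<in> G" using kG fgrpD(3)[OF G] by auto
    show "?W \<subseteq> fix_pts (k \<circ> k)"
    proof
      fix p assume p: "p \<in> ?W"
      obtain r where r: "pr p = {p, r}"
      proof -
        obtain x y where xy: "pr p = {x, y}" using pr2[OF p] by (auto simp: card_2_iff)
        moreover have "p \<in> pr p" using p by (simp add: pr_def)
        ultimately show ?thesis using that[of x] that[of y] by (auto simp: insert_commute)
      qed
      have "k ` pr p = pr p" using k p by (auto simp: N_def PP_def)
      then have "k p \<in> {p, r}" "k r \<in> {p, r}" "inj k" using r fgrpD(4)[OF G kG] by (auto simp: bij_def)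
      then have "k p = p \<or> k p = r \<and> (k r = r \<longrightarrow> p = r) \<and> k r \<in> {p, r}"
        by (metis injD insert_iff singletonD)
      then have "k (k p) = p" by auto
      then show "p \<in> fix_pts (k \<circ> k)" by (simp add: fix_pts_def)
    qed
    show "finite ?W" "2 < card ?W" using finO W by auto
  qed
  have Ncl: "f \<circ> g \<in> N" if "f \<in> N" "g \<in> N" for f g
  proof -
    have "(f \<circ> g) ` A = A" if "A \<in> PP" for A
    proof -
      have "(f \<circ> g) ` A = f ` (g ` A)" by (rule image_comp[symmetric])
      then show ?thesis using \<open>f \<in> N\<close> \<open>g \<in> N\<close> that by (simp add: N_def)
    qed
    then show ?thesis using that fgrpD(3)[OF G] by (simp add: N_def)
  qed
  have "normal_abelian G N"
    unfolding normal_abelian_def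
  proof (intro conjI ballI)
    show "N \<subseteq> G" "id \<in> N" using fgrpD(2)[OF G] by (auto simp: N_def)
    fix f g assume fg: "f \<in> N" "g \<in> N"
    show "f \<circ> g \<in> N" by (rule Ncl[OF fg])
    \<comment> \<open>The word f(fgfg)g equals fg because fg has square one, and gf because f and g
      do.\<close>
    have "f \<circ> (f \<circ> g \<circ> (f \<circ> g)) \<circ> g = f \<circ> g" using N_sq[OF Ncl[OF fg]] by simp
    moreover have "f \<circ> (f \<circ> g \<circ> (f \<circ> g)) \<circ> g = (f \<circ> f) \<circ> (g \<circ> f) \<circ> (g \<circ> g)" by (simp add: comp_assoc)
    ultimately show "f \<circ> g = g \<circ> f" using N_sq fg by simp
  next
    fix g n assume g: "g \<in> G" and n: "n \<in> N"
    have "(g \<circ> n \<circ> finv g) ` A = A" if A: "A \<in> PP" for A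
    proof -
      obtain p where p: "p \<in> ?W" "A = pr p" using A by (auto simp: PP_def)
      have g': "finv g \<in> G" "finv g p \<in> ?W" using fgrp_inv[OF G g] gO p(1) by auto
      have "(g \<circ> n \<circ> finv g) ` A = g ` n ` pr (finv g p)"
        unfolding p(2) gpr[OF g'(1) p(1), symmetric] by (simp add: image_image)
      also have "n ` pr (finv g p) = pr (finv g p)" using n g'(2) by (auto simp: N_def PP_def)
      also have "g ` pr (finv g p) = A"
        using gpr[OF g g'(2)] fgrpD(4)[OF G g] by (simp add: p(2) inv_apply_bij)
      finally show ?thesis .
    qed
    then show "g \<circ> n \<circ> finv g \<in> N"
      using g n fgrp_inv[OF G g] fgrpD(3)[OF G] by (auto simp: N_def)
  qed
  moreover have "card G \<le> 6 * card N"
  proof -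
    \<comment> \<open>Extended by the identity outside \<open>PP\<close> to give a permutation in
      the sense of \<open>permutes\<close>; three pairs admit 3! = 6 of them.\<close>
    define \<phi> where "\<phi> g = (\<lambda>A. if A \<in> PP then g ` A else A)" for g :: "'p \<Rightarrow> 'p"
    have gPP: "g ` A \<in> PP" if "g \<in> G" "A \<in> PP" for g A
      using that gpr gO by (auto simp: PP_def)
    have inv_im: "finv g ` g ` A = A" if "g \<in> G" for g A
      using fgrpD(4)[OF G that] by (simp add: image_comp inv_o_bij)
    have "card G \<le> card (\<phi> ` G) * card N"
    proof (rule card_le_fibres[OF G])
      show "finite N" using fgrpD(1)[OF G] by (simp add: N_def)
      fix f g assume fg: "f \<in> G" "g \<in> G" "\<phi> f = \<phi> g"
      have "(finv f \<circ> g) ` A = A" if "A \<in> PP" for A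
        using fun_cong[OF fg(3), of A] that inv_im[OF fg(1)] by (simp add: \<phi>_def image_image) (metis image_image)
      then show "finv f \<circ> g \<in> N" using fg fgrp_inv[OF G] fgrpD(3)[OF G] by (auto simp: N_def)
    qed
    moreover have "\<phi> ` G \<subseteq> {f. f permutes PP}"
    proof (clarify)
      fix g assume g: "g \<in> G"
      show "\<phi> g permutes PP"
      proof (rule bij_imp_permutes)
        show "bij_betw (\<phi> g) PP PP"
        proof (rule bij_betw_byWitness[where f' = "\<lambda>A. finv g ` A"])
          show "\<forall>A\<in>PP. finv g ` \<phi> g A = A" using inv_im[OF g] by (simp add: \<phi>_def)
          show "\<forall>A\<in>PP. \<phi> g (finv g ` A) = A"
            using gPP[OF fgrp_inv[OF G g]] fgrpD(4)[OF G g] by (simp add: \<phi>_def image_comp inv_o_bij)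
          show "\<phi> g ` PP \<subseteq> PP" "(`) (finv g) ` PP \<subseteq> PP"
            using gPP[OF g] gPP[OF fgrp_inv[OF G g]] by (auto simp: \<phi>_def)
        qed
      qed (simp add: \<phi>_def)
    qed
    then have "card (\<phi> ` G) \<le> card {f. f permutes PP}" using finite_permutations[OF finPP] by (rule card_mono[rotated])
    then have "card (\<phi> ` G) \<le> 6" using card_permutations[OF cPP finPP] by (simp add: fact_numeral)
    ultimately show ?thesis by (meson le_trans mult_le_mono1)
  qed
  ultimately show ?thesis unfolding jordan_le_def by auto
qed

text \<open>By \<open>burnside\<close>, the terms 1 - 1/n, one for each orbit with stabilizers of
  order n > 1, add up to 2 - 2/N, where N is the order of \<open>G\<close>. Each term is at least
  1/2 and at most 1 - 1/N, so a nontrivial group has two or three such orbits: there is a common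
  fixed point in the first case, and one of the types of \<open>triangle_group_arith\<close> in the
  second.\<close>

theorem classification:
  "jordan_le G 2 \<or> (jordan_le G 6 \<and> card G \<le> 24) \<or> (card G = 60 \<and> (\<exists>g\<in>G. g \<noteq> id \<and> g ^^ 5 = id))"
proof (cases "card G = 1")
  case True
  then show ?thesis using jordan_le_card[OF G] jordan_le_mono by fastforce
next
  case False
  have fin: "finite G" using fgrpD(1)[OF G] .
  have "card G \<noteq> 0" using fin fgrpD(2)[OF G] by auto
  then have N2: "card G \<ge> 2" using False by auto
  let ?Q = "orb G ` F"
  have finQ: "finite ?Q" using finite_F by simp
  have orbc: "\<exists>p\<in>F. W = orb G p \<and> card W * card (stab G p) = card G \<and> 2 \<le> card (stab G p) \<and> card W > 0"
    if "W \<in> ?Q" for W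
  proof -
    from that obtain p where p: "p \<in> F" "W = orb G p" by auto
    have e: "card W * card (stab G p) = card G" using p orbit_stabilizer[OF G] by auto
    then have "card W > 0" using N2 by (cases "card W") auto
    then show ?thesis using p e two_le_stab[OF p(1)] by auto
  qed
  have half: "2 * card W \<le> card G" "card W > 0" if "W \<in> ?Q" for W
  proof -
    from orbc[OF that] obtain p
      where p: "card W * card (stab G p) = card G" "2 \<le> card (stab G p)" "card W > 0"
      by blast
    show "card W > 0" by fact
    have "card W * 2 \<le> card W * card (stab G p)" using p(2) by (rule mult_le_mono2)
    then show "2 * card W \<le> card G" using p(1) by simp
  qed
  have lo: "card ?Q * card G \<le> 2 * (2 * (card G - 1))"
  proof -
    have "card ?Q * card G = (\<Sum>W\<in>?Q. card G)" by simp
    also have "\<dots> \<le> (\<Sum>W\<in>?Q. 2 * (card G - card W))" using half by (intro sum_mono) fastforce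
    also have "\<dots> = 2 * (2 * (card G - 1))" using burnside by (simp add: sum_distrib_left[symmetric])
    finally show ?thesis .
  qed
  have "card ?Q < 4"
  proof (rule ccontr)
    assume "\<not> card ?Q < 4"
    then have "4 * card G \<le> card ?Q * card G" by (intro mult_le_mono1) simp
    then show False using lo N2 by linarith
  qed
  have hi: "2 * (card G - 1) \<le> card ?Q * (card G - 1)"
  proof -
    have "2 * (card G - 1) = (\<Sum>W\<in>?Q. card G - card W)" using burnside by simp
    also have "\<dots> \<le> (\<Sum>W\<in>?Q. card G - 1)" using half by (intro sum_mono) fastforce
    also have "\<dots> = card ?Q * (card G - 1)" by simp
    finally show ?thesis .
  qed
  then have "2 \<le> card ?Q" using N2 by simp
  then consider "card ?Q = 2" | "card ?Q = 3" using \<open>card ?Q < 4\<close> by linarith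
  then show ?thesis
  proof cases
    case 1
    then obtain A B where AB: "?Q = {A, B}" "A \<noteq> B" by (auto simp: card_2_iff)
    have "(card G - card A) + (card G - card B) = 2 * (card G - 1)" using burnside AB by simp
    moreover have "card A > 0" "card B > 0" "2 * card A \<le> card G" using half AB by auto
    \<comment> \<open>The two orbit lengths are positive and add up to 2.\<close>
    ultimately have "card A = 1" using N2 by linarith
    then obtain p where p: "p \<in> F" "A = orb G p" "card (orb G p) = 1" using orbc[of A] AB by auto
    then have op: "orb G p = {p}" using orb_self[OF G, of p] by (auto simp: card_1_singleton_iff)
    have "g p = p" if "g \<in> G" for g using op that by (auto simp: orb_def)
    then have "jordan_le G 1" using comm by (intro jordan_le_abelian[OF G]) blast
    then show ?thesis using jordan_le_mono by fastforce
  next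
    case 2
    define n where "n W = card G div card W" for W :: "'p set"
    have nO: "card W * n W = card G" "2 \<le> n W" if "W \<in> ?Q" for W
    proof -
      from orbc[OF that] obtain p
        where p: "card W * card (stab G p) = card G" "2 \<le> card (stab G p)" "card W > 0"
        by blast
      then have "n W = card (stab G p)" unfolding n_def by (metis nonzero_mult_div_cancel_left less_numeral_extra(3))
      then show "card W * n W = card G" "2 \<le> n W" using p by auto
    qed
    have nstab: "card (stab G q) = n (orb G q)" if "q \<in> F" for q
      using orbit_stabilizer[OF G, of q] nO(1)[of "orb G q"] half(2)[of "orb G q"] that by (metis imageI mult_left_cancel not_gr_zero)
    obtain A B C where Q: "?Q = {A, B, C}" "A \<noteq> B" "A \<noteq> C" "B \<noteq> C" "n A \<le> n B" "n B \<le> n C"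
      using sorted_triple[OF 2, of n] .
    have "(card G - card A) + (card G - card B) + (card G - card C) = 2 * (card G - 1)"
      using burnside Q by simp
    moreover have "2 * card A \<le> card G" "2 * card B \<le> card G" "2 * card C \<le> card G" using half Q by auto
    ultimately have s: "card A + card B + card C = card G + 2" using N2 by linarith
    have ar: "n A = 2 \<and> (n B = 2 \<and> card C = 2 \<or> n B = 3 \<and>
      (n C = 3 \<and> card G = 12 \<or> n C = 4 \<and> card G = 24 \<or> n C = 5 \<and> card G = 60))"
      by (rule triangle_group_arith[OF _ _ _ _ Q(5,6) s]) (use nO Q(1) N2 in auto)
    obtain p where pA: "p \<in> F" "A = orb G p" using Q(1) by blast
    obtain r where rC: "r \<in> F" "C = orb G r" using Q(1) by blast
    consider "card C = 2" | "n A = 2" "n B = 3" "n C = 3" "card G = 12"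
      | "n A = 2" "n B = 3" "n C = 4" "card G = 24" | "n C = 5" "card G = 60"
      using ar by blast
    then show ?thesis
    proof cases
      case 1
      then show ?thesis using index_two[of r] rC by auto
    next
      case c: 2
      \<comment> \<open>Order 12: the six points are those with stabilizers of order 2, as the other
        two orbits have stabilizers of order 3.\<close>
      have "jordan_le G 6"
      proof (rule six_orbit[OF pA(1)])
        show "card (orb G p) = 6" using nO(1)[of A] Q(1) c pA by auto
        fix q assume q: "q \<in> F" "card (stab G q) = card (stab G p)"
        then have "n (orb G q) = n A" using nstab pA by auto
        moreover have "orb G q \<in> {A, B, C}" using q(1) Q(1) by blast
        ultimately have "orb G q = A" using c by auto
        then show "q \<in> orb G p" using orb_self[OF G, of q] pA by auto
      qed
      then show ?thesis using c by auto
    next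
      case c: 3
      \<comment> \<open>Order 24: the six points are those with stabilizers of order 4, the others
        having order 2 and 3.\<close>
      have "jordan_le G 6"
      proof (rule six_orbit[OF rC(1)])
        show "card (orb G r) = 6" using nO(1)[of C] Q(1) c rC by auto
        fix q assume q: "q \<in> F" "card (stab G q) = card (stab G r)"
        then have "n (orb G q) = n C" using nstab rC by auto
        moreover have "orb G q \<in> {A, B, C}" using q(1) Q(1) by blast
        ultimately have "orb G q = C" using c by auto
        then show "q \<in> orb G r" using orb_self[OF G, of q] rC by auto
      qed
      then show ?thesis using c by auto
    next
      case c: 4
      have c5: "card (stab G r) = 5" using nstab[OF rC(1)] rC(2) c by auto
      obtain g where g: "g \<in> G" "g \<noteq> id" "g r = r" using rC(1) by (auto simp: F_def)
      then have "g \<in> stab G r" by (simp add: stab_def)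
      then have "g ^^ 5 = id" using fgrp_pow[OF fgrp_stab[OF G, of r]] c5 by metis
      then show ?thesis using g c by auto
    qed
  qed
qed

end

section \<open>Moebius transformations\<close>

text \<open>\<open>None\<close> is the point at infinity. The value of \<open>pt\<close> at \<open>(0, 0)\<close> is junk.\<close>

type_synonym cp1 = "complex option"

definition pt :: "complex \<Rightarrow> complex \<Rightarrow> cp1" where
  "pt a b = (if b = 0 then None else Some (a / b))"

lemma pt_eq: "a \<noteq> 0 \<or> b \<noteq> 0 \<Longrightarrow> c \<noteq> 0 \<or> d \<noteq> 0 \<Longrightarrow> pt a b = pt c d \<longleftrightarrow> a * d = b * c"
  by (auto simp: pt_def field_simps)

lemma pt_surj: obtains a b where "a \<noteq> 0 \<or> b \<noteq> 0" "p = pt a b"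
proof (cases p)
  case None then show ?thesis using that[of 1 0] by (simp add: pt_def)
next
  case (Some t) then show ?thesis using that[of t 1] by (simp add: pt_def)
qed

lemma pt_scale: "k \<noteq> 0 \<Longrightarrow> pt (k * a) (k * b) = pt a b"
  by (simp add: pt_def)

text \<open>A relation between matrices and maps, since a map determines its matrix only up to a
  scalar (\<open>mobm_unique\<close>).\<close>

definition mobm :: "complex \<Rightarrow> complex \<Rightarrow> complex \<Rightarrow> complex \<Rightarrow> (cp1 \<Rightarrow> cp1) \<Rightarrow> bool" where
  "mobm a b c d g \<longleftrightarrow> a * d - b * c \<noteq> 0 \<and>
     (\<forall>x y. x \<noteq> 0 \<or> y \<noteq> 0 \<longrightarrow> g (pt x y) = pt (a * x + b * y) (c * x + d * y))"

text \<open>For a subfield \<open>K\<close> this is PGL_2(K), acting on the complex projective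
  line.\<close>

definition mob :: "complex set \<Rightarrow> (cp1 \<Rightarrow> cp1) set" where
  "mob K = {g. \<exists>a\<in>K. \<exists>b\<in>K. \<exists>c\<in>K. \<exists>d\<in>K. mobm a b c d g}"

lemma lin_nonzero:
  fixes a b c d x y :: complex
  assumes "a * d - b * c \<noteq> 0" "x \<noteq> 0 \<or> y \<noteq> 0"
  shows "a * x + b * y \<noteq> 0 \<or> c * x + d * y \<noteq> 0"
proof (rule ccontr)
  assume "\<not> ?thesis"
  then have "a * x + b * y = 0" "c * x + d * y = 0" by auto
  moreover have "(a * d - b * c) * x = d * (a * x + b * y) - b * (c * x + d * y)"
    "(a * d - b * c) * y = a * (c * x + d * y) - c * (a * x + b * y)" by (simp_all add: algebra_simps)
  ultimately show False using assms by auto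
qed

lemma mobm_det: "mobm a b c d g \<Longrightarrow> a * d - b * c \<noteq> 0" by (simp add: mobm_def)

lemma mobm_apply: "mobm a b c d g \<Longrightarrow> x \<noteq> 0 \<or> y \<noteq> 0 \<Longrightarrow> g (pt x y) = pt (a * x + b * y) (c * x + d * y)"
  by (simp add: mobm_def)

lemma mobm_nonzero: "mobm a b c d g \<Longrightarrow> x \<noteq> 0 \<or> y \<noteq> 0 \<Longrightarrow> a * x + b * y \<noteq> 0 \<or> c * x + d * y \<noteq> 0"
  using lin_nonzero mobm_det by blast

lemma mobm_ext: "mobm a b c d g \<Longrightarrow> mobm a b c d h \<Longrightarrow> g = h"
proof
  fix p assume "mobm a b c d g" "mobm a b c d h"
  then show "g p = h p" by (rule_tac pt_surj[of p]) (simp add: mobm_apply)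
qed

lemma mobm_ex: "a * d - b * c \<noteq> 0 \<Longrightarrow> \<exists>g. mobm a b c d g"
proof -
  assume d: "a * d - b * c \<noteq> 0"
  define g where "g p = (case p of None \<Rightarrow> pt a c | Some t \<Rightarrow> pt (a * t + b) (c * t + d))" for p
  have "g (pt x y) = pt (a * x + b * y) (c * x + d * y)" if xy: "x \<noteq> 0 \<or> y \<noteq> 0" for x y
  proof (cases "y = 0")
    case True
    then show ?thesis using xy pt_scale[of x a c] by (simp add: g_def pt_def[of x 0] mult.commute)
  next
    case False
    have "a * x + b * y = y * (a * (x / y) + b)" "c * x + d * y = y * (c * (x / y) + d)"
      using False by (simp_all add: distrib_left)
    then have "pt (a * x + b * y) (c * x + d * y) = pt (a * (x / y) + b) (c * (x / y) + d)"
      using pt_scale[OF False] by metis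
    then show ?thesis using False by (simp add: g_def pt_def[of x y])
  qed
  then show ?thesis using d unfolding mobm_def by blast
qed

lemma mobm_comp:
  assumes "mobm a b c d g" "mobm a' b' c' d' h"
  shows "mobm (a * a' + b * c') (a * b' + b * d') (c * a' + d * c') (c * b' + d * d') (g \<circ> h)"
  unfolding mobm_def
proof (intro conjI allI impI)
  have "(a * a' + b * c') * (c * b' + d * d') - (a * b' + b * d') * (c * a' + d * c') =
    (a * d - b * c) * (a' * d' - b' * c')" by Groebner_Basis.algebra
  then show "(a * a' + b * c') * (c * b' + d * d') - (a * b' + b * d') * (c * a' + d * c') \<noteq> 0"
    using assms mobm_det by simp
  fix x y :: complex assume xy: "x \<noteq> 0 \<or> y \<noteq> 0"
  show "(g \<circ> h) (pt x y) = pt ((a * a' + b * c') * x + (a * b' + b * d') * y)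
     ((c * a' + d * c') * x + (c * b' + d * d') * y)"
    using mobm_apply[OF assms(2) xy] mobm_apply[OF assms(1) mobm_nonzero[OF assms(2) xy]]
    by (simp add: algebra_simps)
qed

lemma mobm_scale: "mobm a b c d g \<Longrightarrow> k \<noteq> 0 \<Longrightarrow> mobm (k * a) (k * b) (k * c) (k * d) g"
proof -
  assume m: "mobm a b c d g" and k: "k \<noteq> 0"
  have "k * a * (k * d) - k * b * (k * c) = k * k * (a * d - b * c)" by Groebner_Basis.algebra
  moreover have "k * a * x + k * b * y = k * (a * x + b * y)" "k * c * x + k * d * y = k * (c * x + d * y)" for x y
    by Groebner_Basis.algebra+
  ultimately show ?thesis using m k unfolding mobm_def by (simp add: pt_scale)
qed

lemma mobm_id: "mobm 1 0 0 1 id"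
  by (simp add: mobm_def)

lemma mobm_eq_id:
  assumes "mobm a b c d id" shows "b = 0" "c = 0" "a = d"
proof -
  have n: "a \<noteq> 0 \<or> c \<noteq> 0" "b \<noteq> 0 \<or> d \<noteq> 0" "a + b \<noteq> 0 \<or> c + d \<noteq> 0"
    using mobm_nonzero[OF assms, of 1 0] mobm_nonzero[OF assms, of 0 1] mobm_nonzero[OF assms, of 1 1] by auto
  have "pt 1 0 = pt a c" "pt 0 1 = pt b d" "pt 1 1 = pt (a + b) (c + d)"
    using mobm_apply[OF assms, of 1 0] mobm_apply[OF assms, of 0 1] mobm_apply[OF assms, of 1 1] by auto
  then show "b = 0" "c = 0" "a = d" using n by (auto simp: pt_eq)
qed

lemma mobm_scalar: "mobm a 0 0 a g \<Longrightarrow> g = id"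
proof -
  assume m: "mobm a 0 0 a g"
  then have "a \<noteq> 0" using mobm_det by fastforce
  then have "mobm (a * 1) (a * 0) (a * 0) (a * 1) id" by (intro mobm_scale[OF mobm_id])
  then show ?thesis using mobm_ext m by simp
qed

lemma mobm_inv:
  assumes "mobm a b c d g"
  shows "bij g" "mobm d (- b) (- c) a (finv g)"
proof -
  have "d * a - - b * - c \<noteq> 0" using mobm_det[OF assms] by (simp add: algebra_simps)
  then obtain h where h: "mobm d (- b) (- c) a h" using mobm_ex by blast
  have "g \<circ> h = id" "h \<circ> g = id"
  proof -
    have "mobm (a * d - b * c) 0 0 (a * d - b * c) (g \<circ> h)" using mobm_comp[OF assms h] by (simp add: algebra_simps)
    then show "g \<circ> h = id" by (rule mobm_scalar)
    have "mobm (a * d - b * c) 0 0 (a * d - b * c) (h \<circ> g)" using mobm_comp[OF h assms] by (simp add: algebra_simps)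
    then show "h \<circ> g = id" by (rule mobm_scalar)
  qed
  then show "bij g" "mobm d (- b) (- c) a (finv g)"
    using h o_bij inv_unique_comp by blast+
qed

text \<open>The adjugate of the first matrix times the second represents the identity, so it is a
  scalar \<open>e\<close>.\<close>

lemma mobm_unique:
  assumes "mobm a b c d g" "mobm a' b' c' d' g"
  obtains k where "k \<noteq> 0" "a' = k * a" "b' = k * b" "c' = k * c" "d' = k * d"
proof -
  let ?D = "a * d - b * c"
  have D: "?D \<noteq> 0" by (rule mobm_det[OF assms(1)])
  have "finv g \<circ> g = id" using mobm_inv(1)[OF assms(1)] by (rule inv_o_bij)
  then have m: "mobm (d * a' + - b * c') (d * b' + - b * d') (- c * a' + a * c') (- c * b' + a * d') id"
    using mobm_comp[OF mobm_inv(2)[OF assms(1)] assms(2)] by metis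
  define e where "e = d * a' + - b * c'"
  have e1: "d * b' - b * d' = 0" "a * c' - c * a' = 0" "a * d' - c * b' = e" "d * a' - b * c' = e"
    using mobm_eq_id[OF m] by (auto simp: e_def)
  have "?D * a' = e * a" "?D * b' = e * b" "?D * c' = e * c" "?D * d' = e * d" using e1 by Groebner_Basis.algebra+
  then have r: "a' = e / ?D * a" "b' = e / ?D * b" "c' = e / ?D * c" "d' = e / ?D * d"
    using D by (auto simp: field_simps)
  moreover have "e / ?D \<noteq> 0" using r mobm_det[OF assms(2)] by auto
  ultimately show ?thesis using that by blast
qed

section \<open>Moebius transformations over a subfield\<close>

definition subfld :: "complex set \<Rightarrow> bool" where
  "subfld K \<longleftrightarrow> 0 \<in> K \<and> 1 \<in> K \<and> (\<forall>x\<in>K. \<forall>y\<in>K. x + y \<in> K \<and> x * y \<in> K) \<and> (\<forall>x\<in>K. - x \<in> K \<and> inverse x \<in> K)"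

lemma subfldD:
  assumes "subfld K"
  shows "0 \<in> K" "1 \<in> K" "\<And>x y. x \<in> K \<Longrightarrow> y \<in> K \<Longrightarrow> x + y \<in> K" "\<And>x y. x \<in> K \<Longrightarrow> y \<in> K \<Longrightarrow> x * y \<in> K"
    "\<And>x. x \<in> K \<Longrightarrow> - x \<in> K" "\<And>x. x \<in> K \<Longrightarrow> inverse x \<in> K"
    "\<And>x y. x \<in> K \<Longrightarrow> y \<in> K \<Longrightarrow> x - y \<in> K" "\<And>x y. x \<in> K \<Longrightarrow> y \<in> K \<Longrightarrow> x / y \<in> K"
    "\<And>x n. x \<in> K \<Longrightarrow> x ^ n \<in> K" "numeral w \<in> K"
proof -
  note s = assms[unfolded subfld_def]
  show "0 \<in> K" "1 \<in> K" "\<And>x y. x \<in> K \<Longrightarrow> y \<in> K \<Longrightarrow> x + y \<in> K" "\<And>x y. x \<in> K \<Longrightarrow> y \<in> K \<Longrightarrow> x * y \<in> K"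
    "\<And>x. x \<in> K \<Longrightarrow> - x \<in> K" "\<And>x. x \<in> K \<Longrightarrow> inverse x \<in> K" using s by auto
  then show "x - y \<in> K" if "x \<in> K" "y \<in> K" for x y using that by (metis diff_conv_add_uminus)
  show "x / y \<in> K" if "x \<in> K" "y \<in> K" for x y using that s by (simp add: divide_inverse)
  show "x ^ n \<in> K" if "x \<in> K" for x n using that s by (induction n) auto
  have "of_nat n \<in> K" for n using s by (induction n) auto
  from this[of "numeral w"] show "numeral w \<in> K" by simp
qed

lemma mob_comp: "subfld K \<Longrightarrow> g \<in> mob K \<Longrightarrow> h \<in> mob K \<Longrightarrow> g \<circ> h \<in> mob K"
proof -
  assume K: "subfld K" and "g \<in> mob K" "h \<in> mob K"
  then obtain a b c d a' b' c' d' where m: "mobm a b c d g" "mobm a' b' c' d' h"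
    and K': "a \<in> K" "b \<in> K" "c \<in> K" "d \<in> K" "a' \<in> K" "b' \<in> K" "c' \<in> K" "d' \<in> K"
    unfolding mob_def by blast
  have "a * a' + b * c' \<in> K" "a * b' + b * d' \<in> K" "c * a' + d * c' \<in> K" "c * b' + d * d' \<in> K"
    using K' subfldD(3,4)[OF K] by simp_all
  then show "g \<circ> h \<in> mob K" using mobm_comp[OF m] unfolding mob_def by blast
qed

lemma mob_id: "subfld K \<Longrightarrow> id \<in> mob K"
  unfolding mob_def using mobm_id subfldD(1,2) by blast

lemma mob_inv: "subfld K \<Longrightarrow> g \<in> mob K \<Longrightarrow> finv g \<in> mob K"
  unfolding mob_def using mobm_inv(2) subfldD(5)[of K] by blast

lemma mob_bij: "g \<in> mob K \<Longrightarrow> bij g"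
  unfolding mob_def using mobm_inv(1) by blast

lemma mob_mono: "K \<subseteq> L \<Longrightarrow> mob K \<subseteq> mob L"
  unfolding mob_def by blast

lemma mob_UNIV: "mobm a b c d g \<Longrightarrow> g \<in> mob UNIV"
  unfolding mob_def by blast

lemma mob_UNIVE: assumes "g \<in> mob K" obtains a b c d where "mobm a b c d g"
  using assms unfolding mob_def by blast

lemma subfld_UNIV: "subfld UNIV" by (simp add: subfld_def)

definition rat_pt :: "complex set \<Rightarrow> cp1 \<Rightarrow> bool" where
  "rat_pt L p \<longleftrightarrow> (\<exists>x\<in>L. \<exists>y\<in>L. (x \<noteq> 0 \<or> y \<noteq> 0) \<and> p = pt x y)"

lemma pt_eq_scale:
  assumes "a \<noteq> 0 \<or> b \<noteq> 0" "c \<noteq> 0 \<or> d \<noteq> 0" "pt a b = pt c d"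
  obtains k where "k \<noteq> 0" "a = k * c" "b = k * d"
proof -
  have e: "a * d = b * c" using assms pt_eq by blast
  show ?thesis
  proof (cases "c = 0")
    case True
    then show ?thesis using assms e by (intro that[of "b / d"]) auto
  next
    case False
    then show ?thesis using assms e by (intro that[of "a / c"]) (auto simp: field_simps)
  qed
qed

text \<open>Rationality of the images of infinity and 0 makes the two columns rational up to factors
  \<open>k\<close> and \<open>l\<close>. The image of 1 then makes the ratio of these factors
  rational, by Cramer's rule with the determinant \<open>D\<close>.\<close>

lemma mob_of_rat_pts:
  assumes L: "subfld L" and g: "g \<in> mob UNIV"
    and r: "rat_pt L (g (pt 1 0))" "rat_pt L (g (pt 0 1))" "rat_pt L (g (pt 1 1))"
  shows "g \<in> mob L"
proof -
  obtain a b c d where m: "mobm a b c d g" using g by (rule mob_UNIVE)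
  have n: "a \<noteq> 0 \<or> c \<noteq> 0" "b \<noteq> 0 \<or> d \<noteq> 0" "a + b \<noteq> 0 \<or> c + d \<noteq> 0"
    using mobm_nonzero[OF m, of 1 0] mobm_nonzero[OF m, of 0 1] mobm_nonzero[OF m, of 1 1] by auto
  have e: "g (pt 1 0) = pt a c" "g (pt 0 1) = pt b d" "g (pt 1 1) = pt (a + b) (c + d)"
    using mobm_apply[OF m, of 1 0] mobm_apply[OF m, of 0 1] mobm_apply[OF m, of 1 1] by auto
  obtain a1 c1 where 1: "a1 \<in> L" "c1 \<in> L" "a1 \<noteq> 0 \<or> c1 \<noteq> 0" "pt a c = pt a1 c1" using r(1) e by (auto simp: rat_pt_def)
  obtain b1 d1 where 2: "b1 \<in> L" "d1 \<in> L" "b1 \<noteq> 0 \<or> d1 \<noteq> 0" "pt b d = pt b1 d1" using r(2) e by (auto simp: rat_pt_def)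
  obtain e1 f1 where 3: "e1 \<in> L" "f1 \<in> L" "e1 \<noteq> 0 \<or> f1 \<noteq> 0" "pt (a + b) (c + d) = pt e1 f1" using r(3) e by (auto simp: rat_pt_def)
  obtain k where k: "k \<noteq> 0" "a = k * a1" "c = k * c1" using pt_eq_scale[OF n(1) 1(3,4)] .
  obtain l where l: "l \<noteq> 0" "b = l * b1" "d = l * d1" using pt_eq_scale[OF n(2) 2(3,4)] .
  obtain w where w: "w \<noteq> 0" "a + b = w * e1" "c + d = w * f1" using pt_eq_scale[OF n(3) 3(3,4)] .
  define D where "D = a1 * d1 - b1 * c1"
  have D: "D \<noteq> 0" using mobm_det[OF m] k l by (auto simp: D_def algebra_simps)
  have "k * D = w * (e1 * d1 - b1 * f1)" "l * D = w * (a1 * f1 - c1 * e1)"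
    using w k l unfolding D_def by Groebner_Basis.algebra+
  then have kl: "inverse w * k = (e1 * d1 - b1 * f1) / D" "inverse w * l = (a1 * f1 - c1 * e1) / D"
    using D w by (auto simp: field_simps)
  have DL: "D \<in> L" unfolding D_def using 1 2 subfldD[OF L] by simp
  have "inverse w * k \<in> L" "inverse w * l \<in> L" unfolding kl using 1 2 3 DL subfldD[OF L] by simp_all
  then have "inverse w * a \<in> L" "inverse w * b \<in> L" "inverse w * c \<in> L" "inverse w * d \<in> L"
    using 1 2 subfldD(4)[OF L] unfolding k(2,3) l(2,3) mult.assoc[symmetric] by blast+
  moreover have "mobm (inverse w * a) (inverse w * b) (inverse w * c) (inverse w * d) g"
    using mobm_scale[OF m] w(1) by simp
  ultimately show ?thesis unfolding mob_def by blast
qed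

text \<open>With half the trace called \<open>l\<close>, the matrix is \<open>l\<close> times the
  identity plus a matrix of square zero, so up to a scalar its powers grow linearly.\<close>

lemma parabolic_pow:
  assumes m: "mobm a b c d g" and disc: "(a - d)\<^sup>2 + 4 * b * c = 0"
  shows "mobm ((a + d) / 2 + of_nat (Suc n) * ((a - d) / 2)) (of_nat (Suc n) * b) (of_nat (Suc n) * c)
    ((a + d) / 2 - of_nat (Suc n) * ((a - d) / 2)) (g ^^ Suc n)"
proof (induction n)
  case 0
  have "(a + d) / 2 + (a - d) / 2 = a" "(a + d) / 2 - (a - d) / 2 = d" by (auto simp: field_simps)
  then show ?case using m by simp
next
  case (Suc n)
  define l where "l = (a + d) / 2"
  define u where "u = (a - d) / 2"
  define k :: complex where "k = of_nat (Suc n)"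
  have ad: "a = l + u" "d = l - u" by (auto simp: l_def u_def field_simps)
  have uu: "u * u = - (b * c)"
    using disc unfolding u_def by (simp add: power2_eq_square field_simps eq_neg_iff_add_eq_0)
  have "a * d - b * c = l * l" using uu ad by Groebner_Basis.algebra
  then have l0: "l \<noteq> 0" using mobm_det[OF m] by auto
  have IH: "mobm (l + k * u) (k * b) (k * c) (l - k * u) (g ^^ Suc n)" using Suc by (simp only: l_def u_def k_def)
  have eqs: "a * (l + k * u) + b * (k * c) = l * (l + (1 + k) * u)" "a * (k * b) + b * (l - k * u) = l * ((1 + k) * b)"
    "c * (l + k * u) + d * (k * c) = l * ((1 + k) * c)" "c * (k * b) + d * (l - k * u) = l * (l - (1 + k) * u)"
    using uu ad by Groebner_Basis.algebra+
  have "mobm (l * (l + (1 + k) * u)) (l * ((1 + k) * b)) (l * ((1 + k) * c)) (l * (l - (1 + k) * u)) (g \<circ> g ^^ Suc n)"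
    using mobm_comp[OF m IH] unfolding eqs .
  from mobm_scale[OF this, of "inverse l"] l0
  have "mobm (l + (1 + k) * u) ((1 + k) * b) ((1 + k) * c) (l - (1 + k) * u) (g \<circ> g ^^ Suc n)"
    by (simp add: mult.assoc[symmetric])
  moreover have "(1 + k) = of_nat (Suc (Suc n))" by (simp add: k_def)
  ultimately show ?case by (simp only: l_def u_def funpow.simps)
qed

text \<open>The \<open>n\<close>-th power multiplies the nilpotent part by \<open>n\<close>, which
  is not zero in characteristic zero.\<close>

lemma parabolic_finite_order:
  assumes m: "mobm a b c d g" and disc: "(a - d)\<^sup>2 + 4 * b * c = 0" and "g ^^ n = id" "n > 0"
  shows "g = id"
proof -
  obtain k where k: "n = Suc k" using assms(4) by (cases n) auto
  have s0: "(of_nat (Suc k) :: complex) \<noteq> 0" by (simp del: of_nat_Suc)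
  note M = parabolic_pow[OF m disc, of k, folded k, unfolded assms(3)]
  have "b = 0" "c = 0" using mobm_eq_id(1,2)[OF M] s0 k by auto
  then have "a = d" using disc by simp
  then show ?thesis using m \<open>b = 0\<close> \<open>c = 0\<close> mobm_scalar by auto
qed

lemma mobm_fixed:
  assumes "mobm a b c d g" "x \<noteq> 0 \<or> y \<noteq> 0"
  shows "g (pt x y) = pt x y \<longleftrightarrow> c * x\<^sup>2 + (d - a) * x * y - b * y\<^sup>2 = 0"
proof -
  have "g (pt x y) = pt x y \<longleftrightarrow> (a * x + b * y) * y = (c * x + d * y) * x"
    using mobm_apply[OF assms] pt_eq[OF mobm_nonzero[OF assms] assms(2)] by simp
  then show ?thesis by (auto simp: algebra_simps power2_eq_square)
qed

text \<open>The condition says that the quadratic form of \<open>mobm_fixed\<close> has nonzero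
  discriminant. Infinity is one of its zeros exactly when \<open>c = 0\<close>, which is why that
  case is separate.\<close>

lemma mobm_two_fixed:
  assumes m: "mobm a b c d g" and disc: "(a - d)\<^sup>2 + 4 * b * c \<noteq> 0"
  shows "card (fix_pts g) = 2"
proof (cases "c = 0")
  case True
  then have ad: "a \<noteq> d" using disc by auto
  have "fix_pts g = {pt 1 0, pt b (d - a)}"
  proof (rule Set.set_eqI)
    fix p obtain x y where p: "x \<noteq> 0 \<or> y \<noteq> 0" "p = pt x y" by (rule pt_surj[of p])
    have "c * x\<^sup>2 + (d - a) * x * y - b * y\<^sup>2 = y * ((d - a) * x - b * y)"
      unfolding True by Groebner_Basis.algebra
    then have "p \<in> fix_pts g \<longleftrightarrow> y * ((d - a) * x - b * y) = 0"
      unfolding p(2) fix_pts_def mem_Collect_eq mobm_fixed[OF m p(1)] by simp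
    also have "\<dots> \<longleftrightarrow> p = pt 1 0 \<or> p = pt b (d - a)"
    proof -
      have "pt x y = pt 1 0 \<longleftrightarrow> y = 0" using pt_eq[OF p(1), of 1 0] by auto
      moreover have "pt x y = pt b (d - a) \<longleftrightarrow> x * (d - a) = y * b" using ad by (intro pt_eq[OF p(1)]) simp
      ultimately show ?thesis unfolding p(2) by (simp add: mult.commute)
    qed
    finally show "p \<in> fix_pts g \<longleftrightarrow> p \<in> {pt 1 0, pt b (d - a)}" by simp
  qed
  moreover have "pt 1 0 \<noteq> pt b (d - a)" using ad by (simp add: pt_eq)
  ultimately show ?thesis by simp
next
  case False
  define s where "s = csqrt ((a - d)\<^sup>2 + 4 * b * c)"
  have s: "s\<^sup>2 = (a - d)\<^sup>2 + 4 * b * c" "s \<noteq> 0" using disc by (auto simp: s_def)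
  have "fix_pts g = {pt (a - d + s) (2 * c), pt (a - d - s) (2 * c)}"
  proof (rule Set.set_eqI)
    fix p obtain x y where p: "x \<noteq> 0 \<or> y \<noteq> 0" "p = pt x y" by (rule pt_surj[of p])
    have "4 * c * (c * x\<^sup>2 + (d - a) * x * y - b * y\<^sup>2) =
      (2 * c * x - (a - d + s) * y) * (2 * c * x - (a - d - s) * y)"
      using s(1) by Groebner_Basis.algebra
    then have "p \<in> fix_pts g \<longleftrightarrow> (2 * c * x - (a - d + s) * y) * (2 * c * x - (a - d - s) * y) = 0"
      unfolding p(2) fix_pts_def mem_Collect_eq mobm_fixed[OF m p(1)] using False
      by (metis mult_eq_0_iff zero_neq_numeral)
    also have "\<dots> \<longleftrightarrow> p = pt (a - d + s) (2 * c) \<or> p = pt (a - d - s) (2 * c)"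
    proof -
      have "pt x y = pt (a - d + s) (2 * c) \<longleftrightarrow> x * (2 * c) = y * (a - d + s)"
        "pt x y = pt (a - d - s) (2 * c) \<longleftrightarrow> x * (2 * c) = y * (a - d - s)"
        using False by (intro pt_eq[OF p(1)]; simp)+
      then show ?thesis unfolding p(2) by (auto simp: mult.commute)
    qed
    finally show "p \<in> fix_pts g \<longleftrightarrow> p \<in> {pt (a - d + s) (2 * c), pt (a - d - s) (2 * c)}" by simp
  qed
  moreover have "pt (a - d + s) (2 * c) \<noteq> pt (a - d - s) (2 * c)" using False s(2) by (simp add: pt_eq)
  ultimately show ?thesis by simp
qed

lemma eigenvalue_quadratic:
  fixes a b c d x y e :: complex
  assumes "a * x + b * y = e * x" "c * x + d * y = e * y" "x \<noteq> 0 \<or> y \<noteq> 0"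
  shows "e\<^sup>2 - (a + d) * e + (a * d - b * c) = 0"
proof -
  have "(e\<^sup>2 - (a + d) * e + (a * d - b * c)) * x = 0" "(e\<^sup>2 - (a + d) * e + (a * d - b * c)) * y = 0"
    using assms(1,2) by Groebner_Basis.algebra+
  then show ?thesis using assms(3) by auto
qed

text \<open>The commutator of two matrices with a common eigenvector is, up to the scalar \<open>det M det N\<close>,
  unipotent; being of finite order it is trivial.\<close>

lemma common_fixed_comm:
  assumes G: "fgrp G" "G \<subseteq> mob UNIV" and g: "g \<in> G" "g p = p" and h: "h \<in> G" "h p = p"
  shows "g \<circ> h = h \<circ> g"
proof -
  obtain x y where p: "x \<noteq> 0 \<or> y \<noteq> 0" "p = pt x y" by (rule pt_surj[of p])
  obtain a b c d where m: "mobm a b c d g" using G(2) g(1) mob_UNIVE by blast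
  obtain a' b' c' d' where m': "mobm a' b' c' d' h" using G(2) h(1) mob_UNIVE by blast
  have "pt (a * x + b * y) (c * x + d * y) = pt x y" using mobm_apply[OF m p(1)] g(2) p(2) by simp
  then obtain e where e: "a * x + b * y = e * x" "c * x + d * y = e * y"
    using pt_eq_scale[OF mobm_nonzero[OF m p(1)] p(1)] by metis
  have "pt (a' * x + b' * y) (c' * x + d' * y) = pt x y" using mobm_apply[OF m' p(1)] h(2) p(2) by simp
  then obtain e' where e': "a' * x + b' * y = e' * x" "c' * x + d' * y = e' * y"
    using pt_eq_scale[OF mobm_nonzero[OF m' p(1)] p(1)] by metis
  define D where "D = a * d - b * c"
  define D' where "D' = a' * d' - b' * c'"
  define A B C E where "A = a * a' + b * c'" and "B = a * b' + b * d'" and "C = c * a' + d * c'" and "E = c * b' + d * d'"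
  define A' B' C' E' where "A' = d * d' + - b * - c'" and "B' = d * - b' + - b * a'"
    and "C' = - c * d' + a * - c'" and "E' = - c * - b' + a * a'"
  have gh: "mobm A B C E (g \<circ> h)" unfolding A_def B_def C_def E_def by (rule mobm_comp[OF m m'])
  have gh': "mobm A' B' C' E' (finv g \<circ> finv h)" unfolding A'_def B'_def C'_def E'_def
    by (rule mobm_comp[OF mobm_inv(2)[OF m] mobm_inv(2)[OF m']])
  define k where "k = (g \<circ> h) \<circ> (finv g \<circ> finv h)"
  have km: "mobm (A * A' + B * C') (A * B' + B * E') (C * A' + E * C') (C * B' + E * E') k"
    unfolding k_def by (rule mobm_comp[OF gh gh'])
  have kG: "k \<in> G" unfolding k_def using g(1) h(1) fgrp_inv[OF G(1)] fgrpD(3)[OF G(1)] by simp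
  have v1: "A * x + B * y = e * e' * x" "C * x + E * y = e * e' * y"
    unfolding A_def B_def C_def E_def using e e' by Groebner_Basis.algebra+
  have "e\<^sup>2 - (a + d) * e + D = 0" "e'\<^sup>2 - (a' + d') * e' + D' = 0"
    using eigenvalue_quadratic[OF e p(1)] eigenvalue_quadratic[OF e' p(1)] by (simp_all add: D_def D'_def)
  then have tr: "e * (a + d - e) = D" "e' * (a' + d' - e') = D'" by (auto simp: algebra_simps power2_eq_square)
  \<comment> \<open>The second eigenvalues of the two matrices; on the common eigenvector they are
    the eigenvalues of the adjugates.\<close>
  define f f' where "f = a + d - e" and "f' = a' + d' - e'"
  have i1: "d * x + - b * y = f * x" "- c * x + a * y = f * y" unfolding f_def using e by Groebner_Basis.algebra+
  have i2: "d' * x + - b' * y = f' * x" "- c' * x + a' * y = f' * y" unfolding f'_def using e' by Groebner_Basis.algebra+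
  have v2: "A' * x + B' * y = f * f' * x" "C' * x + E' * y = f * f' * y"
    unfolding A'_def B'_def C'_def E'_def using i1 i2 by Groebner_Basis.algebra+
  have v3: "(A * A' + B * C') * x + (A * B' + B * E') * y = D * D' * x"
    "(C * A' + E * C') * x + (C * B' + E * E') * y = D * D' * y"
  proof -
    have ff: "e * e' * (f * f') = D * D'" using arg_cong2[where f="(*)", OF tr] unfolding f_def f'_def by (simp only: mult.assoc mult.left_commute)
    have "(A * A' + B * C') * x + (A * B' + B * E') * y = A * (A' * x + B' * y) + B * (C' * x + E' * y)"
      "(C * A' + E * C') * x + (C * B' + E * E') * y = C * (A' * x + B' * y) + E * (C' * x + E' * y)"
      by Groebner_Basis.algebra+
    then have "(A * A' + B * C') * x + (A * B' + B * E') * y = f * f' * (A * x + B * y)"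
      "(C * A' + E * C') * x + (C * B' + E * E') * y = f * f' * (C * x + E * y)"
      unfolding v2 by Groebner_Basis.algebra+
    then show "(A * A' + B * C') * x + (A * B' + B * E') * y = D * D' * x"
      "(C * A' + E * C') * x + (C * B' + E * E') * y = D * D' * y"
      unfolding v1 using ff by Groebner_Basis.algebra+
  qed
  have det: "(A * A' + B * C') * (C * B' + E * E') - (A * B' + B * E') * (C * A' + E * C') = (D * D')\<^sup>2"
  proof -
    have "(A * A' + B * C') * (C * B' + E * E') - (A * B' + B * E') * (C * A' + E * C') = (A * E - B * C) * (A' * E' - B' * C')"
      by Groebner_Basis.algebra
    moreover have "A * E - B * C = D * D'" unfolding A_def B_def C_def E_def D_def D'_def by Groebner_Basis.algebra
    moreover have "A' * E' - B' * C' = D * D'" unfolding A'_def B'_def C'_def E'_def D_def D'_def by Groebner_Basis.algebra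
    ultimately show ?thesis by (simp add: power2_eq_square)
  qed
  \<comment> \<open>The matrix of the commutator has the eigenvalue \<open>D * D'\<close> and the
    determinant \<open>(D * D')\<^sup>2\<close>, so its trace \<open>T\<close> is
    \<open>2 * (D * D')\<close> and its discriminant vanishes.\<close>
  define T where "T = A * A' + B * C' + (C * B' + E * E')"
  have DD: "D * D' \<noteq> 0" using mobm_det[OF m] mobm_det[OF m'] by (simp add: D_def D'_def)
  have "(D * D')\<^sup>2 - T * (D * D') + (D * D')\<^sup>2 = 0"
    using eigenvalue_quadratic[OF v3 p(1)] unfolding det T_def .
  then have "(D * D') * (2 * (D * D') - T) = 0" by Groebner_Basis.algebra
  then have T: "T = 2 * (D * D')" using DD by simp
  have "((A * A' + B * C') - (C * B' + E * E'))\<^sup>2 + 4 * (A * B' + B * E') * (C * A' + E * C') = T\<^sup>2 - 4 * (D * D')\<^sup>2"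
    unfolding det[symmetric] T_def by Groebner_Basis.algebra
  also have "\<dots> = 0" using T by Groebner_Basis.algebra
  finally have "k = id"
    by (rule parabolic_finite_order[OF km _ fgrp_pow[OF G(1) kG]])
      (use fgrpD[OF G(1)] in \<open>auto simp: card_gt_0_iff\<close>)
  have bg: "bij g" "bij h" using mobm_inv(1) m m' by auto
  have "g \<circ> h = k \<circ> (h \<circ> g)" unfolding k_def using bg by (auto simp: fun_eq_iff inv_apply_bij)
  then show ?thesis using \<open>k = id\<close> by simp
qed

lemma two_fix_mob:
  assumes "fgrp G" "G \<subseteq> mob UNIV" shows "two_fix G"
proof
  show "fgrp G" by fact
  fix g assume g: "g \<in> G" "g \<noteq> id"
  obtain a b c d where m: "mobm a b c d g" using assms(2) g(1) mob_UNIVE by blast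
  have "card G > 0" using fgrpD[OF assms(1)] by (auto simp: card_gt_0_iff)
  then have "(a - d)\<^sup>2 + 4 * b * c \<noteq> 0"
    using parabolic_finite_order[OF m _ fgrp_pow[OF assms(1) g(1)]] g(2) by auto
  then show "card (fix_pts g) = 2" by (rule mobm_two_fixed[OF m])
next
  fix g h p assume "g \<in> G" "h \<in> G" "g p = p" "h p = p"
  then show "g \<circ> h = h \<circ> g" by (intro common_fixed_comm[OF assms, of g p h])
qed

text \<open>By Cayley-Hamilton every power of a matrix is \<open>u\<close> times the matrix plus
  \<open>v\<close> times the identity; this is the recursion for the two coefficients.\<close>

lemma mobm_linear_pow:
  assumes m: "mobm a b c d g" and n: "mobm (u * a + v) (u * b) (u * c) (u * d + v) (g ^^ n)"
    and w: "w = u * (a + d) + v" "z = - (u * (a * d - b * c))"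
  shows "mobm (w * a + z) (w * b) (w * c) (w * d + z) (g ^^ Suc n)"
proof -
  have "a * (u * a + v) + b * (u * c) = w * a + z" "a * (u * b) + b * (u * d + v) = w * b"
    "c * (u * a + v) + d * (u * c) = w * c" "c * (u * b) + d * (u * d + v) = w * d + z"
    unfolding w by Groebner_Basis.algebra+
  then show ?thesis using mobm_comp[OF m n] by simp
qed

text \<open>The fifth power is \<open>w\<close> times the matrix plus a scalar matrix, so
  \<open>w = 0\<close> unless \<open>g\<close> is trivial. With trace \<open>s\<close> and
  determinant \<open>p\<close>, this is the equation t^2 - 3 t + 1 = 0 for t = s^2/p, whose
  discriminant is 5; its root 2 t - 3 is expressed by the entries of the matrix.\<close>

lemma order_five_sqrt5:
  assumes L: "subfld L" and g: "g \<in> mob L" "g \<noteq> id" "g ^^ 5 = id"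
  shows "\<exists>r\<in>L. r\<^sup>2 = 5"
proof -
  obtain a b c d where K: "a \<in> L" "b \<in> L" "c \<in> L" "d \<in> L" and m: "mobm a b c d g"
    using g(1) unfolding mob_def by blast
  define s p where "s = a + d" and "p = a * d - b * c"
  have p0: "p \<noteq> 0" using mobm_det[OF m] by (simp add: p_def)
  have 1: "mobm (1 * a + 0) (1 * b) (1 * c) (1 * d + 0) (g ^^ 1)" using m by simp
  have 2: "mobm (s * a + - p) (s * b) (s * c) (s * d + - p) (g ^^ Suc 1)"
    by (rule mobm_linear_pow[OF m 1]) (simp_all add: s_def p_def)
  have 3: "mobm ((s\<^sup>2 - p) * a + - (s * p)) ((s\<^sup>2 - p) * b) ((s\<^sup>2 - p) * c) ((s\<^sup>2 - p) * d + - (s * p)) (g ^^ Suc (Suc 1))"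
    by (rule mobm_linear_pow[OF m 2]) (simp_all add: s_def p_def power2_eq_square)
  have 4: "mobm ((s^3 - 2 * s * p) * a + - ((s\<^sup>2 - p) * p)) ((s^3 - 2 * s * p) * b) ((s^3 - 2 * s * p) * c)
     ((s^3 - 2 * s * p) * d + - ((s\<^sup>2 - p) * p)) (g ^^ Suc (Suc (Suc 1)))"
  proof (rule mobm_linear_pow[OF m 3])
    show "s^3 - 2 * s * p = (s\<^sup>2 - p) * (a + d) + - (s * p)"
      unfolding s_def[symmetric] by Groebner_Basis.algebra
  qed (simp add: p_def)
  define w where "w = s^4 - 3 * s\<^sup>2 * p + p\<^sup>2"
  have 5: "mobm (w * a + - ((s^3 - 2 * s * p) * p)) (w * b) (w * c)
     (w * d + - ((s^3 - 2 * s * p) * p)) (g ^^ Suc (Suc (Suc (Suc 1))))"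
  proof (rule mobm_linear_pow[OF m 4])
    show "w = (s^3 - 2 * s * p) * (a + d) + - ((s\<^sup>2 - p) * p)"
      unfolding s_def[symmetric] w_def by Groebner_Basis.algebra
  qed (simp add: p_def)
  have "Suc (Suc (Suc (Suc 1))) = 5" by simp
  note 6 = 5[unfolded this g(3)]
  have "w * b = 0" "w * c = 0" "w * a = w * d" using mobm_eq_id[OF 6] by auto
  then have "w = 0" using g(2) m mobm_scalar by (cases "w = 0") auto
  then have "((2 * s\<^sup>2 - 3 * p) / p)\<^sup>2 = 5" using p0 unfolding w_def
    by (simp add: power_divide divide_eq_eq) Groebner_Basis.algebra
  moreover have "(2 * s\<^sup>2 - 3 * p) / p \<in> L" unfolding s_def p_def using K subfldD[OF L] by simp
  ultimately show ?thesis by blast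
qed

section \<open>Jordan bounds for finite Moebius groups\<close>

lemma mob_jordan_60:
  assumes "fgrp G" "G \<subseteq> mob UNIV" shows "jordan_le G 60"
  using two_fix.classification[OF two_fix_mob[OF assms]]
proof (elim disjE conjE)
  assume "card G = 60"
  then show ?thesis using jordan_le_card[OF assms(1)] by simp
qed (auto elim: jordan_le_mono)

lemma mob_card_or_jordan_2:
  assumes "fgrp G" "G \<subseteq> mob UNIV" shows "card G \<le> 60 \<or> jordan_le G 2"
  using two_fix.classification[OF two_fix_mob[OF assms]] by (elim disjE conjE) simp_all

lemma mob_jordan_6:
  assumes "fgrp G" "G \<subseteq> mob UNIV" "\<And>g. g \<in> G \<Longrightarrow> g ^^ 5 = id \<Longrightarrow> g = id"
  shows "jordan_le G 6"
  using two_fix.classification[OF two_fix_mob[OF assms(1,2)]]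
proof (elim disjE conjE)
  assume "jordan_le G 2"
  then show ?thesis by (rule jordan_le_mono) simp
next
  assume "\<exists>g\<in>G. g \<noteq> id \<and> g ^^ 5 = id"
  then show ?thesis using assms(3) by blast
qed

section \<open>Groups containing antiholomorphic elements\<close>

definition cj :: "cp1 \<Rightarrow> cp1" where "cj = map_option cnj"

lemma cj_pt [simp]: "cj (pt a b) = pt (cnj a) (cnj b)"
  by (simp add: cj_def pt_def)

lemma cj_cj [simp]: "cj (cj p) = p"
  by (simp add: cj_def option.map_comp o_def option.map_ident)

lemma cj_comp_cj [simp]: "cj \<circ> cj = id" by (simp add: fun_eq_iff)

lemma bij_cj: "bij cj" by (rule o_bij[of cj]) simp_all

lemma mobm_cj: "mobm a b c d g \<Longrightarrow> mobm (cnj a) (cnj b) (cnj c) (cnj d) (cj \<circ> g \<circ> cj)"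
  unfolding mobm_def
proof (intro conjI allI impI)
  assume m: "a * d - b * c \<noteq> 0 \<and> (\<forall>x y. x \<noteq> 0 \<or> y \<noteq> 0 \<longrightarrow> g (pt x y) = pt (a * x + b * y) (c * x + d * y))"
  have "cnj a * cnj d - cnj b * cnj c = cnj (a * d - b * c)" by simp
  then show "cnj a * cnj d - cnj b * cnj c \<noteq> 0" using m by (metis complex_cnj_zero_iff)
  fix x y :: complex assume "x \<noteq> 0 \<or> y \<noteq> 0"
  then show "(cj \<circ> g \<circ> cj) (pt x y) = pt (cnj a * x + cnj b * y) (cnj c * x + cnj d * y)" using m by simp
qed

text \<open>The antiholomorphic automorphisms of the sphere.\<close>

definition amob :: "(cp1 \<Rightarrow> cp1) set" where
  "amob = {g. g \<circ> cj \<in> mob UNIV}"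

text \<open>Conjugation fixes infinity, 0 and 1, which a Moebius map can do only as the identity,
  but it moves the imaginary unit.\<close>

lemma cj_not_mob: "cj \<notin> mob UNIV"
proof
  assume "cj \<in> mob UNIV"
  then obtain a b c d where m: "mobm a b c d cj" by (rule mob_UNIVE)
  have n: "a \<noteq> 0 \<or> c \<noteq> 0" "b \<noteq> 0 \<or> d \<noteq> 0" "a + b \<noteq> 0 \<or> c + d \<noteq> 0"
    using mobm_nonzero[OF m, of 1 0] mobm_nonzero[OF m, of 0 1] mobm_nonzero[OF m, of 1 1] by auto
  have "pt 1 0 = pt a c" "pt 0 1 = pt b d" "pt 1 1 = pt (a + b) (c + d)"
    using mobm_apply[OF m, of 1 0] mobm_apply[OF m, of 0 1] mobm_apply[OF m, of 1 1] by auto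
  then have "b = 0" "c = 0" "a = d" using n by (auto simp: pt_eq)
  then have "cj = id" using m mobm_scalar by simp
  then have "cj (pt \<i> 1) = pt \<i> 1" by simp
  then show False by (simp add: pt_eq)
qed

lemma mob_amob_disjoint: "g \<in> mob UNIV \<Longrightarrow> g \<notin> amob"
proof
  assume "g \<in> mob UNIV" "g \<in> amob"
  then have "finv g \<circ> (g \<circ> cj) \<in> mob UNIV"
    using mob_comp[OF subfld_UNIV] mob_inv[OF subfld_UNIV] by (simp add: amob_def)
  moreover have "finv g \<circ> (g \<circ> cj) = cj"
    using mob_bij[OF \<open>g \<in> mob UNIV\<close>] by (simp add: fun_eq_iff inv_apply_bij)
  ultimately show False using cj_not_mob by simp
qed

lemma cj_conj_mob: "g \<in> mob UNIV \<Longrightarrow> cj \<circ> g \<circ> cj \<in> mob UNIV"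
  using mobm_cj mob_UNIVE mob_UNIV by metis

lemma amobE:
  assumes "g \<in> amob" obtains a b c d where "mobm a b c d (g \<circ> cj)"
    "\<And>x y. x \<noteq> 0 \<or> y \<noteq> 0 \<Longrightarrow> g (pt x y) = pt (a * cnj x + b * cnj y) (c * cnj x + d * cnj y)"
proof -
  obtain a b c d where m: "mobm a b c d (g \<circ> cj)" using assms unfolding amob_def by (auto elim: mob_UNIVE)
  have "g (pt x y) = pt (a * cnj x + b * cnj y) (c * cnj x + d * cnj y)" if "x \<noteq> 0 \<or> y \<noteq> 0" for x y
    using mobm_apply[OF m, of "cnj x" "cnj y"] that by simp
  then show ?thesis using that m by blast
qed

lemma amob_bij: "g \<in> amob \<Longrightarrow> bij g"
proof -
  assume "g \<in> amob"
  then have "bij ((g \<circ> cj) \<circ> cj)" using bij_comp[OF bij_cj] mob_bij unfolding amob_def by blast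
  then show ?thesis by (simp add: comp_assoc)
qed

lemma amob_comps:
  "g \<in> amob \<Longrightarrow> h \<in> amob \<Longrightarrow> g \<circ> h \<in> mob UNIV"
  "g \<in> amob \<Longrightarrow> h \<in> mob UNIV \<Longrightarrow> g \<circ> h \<in> amob"
  "g \<in> mob UNIV \<Longrightarrow> h \<in> amob \<Longrightarrow> g \<circ> h \<in> amob"
proof -
  note mc = mob_comp[OF subfld_UNIV]
  show "g \<circ> h \<in> mob UNIV" if "g \<in> amob" "h \<in> amob"
  proof -
    have "(g \<circ> cj) \<circ> (cj \<circ> (h \<circ> cj) \<circ> cj) \<in> mob UNIV"
      using that mc cj_conj_mob unfolding amob_def by simp
    then show ?thesis by (simp add: fun_eq_iff o_def)
  qed
  show "g \<circ> h \<in> amob" if "g \<in> amob" "h \<in> mob UNIV"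
  proof -
    have "(g \<circ> cj) \<circ> (cj \<circ> h \<circ> cj) \<in> mob UNIV" using that mc cj_conj_mob unfolding amob_def by simp
    then show ?thesis unfolding amob_def by (simp add: fun_eq_iff o_def)
  qed
  show "g \<circ> h \<in> amob" if "g \<in> mob UNIV" "h \<in> amob"
    using that mc unfolding amob_def by (simp add: comp_assoc)
qed

subsection \<open>The invariant Hermitian form\<close>

definition herm_lin :: "complex \<Rightarrow> complex \<Rightarrow> complex \<Rightarrow> complex \<Rightarrow> complex \<Rightarrow> complex \<Rightarrow> complex \<Rightarrow> complex \<Rightarrow> complex" where
  "herm_lin a b c d x y u v = ((a * x + b * y) * cnj (a * u + b * v) + (c * x + d * y) * cnj (c * u + d * v))
     / complex_of_real (cmod (a * d - b * c))"

text \<open>Dividing by \<open>|ad - bc|\<close> makes the form independent of the matrix that represents \<open>e\<close>, so the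
  description is unique for \<open>e \<in> mob UNIV \<union> amob\<close>.\<close>

definition herm_of :: "(cp1 \<Rightarrow> cp1) \<Rightarrow> complex \<Rightarrow> complex \<Rightarrow> complex \<Rightarrow> complex \<Rightarrow> complex" where
  "herm_of e x y u v = (THE r. (\<exists>a b c d. mobm a b c d e \<and> r = herm_lin a b c d x y u v) \<or>
     (\<exists>a b c d. mobm a b c d (e \<circ> cj) \<and> r = cnj (herm_lin a b c d (cnj x) (cnj y) (cnj u) (cnj v))))"

lemma herm_lin_scale:
  "k \<noteq> 0 \<Longrightarrow> herm_lin (k * a) (k * b) (k * c) (k * d) x y u v = herm_lin a b c d x y u v"
proof -
  assume k: "k \<noteq> 0"
  have 1: "k * a * (k * d) - k * b * (k * c) = k * k * (a * d - b * c)" by Groebner_Basis.algebra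
  have 2: "complex_of_real (cmod (k * k * (a * d - b * c))) = k * cnj k * complex_of_real (cmod (a * d - b * c))"
    by (simp add: norm_mult complex_norm_square[symmetric] power2_eq_square)
  have 3: "k * a * x + k * b * y = k * (a * x + b * y)" for a x b y by Groebner_Basis.algebra
  have 4: "k * P * cnj (k * Q) + k * R * cnj (k * S) = (k * cnj k) * (P * cnj Q + R * cnj S)" for P Q R S
    by (simp add: algebra_simps)
  have kk: "k * cnj k \<noteq> 0" using k by simp
  show ?thesis
    unfolding herm_lin_def 1 2 by (simp only: 3[of a _ b] 3[of c _ d] 4 mult_divide_mult_cancel_left[OF kk])
qed

lemma herm_of_mob:
  assumes "mobm a b c d e"
  shows "herm_of e x y u v = herm_lin a b c d x y u v"
  unfolding herm_of_def
proof (rule the_equality)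
  show "(\<exists>a' b' c' d'. mobm a' b' c' d' e \<and> herm_lin a b c d x y u v = herm_lin a' b' c' d' x y u v) \<or>
     (\<exists>a' b' c' d'. mobm a' b' c' d' (e \<circ> cj) \<and> herm_lin a b c d x y u v = cnj (herm_lin a' b' c' d' (cnj x) (cnj y) (cnj u) (cnj v)))"
    using assms by blast
  fix r assume "(\<exists>a b c d. mobm a b c d e \<and> r = herm_lin a b c d x y u v) \<or>
     (\<exists>a b c d. mobm a b c d (e \<circ> cj) \<and> r = cnj (herm_lin a b c d (cnj x) (cnj y) (cnj u) (cnj v)))"
  then show "r = herm_lin a b c d x y u v"
  proof
    assume "\<exists>a b c d. mobm a b c d e \<and> r = herm_lin a b c d x y u v"
    then obtain a' b' c' d' where m: "mobm a' b' c' d' e" "r = herm_lin a' b' c' d' x y u v" by blast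
    obtain k where "k \<noteq> 0" "a' = k * a" "b' = k * b" "c' = k * c" "d' = k * d" using mobm_unique[OF assms m(1)] .
    then show ?thesis using m(2) herm_lin_scale by simp
  next
    assume "\<exists>a b c d. mobm a b c d (e \<circ> cj) \<and> r = cnj (herm_lin a b c d (cnj x) (cnj y) (cnj u) (cnj v))"
    then have "e \<in> amob" unfolding amob_def using mob_UNIV by blast
    then show ?thesis using mob_amob_disjoint mob_UNIV[OF assms] by blast
  qed
qed

lemma herm_of_amob:
  assumes "mobm a b c d (e \<circ> cj)"
  shows "herm_of e x y u v = cnj (herm_lin a b c d (cnj x) (cnj y) (cnj u) (cnj v))"
  unfolding herm_of_def
proof (rule the_equality)
  show "(\<exists>a' b' c' d'. mobm a' b' c' d' e \<and> cnj (herm_lin a b c d (cnj x) (cnj y) (cnj u) (cnj v)) = herm_lin a' b' c' d' x y u v) \<or>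
     (\<exists>a' b' c' d'. mobm a' b' c' d' (e \<circ> cj) \<and>
       cnj (herm_lin a b c d (cnj x) (cnj y) (cnj u) (cnj v)) = cnj (herm_lin a' b' c' d' (cnj x) (cnj y) (cnj u) (cnj v)))"
    using assms by blast
  fix r assume "(\<exists>a b c d. mobm a b c d e \<and> r = herm_lin a b c d x y u v) \<or>
     (\<exists>a b c d. mobm a b c d (e \<circ> cj) \<and> r = cnj (herm_lin a b c d (cnj x) (cnj y) (cnj u) (cnj v)))"
  then show "r = cnj (herm_lin a b c d (cnj x) (cnj y) (cnj u) (cnj v))"
  proof
    assume "\<exists>a b c d. mobm a b c d (e \<circ> cj) \<and> r = cnj (herm_lin a b c d (cnj x) (cnj y) (cnj u) (cnj v))"
    then obtain a' b' c' d' where m: "mobm a' b' c' d' (e \<circ> cj)"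
      "r = cnj (herm_lin a' b' c' d' (cnj x) (cnj y) (cnj u) (cnj v))" by blast
    obtain k where "k \<noteq> 0" "a' = k * a" "b' = k * b" "c' = k * c" "d' = k * d" using mobm_unique[OF assms m(1)] .
    then show ?thesis using m(2) herm_lin_scale by simp
  next
    assume "\<exists>a b c d. mobm a b c d e \<and> r = herm_lin a b c d x y u v"
    then have "e \<in> mob UNIV" using mob_UNIV by blast
    moreover have "e \<in> amob" using assms mob_UNIV unfolding amob_def by blast
    ultimately show ?thesis using mob_amob_disjoint by blast
  qed
qed

lemma herm_lin_comp:
  assumes "a' * d' - b' * c' \<noteq> 0"
  shows "herm_lin a b c d (a' * x + b' * y) (c' * x + d' * y) (a' * u + b' * v) (c' * u + d' * v) =
    complex_of_real (cmod (a' * d' - b' * c')) *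
    herm_lin (a * a' + b * c') (a * b' + b * d') (c * a' + d * c') (c * b' + d * d') x y u v"
proof -
  have 1: "(a * a' + b * c') * (c * b' + d * d') - (a * b' + b * d') * (c * a' + d * c') =
    (a' * d' - b' * c') * (a * d - b * c)" by Groebner_Basis.algebra
  have 2: "a * (a' * x + b' * y) + b * (c' * x + d' * y) = (a * a' + b * c') * x + (a * b' + b * d') * y"
    for a b x y by Groebner_Basis.algebra
  have 3: "complex_of_real (cmod (a' * d' - b' * c')) \<noteq> 0" using assms by simp
  show ?thesis unfolding herm_lin_def 1 2 norm_mult of_real_mult using 3 by simp
qed

text \<open>\<open>herm_of e\<close> is the standard Hermitian form pulled back along
  \<open>e\<close>, and a further pull-back along \<open>f\<close> gives the form of
  \<open>e \<circ> f\<close>. The factor on the right undoes the normalisation by the determinant of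
  \<open>f\<close>.\<close>

lemma herm_of_comp_mob:
  assumes e: "e \<in> mob UNIV \<or> e \<in> amob" and m: "mobm a b c d f"
  shows "herm_of e (a * x + b * y) (c * x + d * y) (a * u + b * v) (c * u + d * v) =
    complex_of_real (cmod (a * d - b * c)) * herm_of (e \<circ> f) x y u v"
  using e
proof
  assume "e \<in> mob UNIV"
  then obtain a' b' c' d' where m': "mobm a' b' c' d' e" by (rule mob_UNIVE)
  show ?thesis
    unfolding herm_of_mob[OF m'] herm_of_mob[OF mobm_comp[OF m' m]] by (rule herm_lin_comp[OF mobm_det[OF m]])
next
  assume "e \<in> amob"
  then obtain a' b' c' d' where m': "mobm a' b' c' d' (e \<circ> cj)" unfolding amob_def by (auto elim: mob_UNIVE)
  have eq: "(e \<circ> f) \<circ> cj = (e \<circ> cj) \<circ> (cj \<circ> f \<circ> cj)" by (simp add: fun_eq_iff)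
  note mc = mobm_comp[OF m' mobm_cj[OF m], folded eq]
  show ?thesis
    unfolding herm_of_amob[OF m'] herm_of_amob[OF mc]
    using herm_lin_comp[of "cnj a" "cnj d" "cnj b" "cnj c" a' b' c' d' "cnj x" "cnj y" "cnj u" "cnj v"]
      mobm_det[OF mobm_cj[OF m]] complex_mod_cnj[of "a * d - b * c"] by simp
qed

text \<open>As in \<open>herm_of_comp_mob\<close>, except that an antilinear substitution conjugates
  the value.\<close>

lemma herm_of_comp_amob:
  assumes e: "e \<in> mob UNIV \<or> e \<in> amob" and m: "mobm a b c d (f \<circ> cj)"
  shows "herm_of e (a * cnj x + b * cnj y) (c * cnj x + d * cnj y) (a * cnj u + b * cnj v) (c * cnj u + d * cnj v) =
    complex_of_real (cmod (a * d - b * c)) * cnj (herm_of (e \<circ> f) x y u v)"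
  using e
proof
  assume "e \<in> mob UNIV"
  then obtain a' b' c' d' where m': "mobm a' b' c' d' e" by (rule mob_UNIVE)
  have eq: "(e \<circ> f) \<circ> cj = e \<circ> (f \<circ> cj)" by (simp add: fun_eq_iff)
  note mc = mobm_comp[OF m' m, folded eq]
  show ?thesis
    unfolding herm_of_mob[OF m'] herm_of_amob[OF mc] complex_cnj_cnj by (rule herm_lin_comp[OF mobm_det[OF m]])
next
  assume "e \<in> amob"
  then obtain a' b' c' d' where m': "mobm a' b' c' d' (e \<circ> cj)" unfolding amob_def by (auto elim: mob_UNIVE)
  have eq: "(e \<circ> f) = (e \<circ> cj) \<circ> (cj \<circ> (f \<circ> cj) \<circ> cj)" by (simp add: fun_eq_iff)
  note mc = mobm_comp[OF m' mobm_cj[OF m], folded eq]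
  show ?thesis
    unfolding herm_of_amob[OF m'] herm_of_mob[OF mc]
    using herm_lin_comp[of "cnj a" "cnj d" "cnj b" "cnj c" a' b' c' d' x y u v]
      mobm_det[OF mobm_cj[OF m]] complex_mod_cnj[of "a * d - b * c"] by simp
qed

lemma herm_lin_expand:
  "herm_lin a b c d x y u v = herm_lin a b c d 1 0 1 0 * (x * cnj u) + herm_lin a b c d 1 0 0 1 * (x * cnj v)
     + herm_lin a b c d 0 1 1 0 * (y * cnj u) + herm_lin a b c d 0 1 0 1 * (y * cnj v)"
  unfolding herm_lin_def by (simp add: add_divide_distrib[symmetric] algebra_simps)

lemma herm_lin_cnj_swap: "cnj (herm_lin a b c d x y u v) = herm_lin a b c d u v x y"
  by (simp add: herm_lin_def mult.commute)

lemma herm_lin_pos: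
  assumes "a * d - b * c \<noteq> 0" "x \<noteq> 0 \<or> y \<noteq> 0"
  shows "Re (herm_lin a b c d x y x y) > 0"
proof -
  have e: "herm_lin a b c d x y x y =
    complex_of_real (((cmod (a * x + b * y))\<^sup>2 + (cmod (c * x + d * y))\<^sup>2) / cmod (a * d - b * c))"
    unfolding herm_lin_def by (simp only: of_real_divide of_real_add complex_norm_square)
  have "(cmod (a * x + b * y))\<^sup>2 + (cmod (c * x + d * y))\<^sup>2 > 0"
    using lin_nonzero[OF assms] by (auto intro: add_pos_nonneg add_nonneg_pos)
  then show ?thesis unfolding e using assms(1) by simp
qed

lemma herm_of_props:
  assumes e: "e \<in> mob UNIV \<or> e \<in> amob"
  shows "herm_of e x y u v = herm_of e 1 0 1 0 * (x * cnj u) + herm_of e 1 0 0 1 * (x * cnj v)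
     + herm_of e 0 1 1 0 * (y * cnj u) + herm_of e 0 1 0 1 * (y * cnj v)"
    "cnj (herm_of e x y u v) = herm_of e u v x y"
    "x \<noteq> 0 \<or> y \<noteq> 0 \<Longrightarrow> Re (herm_of e x y x y) > 0"
proof -
  have "herm_of e x y u v = herm_of e 1 0 1 0 * (x * cnj u) + herm_of e 1 0 0 1 * (x * cnj v)
     + herm_of e 0 1 1 0 * (y * cnj u) + herm_of e 0 1 0 1 * (y * cnj v) \<and>
    cnj (herm_of e x y u v) = herm_of e u v x y \<and>
    (x \<noteq> 0 \<or> y \<noteq> 0 \<longrightarrow> Re (herm_of e x y x y) > 0)"
    using e
  proof
    assume "e \<in> mob UNIV"
    then obtain a b c d where m: "mobm a b c d e" by (rule mob_UNIVE)
    show ?thesis unfolding herm_of_mob[OF m]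
      using herm_lin_expand[of a b c d x y u v] herm_lin_cnj_swap herm_lin_pos[OF mobm_det[OF m]] by blast
  next
    assume "e \<in> amob"
    then obtain a b c d where m: "mobm a b c d (e \<circ> cj)" unfolding amob_def by (auto elim: mob_UNIVE)
    show ?thesis unfolding herm_of_amob[OF m]
      using herm_lin_expand[of a b c d "cnj x" "cnj y" "cnj u" "cnj v"] herm_lin_cnj_swap[of a b c d]
        herm_lin_pos[OF mobm_det[OF m], of "cnj x" "cnj y"] by simp
  qed
  then show "herm_of e x y u v = herm_of e 1 0 1 0 * (x * cnj u) + herm_of e 1 0 0 1 * (x * cnj v)
     + herm_of e 0 1 1 0 * (y * cnj u) + herm_of e 0 1 0 1 * (y * cnj v)"
    "cnj (herm_of e x y u v) = herm_of e u v x y"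
    "x \<noteq> 0 \<or> y \<noteq> 0 \<Longrightarrow> Re (herm_of e x y x y) > 0" by blast+
qed

text \<open>Averaging gives an invariant Hermitian form, and orthogonality with respect to it defines the
  antipodal map.\<close>

lemma antipodal_map:
  assumes E: "fgrp E" "E \<subseteq> mob UNIV \<union> amob"
  obtains z where "z \<in> amob" "z \<circ> z = id" "\<And>e. e \<in> E \<Longrightarrow> z \<circ> e = e \<circ> z" "\<And>p. z p \<noteq> p"
proof -
  have Em: "e \<in> mob UNIV \<or> e \<in> amob" if "e \<in> E" for e using E(2) that by blast
  define h where "h x y u v = (\<Sum>e\<in>E. herm_of e x y u v)" for x y u v
  note P = herm_of_props[OF Em]
  have finE: "finite E" "E \<noteq> {}" using fgrpD[OF E(1)] by auto
  define A B B' C where "A = h 1 0 1 0" and "B = h 1 0 0 1" and "B' = h 0 1 1 0" and "C = h 0 1 0 1"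
  have expand: "h x y u v = A * (x * cnj u) + B * (x * cnj v) + B' * (y * cnj u) + C * (y * cnj v)" for x y u v
    unfolding h_def A_def B_def B'_def C_def sum_distrib_right sum.distrib[symmetric]
    by (intro sum.cong refl P(1))
  have cnjh: "cnj (h x y u v) = h u v x y" for x y u v
    unfolding h_def cnj_sum by (intro sum.cong refl P(2))
  have pos: "h x y x y \<noteq> 0" if "x \<noteq> 0 \<or> y \<noteq> 0" for x y
  proof -
    have "Re (h x y x y) > 0" unfolding h_def Re_sum
      using finE P(3) that by (intro sum_pos) auto
    then show ?thesis by auto
  qed
  have re: "(\<lambda>e. e \<circ> f) ` E = E" "inj_on (\<lambda>e. e \<circ> f) E" if f: "f \<in> E" for f
  proof -
    have bf: "bij f" using fgrpD(4)[OF E(1) f] .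
    show inj: "inj_on (\<lambda>e. e \<circ> f) E"
    proof (rule inj_onI)
      fix x y assume "x \<circ> f = y \<circ> f"
      then have "x \<circ> f \<circ> finv f = y \<circ> f \<circ> finv f" by simp
      then show "x = y" using bf by (simp add: comp_assoc inv_o_bij)
    qed
    have "(\<lambda>e. e \<circ> f) ` E \<subseteq> E" using fgrpD(3)[OF E(1)] f by auto
    then show "(\<lambda>e. e \<circ> f) ` E = E" using inj finE(1) by (simp add: endo_inj_surj)
  qed
  \<comment> \<open>Right translation by \<open>f\<close> permutes \<open>E\<close>, so it only
    reorders the terms of the sum \<open>h\<close>.\<close>
  have inv1: "h (a * x + b * y) (c * x + d * y) (a * u + b * v) (c * u + d * v) =
     complex_of_real (cmod (a * d - b * c)) * h x y u v"
    if f: "f \<in> E" "mobm a b c d f" for a b c d f x y u v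
  proof -
    have "h (a * x + b * y) (c * x + d * y) (a * u + b * v) (c * u + d * v) =
      (\<Sum>e\<in>E. complex_of_real (cmod (a * d - b * c)) * herm_of (e \<circ> f) x y u v)"
      unfolding h_def by (intro sum.cong refl herm_of_comp_mob Em f)
    also have "\<dots> = complex_of_real (cmod (a * d - b * c)) * (\<Sum>e\<in>(\<lambda>e. e \<circ> f) ` E. herm_of e x y u v)"
      using re(2)[OF f(1)] by (simp add: sum_distrib_left sum.reindex)
    finally show ?thesis unfolding re(1)[OF f(1)] h_def .
  qed
  have inv2: "h (a * cnj x + b * cnj y) (c * cnj x + d * cnj y) (a * cnj u + b * cnj v) (c * cnj u + d * cnj v) =
     complex_of_real (cmod (a * d - b * c)) * cnj (h x y u v)"
    if f: "f \<in> E" "mobm a b c d (f \<circ> cj)" for a b c d f x y u v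
  proof -
    have "h (a * cnj x + b * cnj y) (c * cnj x + d * cnj y) (a * cnj u + b * cnj v) (c * cnj u + d * cnj v) =
      (\<Sum>e\<in>E. complex_of_real (cmod (a * d - b * c)) * cnj (herm_of (e \<circ> f) x y u v))"
      unfolding h_def by (intro sum.cong refl herm_of_comp_amob Em f)
    also have "\<dots> = complex_of_real (cmod (a * d - b * c)) * cnj (\<Sum>e\<in>(\<lambda>e. e \<circ> f) ` E. herm_of e x y u v)"
      using re(2)[OF f(1)] by (simp add: sum_distrib_left sum.reindex cnj_sum)
    finally show ?thesis unfolding re(1)[OF f(1)] h_def .
  qed
  have A0: "A \<noteq> 0" using pos[of 1 0] by (simp add: A_def)
  have det: "A * C - B * B' \<noteq> 0"
  proof
    assume "A * C - B * B' = 0"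
    \<comment> \<open>If the determinant vanished, the vector (B', -A) would lie in the radical of
      the form.\<close>
    then have "h B' (- A) B' (- A) = 0" unfolding expand by (simp add: algebra_simps)
    then show False using pos[of B' "- A"] A0 by simp
  qed
  have orth: "h x y u v = cnj u * (A * x + B' * y) + cnj v * (B * x + C * y)" for x y u v
    unfolding expand by (simp add: algebra_simps)
  have "cnj B * - cnj B' - cnj C * - cnj A = cnj (A * C - B * B')" by simp
  then have "cnj B * - cnj B' - cnj C * - cnj A \<noteq> 0" using det by (metis complex_cnj_zero_iff)
  \<comment> \<open>The matrix is chosen so that \<open>z\<close> sends a point to its orthogonal
    complement; conjugation enters because \<open>h\<close> is antilinear in its second
    argument.\<close>
  then obtain m where m: "mobm (cnj B) (cnj C) (- cnj A) (- cnj B') m" using mobm_ex by blast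
  define z where "z = m \<circ> cj"
  have zpt: "z (pt x y) = pt (cnj (B * x + C * y)) (- cnj (A * x + B' * y))" if "x \<noteq> 0 \<or> y \<noteq> 0" for x y
    using mobm_apply[OF m, of "cnj x" "cnj y"] that by (simp add: z_def)
  have nz: "cnj (B * x + C * y) \<noteq> 0 \<or> - cnj (A * x + B' * y) \<noteq> 0" if "x \<noteq> 0 \<or> y \<noteq> 0" for x y
    using mobm_nonzero[OF m, of "cnj x" "cnj y"] that by simp
  have zperp: "z (pt x y) = pt u v \<longleftrightarrow> h x y u v = 0" if xy: "x \<noteq> 0 \<or> y \<noteq> 0" and uv: "u \<noteq> 0 \<or> v \<noteq> 0" for x y u v
  proof -
    have "z (pt x y) = pt u v \<longleftrightarrow> cnj (B * x + C * y) * v = - cnj (A * x + B' * y) * u"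
      unfolding zpt[OF xy] by (rule pt_eq[OF nz[OF xy] uv])
    also have "\<dots> \<longleftrightarrow> cnj (cnj (B * x + C * y) * v) = cnj (- cnj (A * x + B' * y) * u)"
      by (simp only: complex_cnj_cancel_iff)
    also have "\<dots> \<longleftrightarrow> h x y u v = 0" unfolding orth by (simp add: algebra_simps eq_neg_iff_add_eq_0)
    finally show ?thesis .
  qed
  show ?thesis
  proof (rule that)
    show "z \<in> amob" unfolding amob_def z_def using mob_UNIV[OF m] by (simp add: comp_assoc)
    show "z \<circ> z = id"
    proof
      fix p
      obtain x y where p: "x \<noteq> 0 \<or> y \<noteq> 0" "p = pt x y" by (rule pt_surj[of p])
      obtain u v where q: "u \<noteq> 0 \<or> v \<noteq> 0" "z p = pt u v" by (rule pt_surj[of "z p"])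
      have "h x y u v = 0" using zperp[OF p(1) q(1)] p(2) q(2) by simp
      then have "h u v x y = 0" using cnjh[of x y u v] by simp
      then show "(z \<circ> z) p = id p" using zperp[OF q(1) p(1)] q(2) p(2) by simp
    qed
    show "z p \<noteq> p" for p
    proof -
      obtain x y where p: "x \<noteq> 0 \<or> y \<noteq> 0" "p = pt x y" by (rule pt_surj[of p])
      then show ?thesis using zperp[OF p(1) p(1)] pos[OF p(1)] by simp
    qed
    fix e assume e: "e \<in> E"
    show "z \<circ> e = e \<circ> z"
    proof
      fix p
      obtain x y where p: "x \<noteq> 0 \<or> y \<noteq> 0" "p = pt x y" by (rule pt_surj[of p])
      obtain u v where q: "u \<noteq> 0 \<or> v \<noteq> 0" "z p = pt u v" by (rule pt_surj[of "z p"])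
      have h0: "h x y u v = 0" using zperp[OF p(1) q(1)] p(2) q(2) by simp
      show "(z \<circ> e) p = (e \<circ> z) p"
        using Em[OF e]
      proof
        assume "e \<in> mob UNIV"
        then obtain a b c d where m': "mobm a b c d e" by (rule mob_UNIVE)
        have "z (pt (a * x + b * y) (c * x + d * y)) = pt (a * u + b * v) (c * u + d * v)"
          unfolding zperp[OF mobm_nonzero[OF m' p(1)] mobm_nonzero[OF m' q(1)]]
          using inv1[OF e m'] h0 by simp
        then show ?thesis using mobm_apply[OF m' p(1)] mobm_apply[OF m' q(1)] p(2) q(2) by simp
      next
        assume "e \<in> amob"
        then obtain a b c d where m': "mobm a b c d (e \<circ> cj)"
          and ap: "\<And>x y. x \<noteq> 0 \<or> y \<noteq> 0 \<Longrightarrow> e (pt x y) = pt (a * cnj x + b * cnj y) (c * cnj x + d * cnj y)"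
          by (rule amobE) blast
        have n: "a * cnj x + b * cnj y \<noteq> 0 \<or> c * cnj x + d * cnj y \<noteq> 0"
          "a * cnj u + b * cnj v \<noteq> 0 \<or> c * cnj u + d * cnj v \<noteq> 0"
          using mobm_nonzero[OF m', of "cnj x" "cnj y"] mobm_nonzero[OF m', of "cnj u" "cnj v"] p(1) q(1) by simp_all
        have "z (pt (a * cnj x + b * cnj y) (c * cnj x + d * cnj y)) = pt (a * cnj u + b * cnj v) (c * cnj u + d * cnj v)"
          unfolding zperp[OF n] using inv2[OF e m'] h0 by simp
        then show ?thesis using ap[OF p(1)] ap[OF q(1)] p(2) q(2) by simp
      qed
    qed
  qed
qed

text \<open>Composing the orientation reversing elements with the antipodal map embeds the group, up to
  a central subgroup of order two, into the Moebius group.\<close>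

lemma jordan_le_mob_amob:
  assumes E: "fgrp E" "E \<subseteq> mob UNIV \<union> amob" and L: "subfld L"
    and EL: "\<And>e. e \<in> E \<Longrightarrow> e \<in> mob UNIV \<Longrightarrow> e \<in> mob L"
  shows "jordan_le E 60" "\<not> (\<exists>r\<in>L. r\<^sup>2 = 5) \<Longrightarrow> jordan_le E 6"
proof -
  obtain z where z: "z \<in> amob" "z \<circ> z = id" "\<And>e. e \<in> E \<Longrightarrow> z \<circ> e = e \<circ> z" "\<And>p. z p \<noteq> p"
    using antipodal_map[OF E] by blast
  define \<zeta> where "\<zeta> e = (if e \<in> mob UNIV then id else z)" for e :: "cp1 \<Rightarrow> cp1"
  define \<phi> where "\<phi> e = \<zeta> e \<circ> e" for e :: "cp1 \<Rightarrow> cp1"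
  have z_alt: "z (e p) = e (z p)" if "e \<in> E" for e p using z(3)[OF that] by (metis comp_apply)
  have zz: "z (z p) = p" for p using z(2) by (metis comp_apply id_apply)
  have \<zeta>_comm: "\<zeta> f (e p) = e (\<zeta> f p)" if "e \<in> E" for e f p using z_alt[OF that] by (simp add: \<zeta>_def)
  have \<zeta>_\<zeta>: "\<zeta> f (\<zeta> g p) = \<zeta> g (\<zeta> f p)" for f g p by (simp add: \<zeta>_def)
  have \<zeta>_comp: "\<zeta> (f \<circ> g) p = \<zeta> f (\<zeta> g p)" if fg: "f \<in> E" "g \<in> E" for f g p
  proof -
    have "f \<circ> g \<in> mob UNIV \<longleftrightarrow> (f \<in> mob UNIV \<longleftrightarrow> g \<in> mob UNIV)"
      using fg E(2) amob_comps[of f g] mob_comp[OF subfld_UNIV, of f g] mob_amob_disjoint by blast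
    then show ?thesis using zz by (auto simp: \<zeta>_def)
  qed
  have hom: "\<phi> (f \<circ> g) = \<phi> f \<circ> \<phi> g" if fg: "f \<in> E" "g \<in> E" for f g
  proof
    fix p
    have "\<zeta> f (\<zeta> g (f (g p))) = \<zeta> f (f (\<zeta> g (g p)))" using \<zeta>_comm[OF fg(1)] by simp
    then show "\<phi> (f \<circ> g) p = (\<phi> f \<circ> \<phi> g) p" unfolding \<phi>_def using \<zeta>_comp[OF fg] by simp
  qed
  have \<phi>mob: "\<phi> e \<in> mob UNIV" if "e \<in> E" for e
    using that E(2) amob_comps(1)[OF z(1)] by (auto simp: \<phi>_def \<zeta>_def)
  have bij: "bij (\<phi> e)" if "e \<in> E" for e using mob_bij[OF \<phi>mob[OF that]] .
  have comm: "f \<circ> g = g \<circ> f" if fg: "f \<in> E" "g \<in> E" and c: "\<phi> f \<circ> \<phi> g = \<phi> g \<circ> \<phi> f" for f g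
  proof
    fix p
    have i: "\<zeta> k (\<zeta> k q) = q" for k q using zz by (simp add: \<zeta>_def)
    have "\<phi> (f \<circ> g) p = \<phi> (g \<circ> f) p" using hom fg c by simp
    then have "\<zeta> f (\<zeta> g (f (g p))) = \<zeta> f (\<zeta> g (g (f p)))"
      unfolding \<phi>_def comp_apply \<zeta>_comp[OF fg, unfolded comp_def] \<zeta>_comp[OF fg(2,1), unfolded comp_def]
      using \<zeta>_comp[OF fg] \<zeta>_comp[OF fg(2,1)] \<zeta>_\<zeta> by simp
    then have "\<zeta> g (\<zeta> f (\<zeta> f (\<zeta> g (f (g p))))) = \<zeta> g (\<zeta> f (\<zeta> f (\<zeta> g (g (f p)))))" by simp
    then show "(f \<circ> g) p = (g \<circ> f) p" by (simp add: i)
  qed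
  have F: "fgrp (\<phi> ` E)" by (rule fgrp_image[of E \<phi>, OF E(1) hom bij])
  have sub: "\<phi> ` E \<subseteq> mob UNIV" using \<phi>mob by auto
  show "jordan_le E 60"
    by (rule jordan_le_preimage[of E \<phi>, OF E(1) hom bij mob_jordan_60[OF F sub] comm])
  assume no5: "\<not> (\<exists>r\<in>L. r\<^sup>2 = 5)"
  \<comment> \<open>A preimage \<open>e\<close> of \<open>x\<close> need not be a Moebius map, but
    its sixth power is one, and that power still lies over \<open>x\<close> because the sixth power
    of \<open>x\<close> is \<open>x\<close>. So \<open>x\<close> itself has coefficients in
    \<open>L\<close>.\<close>
  have "x = id" if x: "x \<in> \<phi> ` E" "x ^^ 5 = id" for x
  proof (rule ccontr)
    assume "x \<noteq> id"
    obtain e where e: "e \<in> E" "x = \<phi> e" using x(1) by auto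
    have pow: "e ^^ Suc n \<in> E \<and> \<phi> (e ^^ Suc n) = x ^^ Suc n" for n
    proof (induction n)
      case 0
      show ?case using e by simp
    next
      case (Suc n)
      have "e ^^ Suc (Suc n) = e \<circ> e ^^ Suc n" "x ^^ Suc (Suc n) = x \<circ> x ^^ Suc n"
        by (rule funpow.simps(2))+
      then show ?case using Suc e hom[OF e(1), of "e ^^ Suc n"] fgrpD(3)[OF E(1) e(1), of "e ^^ Suc n"] by metis
    qed
    have "e \<circ> e \<in> mob UNIV" using e(1) E(2) amob_comps(1) mob_comp[OF subfld_UNIV] by blast
    then have "(e \<circ> e) \<circ> ((e \<circ> e) \<circ> (e \<circ> e)) \<in> mob UNIV" using mob_comp[OF subfld_UNIV] by blast
    moreover have "(e \<circ> e) \<circ> ((e \<circ> e) \<circ> (e \<circ> e)) = e ^^ Suc 5" by (simp add: numeral_eq_Suc comp_assoc)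
    ultimately have 6: "e ^^ Suc 5 \<in> mob UNIV" by simp
    then have "e ^^ Suc 5 \<in> mob L" using EL pow by blast
    moreover have "\<phi> (e ^^ Suc 5) = e ^^ Suc 5" using 6 unfolding \<phi>_def \<zeta>_def by simp
    moreover have "x ^^ Suc 5 = x" unfolding funpow.simps(2) x(2) by (rule comp_id)
    ultimately have "x \<in> mob L" using pow[of 5] by simp
    then show False using order_five_sqrt5[OF L _ \<open>x \<noteq> id\<close> x(2)] no5 by blast
  qed
  then have J6: "jordan_le (\<phi> ` E) 6" by (rule mob_jordan_6[OF F sub])
  show "jordan_le E 6"
    by (rule jordan_le_preimage[of E \<phi>, OF E(1) hom bij J6 comm])
qed

section \<open>Finite groups of real Moebius transformations\<close>

lemma mob_real_cj: "g \<in> mob \<real> \<Longrightarrow> cj \<circ> g = g \<circ> cj"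
proof -
  assume "g \<in> mob \<real>"
  then obtain a b c d where K: "a \<in> \<real>" "b \<in> \<real>" "c \<in> \<real>" "d \<in> \<real>" and m: "mobm a b c d g"
    unfolding mob_def by blast
  have r: "cnj a = a" "cnj b = b" "cnj c = c" "cnj d = d" using K by (auto simp: Reals_cnj_iff)
  have "cj \<circ> g \<circ> cj = g" using mobm_ext[OF _ m] mobm_cj[OF m] unfolding r by blast
  then have "cj \<circ> g \<circ> cj \<circ> cj = g \<circ> cj" by simp
  then show ?thesis by (simp add: comp_assoc)
qed

text \<open>Complex conjugation commutes with \<open>G\<close> and can be adjoined to it. Composed
  with the antipodal map of the enlarged group it becomes a holomorphic involution \<open>w\<close>
  that commutes with \<open>G\<close>, so \<open>G\<close> permutes the two fixed points of
  \<open>w\<close>. This is the reason why finite subgroups of PGL_2(R) are cyclic or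
  dihedral.\<close>

lemma mob_real_jordan_2:
  assumes G: "fgrp G" "G \<subseteq> mob \<real>"
  shows "jordan_le G 2"
proof -
  have GU: "G \<subseteq> mob UNIV" using G(2) mob_mono[of \<real> UNIV] by blast
  define E where "E = G \<union> (\<lambda>g. g \<circ> cj) ` G"
  have cjG: "cj \<circ> g = g \<circ> cj" if "g \<in> G" for g using that G(2) mob_real_cj by blast
  have cjG': "cj (g p) = g (cj p)" if "g \<in> G" for g p using cjG[OF that] by (metis comp_apply)
  have E: "fgrp E"
    unfolding fgrp_def
  proof (intro conjI ballI)
    show "finite E" "id \<in> E" using fgrpD[OF G(1)] by (auto simp: E_def)
    fix f assume f: "f \<in> E"
    show "bij f" using f fgrpD(4)[OF G(1)] bij_comp[OF bij_cj] by (auto simp: E_def)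
    fix g assume g: "g \<in> E"
    have eqs: "(x \<circ> cj) \<circ> y = (x \<circ> y) \<circ> cj" "x \<circ> (y \<circ> cj) = (x \<circ> y) \<circ> cj" "(x \<circ> cj) \<circ> (y \<circ> cj) = x \<circ> y"
      if "y \<in> G" for x y using cjG'[OF that] by (auto simp: fun_eq_iff)
    obtain x where x: "x \<in> G" "f = x \<or> f = x \<circ> cj" using f by (auto simp: E_def)
    obtain y where y: "y \<in> G" "g = y \<or> g = y \<circ> cj" using g by (auto simp: E_def)
    have "f \<circ> g = x \<circ> y \<or> f \<circ> g = (x \<circ> y) \<circ> cj" using x(2) y(2) eqs[OF y(1), of x] by metis
    then show "f \<circ> g \<in> E" using fgrpD(3)[OF G(1) x(1) y(1)]
      unfolding E_def by (elim disjE) (auto simp: image_iff intro!: bexI[of _ "x \<circ> y"])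
  qed
  have EU: "E \<subseteq> mob UNIV \<union> amob" using GU by (auto simp: E_def amob_def comp_assoc)
  obtain z where z: "z \<in> amob" "z \<circ> z = id" "\<And>e. e \<in> E \<Longrightarrow> z \<circ> e = e \<circ> z" "\<And>p. z p \<noteq> p"
    using antipodal_map[OF E EU] by blast
  have cjE: "cj \<in> E" using fgrpD(2)[OF G(1)] unfolding E_def by (metis UnI2 id_comp imageI)
  define w where "w = z \<circ> cj"
  have wm: "w \<in> mob UNIV" using z(1) by (simp add: w_def amob_def)
  have ww: "w \<circ> w = id"
  proof -
    have "w \<circ> w = z \<circ> (cj \<circ> z) \<circ> cj" by (simp add: w_def comp_assoc)
    also have "\<dots> = (z \<circ> z) \<circ> (cj \<circ> cj)" unfolding z(3)[OF cjE, symmetric] by (simp only: comp_assoc)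
    finally show ?thesis using z(2) by simp
  qed
  \<comment> \<open>Conjugation fixes infinity, whereas the antipodal map has no fixed
    point.\<close>
  have "w \<noteq> id"
  proof
    assume "w = id"
    then have "w (pt 1 0) = pt 1 0" by simp
    then show False using z(4)[of "pt 1 0"] by (simp add: w_def)
  qed
  have fw: "fgrp {id, w}" using ww mob_bij[OF wm] by (auto simp: fgrp_def)
  interpret W: two_fix "{id, w}" by (rule two_fix_mob[OF fw]) (use wm mob_id[OF subfld_UNIV] in auto)
  have cw: "card (fix_pts w) = 2" using W.two \<open>w \<noteq> id\<close> by auto
  then obtain p q where pq: "fix_pts w = {p, q}" "p \<noteq> q" by (auto simp: card_2_iff)
  interpret T: two_fix G by (rule two_fix_mob[OF G(1) GU])
  have gw: "g \<circ> w = w \<circ> g" if g: "g \<in> G" for g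
  proof -
    have "g \<in> E" using g by (simp add: E_def)
    then have "g \<circ> w = z \<circ> (g \<circ> cj)" using z(3)[of g] by (simp add: w_def o_assoc)
    then show ?thesis using cjG[OF g] by (simp add: w_def comp_assoc)
  qed
  have "orb G p \<subseteq> {p, q}"
  proof
    fix r assume "r \<in> orb G p"
    then obtain g where g: "g \<in> G" "r = g p" by (auto simp: orb_def)
    have "w p = p" using pq(1) by (auto simp: fix_pts_def)
    then have "w r = r" using gw[OF g(1)] g(2) by (metis comp_apply)
    then show "r \<in> {p, q}" using pq(1) by (auto simp: fix_pts_def)
  qed
  moreover have pO: "p \<in> orb G p" by (rule orb_self[OF G(1)])
  ultimately consider "orb G p = {p}" | "orb G p = {p, q}" by blast
  then show ?thesis
  proof cases
    case 1
    then have "g p = p" if "g \<in> G" for g using that by (auto simp: orb_def)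
    then have "jordan_le G 1" using T.comm by (intro jordan_le_abelian[OF G(1)]) blast
    then show ?thesis by (rule jordan_le_mono) simp
  next
    case 2
    then show ?thesis using T.index_two[of p] pq(2) by simp
  qed
qed

section \<open>Biregular maps of the product of two projective lines\<close>

text \<open>Bihomogeneous polynomial functions of bidegree \<open>(m, n)\<close> in the pairs (a, b)
  and (c, d), generated so that rule induction applies. Zero has every bidegree.\<close>

inductive bihom :: "nat \<Rightarrow> nat \<Rightarrow> (complex \<Rightarrow> complex \<Rightarrow> complex \<Rightarrow> complex \<Rightarrow> complex) \<Rightarrow> bool" where
  bihom_const: "bihom 0 0 (\<lambda>_ _ _ _. k)"
| bihom_zero: "bihom m n (\<lambda>_ _ _ _. 0)"
| bihom_s0: "bihom 1 0 (\<lambda>a b c d. a)"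
| bihom_s1: "bihom 1 0 (\<lambda>a b c d. b)"
| bihom_t0: "bihom 0 1 (\<lambda>a b c d. c)"
| bihom_t1: "bihom 0 1 (\<lambda>a b c d. d)"
| bihom_add: "bihom m n f \<Longrightarrow> bihom m n g \<Longrightarrow> bihom m n (\<lambda>a b c d. f a b c d + g a b c d)"
| bihom_mult: "bihom m n f \<Longrightarrow> bihom m' n' g \<Longrightarrow> bihom (m + m') (n + n') (\<lambda>a b c d. f a b c d * g a b c d)"

lemma bihom_cmult: "bihom m n f \<Longrightarrow> bihom m n (\<lambda>a b c d. k * f a b c d)"
  using bihom_mult[OF bihom_const, of m n f k] by simp

lemma bihom_diff: "bihom m n f \<Longrightarrow> bihom m n g \<Longrightarrow> bihom m n (\<lambda>a b c d. f a b c d - g a b c d)"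
  using bihom_add[OF _ bihom_cmult, of m n f g "-1"] by simp

lemma bihom_sum: "(\<And>i. i \<in> A \<Longrightarrow> bihom m n (f i)) \<Longrightarrow> bihom m n (\<lambda>a b c d. \<Sum>i\<in>A. f i a b c d)"
proof (induction A rule: infinite_finite_induct)
  case (insert x A)
  then show ?case using bihom_add[of m n "f x" "\<lambda>a b c d. \<Sum>i\<in>A. f i a b c d"] by simp
qed (simp_all add: bihom_zero)

lemma bihom_power: "bihom m n f \<Longrightarrow> bihom (k * m) (k * n) (\<lambda>a b c d. f a b c d ^ k)"
proof (induction k)
  case 0 then show ?case using bihom_const[of 1] by simp
next
  case (Suc k) then show ?case using bihom_mult[of m n f "k * m" "k * n"] by simp
qed

lemma bihom_swap: "bihom m n f \<Longrightarrow> bihom n m (\<lambda>a b c d. f c d a b)"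
  by (induction rule: bihom.induct) (auto intro: bihom.intros simp del: One_nat_def)

lemma bihom_comp:
  assumes "bihom m n f" "bihom p q g0" "bihom p q g1" "bihom r s h0" "bihom r s h1"
  shows "bihom (m * p + n * r) (m * q + n * s)
    (\<lambda>a b c d. f (g0 a b c d) (g1 a b c d) (h0 a b c d) (h1 a b c d))"
  using assms(1)
proof (induction rule: bihom.induct)
  case (bihom_mult m n f m' n' g)
  then show ?case using bihom.bihom_mult[OF bihom_mult.IH] by (simp add: algebra_simps)
qed (use assms(2-) in \<open>auto intro: bihom.intros\<close>)

lemma bihom_homog: "bihom m n f \<Longrightarrow> f (k * a) (k * b) (l * c) (l * d) = k ^ m * l ^ n * f a b c d"
  by (induction rule: bihom.induct) (auto simp: algebra_simps power_add)

lemma bihom_isCont: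
  assumes "bihom m n f"
  shows "isCont (\<lambda>a. f a b c d) x" "isCont (\<lambda>c. f a b c d) x"
  using assms by (induction rule: bihom.induct) (auto intro: continuous_intros)

text \<open>Carries polynomial identities from an affine chart to the points at infinity.\<close>

lemma isCont_zero:
  fixes h :: "complex \<Rightarrow> complex"
  assumes "isCont h 0" "\<And>x. x \<noteq> 0 \<Longrightarrow> h x = 0"
  shows "h 0 = 0"
proof -
  have "(h \<longlongrightarrow> h 0) (at 0)" using assms(1) by (simp add: isCont_def)
  moreover have "(h \<longlongrightarrow> 0) (at 0)"
    by (rule tendsto_eventually) (use assms(2) in \<open>auto simp: eventually_at_filter\<close>)
  ultimately show ?thesis using tendsto_unique[OF at_neq_bot] by blast
qed

text \<open>Homogeneity covers all arguments with \<open>a\<close> and \<open>c\<close> nonzero;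
  continuity in \<open>a\<close>, and then in \<open>c\<close>, covers the remaining ones.\<close>

lemma bihom_zeroI:
  assumes f: "bihom m n f" and 0: "\<And>x y. f 1 x 1 y = 0"
  shows "f a b c d = 0"
proof -
  have 1: "f a b c d = 0" if "a \<noteq> 0" "c \<noteq> 0" for a b c d
    using bihom_homog[OF f, of a 1 "b / a" c 1 "d / c"] that 0 by simp
  have 2: "f a b c d = 0" if "c \<noteq> 0" for a b c d
    using isCont_zero[OF bihom_isCont(1)[OF f], of b c d] 1 that by (cases "a = 0") auto
  show ?thesis
    using isCont_zero[OF bihom_isCont(2)[OF f], of a b d] 2 by (cases "c = 0") auto
qed

lemma bihom_eqI:
  assumes "bihom m n f" "bihom m n g" "\<And>x y. f 1 x 1 y = g 1 x 1 y"
  shows "f a b c d = g a b c d"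
  using bihom_zeroI[OF bihom_diff[OF assms(1,2)], of a b c d] assms(3) by simp

text \<open>Polynomials in \<open>y\<close> over \<open>\<complex>[x]\<close>; \<open>dx\<close> below is the degree in \<open>x\<close>.\<close>

definition ev :: "complex poly poly \<Rightarrow> complex \<Rightarrow> complex \<Rightarrow> complex" where
  "ev p x y = poly (poly p [:y:]) x"

lemma ev_simps [simp]: "ev (p + q) x y = ev p x y + ev q x y" "ev (p * q) x y = ev p x y * ev q x y"
  "ev (p - q) x y = ev p x y - ev q x y" "ev 0 x y = 0" "ev 1 x y = 1"
  by (simp_all add: ev_def)

text \<open>A nonzero polynomial over the domain C[x] has finitely many roots, but here every
  constant \<open>[:y:]\<close> would be one.\<close>

lemma ev_eq_0: "(\<And>x y. ev p x y = 0) \<Longrightarrow> p = 0"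
proof (rule ccontr)
  assume 0: "\<And>x y. ev p x y = 0" and p: "p \<noteq> 0"
  have "poly p [:y:] = 0" for y
    using 0[of _ y] unfolding ev_def by (metis poly_all_0_iff_0)
  then have "range (\<lambda>y. [:y:]) \<subseteq> {z. poly p z = 0}" by auto
  then have "finite (range (\<lambda>y::complex. [:y:]))" using poly_roots_finite[OF p] finite_subset by blast
  moreover have "inj (\<lambda>y::complex. [:y:])" by (auto simp: inj_def)
  ultimately have "finite (UNIV :: complex set)" using finite_imageD by blast
  then show False using infinite_UNIV_char_0 by blast
qed

definition dx :: "complex poly poly \<Rightarrow> nat" where
  "dx p = Max ((\<lambda>j. degree (coeff p j)) ` {..degree p})"

lemma dx_ge: "degree (coeff p j) \<le> dx p"
proof (cases "j \<le> degree p")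
  case True then show ?thesis unfolding dx_def by (intro Max_ge) auto
next
  case False then show ?thesis by (simp add: coeff_eq_0)
qed

lemma dx_le: "(\<And>j. degree (coeff p j) \<le> m) \<Longrightarrow> dx p \<le> m"
  unfolding dx_def by (intro Max.boundedI) auto

lemma dx_0 [simp]: "dx 0 = 0" by (simp add: dx_def)

lemma dx_attained: "p \<noteq> 0 \<Longrightarrow> \<exists>j. coeff (coeff p j) (dx p) \<noteq> 0"
proof -
  assume p: "p \<noteq> 0"
  have "dx p \<in> (\<lambda>j. degree (coeff p j)) ` {..degree p}" unfolding dx_def by (intro Max_in) auto
  then obtain j where j: "dx p = degree (coeff p j)" by auto
  show ?thesis
  proof (cases "coeff p j = 0")
    case False
    then show ?thesis using j by (metis leading_coeff_0_iff)
  next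
    case True
    then have d: "dx p = 0" using j by simp
    have "degree (lead_coeff p) = 0" using dx_ge[of p "degree p"] d by simp
    then show ?thesis using p d by (metis leading_coeff_0_iff)
  qed
qed

lemma coeff_mult_bounds:
  fixes p q :: "complex poly"
  assumes "degree p \<le> m" "degree q \<le> n"
  shows "coeff (p * q) (m + n) = coeff p m * coeff q n"
proof -
  have "coeff (p * q) (m + n) = (\<Sum>i\<le>m + n. coeff p i * coeff q (m + n - i))" by (rule coeff_mult)
  also have "\<dots> = (\<Sum>i\<in>{m}. coeff p i * coeff q (m + n - i))"
  proof (rule sum.mono_neutral_right)
    show "\<forall>i\<in>{..m + n} - {m}. coeff p i * coeff q (m + n - i) = 0"
    proof
      fix i assume "i \<in> {..m + n} - {m}"
      then have "i > m \<or> m + n - i > n" by auto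
      then show "coeff p i * coeff q (m + n - i) = 0" using assms by (auto simp: coeff_eq_0)
    qed
  qed auto
  finally show ?thesis by simp
qed

text \<open>In each factor the highest power of y is taken whose coefficient attains the x-degree.
  To the corresponding coefficient of the product only this one pair contributes in x-degree
  \<open>dx p + dx q\<close>, so nothing cancels.\<close>

lemma dx_mult:
  assumes "p \<noteq> 0" "q \<noteq> 0"
  shows "dx p + dx q \<le> dx (p * q)"
proof -
  define S where "S p = {j. coeff (coeff p j) (dx p) \<noteq> 0}" for p
  have "S p \<subseteq> {..degree p}" for p unfolding S_def by (auto intro: ccontr simp: coeff_eq_0 not_le)
  then have fin: "finite (S p)" for p using finite_subset by blast
  have ne: "S p \<noteq> {}" "S q \<noteq> {}" using dx_attained assms by (auto simp: S_def)
  define J where "J = Max (S p)"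
  define J' where "J' = Max (S q)"
  have J: "J \<in> S p" "J' \<in> S q" using Max_in fin ne by (auto simp: J_def J'_def)
  have hi: "j \<notin> S p" if "j > J" for j using that Max_ge[OF fin, of j p] unfolding J_def by (meson not_le)
  have hi': "j \<notin> S q" if "j > J'" for j using that Max_ge[OF fin, of j q] unfolding J'_def by (meson not_le)
  have "coeff (coeff (p * q) (J + J')) (dx p + dx q) =
    (\<Sum>i\<le>J + J'. coeff (coeff p i) (dx p) * coeff (coeff q (J + J' - i)) (dx q))"
    unfolding coeff_mult[of p q] coeff_sum by (intro sum.cong refl coeff_mult_bounds dx_ge)
  also have "\<dots> = (\<Sum>i\<in>{J}. coeff (coeff p i) (dx p) * coeff (coeff q (J + J' - i)) (dx q))"
  proof (rule sum.mono_neutral_right)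
    show "\<forall>i\<in>{..J + J'} - {J}. coeff (coeff p i) (dx p) * coeff (coeff q (J + J' - i)) (dx q) = 0"
    proof
      fix i assume "i \<in> {..J + J'} - {J}"
      then have "i > J \<or> J + J' - i > J'" by auto
      then show "coeff (coeff p i) (dx p) * coeff (coeff q (J + J' - i)) (dx q) = 0"
        using hi hi' by (auto simp: S_def)
    qed
  qed auto
  also have "\<dots> \<noteq> 0" using J by (simp add: S_def)
  finally have "dx p + dx q \<le> degree (coeff (p * q) (J + J'))" by (rule le_degree)
  then show ?thesis using dx_ge le_trans by blast
qed

lemma bihom_dehom:
  "bihom m n f \<Longrightarrow> \<exists>p. degree p \<le> n \<and> dx p \<le> m \<and> (\<forall>x y. f 1 x 1 y = ev p x y)"
proof (induction rule: bihom.induct)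
  case (bihom_const k)
  have "dx [:[:k:]:] \<le> 0" by (rule dx_le) (auto simp: coeff_pCons split: nat.splits)
  then show ?case by (intro exI[of _ "[:[:k:]:]"]) (simp add: ev_def)
next
  case (bihom_zero m n)
  show ?case by (rule exI[of _ 0]) simp
next
  case bihom_s0
  have "dx 1 \<le> 1" by (rule dx_le) (auto simp: coeff_pCons one_pCons split: nat.splits)
  then show ?case by (intro exI[of _ 1]) simp
next
  case bihom_s1
  have "dx [:[:0, 1:]:] \<le> 1" by (rule dx_le) (auto simp: coeff_pCons split: nat.splits)
  then show ?case by (intro exI[of _ "[:[:0, 1:]:]"]) (simp add: ev_def)
next
  case bihom_t0
  have "dx 1 \<le> 0" by (rule dx_le) (auto simp: coeff_pCons one_pCons split: nat.splits)
  then show ?case by (intro exI[of _ 1]) simp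
next
  case bihom_t1
  have "dx [:0, 1:] \<le> 0" by (rule dx_le) (auto simp: coeff_pCons one_pCons split: nat.splits)
  then show ?case by (intro exI[of _ "[:0, 1:]"]) (simp add: ev_def)
next
  case (bihom_add m n f g)
  then obtain p q where p: "degree p \<le> n" "dx p \<le> m" "\<forall>x y. f 1 x 1 y = ev p x y"
    and q: "degree q \<le> n" "dx q \<le> m" "\<forall>x y. g 1 x 1 y = ev q x y" by blast
  have "degree (coeff p j + coeff q j) \<le> m" for j
    using dx_ge[of p j] dx_ge[of q j] p(2) q(2) by (intro degree_add_le) linarith+
  then show ?case using p q by (intro exI[of _ "p + q"]) (auto intro!: dx_le degree_add_le)
next
  case (bihom_mult m n f m' n' g)
  then obtain p q where p: "degree p \<le> n" "dx p \<le> m" "\<forall>x y. f 1 x 1 y = ev p x y"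
    and q: "degree q \<le> n'" "dx q \<le> m'" "\<forall>x y. g 1 x 1 y = ev q x y" by blast
  have "degree (coeff p i * coeff q j) \<le> m + m'" for i j
    using degree_mult_le[of "coeff p i" "coeff q j"] dx_ge[of p i] dx_ge[of q j] p(2) q(2) by linarith
  then have "dx (p * q) \<le> m + m'" unfolding coeff_mult by (intro dx_le) (auto simp: coeff_mult intro!: degree_sum_le)
  moreover have "degree (p * q) \<le> n + n'" using degree_mult_le[of p q] p(1) q(1) by linarith
  ultimately show ?case using p q by (intro exI[of _ "p * q"]) auto
qed

definition homog :: "nat \<Rightarrow> nat \<Rightarrow> complex poly poly \<Rightarrow> complex \<Rightarrow> complex \<Rightarrow> complex \<Rightarrow> complex \<Rightarrow> complex" where
  "homog m n p a b c d =
    (\<Sum>j\<le>n. \<Sum>i\<le>m. coeff (coeff p j) i * ((a ^ (m - i) * b ^ i) * (c ^ (n - j) * d ^ j)))"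

lemma bihom_homog_poly: "bihom m n (homog m n p)"
proof -
  have "bihom m n (\<lambda>a b c d. coeff (coeff p j) i * ((a ^ (m - i) * b ^ i) * (c ^ (n - j) * d ^ j)))"
    if "i \<le> m" "j \<le> n" for i j
    using bihom_cmult[OF bihom_mult[OF bihom_mult[OF bihom_power[OF bihom_s0, of "m - i"] bihom_power[OF bihom_s1, of i]]
        bihom_mult[OF bihom_power[OF bihom_t0, of "n - j"] bihom_power[OF bihom_t1, of j]]], of "coeff (coeff p j) i"] that
    by simp
  then have "bihom m n (\<lambda>a b c d. \<Sum>j\<in>{..n}. \<Sum>i\<in>{..m}. coeff (coeff p j) i * ((a ^ (m - i) * b ^ i) * (c ^ (n - j) * d ^ j)))"
    by (intro bihom_sum) auto
  then show ?thesis unfolding homog_def .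
qed

lemma poly_bound:
  fixes p :: "'a::comm_semiring_1 poly"
  shows "degree p \<le> n \<Longrightarrow> poly p x = (\<Sum>i\<le>n. coeff p i * x ^ i)"
  unfolding poly_altdef by (rule sum.mono_neutral_left) (auto simp: coeff_eq_0)

lemma homog_dehom:
  assumes "degree p \<le> n" "dx p \<le> m"
  shows "homog m n p 1 x 1 y = ev p x y"
proof -
  have "ev p x y = (\<Sum>j\<le>n. poly (coeff p j) x * y ^ j)"
    unfolding ev_def poly_bound[OF assms(1)] by (simp add: poly_sum poly_power)
  also have "\<dots> = (\<Sum>j\<le>n. (\<Sum>i\<le>m. coeff (coeff p j) i * x ^ i) * y ^ j)"
    using dx_ge assms(2) le_trans by (intro sum.cong refl arg_cong2[where f = "(*)"] poly_bound) blast
  finally show ?thesis unfolding homog_def by (simp add: sum_distrib_right mult.assoc)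
qed

section \<open>Representations of maps by bihomogeneous forms\<close>

definition birep :: "nat \<Rightarrow> nat \<Rightarrow> (complex \<Rightarrow> complex \<Rightarrow> complex \<Rightarrow> complex \<Rightarrow> complex) \<Rightarrow>
   (complex \<Rightarrow> complex \<Rightarrow> complex \<Rightarrow> complex \<Rightarrow> complex) \<Rightarrow> (cp1 \<times> cp1 \<Rightarrow> cp1) \<Rightarrow> bool" where
  "birep m n P Q \<phi> \<longleftrightarrow> bihom m n P \<and> bihom m n Q \<and>
     (\<forall>a b c d. (a \<noteq> 0 \<or> b \<noteq> 0) \<and> (c \<noteq> 0 \<or> d \<noteq> 0) \<longrightarrow>
        (P a b c d \<noteq> 0 \<or> Q a b c d \<noteq> 0) \<and> \<phi> (pt a b, pt c d) = pt (P a b c d) (Q a b c d))"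

text \<open>The bidegree is \<open>(n, n)\<close> because that is what a form of degree
  \<open>n\<close> on projective space becomes under the Segre map.\<close>

definition locrep_at :: "complex \<Rightarrow> complex \<Rightarrow> complex \<Rightarrow> complex \<Rightarrow> nat \<Rightarrow> (complex \<Rightarrow> complex \<Rightarrow> complex \<Rightarrow> complex \<Rightarrow> complex) \<Rightarrow>
   (complex \<Rightarrow> complex \<Rightarrow> complex \<Rightarrow> complex \<Rightarrow> complex) \<Rightarrow> (cp1 \<times> cp1 \<Rightarrow> cp1) \<Rightarrow> bool" where
  "locrep_at a b c d n P Q \<phi> \<longleftrightarrow> bihom n n P \<and> bihom n n Q \<and> (P a b c d \<noteq> 0 \<or> Q a b c d \<noteq> 0) \<and>
     (\<forall>a b c d. (a \<noteq> 0 \<or> b \<noteq> 0) \<and> (c \<noteq> 0 \<or> d \<noteq> 0) \<and> (P a b c d \<noteq> 0 \<or> Q a b c d \<noteq> 0) \<longrightarrow>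
        \<phi> (pt a b, pt c d) = pt (P a b c d) (Q a b c d))"

definition locrep :: "(cp1 \<times> cp1 \<Rightarrow> cp1) \<Rightarrow> bool" where
  "locrep \<phi> \<longleftrightarrow> (\<forall>a b c d. (a \<noteq> 0 \<or> b \<noteq> 0) \<and> (c \<noteq> 0 \<or> d \<noteq> 0) \<longrightarrow> (\<exists>n P Q. locrep_at a b c d n P Q \<phi>))"

lemma locrep_atD:
  "locrep_at a b c d n P Q \<phi> \<Longrightarrow> a' \<noteq> 0 \<or> b' \<noteq> 0 \<Longrightarrow> c' \<noteq> 0 \<or> d' \<noteq> 0 \<Longrightarrow>
    P a' b' c' d' \<noteq> 0 \<or> Q a' b' c' d' \<noteq> 0 \<Longrightarrow> \<phi> (pt a' b', pt c' d') = pt (P a' b' c' d') (Q a' b' c' d')"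
  unfolding locrep_at_def by blast

lemma birepD:
  assumes "birep m n P Q \<phi>"
  shows "bihom m n P" "bihom m n Q"
    "\<And>a b c d. a \<noteq> 0 \<or> b \<noteq> 0 \<Longrightarrow> c \<noteq> 0 \<or> d \<noteq> 0 \<Longrightarrow> P a b c d \<noteq> 0 \<or> Q a b c d \<noteq> 0"
    "\<And>a b c d. a \<noteq> 0 \<or> b \<noteq> 0 \<Longrightarrow> c \<noteq> 0 \<or> d \<noteq> 0 \<Longrightarrow> \<phi> (pt a b, pt c d) = pt (P a b c d) (Q a b c d)"
  using assms unfolding birep_def by blast+

text \<open>Dividing a local representation by the greatest common divisor of its dehomogenisation in
  the factorial ring \<open>C[x][y]\<close> gives one that all others are multiples of, hence a global one.\<close>

lemma global_rep:
  assumes "locrep \<phi>"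
  obtains m n P Q where "birep m n P Q \<phi>"
proof -
  obtain n F0 F1 where F: "locrep_at 1 0 1 0 n F0 F1 \<phi>" using assms unfolding locrep_def by force
  have bF: "bihom n n F0" "bihom n n F1" using F by (auto simp: locrep_at_def)
  obtain p0 where p0: "degree p0 \<le> n" "dx p0 \<le> n" "\<And>x y. F0 1 x 1 y = ev p0 x y" using bihom_dehom[OF bF(1)] by blast
  obtain p1 where p1: "degree p1 \<le> n" "dx p1 \<le> n" "\<And>x y. F1 1 x 1 y = ev p1 x y" using bihom_dehom[OF bF(2)] by blast
  have "p0 \<noteq> 0 \<or> p1 \<noteq> 0"
  proof (rule ccontr)
    assume "\<not> ?thesis"
    then have "F0 1 0 1 0 = 0" "F1 1 0 1 0 = 0" using p0(3) p1(3) by auto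
    then show False using F by (simp add: locrep_at_def)
  qed
  define g where "g = gcd p0 p1"
  define P where "P = p0 div g"
  define Q where "Q = p1 div g"
  have g0: "g \<noteq> 0" using \<open>p0 \<noteq> 0 \<or> p1 \<noteq> 0\<close> by (simp add: g_def)
  have gP: "p0 = g * P" "p1 = g * Q" by (simp_all add: P_def Q_def g_def)
  have PQ: "P \<noteq> 0 \<or> Q \<noteq> 0" using gP \<open>p0 \<noteq> 0 \<or> p1 \<noteq> 0\<close> by auto
  have cop: "coprime P Q" unfolding P_def Q_def g_def using \<open>p0 \<noteq> 0 \<or> p1 \<noteq> 0\<close> by (rule div_gcd_coprime)
  define a where "a = max (dx P) (dx Q)"
  define b where "b = max (degree P) (degree Q)"
  let ?P = "homog a b P" and ?Q = "homog a b Q"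
  have dehom: "?P 1 x 1 y = ev P x y" "?Q 1 x 1 y = ev Q x y" for x y
    by (rule homog_dehom; simp add: a_def b_def)+
  have "(?P s0 s1 t0 t1 \<noteq> 0 \<or> ?Q s0 s1 t0 t1 \<noteq> 0) \<and> \<phi> (pt s0 s1, pt t0 t1) = pt (?P s0 s1 t0 t1) (?Q s0 s1 t0 t1)"
    if nz: "(s0 \<noteq> 0 \<or> s1 \<noteq> 0) \<and> (t0 \<noteq> 0 \<or> t1 \<noteq> 0)" for s0 s1 t0 t1
  proof -
    obtain n' G0 G1 where G: "locrep_at s0 s1 t0 t1 n' G0 G1 \<phi>" using assms nz unfolding locrep_def by blast
    have bG: "bihom n' n' G0" "bihom n' n' G1" using G by (auto simp: locrep_at_def)
    obtain q0 where q0: "degree q0 \<le> n'" "dx q0 \<le> n'" "\<And>x y. G0 1 x 1 y = ev q0 x y" using bihom_dehom[OF bG(1)] by blast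
    obtain q1 where q1: "degree q1 \<le> n'" "dx q1 \<le> n'" "\<And>x y. G1 1 x 1 y = ev q1 x y" using bihom_dehom[OF bG(2)] by blast
    \<comment> \<open>Where both pairs of forms are nonzero they represent the same point; elsewhere
      one pair vanishes and the identity is trivial.\<close>
    have "ev (p0 * q1 - p1 * q0) x y = 0" for x y
    proof (cases "(F0 1 x 1 y \<noteq> 0 \<or> F1 1 x 1 y \<noteq> 0) \<and> (G0 1 x 1 y \<noteq> 0 \<or> G1 1 x 1 y \<noteq> 0)")
      case True
      then have "pt (F0 1 x 1 y) (F1 1 x 1 y) = pt (G0 1 x 1 y) (G1 1 x 1 y)"
        using locrep_atD[OF F, of 1 x 1 y] locrep_atD[OF G, of 1 x 1 y] by simp
      then have "F0 1 x 1 y * G1 1 x 1 y = F1 1 x 1 y * G0 1 x 1 y" using True pt_eq by blast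
      then show ?thesis using p0(3) p1(3) q0(3) q1(3) by simp
    next
      case False
      then show ?thesis using p0(3)[of x y] p1(3)[of x y] q0(3)[of x y] q1(3)[of x y] by auto
    qed
    then have "p0 * q1 - p1 * q0 = 0" by (rule ev_eq_0)
    then have "g * (P * q1 - Q * q0) = 0" unfolding gP by (simp add: algebra_simps)
    then have cross: "P * q1 = Q * q0" using g0 by simp
    have "P dvd Q * q0" using cross by (metis dvd_triv_left)
    then have "P dvd q0" using cop coprime_dvd_mult_right_iff by blast
    moreover have "Q dvd P * q1" using cross by (metis dvd_triv_left)
    then have "Q dvd q1" using cop by (simp add: coprime_dvd_mult_right_iff coprime_commute)
    \<comment> \<open>The two cofactors agree unless \<open>P\<close> or \<open>Q\<close> is zero,
      and in that case the cofactor of the other component is taken.\<close>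
    ultimately obtain k where k: "q0 = P * k" "q1 = Q * k"
    proof -
      assume "P dvd q0" "Q dvd q1"
      then obtain k k' where kk: "q0 = P * k" "q1 = Q * k'" by (auto elim!: dvdE)
      have "P * Q * k' = P * Q * k" using cross kk by (simp add: algebra_simps)
      then consider "k = k'" | "P = 0" | "Q = 0" by auto
      then show ?thesis
      proof cases
        case 1 then show ?thesis using that[of k] kk by simp
      next
        case 2 then show ?thesis using that[of k'] kk by simp
      next
        case 3 then show ?thesis using that[of k] kk by simp
      qed
    qed
    have GH: "G0 a b c d = homog n' n' q0 a b c d" "G1 a b c d = homog n' n' q1 a b c d" for a b c d
      by (rule bihom_eqI[OF bG(1) bihom_homog_poly], simp add: q0(3) homog_dehom[OF q0(1,2)])
        (rule bihom_eqI[OF bG(2) bihom_homog_poly], simp add: q1(3) homog_dehom[OF q1(1,2)])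
    have "k \<noteq> 0"
    proof
      assume "k = 0"
      then have "G0 s0 s1 t0 t1 = 0" "G1 s0 s1 t0 t1 = 0" using k GH by (auto simp: homog_def)
      then show False using G by (simp add: locrep_at_def)
    qed
    then have dP: "dx P + dx k \<le> n' \<and> degree P + degree k \<le> n'" if "P \<noteq> 0"
      using dx_mult[OF that] degree_mult_eq[OF that] q0(1,2) unfolding k by fastforce
    have dQ: "dx Q + dx k \<le> n' \<and> degree Q + degree k \<le> n'" if "Q \<noteq> 0"
      using dx_mult[OF that] degree_mult_eq[OF that] q1(1,2) \<open>k \<noteq> 0\<close> unfolding k by fastforce
    \<comment> \<open>Degrees add up in products, so the cofactor can be homogenised in the bidegree
      that is left over.\<close>
    have a: "a + dx k \<le> n'" and b: "b + degree k \<le> n'"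
      using dP dQ PQ by (cases "P = 0"; cases "Q = 0"; auto simp: a_def b_def)+
    let ?k = "homog (n' - a) (n' - b) k"
    have kd: "?k 1 x 1 y = ev k x y" for x y using a b by (intro homog_dehom) auto
    have bk: "bihom n' n' (\<lambda>s0 s1 t0 t1. homog a b R s0 s1 t0 t1 * ?k s0 s1 t0 t1)" for R
      using bihom_mult[OF bihom_homog_poly[of a b R] bihom_homog_poly[of "n' - a" "n' - b" k]] a b by simp
    have "G0 s0 s1 t0 t1 = ?P s0 s1 t0 t1 * ?k s0 s1 t0 t1"
      by (rule bihom_eqI[OF bG(1) bk]) (simp add: q0(3) k dehom kd)
    moreover have "G1 s0 s1 t0 t1 = ?Q s0 s1 t0 t1 * ?k s0 s1 t0 t1"
      by (rule bihom_eqI[OF bG(2) bk]) (simp add: q1(3) k dehom kd)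
    moreover have "\<phi> (pt s0 s1, pt t0 t1) = pt (G0 s0 s1 t0 t1) (G1 s0 s1 t0 t1)"
      "G0 s0 s1 t0 t1 \<noteq> 0 \<or> G1 s0 s1 t0 t1 \<noteq> 0" using G nz by (auto simp: locrep_at_def)
    ultimately show ?thesis using pt_scale[of "?k s0 s1 t0 t1"] by (auto simp: mult.commute)
  qed
  then have "birep a b ?P ?Q \<phi>" unfolding birep_def using bihom_homog_poly by blast
  then show ?thesis by (rule that)
qed

text \<open>Without zeros, \<open>f\<close> would be a polynomial without roots in the affine chart,
  hence a constant \<open>k\<close>. By homogeneity its value at (a, 1) is then
  \<open>k * a ^ m\<close> for nonzero \<open>a\<close>, and by continuity also at
  \<open>a = 0\<close>, where it vanishes because \<open>m > 0\<close>.\<close>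

lemma bihom_root:
  assumes "bihom m n f" "m > 0"
  shows "\<exists>a b. (a \<noteq> 0 \<or> b \<noteq> 0) \<and> f a b c d = 0"
proof (rule ccontr)
  assume no: "\<not> ?thesis"
  obtain p where p: "\<And>x. f 1 x c d = poly p x"
  proof -
    have "\<exists>p. \<forall>x. f 1 x c d = poly p x"
      using assms(1)
    proof (induction rule: bihom.induct)
      case (bihom_const k) show ?case by (rule exI[of _ "[:k:]"]) simp
    next
      case (bihom_zero m n) show ?case by (rule exI[of _ 0]) simp
    next
      case bihom_s0 show ?case by (rule exI[of _ 1]) simp
    next
      case bihom_s1 show ?case by (rule exI[of _ "[:0, 1:]"]) simp
    next
      case bihom_t0 show ?case by (rule exI[of _ "[:c:]"]) simp
    next
      case bihom_t1 show ?case by (rule exI[of _ "[:d:]"]) simp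
    next
      case (bihom_add m n f g)
      then obtain p q where "\<forall>x. f 1 x c d = poly p x" "\<forall>x. g 1 x c d = poly q x" by blast
      then show ?case by (intro exI[of _ "p + q"]) simp
    next
      case (bihom_mult m n f m' n' g)
      then obtain p q where "\<forall>x. f 1 x c d = poly p x" "\<forall>x. g 1 x c d = poly q x" by blast
      then show ?case by (intro exI[of _ "p * q"]) simp
    qed
    then show ?thesis using that by blast
  qed
  have "constant (poly p)"
  proof (rule ccontr)
    assume "\<not> constant (poly p)"
    then obtain x where "poly p x = 0" using fundamental_theorem_of_algebra by blast
    then show False using no p by (metis one_neq_zero)
  qed
  then obtain k where k: "\<And>x. f 1 x c d = k" using p unfolding constant_def by metis
  have "f a 1 c d - a ^ m * k = 0" if "a \<noteq> 0" for a
    using bihom_homog[OF assms(1), of a 1 "1 / a" 1 c d] that k by simp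
  then have "f 0 1 c d - 0 ^ m * k = 0"
    by (intro isCont_zero[where h = "\<lambda>a. f a 1 c d - a ^ m * k"] continuous_intros bihom_isCont[OF assms(1)])
  moreover have "f 0 1 c d \<noteq> 0" using no by (metis zero_neq_one)
  ultimately show False using assms(2) by simp
qed

text \<open>Comparison with the tautological representation gives \<open>a * Q = b * P\<close>. Over
  the point (1, 0) a zero of \<open>P\<close> would also be one of \<open>Q\<close>, which forces
  \<open>n = 0\<close>. In the chart \<open>Q\<close> is x times \<open>P\<close>, so
  \<open>P\<close> has no zero there and is constant; then \<open>Q\<close> at (a, 1) is a multiple
  of a^(m-1) and can be nonzero at a = 0 only for \<open>m = 1\<close>.\<close>

lemma birep_fst_degree:
  assumes "birep m n P Q fst"
  shows "m = 1" "n = 0"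
proof -
  note P = birepD(1,2)[OF assms]
  have r: "(P a b c d \<noteq> 0 \<or> Q a b c d \<noteq> 0) \<and> pt a b = pt (P a b c d) (Q a b c d)"
    if nz: "a \<noteq> 0 \<or> b \<noteq> 0" "c \<noteq> 0 \<or> d \<noteq> 0" for a b c d
    using birepD(3)[OF assms nz] birepD(4)[OF assms nz] unfolding fst_conv by (rule conjI)
  have cross: "a * Q a b c d = b * P a b c d" if "a \<noteq> 0 \<or> b \<noteq> 0" "c \<noteq> 0 \<or> d \<noteq> 0" for a b c d
    using r[OF that] that pt_eq by metis
  show "n = 0"
  proof (rule ccontr)
    assume "n \<noteq> 0"
    then obtain c d where cd: "c \<noteq> 0 \<or> d \<noteq> 0" "P 1 0 c d = 0"
      using bihom_root[OF bihom_swap[OF P(1)], of 1 0] by auto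
    then show False using r[of 1 0 c d] cross[of 1 0 c d] by simp
  qed
  have Q: "Q 1 x 1 0 = x * P 1 x 1 0" for x using cross[of 1 x 1 0] by simp
  show "m = 1"
  proof (cases m)
    case 0
    have "P 0 1 1 0 = P 1 0 1 0"  "Q 0 1 1 0 = Q 1 0 1 0"
    proof -
      have const: "bihom m' n' f \<Longrightarrow> m' = 0 \<Longrightarrow> f a b c d = f a' b' c d" for m' n' f a b a' b' c d
        by (induction rule: bihom.induct) auto
      show "P 0 1 1 0 = P 1 0 1 0"  "Q 0 1 1 0 = Q 1 0 1 0" using const P 0 by blast+
    qed
    then show ?thesis using cross[of 1 0 1 0] cross[of 0 1 1 0] r[of 1 0 1 0] by simp
  next
    case (Suc k)
    obtain a b where ab: "a \<noteq> 0 \<or> b \<noteq> 0" "P a b 1 0 = 0" using bihom_root[OF P(1), of 1 0] Suc by auto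
    have a0: "a = 0" using cross[OF ab(1), of 1 0] r[OF ab(1), of 1 0] ab(2) by auto
    have "P 1 x 1 0 \<noteq> 0" for x using r[of 1 x 1 0] Q[of x] by auto
    have "\<exists>p. \<forall>x. P 1 x 1 0 = poly p x"
      using bihom_dehom[OF P(1)] unfolding ev_def by metis
    then obtain p where p: "\<And>x. P 1 x 1 0 = poly p x" by blast
    have "constant (poly p)"
    proof (rule ccontr)
      assume "\<not> constant (poly p)"
      then obtain x where "poly p x = 0" using fundamental_theorem_of_algebra by blast
      then show False using \<open>P 1 x 1 0 \<noteq> 0\<close> p by metis
    qed
    then obtain \<kappa> where \<kappa>: "\<And>x. P 1 x 1 0 = \<kappa>" using p unfolding constant_def by metis
    have "Q a 1 1 0 - a ^ k * \<kappa> = 0" if "a \<noteq> 0" for a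
      using bihom_homog[OF P(2), of a 1 "1 / a" 1 1 0] Q[of "1 / a"] \<kappa> that Suc by simp
    then have Q0: "Q 0 1 1 0 - 0 ^ k * \<kappa> = 0"
      by (intro isCont_zero[where h = "\<lambda>a. Q a 1 1 0 - a ^ k * \<kappa>"] continuous_intros bihom_isCont[OF P(2)])
    have "P 0 1 1 0 = 0" using cross[of 0 1 1 0] by simp
    then have "Q 0 1 1 0 \<noteq> 0" using r[of 0 1 1 0] by simp
    then have "k = 0" using Q0 by (cases k) auto
    then show ?thesis using Suc by simp
  qed
qed

lemma birep_swap: "birep m n P Q \<phi> \<Longrightarrow> birep n m (\<lambda>a b c d. P c d a b) (\<lambda>a b c d. Q c d a b) (\<phi> \<circ> prod.swap)"
  unfolding birep_def by (auto simp: bihom_swap)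

lemma birep_snd_degree:
  assumes "birep m n P Q snd" shows "m = 0" "n = 1"
proof -
  have "snd \<circ> prod.swap = fst" by (auto simp: fun_eq_iff)
  then show "m = 0" "n = 1" using birep_fst_degree[OF birep_swap[OF assms, unfolded \<open>snd \<circ> prod.swap = fst\<close>]] by auto
qed

lemma bihom_linear: "bihom 1 0 f \<Longrightarrow> \<exists>u v. \<forall>a b c d. f a b c d = u * a + v * b"
proof -
  assume f: "bihom 1 0 f"
  obtain p where p: "degree p \<le> 0" "dx p \<le> 1" "\<And>x y. f 1 x 1 y = ev p x y" using bihom_dehom[OF f] by blast
  have "f a b c d = homog 1 0 p a b c d" for a b c d
    by (rule bihom_eqI[OF f bihom_homog_poly]) (simp only: p(3) homog_dehom[OF p(1,2)])
  then show ?thesis by (intro exI[of _ "coeff (coeff p 0) 0"] exI[of _ "coeff (coeff p 0) 1"]) (simp add: homog_def)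
qed

text \<open>A vanishing determinant would give the two linear forms a common zero.\<close>

lemma birep_linear_mob:
  assumes "birep 1 0 P Q \<phi>"
  obtains g where "g \<in> mob UNIV" "\<And>p q. \<phi> (p, q) = g p"
proof -
  have P: "bihom 1 0 P" "bihom 1 0 Q"
    and r: "\<And>a b c d. a \<noteq> 0 \<or> b \<noteq> 0 \<Longrightarrow> c \<noteq> 0 \<or> d \<noteq> 0 \<Longrightarrow>
      (P a b c d \<noteq> 0 \<or> Q a b c d \<noteq> 0) \<and> \<phi> (pt a b, pt c d) = pt (P a b c d) (Q a b c d)"
    using birepD[OF assms] by simp_all
  obtain u v where uv: "\<And>a b c d. P a b c d = u * a + v * b" using bihom_linear[OF P(1)] by blast
  obtain w z where wz: "\<And>a b c d. Q a b c d = w * a + z * b" using bihom_linear[OF P(2)] by blast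
  have nz: "u * a + v * b \<noteq> 0 \<or> w * a + z * b \<noteq> 0" if "a \<noteq> 0 \<or> b \<noteq> 0" for a b
    using r[OF that, of 1 0] uv wz by simp
  have "u * z - v * w \<noteq> 0"
  proof
    assume d: "u * z - v * w = 0"
    show False
    proof (cases "u = 0 \<and> v = 0")
      case True
      have "z \<noteq> 0 \<or> w \<noteq> 0" using nz[of 1 0] nz[of 0 1] True by auto
      then show False using nz[of z "- w"] True by (simp add: mult.commute)
    next
      case False
      then show False using nz[of v "- u"] d by (auto simp: algebra_simps)
    qed
  qed
  then obtain g where g: "mobm u v w z g" using mobm_ex by blast
  have "\<phi> (p, q) = g p" for p q
  proof -
    obtain a b where p: "a \<noteq> 0 \<or> b \<noteq> 0" "p = pt a b" by (rule pt_surj[of p])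
    obtain c d where q: "c \<noteq> 0 \<or> d \<noteq> 0" "q = pt c d" by (rule pt_surj[of q])
    show ?thesis using r[OF p(1) q(1)] mobm_apply[OF g p(1)] uv wz p(2) q(2) by simp
  qed
  then show ?thesis using that mob_UNIV[OF g] by blast
qed

text \<open>Substitution of forms multiplies the matrices of bidegrees.\<close>

lemma birep_comp:
  assumes A: "birep a b A0 A1 \<phi>" and F: "birep c d F0 F1 (fst \<circ> f)" and E: "birep e h E0 E1 (snd \<circ> f)"
  shows "birep (a * c + b * e) (a * d + b * h)
    (\<lambda>s0 s1 t0 t1. A0 (F0 s0 s1 t0 t1) (F1 s0 s1 t0 t1) (E0 s0 s1 t0 t1) (E1 s0 s1 t0 t1))
    (\<lambda>s0 s1 t0 t1. A1 (F0 s0 s1 t0 t1) (F1 s0 s1 t0 t1) (E0 s0 s1 t0 t1) (E1 s0 s1 t0 t1)) (\<phi> \<circ> f)"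
  unfolding birep_def
proof (intro conjI allI impI)
  have bF: "bihom c d F0" "bihom c d F1" and bE: "bihom e h E0" "bihom e h E1" and bA: "bihom a b A0" "bihom a b A1"
    using A F E by (auto simp: birep_def)
  show "bihom (a * c + b * e) (a * d + b * h) (\<lambda>s0 s1 t0 t1. A0 (F0 s0 s1 t0 t1) (F1 s0 s1 t0 t1) (E0 s0 s1 t0 t1) (E1 s0 s1 t0 t1))"
    "bihom (a * c + b * e) (a * d + b * h) (\<lambda>s0 s1 t0 t1. A1 (F0 s0 s1 t0 t1) (F1 s0 s1 t0 t1) (E0 s0 s1 t0 t1) (E1 s0 s1 t0 t1))"
    using bihom_comp[OF bA(1) bF bE] bihom_comp[OF bA(2) bF bE] by auto
  fix s0 s1 t0 t1 :: complex assume nz: "(s0 \<noteq> 0 \<or> s1 \<noteq> 0) \<and> (t0 \<noteq> 0 \<or> t1 \<noteq> 0)"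
  have f: "f (pt s0 s1, pt t0 t1) = (pt (F0 s0 s1 t0 t1) (F1 s0 s1 t0 t1), pt (E0 s0 s1 t0 t1) (E1 s0 s1 t0 t1))"
    "F0 s0 s1 t0 t1 \<noteq> 0 \<or> F1 s0 s1 t0 t1 \<noteq> 0" "E0 s0 s1 t0 t1 \<noteq> 0 \<or> E1 s0 s1 t0 t1 \<noteq> 0"
    using birepD(3,4)[OF F, of s0 s1 t0 t1] birepD(3,4)[OF E, of s0 s1 t0 t1] nz by (auto simp: prod_eq_iff)
  show "A0 (F0 s0 s1 t0 t1) (F1 s0 s1 t0 t1) (E0 s0 s1 t0 t1) (E1 s0 s1 t0 t1) \<noteq> 0 \<or>
       A1 (F0 s0 s1 t0 t1) (F1 s0 s1 t0 t1) (E0 s0 s1 t0 t1) (E1 s0 s1 t0 t1) \<noteq> 0"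
    "(\<phi> \<circ> f) (pt s0 s1, pt t0 t1) = pt (A0 (F0 s0 s1 t0 t1) (F1 s0 s1 t0 t1) (E0 s0 s1 t0 t1) (E1 s0 s1 t0 t1))
       (A1 (F0 s0 s1 t0 t1) (F1 s0 s1 t0 t1) (E0 s0 s1 t0 t1) (E1 s0 s1 t0 t1))"
    using birepD(3,4)[OF A f(2,3)] f(1) by simp_all
qed

text \<open>The matrices of bidegrees of a map and its inverse have nonnegative entries and are inverse to
  each other, so they are permutation matrices.\<close>

lemma biregular_is_product:
  assumes l: "locrep (fst \<circ> f)" "locrep (snd \<circ> f)" "locrep (fst \<circ> g)" "locrep (snd \<circ> g)"
    and gf: "g \<circ> f = id"
  obtains \<alpha> \<beta> where "\<alpha> \<in> mob UNIV" "\<beta> \<in> mob UNIV" "f = map_prod \<alpha> \<beta> \<or> f = map_prod \<alpha> \<beta> \<circ> prod.swap"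
proof -
  obtain c d F0 F1 where F: "birep c d F0 F1 (fst \<circ> f)" using global_rep[OF l(1)] .
  obtain e h E0 E1 where E: "birep e h E0 E1 (snd \<circ> f)" using global_rep[OF l(2)] .
  obtain a b A0 A1 where A: "birep a b A0 A1 (fst \<circ> g)" using global_rep[OF l(3)] .
  obtain a' b' B0 B1 where B: "birep a' b' B0 B1 (snd \<circ> g)" using global_rep[OF l(4)] .
  have c1: "(fst \<circ> g) \<circ> f = fst" "(snd \<circ> g) \<circ> f = snd" using gf by (simp_all add: comp_assoc)
  \<comment> \<open>The composite is the identity, so its components are the projections and have
    the bidegrees (1, 0) and (0, 1).\<close>
  have 1: "a * c + b * e = 1" "a * d + b * h = 0" using birep_fst_degree[OF birep_comp[OF A F E, unfolded c1]] .
  have 2: "a' * c + b' * e = 0" "a' * d + b' * h = 1" using birep_snd_degree[OF birep_comp[OF B F E, unfolded c1]] .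
  from 1(1) consider "a = 1" "c = 1" "b * e = 0" | "b = 1" "e = 1" "a * c = 0"
  proof -
    from 1(1) have "a * c = 1 \<and> b * e = 0 \<or> a * c = 0 \<and> b * e = 1" by arith
    then show ?thesis using that by (auto simp: nat_mult_eq_1_iff)
  qed
  then show ?thesis
  proof cases
    case 1
    then have "d = 0" "a' = 0" using \<open>a * d + b * h = 0\<close> 2(1) by auto
    moreover have "b' = 1" "h = 1" using 2(2) \<open>a' = 0\<close> by auto
    moreover have "e = 0" using 2(1) \<open>b' = 1\<close> by auto
    ultimately have F': "birep 1 0 F0 F1 (fst \<circ> f)" and E': "birep 0 1 E0 E1 (snd \<circ> f)" using F E 1 by auto
    obtain \<alpha> where \<alpha>: "\<alpha> \<in> mob UNIV" "\<And>p q. (fst \<circ> f) (p, q) = \<alpha> p" using birep_linear_mob[OF F'] by blast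
    obtain \<beta> where \<beta>: "\<beta> \<in> mob UNIV" "\<And>p q. (snd \<circ> f \<circ> prod.swap) (p, q) = \<beta> p"
      using birep_linear_mob[OF birep_swap[OF E']] by blast
    have "f = map_prod \<alpha> \<beta>" using \<alpha>(2) \<beta>(2) by (auto simp: fun_eq_iff prod_eq_iff)
    then show ?thesis using that \<alpha>(1) \<beta>(1) by blast
  next
    case 2
    then have "h = 0" "b' = 0" using \<open>a * d + b * h = 0\<close> \<open>a' * c + b' * e = 0\<close> by auto
    moreover have "a' = 1" "d = 1" using \<open>a' * d + b' * h = 1\<close> \<open>h = 0\<close> by auto
    moreover have "c = 0" using \<open>a' * c + b' * e = 0\<close> \<open>a' = 1\<close> by auto
    ultimately have F': "birep 0 1 F0 F1 (fst \<circ> f)" and E': "birep 1 0 E0 E1 (snd \<circ> f)" using F E 2 by auto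
    obtain \<beta> where \<beta>: "\<beta> \<in> mob UNIV" "\<And>p q. (snd \<circ> f) (p, q) = \<beta> p" using birep_linear_mob[OF E'] by blast
    obtain \<alpha> where \<alpha>: "\<alpha> \<in> mob UNIV" "\<And>p q. (fst \<circ> f \<circ> prod.swap) (p, q) = \<alpha> p"
      using birep_linear_mob[OF birep_swap[OF F']] by blast
    have "f = map_prod \<alpha> \<beta> \<circ> prod.swap" using \<alpha>(2) \<beta>(2) by (auto simp: fun_eq_iff prod_eq_iff)
    then show ?thesis using that \<alpha>(1) \<beta>(1) by blast
  qed
qed

section \<open>Forms and quadrics over a subfield\<close>

no_notation fps_nth (infixl \<open>$\<close> 75)

lemma subfld_sum: "subfld K \<Longrightarrow> (\<And>i. i \<in> A \<Longrightarrow> f i \<in> K) \<Longrightarrow> sum f A \<in> K"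
  by (induction A rule: infinite_finite_induct) (auto simp: subfldD)

lemma subfld_infinite: "subfld K \<Longrightarrow> infinite K"
proof
  assume K: "subfld K" and fin: "finite K"
  have "of_nat n \<in> K" for n by (induction n) (auto simp: subfldD[OF K])
  then have "range (of_nat :: nat \<Rightarrow> complex) \<subseteq> K" by auto
  then have "finite (range (of_nat :: nat \<Rightarrow> complex))" using fin finite_subset by blast
  then show False using finite_imageD[OF _ inj_of_nat] infinite_UNIV_nat by blast
qed

inductive hpoly :: "complex set \<Rightarrow> nat \<Rightarrow> (complex ^ 'n::finite \<Rightarrow> complex) \<Rightarrow> bool" for K where
  hpoly_const: "k \<in> K \<Longrightarrow> hpoly K 0 (\<lambda>_. k)"
| hpoly_zero: "hpoly K n (\<lambda>_. 0)"
| hpoly_coord: "hpoly K 1 (\<lambda>x. x $ i)"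
| hpoly_add: "hpoly K n f \<Longrightarrow> hpoly K n g \<Longrightarrow> hpoly K n (\<lambda>x. f x + g x)"
| hpoly_mult: "hpoly K m f \<Longrightarrow> hpoly K n g \<Longrightarrow> hpoly K (m + n) (\<lambda>x. f x * g x)"

lemma hpoly_cmult: "k \<in> K \<Longrightarrow> hpoly K n f \<Longrightarrow> hpoly K n (\<lambda>x. k * f x)"
  using hpoly_mult[OF hpoly_const, of k K n f] by simp

lemma hpoly_diff: "subfld K \<Longrightarrow> hpoly K n f \<Longrightarrow> hpoly K n g \<Longrightarrow> hpoly K n (\<lambda>x. f x - g x)"
  using hpoly_add[OF _ hpoly_cmult, of K n f "-1" g] by (simp add: subfldD)

lemma hpoly_sum: "(\<And>i. i \<in> A \<Longrightarrow> hpoly K n (f i)) \<Longrightarrow> hpoly K n (\<lambda>x. \<Sum>i\<in>A. f i x)"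
proof (induction A rule: infinite_finite_induct)
  case (insert x A)
  then show ?case using hpoly_add[of K n "f x" "\<lambda>y. \<Sum>i\<in>A. f i y"] by simp
qed (simp_all add: hpoly_zero)

lemma hpoly_power: "1 \<in> K \<Longrightarrow> hpoly K n f \<Longrightarrow> hpoly K (k * n) (\<lambda>x. f x ^ k)"
proof (induction k)
  case 0 then show ?case using hpoly_const[of 1] by simp
next
  case (Suc k) then show ?case using hpoly_mult[of K n f "k * n"] by simp
qed

lemma hpoly_prod:
  "finite A \<Longrightarrow> 1 \<in> K \<Longrightarrow> (\<And>i. i \<in> A \<Longrightarrow> hpoly K (n i) (f i)) \<Longrightarrow> hpoly K (\<Sum>i\<in>A. n i) (\<lambda>x. \<Prod>i\<in>A. f i x)"
proof (induction A rule: finite_induct)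
  case (insert x A)
  then show ?case using hpoly_mult[of K "n x" "f x"] by simp
qed (simp add: hpoly_const)

lemma finite_exponents: "finite {m :: 'n::finite \<Rightarrow> nat. (\<Sum>i\<in>UNIV. m i) = d}"
proof (rule finite_subset)
  show "{m :: 'n \<Rightarrow> nat. (\<Sum>i\<in>UNIV. m i) = d} \<subseteq> PiE UNIV (\<lambda>_. {..d})"
    by (auto simp: PiE_iff extensional_def intro: member_le_sum)
  show "finite (PiE (UNIV :: 'n set) (\<lambda>_. {..d}))" by (intro finite_PiE) auto
qed

text \<open>Replaces families of coefficients by an inductive description, so that closure
  properties follow by rule induction. In the product case the coefficient of a monomial is the sum
  over all ways to split its exponents.\<close>

lemma homog_polys_hpoly:
  assumes K: "subfld K"
  shows "f \<in> homog_polys K d \<longleftrightarrow> hpoly K d (f :: complex ^ 'n::finite \<Rightarrow> complex)"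
proof
  assume "f \<in> homog_polys K d"
  then obtain c where c: "range c \<subseteq> K" "f = (\<lambda>x. \<Sum>m | (\<Sum>i\<in>UNIV. m i) = d. c m * (\<Prod>i\<in>UNIV. x $ i ^ m i))"
    unfolding homog_polys_def by blast
  have "hpoly K d (\<lambda>x :: complex ^ 'n. c m * (\<Prod>i\<in>UNIV. x $ i ^ m i))" if "(\<Sum>i\<in>UNIV. m i) = d" for m
  proof -
    have "hpoly K (\<Sum>i\<in>UNIV. m i * 1) (\<lambda>x :: complex ^ 'n. \<Prod>i\<in>UNIV. x $ i ^ m i)"
      by (intro hpoly_prod hpoly_power hpoly_coord) (auto simp: subfldD[OF K])
    then have "hpoly K d (\<lambda>x :: complex ^ 'n. \<Prod>i\<in>UNIV. x $ i ^ m i)" using that by simp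
    then show ?thesis using c(1) by (intro hpoly_cmult) auto
  qed
  then show "hpoly K d f" unfolding c(2) by (intro hpoly_sum) auto
next
  assume "hpoly K d f"
  then show "f \<in> homog_polys K d"
  proof (induction rule: hpoly.induct)
    case (hpoly_const k)
    have "{m :: 'n \<Rightarrow> nat. (\<Sum>i\<in>UNIV. m i) = 0} = {\<lambda>_. 0}" by (auto simp: fun_eq_iff)
    then show ?case unfolding homog_polys_def mem_Collect_eq
      using hpoly_const by (intro exI[of _ "\<lambda>_. k"]) auto
  next
    case (hpoly_zero n)
    show ?case unfolding homog_polys_def mem_Collect_eq
      using subfldD[OF K] by (intro exI[of _ "\<lambda>_. 0"]) auto
  next
    case (hpoly_coord i)
    let ?e = "\<lambda>j. if j = i then 1 else 0 :: nat"
    have "(\<Sum>m | (\<Sum>i\<in>UNIV. m i) = (1::nat). (if m = ?e then 1 else 0) * (\<Prod>i\<in>UNIV. x $ i ^ m i)) = x $ i"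
      for x :: "complex ^ 'n"
    proof -
      have "(\<Sum>m | (\<Sum>i\<in>UNIV. m i) = (1::nat). (if m = ?e then 1 else 0) * (\<Prod>i\<in>UNIV. x $ i ^ m i)) =
        (\<Sum>m\<in>{?e}. (if m = ?e then 1 else 0) * (\<Prod>i\<in>UNIV. x $ i ^ m i))"
        by (rule sum.mono_neutral_right[OF finite_exponents]) auto
      also have "\<dots> = (\<Prod>j\<in>UNIV. if j = i then x $ j else 1)"
        by (simp add: if_distrib[of "\<lambda>n. _ ^ n"] cong: if_cong)
      finally show ?thesis by simp
    qed
    then show ?case unfolding homog_polys_def mem_Collect_eq
      using subfldD[OF K] by (intro exI[of _ "\<lambda>m. if m = ?e then 1 else 0"]) auto
  next
    case (hpoly_add n f g)
    then obtain c c' where c: "range c \<subseteq> K" "f = (\<lambda>x. \<Sum>m | (\<Sum>i\<in>UNIV. m i) = n. c m * (\<Prod>i\<in>UNIV. x $ i ^ m i))"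
      and c': "range c' \<subseteq> K" "g = (\<lambda>x. \<Sum>m | (\<Sum>i\<in>UNIV. m i) = n. c' m * (\<Prod>i\<in>UNIV. x $ i ^ m i))"
      unfolding homog_polys_def by blast
    show ?case unfolding homog_polys_def mem_Collect_eq c(2) c'(2)
      using c(1) c'(1) subfldD(3)[OF K]
      by (intro exI[of _ "\<lambda>m. c m + c' m"]) (auto simp: sum.distrib distrib_right)
  next
    case (hpoly_mult n f n' g)
    then obtain c c' where c: "range c \<subseteq> K" "f = (\<lambda>x. \<Sum>m | (\<Sum>i\<in>UNIV. m i) = n. c m * (\<Prod>i\<in>UNIV. x $ i ^ m i))"
      and c': "range c' \<subseteq> K" "g = (\<lambda>x. \<Sum>m | (\<Sum>i\<in>UNIV. m i) = n'. c' m * (\<Prod>i\<in>UNIV. x $ i ^ m i))"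
      unfolding homog_polys_def by blast
    define expo where "expo d = {m :: 'n \<Rightarrow> nat. (\<Sum>i\<in>UNIV. m i) = d}" for d
    have finexpo: "finite (expo d)" for d unfolding expo_def by (rule finite_exponents)
    define e where "e M = (\<Sum>p\<in>{p \<in> expo n \<times> expo n'. (\<lambda>i. fst p i + snd p i) = M}. c (fst p) * c' (snd p))" for M
    have eK: "range e \<subseteq> K" unfolding e_def using c(1) c'(1) subfldD(4)[OF K] by (auto intro!: subfld_sum[OF K])
    have "f x * g x = (\<Sum>M | (\<Sum>i\<in>UNIV. M i) = n + n'. e M * (\<Prod>i\<in>UNIV. x $ i ^ M i))" for x
    proof -
      define mn where "mn m = (\<Prod>i\<in>UNIV. x $ i ^ m i)" for m :: "'n \<Rightarrow> nat"
      have mn: "mn m * mn m' = mn (\<lambda>i. m i + m' i)" for m m' by (simp add: mn_def power_add prod.distrib)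
      have "f x * g x = (\<Sum>m\<in>expo n. c m * mn m) * (\<Sum>m\<in>expo n'. c' m * mn m)"
        unfolding c(2) c'(2) expo_def mn_def ..
      also have "\<dots> = (\<Sum>p\<in>expo n \<times> expo n'. c (fst p) * c' (snd p) * mn (\<lambda>i. fst p i + snd p i))"
        unfolding sum_product sum.cartesian_product mn[symmetric] by (intro sum.cong) (auto simp: algebra_simps)
      also have "\<dots> = (\<Sum>M\<in>expo (n + n'). \<Sum>p\<in>{p \<in> expo n \<times> expo n'. (\<lambda>i. fst p i + snd p i) = M}.
          c (fst p) * c' (snd p) * mn (\<lambda>i. fst p i + snd p i))"
        using finexpo by (intro sum.group[symmetric]) (auto simp: expo_def sum.distrib)
      also have "\<dots> = (\<Sum>M\<in>expo (n + n'). e M * mn M)"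
        unfolding e_def sum_distrib_right by (intro sum.cong refl) auto
      finally show ?thesis unfolding expo_def mn_def .
    qed
    then show ?case unfolding homog_polys_def mem_Collect_eq using eK by blast
  qed
qed

lemma hpoly_mono: "hpoly K d f \<Longrightarrow> K \<subseteq> L \<Longrightarrow> hpoly L d f"
  by (induction rule: hpoly.induct) (auto intro: hpoly.intros simp del: One_nat_def)

lemma hpoly_homog: "hpoly K d f \<Longrightarrow> f (c *s x) = c ^ d * f x"
  by (induction rule: hpoly.induct) (auto simp: algebra_simps power_add)

lemma hpoly_val:
  fixes x :: "complex ^ 'n::finite"
  assumes "subfld K" "hpoly K d f" "\<And>i. x $ i \<in> K"
  shows "f x \<in> K"
  using assms(2) by (induction rule: hpoly.induct) (use assms(1,3) in \<open>auto simp: subfldD\<close>)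

lemma hpoly_comp:
  fixes F :: "complex ^ 'n::finite \<Rightarrow> complex ^ 'm::finite"
  assumes "hpoly K d f" "\<And>i. hpoly K e (\<lambda>x. F x $ i)"
  shows "hpoly K (d * e) (\<lambda>x. f (F x))"
  using assms(1)
proof (induction rule: hpoly.induct)
  case (hpoly_mult m f n g)
  then show ?case using hpoly.hpoly_mult[OF hpoly_mult.IH] by (simp add: algebra_simps)
qed (use assms(2) in \<open>auto intro: hpoly.intros\<close>)

lemma hpoly_linear:
  fixes M :: "complex ^ 'n::finite ^ 'm::finite"
  shows "(\<And>i j. M $ i $ j \<in> K) \<Longrightarrow> hpoly K 1 (\<lambda>x. (M *v x) $ i)"
  unfolding matrix_vector_mult_def by (simp, intro hpoly_sum hpoly_cmult hpoly_coord[unfolded One_nat_def]) auto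

text \<open>The coordinates are replaced one at a time: along one coordinate \<open>f\<close> is a
  nonzero polynomial with finitely many roots, and the infinite field \<open>K\<close> contains an
  element that avoids them.\<close>

lemma hpoly_nonzero_rational:
  fixes f :: "complex ^ 'n::finite \<Rightarrow> complex"
  assumes K: "subfld K" and f: "hpoly K d f" "f v \<noteq> 0"
  obtains w where "f w \<noteq> 0" "\<And>i. w $ i \<in> K"
proof -
  have "\<exists>w. f w \<noteq> 0 \<and> (\<forall>i\<in>A. w $ i \<in> K)" for A :: "'n set"
  proof (induction A rule: infinite_finite_induct)
    case (infinite A) then show ?case by simp
  next
    case empty then show ?case using f(2) by auto
  next
    case (insert i A)
    then obtain w where w: "f w \<noteq> 0" "\<forall>i\<in>A. w $ i \<in> K" by blast
    define u where "u t = (\<chi> j. if j = i then t else w $ j)" for t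
    have "\<exists>p. \<forall>t. f (u t) = poly p t"
      using f(1)
    proof (induction rule: hpoly.induct)
      case (hpoly_const k) show ?case by (rule exI[of _ "[:k:]"]) simp
    next
      case (hpoly_zero n) show ?case by (rule exI[of _ 0]) simp
    next
      case (hpoly_coord j) show ?case
        by (rule exI[of _ "if j = i then [:0, 1:] else [:w $ j:]"]) (simp add: u_def)
    next
      case (hpoly_add n f g)
      then obtain p q where "\<forall>t. f (u t) = poly p t" "\<forall>t. g (u t) = poly q t" by blast
      then show ?case by (intro exI[of _ "p + q"]) simp
    next
      case (hpoly_mult n f n' g)
      then obtain p q where "\<forall>t. f (u t) = poly p t" "\<forall>t. g (u t) = poly q t" by blast
      then show ?case by (intro exI[of _ "p * q"]) simp
    qed
    then obtain p where p: "\<And>t. f (u t) = poly p t" by blast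
    have "u (w $ i) = w" by (simp add: u_def vec_eq_iff)
    then have "p \<noteq> 0" using p[of "w $ i"] w(1) by auto
    then have "finite {t. poly p t = 0}" by (rule poly_roots_finite)
    then obtain t where t: "t \<in> K" "poly p t \<noteq> 0"
      using subfld_infinite[OF K] by (metis (mono_tags, lifting) finite_subset mem_Collect_eq subsetI)
    then show ?case using p w(2) by (intro exI[of _ "u t"]) (auto simp: u_def)
  qed
  from this[of UNIV] show ?thesis using that by auto
qed

section \<open>Rational points of a rational surface\<close>

definition kvec :: "complex set \<Rightarrow> complex ^ 'n \<Rightarrow> bool" where
  "kvec K v \<longleftrightarrow> (\<forall>i. v $ i \<in> K)"

lemma proj_point_scale:
  assumes c: "c \<noteq> 0" shows "proj_point (c *s v) = proj_point v"
proof (intro equalityI subsetI)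
  fix x assume "x \<in> proj_point (c *s v)"
  then obtain k where "k \<noteq> 0" "x = k *s (c *s v)" unfolding proj_point_def by blast
  then have "k * c \<noteq> 0" "x = (k * c) *s v" using c by (simp_all add: vector_smult_assoc)
  then show "x \<in> proj_point v" unfolding proj_point_def by blast
next
  fix x assume "x \<in> proj_point v"
  then obtain k where "k \<noteq> 0" "x = k *s v" unfolding proj_point_def by blast
  then have "k / c \<noteq> 0" "x = (k / c) *s (c *s v)" using c by (simp_all add: vector_smult_assoc)
  then show "x \<in> proj_point (c *s v)" unfolding proj_point_def by blast
qed

lemma proj_point_self: "v \<in> proj_point v"
  unfolding proj_point_def by (auto intro!: exI[of _ 1])

lemma proj_point_eqD: "proj_point v = proj_point w \<Longrightarrow> \<exists>c. c \<noteq> 0 \<and> v = c *s w"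
  using proj_point_self[of v] unfolding proj_point_def by auto

lemma proj_pointD: "w \<in> proj_point v \<Longrightarrow> \<exists>c. c \<noteq> 0 \<and> w = c *s v"
  unfolding proj_point_def by auto

text \<open>The open subset of the plane contains a point over \<open>K\<close> because
  \<open>K\<close> is infinite, and the inverse map, being defined over \<open>K\<close>, sends it
  to a point over \<open>K\<close>.\<close>

lemma rational_has_kpoint:
  assumes K: "subfld K" and r: "rational_surface_over K Z" and Z: "Z \<subseteq> proj_space"
  obtains v where "kvec K v" "v \<noteq> 0" "proj_point v \<in> Z"
proof -
  obtain U V g where UV: "zariski_open_in K Z U" "zariski_open_in K (proj_space :: (complex ^ 3) set set) V"
    "V \<noteq> {}" and g: "regular_map K V U g"
    using r unfolding rational_surface_over_def birational_over_def by (elim exE conjE) (rule that)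
  obtain S where S: "S \<subseteq> (\<Union>d. homog_polys K d)" "V = {p \<in> proj_space. \<exists>G\<in>S. \<forall>v\<in>p. G v \<noteq> 0}"
    using UV(2) unfolding zariski_open_in_def by blast
  obtain q G where q: "q \<in> proj_space" "G \<in> S" "\<forall>v\<in>q. G v \<noteq> 0" using UV(3) S(2) by blast
  obtain u where u: "u \<noteq> 0" "q = proj_point u" using q(1) unfolding proj_space_def by blast
  obtain i where i: "u $ i \<noteq> 0" using u(1) by (metis vec_eq_iff zero_index)
  obtain d where d: "hpoly K d G" using q(2) S(1) homog_polys_hpoly[OF K] by blast
  \<comment> \<open>The additional coordinate ensures that the rational vector is nonzero even when
    \<open>G\<close> is constant.\<close>
  have "hpoly K (d + 1) (\<lambda>x. G x * x $ i)" by (rule hpoly_mult[OF d hpoly_coord])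
  moreover have "G u * u $ i \<noteq> 0" using q(3) u proj_point_self i by auto
  ultimately obtain w where w: "G w * w $ i \<noteq> 0" "\<And>i. w $ i \<in> K" using hpoly_nonzero_rational[OF K] by blast
  have w0: "w \<noteq> 0" using w(1) by auto
  have "proj_point w \<in> V"
    unfolding S(2) mem_Collect_eq
  proof
    show "proj_point w \<in> proj_space" using w0 unfolding proj_space_def by blast
    show "\<exists>G\<in>S. \<forall>v\<in>proj_point w. G v \<noteq> 0"
      using q(2) w(1) hpoly_homog[OF d] by (intro bexI[of _ G]) (auto dest!: proj_pointD)
  qed
  then have wV: "w \<in> \<Union>V" using proj_point_self by blast
  obtain e F where F: "\<forall>i. (\<lambda>x. F x $ i) \<in> homog_polys K e" "F w \<noteq> 0" "g (proj_point w) = proj_point (F w)"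
    using g wV unfolding regular_map_def by blast
  have "kvec K (F w)" unfolding kvec_def
    using hpoly_val[OF K] F(1) w(2) homog_polys_hpoly[OF K] by blast
  moreover have "proj_point (F w) \<in> U" using g \<open>proj_point w \<in> V\<close> F(3) unfolding regular_map_def by (metis PiE Pi_mem)
  then have "proj_point (F w) \<in> Z" using UV(1) unfolding zariski_open_in_def by blast
  ultimately show ?thesis using that F(2) by blast
qed

subsection \<open>Normal form of a quadric with a rational point\<close>

text \<open>The polar form Q(x + y) - Q(x) - Q(y), written with the partial derivatives so that
  smoothness turns into nondegeneracy.\<close>

definition polar :: "complex ^ 4 ^ 4 \<Rightarrow> complex ^ 4 \<Rightarrow> complex ^ 4 \<Rightarrow> complex" where
  "polar A x y = (\<Sum>k\<in>UNIV. x $ k * quad_form_partial A k y)"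

lemma polar_simps:
  "polar A (x + x') y = polar A x y + polar A x' y" "polar A (c *s x) y = c * polar A x y"
  "polar A (x - x') y = polar A x y - polar A x' y"
  by (simp_all add: polar_def sum.distrib sum_subtractf sum_distrib_left algebra_simps)

lemma polar_sym: "polar A x y = polar A y x"
  by (simp add: polar_def quad_form_partial_def sum_4 algebra_simps)

lemma polar_simps2:
  "polar A y (x + x') = polar A y x + polar A y x'" "polar A y (c *s x) = c * polar A y x"
  "polar A y (x - x') = polar A y x - polar A y x'"
  by (simp_all add: polar_sym[of A y] polar_simps)

lemma polar_self: "polar A x x = 2 * quad_form A x"
  by (simp add: polar_def quad_form_partial_def quad_form_def sum_4 algebra_simps)

lemma quad_form_add:
  fixes A :: "complex ^ 4 ^ 4"
  shows "quad_form A (x + y) = quad_form A x + quad_form A y + polar A x y"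
  by (simp add: polar_def quad_form_partial_def quad_form_def sum_4 algebra_simps)

lemma quad_form_scale:
  fixes A :: "complex ^ 4 ^ 4"
  shows "quad_form A (c *s x) = c\<^sup>2 * quad_form A x"
  by (simp add: quad_form_def sum_4 algebra_simps power2_eq_square)

lemma polar_axis: "polar A (axis k 1) y = quad_form_partial A k y"
  by (simp add: polar_def axis_def if_distrib[of "\<lambda>a. a * _"] cong: if_cong)

lemma polar_K: "subfld K \<Longrightarrow> (\<And>i j. A $ i $ j \<in> K) \<Longrightarrow> kvec K x \<Longrightarrow> kvec K y \<Longrightarrow> polar A x y \<in> K"
  unfolding polar_def quad_form_partial_def kvec_def by (intro subfld_sum) (auto intro!: subfldD subfld_sum)

lemma quad_form_K: "subfld K \<Longrightarrow> (\<And>i j. A $ i $ j \<in> K) \<Longrightarrow> kvec K x \<Longrightarrow> quad_form A x \<in> K"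
  unfolding quad_form_def kvec_def by (intro subfld_sum) (auto intro!: subfldD)

lemma kvec_simps:
  assumes "subfld K"
  shows "kvec K x \<Longrightarrow> kvec K y \<Longrightarrow> kvec K (x + y)" "kvec K x \<Longrightarrow> kvec K y \<Longrightarrow> kvec K (x - y)"
    "c \<in> K \<Longrightarrow> kvec K x \<Longrightarrow> kvec K (c *s x)" "kvec K (axis i 1)" "kvec K 0"
  using assms by (auto simp: kvec_def axis_def subfldD)

text \<open>A square matrix with a zero row has a nontrivial kernel.\<close>

lemma three_functionals:
  fixes u1 u2 u3 :: "complex ^ 4"
  obtains x where "x \<noteq> 0" "(\<Sum>k\<in>UNIV. u1 $ k * x $ k) = 0" "(\<Sum>k\<in>UNIV. u2 $ k * x $ k) = 0" "(\<Sum>k\<in>UNIV. u3 $ k * x $ k) = 0"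
proof -
  define M :: "complex ^ 4 ^ 4" where "M = (\<chi> i. if i = 1 then u1 else if i = 2 then u2 else if i = 3 then u3 else 0)"
  have r: "M $ 1 = u1" "M $ 2 = u2" "M $ 3 = u3" "M $ 4 = 0" by (simp_all add: M_def)
  have "\<not> (\<exists>B. M ** B = mat 1)"
  proof
    assume "\<exists>B. M ** B = mat 1"
    then obtain B where "M ** B = mat 1" by blast
    then have "(M ** B) $ 4 $ 4 = 1" by (simp add: mat_def)
    then show False using r(4) by (simp add: matrix_matrix_mult_def)
  qed
  then have "\<not> (\<exists>B. B ** M = mat 1)" using matrix_left_right_inverse by blast
  then obtain x where x: "M *v x = 0" "x \<noteq> 0" using matrix_left_invertible_ker[of M] by blast
  have "(M *v x) $ i = 0" for i using x(1) by simp
  from this[of 1] this[of 2] this[of 3] show ?thesis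
    using x(2) that[of x] r by (simp add: matrix_vector_mult_def)
qed

lemma vec_basis_expansion: "(x :: complex ^ 4) = (\<Sum>i\<in>UNIV. x $ i *s axis i 1)"
  by (simp add: vec_eq_iff axis_def if_distrib[of "\<lambda>a. _ * a"] cong: if_cong)

text \<open>\<open>P\<close> plays the role of an orthogonal projection over \<open>K\<close>, and
  \<open>x\<close> is a vector in its image. If the polar form vanished on all projected basis
  vectors, \<open>x\<close> would lie in the radical. A nonzero value on two of them makes the form
  nonzero on one of the two or on their sum, and these have entries in \<open>K\<close>.\<close>

lemma anisotropic_vector:
  fixes A :: "complex ^ 4 ^ 4"
  assumes K: "subfld K" and nondeg: "\<And>v. (\<And>k. quad_form_partial A k v = 0) \<Longrightarrow> v = 0"
    and P: "\<And>x y. P (x + y) = P x + P y" "\<And>c x. P (c *s x) = c *s P x" "\<And>x. kvec K x \<Longrightarrow> kvec K (P x)"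
    and x: "x \<noteq> 0" "P x = x" "\<And>u. polar A x (P u) = polar A x u"
  obtains u where "kvec K (P u)" "quad_form A (P u) \<noteq> 0"
proof -
  let ?e = "\<lambda>i. axis i 1 :: complex ^ 4"
  have "\<exists>i j. polar A (P (?e i)) (P (?e j)) \<noteq> 0"
  proof (rule ccontr)
    assume no: "\<not> ?thesis"
    have Pexp: "P x = (\<Sum>i\<in>UNIV. x $ i *s P (?e i))"
      by (subst (1) vec_basis_expansion[of x]) (simp only: sum_4 P)
    have "quad_form_partial A k x = 0" for k
    proof -
      have "quad_form_partial A k x = polar A (P x) (P (?e k))"
        using x(2) x(3)[of "?e k"] polar_axis polar_sym by metis
      also have "\<dots> = 0" using no unfolding Pexp sum_4 by (simp add: polar_simps)
      finally show ?thesis .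
    qed
    then show False using nondeg x(1) by blast
  qed
  then obtain i j where ij: "polar A (P (?e i)) (P (?e j)) \<noteq> 0" by blast
  have k: "kvec K (P (?e i))" "kvec K (P (?e j))" "kvec K (P (?e i + ?e j))"
    by (intro P(3) kvec_simps[OF K])+
  have "quad_form A (P (?e i + ?e j)) = quad_form A (P (?e i)) + quad_form A (P (?e j)) + polar A (P (?e i)) (P (?e j))"
    by (simp add: P(1) quad_form_add)
  then show ?thesis using that k ij by (metis add.right_neutral add_0)
qed

definition qcone :: "complex \<Rightarrow> complex ^ 4 \<Rightarrow> bool" where
  "qcone d x \<longleftrightarrow> x $ 1 * x $ 2 = (x $ 3)\<^sup>2 - d * (x $ 4)\<^sup>2"

definition normal_quadric :: "complex set \<Rightarrow> (complex ^ 4) set set \<Rightarrow> complex ^ 4 ^ 4 \<Rightarrow> complex ^ 4 ^ 4 \<Rightarrow> complex \<Rightarrow> bool" where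
  "normal_quadric K Z T T' d \<longleftrightarrow> (\<forall>i j. T $ i $ j \<in> K) \<and> (\<forall>i j. T' $ i $ j \<in> K) \<and> T ** T' = mat 1 \<and> T' ** T = mat 1 \<and>
     d \<in> K \<and> d \<noteq> 0 \<and> Z = {proj_point (T *v x) | x. x \<noteq> 0 \<and> qcone d x}"

text \<open>The given point \<open>p\<close> is completed to a hyperbolic plane by \<open>w\<close>,
  and the orthogonal complement of that plane is diagonalised by two anisotropic vectors
  \<open>y\<close> and \<open>z\<close>, all with entries in \<open>K\<close>.\<close>

lemma normal_form:
  assumes K: "subfld K" and A: "\<And>i j. A $ i $ j \<in> K"
    and smooth: "\<And>v. v \<noteq> 0 \<Longrightarrow> quad_form A v = 0 \<Longrightarrow> \<exists>k. quad_form_partial A k v \<noteq> 0"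
    and p: "kvec K p" "p \<noteq> 0" "quad_form A p = 0"
  obtains T T' d where "normal_quadric K (quadric A) T T' d"
proof -
  let ?e = "\<lambda>i. axis i 1 :: complex ^ 4"
  let ?B = "polar A" and ?Q = "quad_form A"
  have nondeg: "v = 0" if "\<And>k. quad_form_partial A k v = 0" for v
  proof (rule ccontr)
    assume v: "v \<noteq> 0"
    have "?B v v = 0" unfolding polar_def using that by simp
    then have "?Q v = 0" using polar_self[of A v] by simp
    then show False using smooth[OF v] that by blast
  qed
  obtain k where k: "quad_form_partial A k p \<noteq> 0" using smooth[OF p(2,3)] by blast
  define w0 where "w0 = inverse (quad_form_partial A k p) *s ?e k"
  \<comment> \<open>Subtracting a multiple of \<open>p\<close> makes the vector isotropic without
    changing its pairing with \<open>p\<close>.\<close>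
  define w where "w = w0 - ?Q w0 *s p"
  have Bpp: "?B p p = 0" using p(3) by (simp add: polar_self)
  have "?B w0 p = 1" using k by (simp add: w0_def polar_simps polar_axis)
  then have Bwp: "?B w p = 1" using Bpp by (simp add: w_def polar_simps)
  have w_alt: "w = w0 + (- ?Q w0) *s p" by (simp add: w_def vec_eq_iff)
  have Qw: "?Q w = 0"
    unfolding w_alt quad_form_add quad_form_scale polar_simps2 p(3) \<open>?B w0 p = 1\<close> by simp
  have Bpw: "?B p w = 1" using Bwp by (simp add: polar_sym)
  have Bww: "?B w w = 0" using Qw by (simp add: polar_self)
  have partK: "quad_form_partial A k p \<in> K"
    using polar_K[OF K A kvec_simps(4)[OF K] p(1), of k] by (simp add: polar_axis)
  have Kw0: "kvec K w0" unfolding w0_def using partK by (intro kvec_simps[OF K] subfldD[OF K])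
  have Kw: "kvec K w" unfolding w_def by (intro kvec_simps[OF K] quad_form_K[OF K A] Kw0 p(1))
  define P where "P x = x - ?B x w *s p - ?B x p *s w" for x
  have P: "P (x + y) = P x + P y" "P (c *s x) = c *s P x" for x y c
    by (simp_all add: P_def polar_simps vec_eq_iff algebra_simps)
  have PK: "kvec K (P x)" if "kvec K x" for x
    unfolding P_def using that Kw p(1) by (intro kvec_simps[OF K] polar_K[OF K A])
  have Pp: "?B (P x) p = 0" "?B (P x) w = 0" for x
    using Bpp Bwp Bpw Bww by (simp_all add: P_def polar_simps)
  have "\<exists>x. x \<noteq> 0 \<and> ?B x p = 0 \<and> ?B x w = 0 \<and> ?B x z = 0" for z
  proof -
    let ?f = "\<lambda>y. \<chi> k. quad_form_partial A k y"
    have "(\<Sum>k\<in>UNIV. ?f y $ k * x $ k) = ?B x y" for x y by (simp add: polar_def mult.commute)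
    then show ?thesis using three_functionals[of "?f p" "?f w" "?f z"] by metis
  qed
  note ker = this
  obtain x where x: "x \<noteq> 0" "?B x p = 0" "?B x w = 0" using ker by blast
  have "P x = x" using x by (simp add: P_def)
  moreover have "?B x (P u) = ?B x u" for u using x by (simp add: P_def polar_simps2)
  ultimately obtain u where u: "kvec K (P u)" "?Q (P u) \<noteq> 0"
    using anisotropic_vector[OF K nondeg P PK x(1)] by blast
  define y where "y = P u"
  have y: "kvec K y" "?Q y \<noteq> 0" "?B y p = 0" "?B y w = 0" using u Pp by (auto simp: y_def)
  define q where "q = 2 * ?Q y"
  have q: "?B y y = q" "q \<noteq> 0" "q \<in> K" using y quad_form_K[OF K A y(1)] by (auto simp: q_def polar_self subfldD[OF K])
  define P' where "P' x = P x - (?B (P x) y / q) *s y" for x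
  have P': "P' (x + y) = P' x + P' y" "P' (c *s x) = c *s P' x" for x y c
    by (simp_all add: P'_def P polar_simps vec_eq_iff algebra_simps add_divide_distrib)
  have PK': "kvec K (P' x)" if "kvec K x" for x
    unfolding P'_def using PK[OF that] y(1) q(3) by (intro kvec_simps[OF K] subfldD(8)[OF K] polar_K[OF K A])
  have Pp': "?B (P' x) p = 0" "?B (P' x) w = 0" "?B (P' x) y = 0" for x
    using Pp y q by (simp_all add: P'_def polar_simps)
  obtain x' where x': "x' \<noteq> 0" "?B x' p = 0" "?B x' w = 0" "?B x' y = 0" using ker by blast
  have "P' x' = x'" using x' by (simp add: P'_def P_def)
  moreover have "?B x' (P' u) = ?B x' u" for u using x' by (simp add: P'_def P_def polar_simps2)
  ultimately obtain u' where u': "kvec K (P' u')" "?Q (P' u') \<noteq> 0"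
    using anisotropic_vector[OF K nondeg P' PK' x'(1)] by blast
  define z where "z = P' u'"
  have z: "kvec K z" "?Q z \<noteq> 0" "?B z p = 0" "?B z w = 0" "?B z y = 0" using u' Pp' by (auto simp: z_def)
  have sy: "?B p y = 0" "?B w y = 0" "?B p z = 0" "?B w z = 0" "?B y z = 0"
    using y z by (simp_all add: polar_sym[of A p] polar_sym[of A w] polar_sym[of A y z])
  \<comment> \<open>Scaling \<open>p\<close> by -Q(y) turns the whole form into a multiple of x1 x2
    - x3^2 + d x4^2, with d = -Q(z)/Q(y).\<close>
  define c where "c = - ?Q y"
  define d where "d = ?Q z / c"
  have c: "c \<noteq> 0" "c \<in> K" using y quad_form_K[OF K A y(1)] by (auto simp: c_def subfldD[OF K])
  have d: "d \<noteq> 0" "d \<in> K" using z c quad_form_K[OF K A z(1)] by (auto simp: d_def subfldD[OF K])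
  define T :: "complex ^ 4 ^ 4" where "T = (\<chi> i j. if j = 1 then c * p $ i else if j = 2 then w $ i else if j = 3 then y $ i else z $ i)"
  have Tv: "T *v x = (x $ 1 * c) *s p + x $ 2 *s w + x $ 3 *s y + x $ 4 *s z" for x
    by (simp add: vec_eq_iff matrix_vector_mult_def sum_4 T_def algebra_simps)
  define qz where "qz = 2 * ?Q z"
  \<comment> \<open>Coordinates are read off by pairing with the dual basis: \<open>w\<close>
    detects \<open>p\<close> and conversely, while \<open>y\<close> and \<open>z\<close> detect
    themselves.\<close>
  define T' :: "complex ^ 4 ^ 4" where "T' = (\<chi> i j. if i = 1 then ?B (?e j) w / c else if i = 2 then ?B (?e j) p
     else if i = 3 then ?B (?e j) y / q else ?B (?e j) z / qz)"
  have Be: "(\<Sum>j\<in>UNIV. ?B (?e j) v * x $ j) = ?B x v" for x v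
    unfolding polar_axis by (simp add: polar_def mult.commute)
  have T'v: "(T' *v x) $ 1 = ?B x w / c" "(T' *v x) $ 2 = ?B x p" "(T' *v x) $ 3 = ?B x y / q" "(T' *v x) $ 4 = ?B x z / qz" for x
    by (simp_all add: matrix_vector_mult_def T'_def sum_divide_distrib[symmetric] Be)
  have qz: "?B z z = qz" "qz \<noteq> 0" "qz \<in> K" using z quad_form_K[OF K A z(1)] by (auto simp: qz_def polar_self subfldD[OF K])
  have TT: "T' *v (T *v x) = x" for x
    unfolding vec_eq_iff forall_4 T'v Tv
    using Bpp Bww Bpw Bwp y z sy q qz c by (simp add: polar_simps)
  have "T' ** T = mat 1"
    by (rule matrix_eq[THEN iffD2]) (simp add: TT matrix_vector_mul_assoc[symmetric])
  then have inv: "T' ** T = mat 1" "T ** T' = mat 1" using matrix_left_right_inverse by blast+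
  have TK: "T $ i $ j \<in> K" for i j
    using p(1) Kw y(1) z(1) c by (auto simp: T_def kvec_def intro!: subfldD(4)[OF K])
  have "?B (?e j) v \<in> K" if "kvec K v" for j v using that by (intro polar_K[OF K A] kvec_simps[OF K])
  then have TK': "T' $ i $ j \<in> K" for i j
    using p(1) Kw y(1) z(1) c q qz by (auto simp: T'_def intro!: subfldD(8)[OF K])
  have QT: "?Q (T *v x) = c * (x $ 1 * x $ 2 - ((x $ 3)\<^sup>2 - d * (x $ 4)\<^sup>2))" for x
  proof -
    have "?Q (T *v x) = x $ 1 * c * x $ 2 + (x $ 3)\<^sup>2 * ?Q y + (x $ 4)\<^sup>2 * ?Q z"
      unfolding Tv using p(3) Qw Bpw sy by (simp add: quad_form_add quad_form_scale polar_simps polar_simps2)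
    moreover have "?Q z = d * c" using c by (simp add: d_def)
    ultimately show ?thesis by (simp add: c_def algebra_simps)
  qed
  have "quadric A = {proj_point (T *v x) | x. x \<noteq> 0 \<and> qcone d x}"
  proof (rule Set.set_eqI)
    fix r
    have "(\<exists>v. r = proj_point v \<and> v \<noteq> 0 \<and> ?Q v = 0) \<longleftrightarrow> (\<exists>x. r = proj_point (T *v x) \<and> x \<noteq> 0 \<and> qcone d x)"
    proof
      assume "\<exists>v. r = proj_point v \<and> v \<noteq> 0 \<and> ?Q v = 0"
      then obtain v where v: "r = proj_point v" "v \<noteq> 0" "?Q v = 0" by blast
      have Tv': "T *v (T' *v v) = v" using inv(2) by (simp add: matrix_vector_mul_assoc)
      then have "T' *v v \<noteq> 0" "qcone d (T' *v v)" using v QT[of "T' *v v"] c by (auto simp: qcone_def)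
      then show "\<exists>x. r = proj_point (T *v x) \<and> x \<noteq> 0 \<and> qcone d x" using Tv' v(1) by metis
    next
      assume "\<exists>x. r = proj_point (T *v x) \<and> x \<noteq> 0 \<and> qcone d x"
      then obtain x where x: "r = proj_point (T *v x)" "x \<noteq> 0" "qcone d x" by blast
      have "T *v x \<noteq> 0" using TT[of x] x(2) by auto
      then show "\<exists>v. r = proj_point v \<and> v \<noteq> 0 \<and> ?Q v = 0" using x QT[of x] by (auto simp: qcone_def)
    qed
    then show "r \<in> quadric A \<longleftrightarrow> r \<in> {proj_point (T *v x) | x. x \<noteq> 0 \<and> qcone d x}"
      unfolding quadric_def by blast
  qed
  then have "normal_quadric K (quadric A) T T' d" unfolding normal_quadric_def using TK TK' inv d by blast
  then show ?thesis by (rule that)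
qed

lemma smooth_rational_normal_form:
  assumes K: "subfld K" and s: "smooth_quadric_surface K Z" and r: "rational_surface_over K Z"
  obtains T T' d where "normal_quadric K Z T T' d"
proof -
  obtain A where A: "\<And>i j. A $ i $ j \<in> K" "Z = quadric A"
    "\<And>v. v \<noteq> 0 \<Longrightarrow> quad_form A v = 0 \<Longrightarrow> \<exists>k. quad_form_partial A k v \<noteq> 0"
    using s unfolding smooth_quadric_surface_def by blast
  have "Z \<subseteq> proj_space" unfolding A(2) quadric_def proj_space_def by blast
  then obtain v where v: "kvec K v" "v \<noteq> 0" "proj_point v \<in> Z" using rational_has_kpoint[OF K r] by blast
  then obtain u where u: "proj_point v = proj_point u" "quad_form A u = 0" unfolding A(2) quadric_def by blast
  then obtain c where "v = c *s u" using proj_point_eqD by blast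
  then have "quad_form A v = 0" using u(2) by (simp add: quad_form_scale)
  then show ?thesis using normal_form[OF K A(1,3) v(1,2)] that A(2) by blast
qed

section \<open>Automorphisms of a quadric in normal form\<close>

lemma group_of_fgrp:
  assumes cl: "\<And>x y. x \<in> carrier M \<Longrightarrow> y \<in> carrier M \<Longrightarrow> x \<otimes>\<^bsub>M\<^esub> y \<in> carrier M"
    and hom: "\<And>x y. x \<in> carrier M \<Longrightarrow> y \<in> carrier M \<Longrightarrow> \<phi> (x \<otimes>\<^bsub>M\<^esub> y) = \<phi> x \<circ> \<phi> y"
    and one: "\<one>\<^bsub>M\<^esub> \<in> carrier M" "\<phi> \<one>\<^bsub>M\<^esub> = id"
    and inj: "inj_on \<phi> (carrier M)" and F: "fgrp (\<phi> ` carrier M)"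
  shows "group M"
proof (rule groupI)
  note i = inj_onD[OF inj]
  show "x \<otimes>\<^bsub>M\<^esub> y \<in> carrier M" if "x \<in> carrier M" "y \<in> carrier M" for x y using cl that .
  show "\<one>\<^bsub>M\<^esub> \<in> carrier M" by (rule one(1))
  show "x \<otimes>\<^bsub>M\<^esub> y \<otimes>\<^bsub>M\<^esub> z = x \<otimes>\<^bsub>M\<^esub> (y \<otimes>\<^bsub>M\<^esub> z)"
    if "x \<in> carrier M" "y \<in> carrier M" "z \<in> carrier M" for x y z
    by (rule i) (use that cl hom in \<open>simp_all add: comp_assoc\<close>)
  show "\<one>\<^bsub>M\<^esub> \<otimes>\<^bsub>M\<^esub> x = x" if "x \<in> carrier M" for x
    by (rule i) (use that cl hom one in simp_all)
  fix x assume x: "x \<in> carrier M"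
  then obtain y where y: "y \<in> carrier M" "finv (\<phi> x) = \<phi> y" using fgrp_inv[OF F, of "\<phi> x"] by auto
  have "\<phi> (y \<otimes>\<^bsub>M\<^esub> x) = \<phi> \<one>\<^bsub>M\<^esub>"
    using hom[OF y(1) x] y(2)[symmetric] fgrpD(4)[OF F, of "\<phi> x"] x one(2) by (simp add: inv_o_bij)
  then have "y \<otimes>\<^bsub>M\<^esub> x = \<one>\<^bsub>M\<^esub>" using i[OF _ cl[OF y(1) x] one(1)] by blast
  then show "\<exists>y\<in>carrier M. y \<otimes>\<^bsub>M\<^esub> x = \<one>\<^bsub>M\<^esub>" using y(1) by blast
qed

text \<open>An injective homomorphism into bijections carries normal abelian subgroups in both
  directions, and Lagrange's theorem turns the numbers of cosets in \<open>jordan_finite\<close>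
  into the orders compared by \<open>jordan_le\<close>.\<close>

lemma jordan_finite_transfer:
  assumes cl: "\<And>x y. x \<in> carrier M \<Longrightarrow> y \<in> carrier M \<Longrightarrow> x \<otimes>\<^bsub>M\<^esub> y \<in> carrier M"
    and hom: "\<And>x y. x \<in> carrier M \<Longrightarrow> y \<in> carrier M \<Longrightarrow> \<phi> (x \<otimes>\<^bsub>M\<^esub> y) = \<phi> x \<circ> \<phi> y"
    and one: "\<one>\<^bsub>M\<^esub> \<in> carrier M" "\<phi> \<one>\<^bsub>M\<^esub> = id"
    and inj: "inj_on \<phi> (carrier M)" and F: "fgrp (\<phi> ` carrier M)"
  shows "jordan_le (\<phi> ` carrier M) k \<Longrightarrow> jordan_finite M \<le> k"
    "(\<And>N. normal_abelian (\<phi> ` carrier M) N \<Longrightarrow> k * card N \<le> card (\<phi> ` carrier M)) \<Longrightarrow> k \<le> jordan_finite M"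
proof -
  interpret group M by (rule group_of_fgrp[of M \<phi>, OF cl hom one inj F])
  have cardM: "card (\<phi> ` carrier M) = Coset.order M" using card_image[OF inj] by (simp add: Coset.order_def)
  have finM: "finite (carrier M)" using fgrpD(1)[OF F] inj finite_imageD by blast
  have phi_inv: "\<phi> (inv\<^bsub>M\<^esub> x) = finv (\<phi> x)" if x: "x \<in> carrier M" for x
  proof -
    have b: "bij (\<phi> x)" using fgrpD(4)[OF F] x by blast
    have "\<phi> (inv\<^bsub>M\<^esub> x) \<circ> \<phi> x = id" "\<phi> x \<circ> \<phi> (inv\<^bsub>M\<^esub> x) = id"
      using hom[of "inv\<^bsub>M\<^esub> x" x] hom[of x "inv\<^bsub>M\<^esub> x"] x one(2) by simp_all
    then show ?thesis by (intro inv_unique_comp[symmetric])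
  qed
  show "jordan_finite M \<le> k" if J: "jordan_le (\<phi> ` carrier M) k"
  proof -
    obtain N' where N': "normal_abelian (\<phi> ` carrier M) N'" "card (\<phi> ` carrier M) \<le> k * card N'"
      using J unfolding jordan_le_def by blast
    note D = normal_abelianD[OF N'(1)]
    define N where "N = {x\<in>carrier M. \<phi> x \<in> N'}"
    have N'im: "\<phi> ` N = N'" using D(1) by (auto simp: N_def)
    have "inj_on \<phi> N" using inj by (rule inj_on_subset) (auto simp: N_def)
    then have cardN: "card N = card N'" using card_image N'im by metis
    have FN': "fgrp N'" by (rule normal_abelian_fgrp[OF F N'(1)])
    have sub: "subgroup N M"
    proof (rule subgroupI)
      show "N \<subseteq> carrier M" by (auto simp: N_def)
      show "N \<noteq> {}" using one D(2) by (auto simp: N_def)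
      show "inv\<^bsub>M\<^esub> a \<in> N" if "a \<in> N" for a
        using that fgrp_inv[OF FN'] phi_inv by (auto simp: N_def)
      show "a \<otimes>\<^bsub>M\<^esub> b \<in> N" if "a \<in> N" "b \<in> N" for a b
        using that D(3) hom by (auto simp: N_def)
    qed
    have nrm: "N \<lhd> M"
      unfolding normal_inv_iff
    proof (intro conjI ballI sub)
      fix x h assume "x \<in> carrier M" "h \<in> N"
      then show "x \<otimes>\<^bsub>M\<^esub> h \<otimes>\<^bsub>M\<^esub> inv\<^bsub>M\<^esub> x \<in> N"
        using D(5)[of "\<phi> x" "\<phi> h"] hom phi_inv by (auto simp: N_def)
    qed
    have "comm_group (M\<lparr>carrier := N\<rparr>)"
    proof (rule group.group_comm_groupI)
      show "group (M\<lparr>carrier := N\<rparr>)" by (rule subgroup.subgroup_is_group[OF sub is_group])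
      fix x y assume "x \<in> carrier (M\<lparr>carrier := N\<rparr>)" "y \<in> carrier (M\<lparr>carrier := N\<rparr>)"
      then have xy: "x \<in> carrier M" "y \<in> carrier M" "\<phi> x \<in> N'" "\<phi> y \<in> N'" by (auto simp: N_def)
      have "\<phi> (x \<otimes>\<^bsub>M\<^esub> y) = \<phi> (y \<otimes>\<^bsub>M\<^esub> x)" using D(4)[OF xy(3,4)] hom xy by simp
      then show "x \<otimes>\<^bsub>M\<lparr>carrier := N\<rparr>\<^esub> y = y \<otimes>\<^bsub>M\<lparr>carrier := N\<rparr>\<^esub> x"
        using inj_onD[OF inj] xy by simp
    qed
    then have "jordan_finite M \<le> card (rcosets\<^bsub>M\<^esub> N)"
      unfolding jordan_finite_def using nrm by (intro Least_le) blast
    moreover have "card (rcosets\<^bsub>M\<^esub> N) * card N = Coset.order M" by (rule lagrange[OF sub])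
    then have "card (rcosets\<^bsub>M\<^esub> N) * card N' \<le> k * card N'" using N'(2) cardM cardN by simp
    moreover have "card N' > 0" using fgrpD[OF FN'] by (auto simp: card_gt_0_iff)
    ultimately show ?thesis by simp
  qed
  show "k \<le> jordan_finite M"
    if lo: "\<And>N. normal_abelian (\<phi> ` carrier M) N \<Longrightarrow> k * card N \<le> card (\<phi> ` carrier M)"
  proof -
    let ?P = "\<lambda>n. \<exists>N. normal N M \<and> comm_group (M\<lparr>carrier := N\<rparr>) \<and> n = card (rcosets\<^bsub>M\<^esub> N)"
    have "comm_group (M\<lparr>carrier := {\<one>\<^bsub>M\<^esub>}\<rparr>)"
      by (rule group.group_comm_groupI[OF subgroup.subgroup_is_group[OF triv_subgroup is_group]]) auto
    then have "?P (card (rcosets\<^bsub>M\<^esub> {\<one>\<^bsub>M\<^esub>}))" using one_is_normal by blast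
    then have "?P (jordan_finite M)" unfolding jordan_finite_def by (rule LeastI)
    then obtain N where N: "N \<lhd> M" "comm_group (M\<lparr>carrier := N\<rparr>)" "jordan_finite M = card (rcosets\<^bsub>M\<^esub> N)" by blast
    interpret N: normal N M by (rule N(1))
    interpret C: comm_group "M\<lparr>carrier := N\<rparr>" by (rule N(2))
    have Nsub: "N \<subseteq> carrier M" by (rule N.subset)
    have "normal_abelian (\<phi> ` carrier M) (\<phi> ` N)"
      unfolding normal_abelian_def
    proof (intro conjI ballI)
      show "\<phi> ` N \<subseteq> \<phi> ` carrier M" using Nsub by blast
      show "id \<in> \<phi> ` N" using one(2) N.one_closed by (metis imageI)
      fix f g assume "f \<in> \<phi> ` N" "g \<in> \<phi> ` N"
      then obtain x y where xy: "x \<in> N" "y \<in> N" "f = \<phi> x" "g = \<phi> y" by blast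
      have xy': "x \<in> carrier M" "y \<in> carrier M" using xy Nsub by auto
      have h: "f \<circ> g = \<phi> (x \<otimes>\<^bsub>M\<^esub> y)" "g \<circ> f = \<phi> (y \<otimes>\<^bsub>M\<^esub> x)" using hom xy' xy by simp_all
      show "f \<circ> g \<in> \<phi> ` N" unfolding h using N.m_closed[OF xy(1,2)] by blast
      show "f \<circ> g = g \<circ> f" unfolding h using C.m_comm[of x y] xy by simp
    next
      fix g n assume "g \<in> \<phi> ` carrier M" "n \<in> \<phi> ` N"
      then obtain x y where xy: "x \<in> carrier M" "y \<in> N" "g = \<phi> x" "n = \<phi> y" by blast
      have "y \<in> carrier M" using xy Nsub by auto
      then have "g \<circ> n \<circ> finv g = \<phi> (x \<otimes>\<^bsub>M\<^esub> y \<otimes>\<^bsub>M\<^esub> inv\<^bsub>M\<^esub> x)"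
        using hom xy phi_inv by simp
      then show "g \<circ> n \<circ> finv g \<in> \<phi> ` N" using N.inv_op_closed2[OF xy(1,2)] by blast
    qed
    from lo[OF this] have "k * card (\<phi> ` N) \<le> Coset.order M" unfolding cardM .
    moreover have "card (\<phi> ` N) = card N" using inj_on_subset[OF inj Nsub] card_image by blast
    moreover have "card (rcosets\<^bsub>M\<^esub> N) * card N = Coset.order M" by (rule lagrange[OF N.subgroup_axioms])
    moreover have "N \<noteq> {}" using N.one_closed by blast
    then have "card N > 0" using finite_subset[OF Nsub finM] by (simp add: card_gt_0_iff)
    ultimately show ?thesis unfolding N(3) by (metis mult_le_cancel2)
  qed
qed

section \<open>A quadric in normal form and its Segre parametrisation\<close>

lemma regular_map_mono:
  fixes U :: "(complex ^ 'n::finite) set set" and V :: "(complex ^ 'm::finite) set set"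
  assumes "subfld K" "subfld L" "K \<subseteq> L" "regular_map K U V f"
  shows "regular_map L U V f"
proof -
  have sub: "homog_polys K e \<subseteq> (homog_polys L e :: (complex ^ 'n \<Rightarrow> complex) set)" for e
    using homog_polys_hpoly[OF assms(1)] homog_polys_hpoly[OF assms(2)] hpoly_mono[OF _ assms(3)] by blast
  show ?thesis
    unfolding regular_map_def
  proof (intro conjI ballI)
    show "f \<in> U \<rightarrow> V" using assms(4) unfolding regular_map_def by blast
    fix v assume "v \<in> \<Union>U"
    then obtain e F where F: "\<forall>i. (\<lambda>x. F x $ i) \<in> homog_polys K e" "F v \<noteq> 0"
      "\<forall>w\<in>\<Union>U. F w \<noteq> 0 \<longrightarrow> f (proj_point w) = proj_point (F w)"
      using assms(4) unfolding regular_map_def by blast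
    then have "\<forall>i. (\<lambda>x. F x $ i) \<in> homog_polys L e" using sub by blast
    then show "\<exists>e F. (\<forall>i. (\<lambda>x. F x $ i) \<in> homog_polys L e) \<and> F v \<noteq> 0 \<and>
        (\<forall>w\<in>\<Union>U. F w \<noteq> 0 \<longrightarrow> f (proj_point w) = proj_point (F w))"
      using F(2,3) by blast
  qed
qed

text \<open>\<open>T\<close> carries the normal coordinates to the given ones.
  \<open>\<delta>\<close> is a complex square root that may lie outside \<open>K\<close>, so the
  rulings need not be defined over \<open>K\<close>.\<close>

locale normalized_quadric =
  fixes K :: "complex set" and Z :: "(complex ^ 4) set set" and T T' :: "complex ^ 4 ^ 4" and d \<delta> :: complex
  assumes K: "subfld K" and N: "normal_quadric K Z T T' d" and \<delta>: "\<delta>\<^sup>2 = d"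
begin

lemma TK: "T $ i $ j \<in> K" "T' $ i $ j \<in> K" "d \<in> K" "d \<noteq> 0"
  using N unfolding normal_quadric_def by auto

lemma TT: "T *v (T' *v x) = x" "T' *v (T *v x) = x"
  using N unfolding normal_quadric_def by (auto simp: matrix_vector_mul_assoc)

lemma Z: "Z = {proj_point (T *v x) | x. x \<noteq> 0 \<and> qcone d x}"
  using N unfolding normal_quadric_def by auto

lemma \<delta>0: "\<delta> \<noteq> 0" using TK(4) \<delta> by auto

lemma T_scale: "T *v (c *s x) = c *s (T *v x)"
  by (simp add: matrix_vector_mult_def vec_eq_iff sum_distrib_left algebra_simps)

lemma T_eq: "T *v x = T *v y \<longleftrightarrow> x = y" "T' *v x = T' *v y \<longleftrightarrow> x = y" "T *v x = 0 \<longleftrightarrow> x = 0" "T' *v x = 0 \<longleftrightarrow> x = 0"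
  using TT matrix_vector_mult_0_right by metis+

lemma qcone_scale: "qcone d x \<Longrightarrow> qcone d (c *s x)"
proof -
  assume x: "qcone d x"
  have "(c * x $ 1) * (c * x $ 2) - ((c * x $ 3)\<^sup>2 - d * (c * x $ 4)\<^sup>2) =
    c\<^sup>2 * (x $ 1 * x $ 2 - ((x $ 3)\<^sup>2 - d * (x $ 4)\<^sup>2))" by Groebner_Basis.algebra
  then show "qcone d (c *s x)" using x unfolding qcone_def by simp
qed

lemma UZ: "w \<in> \<Union>Z \<longleftrightarrow> (\<exists>x. w = T *v x \<and> x \<noteq> 0 \<and> qcone d x)"
proof
  assume "w \<in> \<Union>Z"
  then obtain x where x: "w \<in> proj_point (T *v x)" "x \<noteq> 0" "qcone d x" unfolding Z by blast
  then obtain c where "c \<noteq> 0" "w = c *s (T *v x)" using proj_pointD by blast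
  then show "\<exists>x. w = T *v x \<and> x \<noteq> 0 \<and> qcone d x"
    using x T_scale qcone_scale by (intro exI[of _ "c *s x"]) auto
next
  assume "\<exists>x. w = T *v x \<and> x \<noteq> 0 \<and> qcone d x"
  then show "w \<in> \<Union>Z" unfolding Z using proj_point_self by blast
qed

text \<open>As \<open>x\<^sub>3\<^sup>2 - d x\<^sub>4\<^sup>2 = (x\<^sub>3 + \<delta> x\<^sub>4) (x\<^sub>3 - \<delta> x\<^sub>4)\<close>, the cone is parametrised by the Segre map \<open>sv\<close>; its two
  rulings are \<open>lf\<close> and \<open>rt\<close>.\<close>

definition sv :: "complex \<Rightarrow> complex \<Rightarrow> complex \<Rightarrow> complex \<Rightarrow> complex ^ 4" where
  "sv s0 s1 t0 t1 = (\<chi> i. if i = 1 then s0 * t0 else if i = 2 then s1 * t1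
     else if i = 3 then (s0 * t1 + s1 * t0) / 2 else (s0 * t1 - s1 * t0) / (2 * \<delta>))"

lemma sv_nth [simp]: "sv s0 s1 t0 t1 $ 1 = s0 * t0" "sv s0 s1 t0 t1 $ 2 = s1 * t1"
  "sv s0 s1 t0 t1 $ 3 = (s0 * t1 + s1 * t0) / 2" "sv s0 s1 t0 t1 $ 4 = (s0 * t1 - s1 * t0) / (2 * \<delta>)"
  by (simp_all add: sv_def)

lemma sv_off [simp]: "(s0 * t1 + s1 * t0) / 2 + \<delta> * ((s0 * t1 - s1 * t0) / (2 * \<delta>)) = s0 * t1"
  "(s0 * t1 + s1 * t0) / 2 - \<delta> * ((s0 * t1 - s1 * t0) / (2 * \<delta>)) = s1 * t0"
  using \<delta>0 by (simp_all add: field_simps)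

definition lf :: "complex ^ 4 \<Rightarrow> cp1" where
  "lf x = (if x $ 1 \<noteq> 0 \<or> x $ 3 - \<delta> * x $ 4 \<noteq> 0 then pt (x $ 1) (x $ 3 - \<delta> * x $ 4) else pt (x $ 3 + \<delta> * x $ 4) (x $ 2))"

definition rt :: "complex ^ 4 \<Rightarrow> cp1" where
  "rt x = (if x $ 1 \<noteq> 0 \<or> x $ 3 + \<delta> * x $ 4 \<noteq> 0 then pt (x $ 1) (x $ 3 + \<delta> * x $ 4) else pt (x $ 3 - \<delta> * x $ 4) (x $ 2))"

lemma qcone_iff: "qcone d x \<longleftrightarrow> x $ 1 * x $ 2 = (x $ 3 + \<delta> * x $ 4) * (x $ 3 - \<delta> * x $ 4)"
  unfolding qcone_def \<delta>[symmetric] by (simp add: algebra_simps power2_eq_square)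

lemma qcone_sv: "qcone d (sv s0 s1 t0 t1)"
  unfolding qcone_iff sv_nth sv_off by (simp add: mult_ac)

lemma sv_nonzero: "s0 \<noteq> 0 \<or> s1 \<noteq> 0 \<Longrightarrow> t0 \<noteq> 0 \<or> t1 \<noteq> 0 \<Longrightarrow> sv s0 s1 t0 t1 \<noteq> 0"
proof
  assume nz: "s0 \<noteq> 0 \<or> s1 \<noteq> 0" "t0 \<noteq> 0 \<or> t1 \<noteq> 0" and z: "sv s0 s1 t0 t1 = 0"
  have "s0 * t1 = sv s0 s1 t0 t1 $ 3 + \<delta> * sv s0 s1 t0 t1 $ 4" "s1 * t0 = sv s0 s1 t0 t1 $ 3 - \<delta> * sv s0 s1 t0 t1 $ 4"
    "s0 * t0 = sv s0 s1 t0 t1 $ 1" "s1 * t1 = sv s0 s1 t0 t1 $ 2"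
    by (simp_all only: sv_nth sv_off)
  then have "s0 * t0 = 0" "s1 * t1 = 0" "s0 * t1 = 0" "s1 * t0 = 0" unfolding z by simp_all
  then show False using nz by auto
qed

lemma lf_rt_sv:
  assumes "s0 \<noteq> 0 \<or> s1 \<noteq> 0" "t0 \<noteq> 0 \<or> t1 \<noteq> 0"
  shows "lf (sv s0 s1 t0 t1) = pt s0 s1" "rt (sv s0 s1 t0 t1) = pt t0 t1"
  using assms unfolding lf_def rt_def sv_nth sv_off by (auto simp: pt_def)

lemma vec4_eqI: "x $ 1 = y $ 1 \<Longrightarrow> x $ 2 = y $ 2 \<Longrightarrow> x $ 3 = y $ 3 \<Longrightarrow> x $ 4 = y $ 4 \<Longrightarrow> (x :: complex ^ 4) = y"
  by (simp add: vec_eq_iff forall_4)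

lemma sv_ex:
  assumes "qcone d x" "x \<noteq> 0"
  obtains s0 s1 t0 t1 where "s0 \<noteq> 0 \<or> s1 \<noteq> 0" "t0 \<noteq> 0 \<or> t1 \<noteq> 0" "x = sv s0 s1 t0 t1"
proof -
  define u v where "u = x $ 3 + \<delta> * x $ 4" and "v = x $ 3 - \<delta> * x $ 4"
  have x34: "x $ 3 = (u + v) / 2" "x $ 4 = (u - v) / (2 * \<delta>)" using \<delta>0 by (simp_all add: u_def v_def field_simps)
  have c: "x $ 1 * x $ 2 = u * v" using assms(1) unfolding qcone_iff u_def v_def .
  consider "x $ 1 \<noteq> 0" | "x $ 1 = 0" "v \<noteq> 0" | "x $ 1 = 0" "v = 0" by blast
  then show ?thesis
  proof cases
    case 1
    have "x = sv (x $ 1) v 1 (u / x $ 1)"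
      using 1 c by (intro vec4_eqI) (simp_all add: x34 field_simps)
    then show ?thesis using 1 that[of "x $ 1" v 1 "u / x $ 1"] by simp
  next
    case 2
    then have "u = 0" using c by simp
    then have "x = sv 0 1 v (x $ 2)"
      using 2 by (intro vec4_eqI) (simp_all add: x34)
    then show ?thesis using 2 that[of 0 1 v "x $ 2"] by simp
  next
    case 3
    have e: "x = sv u (x $ 2) 0 1" using 3 by (intro vec4_eqI) (simp_all add: x34)
    have "u \<noteq> 0 \<or> x $ 2 \<noteq> 0"
    proof (rule ccontr)
      assume "\<not> ?thesis"
      then have "x = 0" using 3 x34 by (intro vec4_eqI) simp_all
      then show False using assms(2) by simp
    qed
    then show ?thesis using e that[of u "x $ 2" 0 1] by simp
  qed
qed

lemma sv_scale: "sv (k * a) (k * b) (l * c) (l * e) = (k * l) *s sv a b c e"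
  by (intro vec4_eqI) (simp_all add: algebra_simps add_divide_distrib diff_divide_distrib)

definition rp :: "cp1 \<Rightarrow> complex \<times> complex" where
  "rp p = (case p of None \<Rightarrow> (1, 0) | Some t \<Rightarrow> (t, 1))"

lemma rp_pt: "a \<noteq> 0 \<or> b \<noteq> 0 \<Longrightarrow> \<exists>k. k \<noteq> 0 \<and> rp (pt a b) = (k * a, k * b)"
  by (cases "b = 0") (auto simp: rp_def pt_def intro: exI[of _ "1 / a"] exI[of _ "1 / b"])

text \<open>The Segre bijection onto \<open>Z\<close>, written with chosen coordinates;
  \<open>Sg_pt\<close> frees it from the choice.\<close>

definition Sg :: "cp1 \<times> cp1 \<Rightarrow> (complex ^ 4) set" where
  "Sg pq = proj_point (T *v sv (fst (rp (fst pq))) (snd (rp (fst pq))) (fst (rp (snd pq))) (snd (rp (snd pq))))"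

lemma Sg_pt:
  assumes "s0 \<noteq> 0 \<or> s1 \<noteq> 0" "t0 \<noteq> 0 \<or> t1 \<noteq> 0"
  shows "Sg (pt s0 s1, pt t0 t1) = proj_point (T *v sv s0 s1 t0 t1)"
proof -
  obtain k where "k \<noteq> 0" "rp (pt s0 s1) = (k * s0, k * s1)" using rp_pt[OF assms(1)] by blast
  moreover obtain l where "l \<noteq> 0" "rp (pt t0 t1) = (l * t0, l * t1)" using rp_pt[OF assms(2)] by blast
  ultimately show ?thesis by (simp add: Sg_def sv_scale T_scale proj_point_scale)
qed

lemma Sg_lf_rt: "qcone d x \<Longrightarrow> x \<noteq> 0 \<Longrightarrow> Sg (lf x, rt x) = proj_point (T *v x)"
  by (erule (1) sv_ex) (simp add: lf_rt_sv Sg_pt)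

lemma lf_rt_scale: "c \<noteq> 0 \<Longrightarrow> lf (c *s x) = lf x" "c \<noteq> 0 \<Longrightarrow> rt (c *s x) = rt x"
proof -
  assume c: "c \<noteq> 0"
  have e: "c * x $ 3 - \<delta> * (c * x $ 4) = c * (x $ 3 - \<delta> * x $ 4)" "c * x $ 3 + \<delta> * (c * x $ 4) = c * (x $ 3 + \<delta> * x $ 4)"
    by (simp_all add: algebra_simps)
  show "lf (c *s x) = lf x" "rt (c *s x) = rt x"
    unfolding lf_def rt_def vector_smult_component e using c by (simp_all add: pt_scale)
qed

lemma bij_Sg: "bij_betw Sg UNIV Z"
proof (rule bij_betw_imageI)
  show "inj Sg"
  proof (rule injI)
    fix x y assume e: "Sg x = Sg y"
    obtain s0 s1 where s: "s0 \<noteq> 0 \<or> s1 \<noteq> 0" "fst x = pt s0 s1" by (rule pt_surj)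
    obtain t0 t1 where t: "t0 \<noteq> 0 \<or> t1 \<noteq> 0" "snd x = pt t0 t1" by (rule pt_surj)
    obtain u0 u1 where u: "u0 \<noteq> 0 \<or> u1 \<noteq> 0" "fst y = pt u0 u1" by (rule pt_surj)
    obtain v0 v1 where v: "v0 \<noteq> 0 \<or> v1 \<noteq> 0" "snd y = pt v0 v1" by (rule pt_surj)
    have "proj_point (T *v sv s0 s1 t0 t1) = proj_point (T *v sv u0 u1 v0 v1)"
      using e Sg_pt[OF s(1) t(1)] Sg_pt[OF u(1) v(1)] s(2) t(2) u(2) v(2) by (metis prod.collapse)
    then obtain c where c: "c \<noteq> 0" "T *v sv s0 s1 t0 t1 = c *s (T *v sv u0 u1 v0 v1)" using proj_point_eqD by blast
    then have "sv s0 s1 t0 t1 = c *s sv u0 u1 v0 v1" using T_scale T_eq(1) by metis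
    then have "pt s0 s1 = pt u0 u1" "pt t0 t1 = pt v0 v1"
      using lf_rt_sv[OF s(1) t(1)] lf_rt_sv[OF u(1) v(1)] lf_rt_scale[OF c(1)] by metis+
    then show "x = y" using s(2) t(2) u(2) v(2) by (simp add: prod_eq_iff)
  qed
  show "range Sg = Z"
  proof
    show "range Sg \<subseteq> Z"
    proof clarify
      fix p q
      obtain s0 s1 where s: "s0 \<noteq> 0 \<or> s1 \<noteq> 0" "p = pt s0 s1" by (rule pt_surj)
      obtain t0 t1 where t: "t0 \<noteq> 0 \<or> t1 \<noteq> 0" "q = pt t0 t1" by (rule pt_surj)
      show "Sg (p, q) \<in> Z" unfolding s(2) t(2) Sg_pt[OF s(1) t(1)] Z
        using sv_nonzero[OF s(1) t(1)] qcone_sv by blast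
    qed
    show "Z \<subseteq> range Sg"
    proof
      fix z assume "z \<in> Z"
      then obtain x where "z = proj_point (T *v x)" "x \<noteq> 0" "qcone d x" unfolding Z by blast
      then have "z = Sg (lf x, rt x)" using Sg_lf_rt by simp
      then show "z \<in> range Sg" by blast
    qed
  qed
qed

lemma Sg_in: "Sg p \<in> Z" using bij_Sg by (auto simp: bij_betw_def)

lemma inv_Sg: "finv Sg (Sg p) = p" "z \<in> Z \<Longrightarrow> Sg (finv Sg z) = z"
  using bij_Sg by (auto simp: bij_betw_def f_inv_into_f)

lemma inv_Sg_proj: "qcone d x \<Longrightarrow> x \<noteq> 0 \<Longrightarrow> finv Sg (proj_point (T *v x)) = (lf x, rt x)"
  using Sg_lf_rt inv_Sg(1) by metis

section \<open>Automorphisms as maps of the product of two lines\<close>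

definition trans :: "((complex ^ 4) set \<Rightarrow> (complex ^ 4) set) \<Rightarrow> cp1 \<times> cp1 \<Rightarrow> cp1 \<times> cp1" where
  "trans f p = finv Sg (f (Sg p))"

lemma bihom_hpoly:
  fixes Y :: "complex \<Rightarrow> complex \<Rightarrow> complex \<Rightarrow> complex \<Rightarrow> complex ^ 'n::finite"
  assumes "hpoly L n f" "\<And>i. bihom 1 1 (\<lambda>a b c e. Y a b c e $ i)"
  shows "bihom n n (\<lambda>a b c e. f (Y a b c e))"
  using assms(1) by (induction rule: hpoly.induct) (use assms(2) in \<open>auto intro: bihom.intros\<close>)

lemma bihom_matrix:
  fixes M :: "complex ^ 4 ^ 4"
  assumes "\<And>i. bihom n n (\<lambda>a b c e. Y a b c e $ i)"
  shows "bihom n n (\<lambda>a b c e. (M *v Y a b c e) $ i)"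
  unfolding matrix_vector_mult_def by (simp, intro bihom_sum bihom_cmult assms)

lemma bihom_sv: "bihom 1 1 (\<lambda>a b c e. sv a b c e $ i)"
proof -
  have 1: "bihom 1 1 (\<lambda>a b c e. a * c)" "bihom 1 1 (\<lambda>a b c e. b * e)" "bihom 1 1 (\<lambda>a b c e. a * e)" "bihom 1 1 (\<lambda>a b c e. b * c)"
    using bihom_mult[OF bihom_s0 bihom_t0] bihom_mult[OF bihom_s1 bihom_t1] bihom_mult[OF bihom_s0 bihom_t1] bihom_mult[OF bihom_s1 bihom_t0]
    by simp_all
  have 2: "bihom 1 1 (\<lambda>a b c e. (a * e + b * c) / 2)"
    using bihom_cmult[OF bihom_add[OF 1(3,4)], of "1 / 2"] by simp
  have 3: "bihom 1 1 (\<lambda>a b c e. (a * e - b * c) / (2 * \<delta>))"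
    using bihom_cmult[OF bihom_diff[OF 1(3,4)], of "1 / (2 * \<delta>)"] by simp
  have "\<forall>i. bihom 1 1 (\<lambda>a b c e. sv a b c e $ i)"
    unfolding forall_4 sv_nth using 1(1,2) 2 3 by blast
  then show ?thesis by blast
qed

text \<open>The cone equation makes the two ratios that define a ruling agree wherever both make
  sense.\<close>

lemma lf_alt: "qcone d x \<Longrightarrow> x $ 3 + \<delta> * x $ 4 \<noteq> 0 \<or> x $ 2 \<noteq> 0 \<Longrightarrow> lf x = pt (x $ 3 + \<delta> * x $ 4) (x $ 2)"
  unfolding lf_def qcone_iff by (auto simp: pt_eq algebra_simps)

lemma rt_alt: "qcone d x \<Longrightarrow> x $ 3 - \<delta> * x $ 4 \<noteq> 0 \<or> x $ 2 \<noteq> 0 \<Longrightarrow> rt x = pt (x $ 3 - \<delta> * x $ 4) (x $ 2)"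
  unfolding rt_def qcone_iff by (auto simp: pt_eq algebra_simps)

lemma vec4_nonzero: "(x :: complex ^ 4) \<noteq> 0 \<Longrightarrow> x $ 1 \<noteq> 0 \<or> x $ 2 \<noteq> 0 \<or> x $ 3 + \<delta> * x $ 4 \<noteq> 0 \<or> x $ 3 - \<delta> * x $ 4 \<noteq> 0"
proof (rule ccontr)
  assume "x \<noteq> 0" "\<not> ?thesis"
  then have z: "x $ 1 = 0" "x $ 2 = 0" "x $ 3 = - (\<delta> * x $ 4)" "2 * \<delta> * x $ 4 = 0" by (auto simp: eq_neg_iff_add_eq_0)
  then have "x = 0" using \<delta>0 by (intro vec4_eqI) simp_all
  then show False using \<open>x \<noteq> 0\<close> by simp
qed

text \<open>The local forms of a morphism become forms of bidegree \<open>(n, n)\<close> under the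
  Segre map. Each ruling of the image is a ratio of two of them; of the two available ratios, one is
  meaningful at the given point because the image vector is nonzero.\<close>

lemma locrep_trans:
  assumes "regular_map UNIV Z Z f"
  shows "locrep (fst \<circ> trans f)" "locrep (snd \<circ> trans f)"
proof -
  have fZ: "f \<in> Z \<rightarrow> Z" using assms unfolding regular_map_def by blast
  have main: "\<exists>n W. (\<forall>i. bihom n n (\<lambda>a b c e. W a b c e $ i)) \<and> W s0 s1 t0 t1 \<noteq> 0 \<and> (\<forall>a b c e. (a \<noteq> 0 \<or> b \<noteq> 0) \<and> (c \<noteq> 0 \<or> e \<noteq> 0) \<longrightarrow>
      W a b c e \<noteq> 0 \<longrightarrow> qcone d (W a b c e) \<and> trans f (pt a b, pt c e) = (lf (W a b c e), rt (W a b c e)))"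
    if nz: "s0 \<noteq> 0 \<or> s1 \<noteq> 0" "t0 \<noteq> 0 \<or> t1 \<noteq> 0" for s0 s1 t0 t1
  proof -
    have "T *v sv s0 s1 t0 t1 \<in> \<Union>Z" unfolding UZ using sv_nonzero[OF nz] qcone_sv by blast
    then obtain n F where F: "\<forall>i. (\<lambda>x. F x $ i) \<in> homog_polys UNIV n" "F (T *v sv s0 s1 t0 t1) \<noteq> 0"
      "\<forall>w\<in>\<Union>Z. F w \<noteq> 0 \<longrightarrow> f (proj_point w) = proj_point (F w)"
      using assms unfolding regular_map_def by blast
    define W where "W a b c e = T' *v F (T *v sv a b c e)" for a b c e
    have hpF: "hpoly UNIV n (\<lambda>x. F x $ i)" for i using F(1) homog_polys_hpoly[OF subfld_UNIV] by blast
    have "bihom n n (\<lambda>a b c e. W a b c e $ i)" for i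
      unfolding W_def by (intro bihom_matrix bihom_hpoly[OF hpF] bihom_sv)
    moreover have "W s0 s1 t0 t1 \<noteq> 0" using F(2) T_eq(4) by (simp add: W_def)
    moreover have "qcone d (W a b c e) \<and> trans f (pt a b, pt c e) = (lf (W a b c e), rt (W a b c e))"
      if nz: "a \<noteq> 0 \<or> b \<noteq> 0" "c \<noteq> 0 \<or> e \<noteq> 0" and W0: "W a b c e \<noteq> 0" for a b c e
    proof -
      let ?w = "T *v sv a b c e"
      have wZ: "?w \<in> \<Union>Z" unfolding UZ using sv_nonzero[OF nz] qcone_sv by blast
      have F0: "F ?w \<noteq> 0" using W0 T_eq(4) by (auto simp: W_def)
      have fw: "f (proj_point ?w) = proj_point (F ?w)" using F(3) wZ F0 by blast
      have "f (proj_point ?w) \<in> Z" using fZ Sg_in Sg_pt[OF nz] by (metis Pi_mem)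
      then have "F ?w \<in> \<Union>Z" unfolding fw using proj_point_self by blast
      then obtain x where x: "F ?w = T *v x" "x \<noteq> 0" "qcone d x" unfolding UZ by blast
      have Wx: "W a b c e = x" using x(1) TT by (simp add: W_def)
      have "trans f (pt a b, pt c e) = finv Sg (proj_point (T *v x))"
        unfolding trans_def Sg_pt[OF nz] fw x(1) ..
      then show ?thesis unfolding Wx using inv_Sg_proj x by simp
    qed
    ultimately show ?thesis by blast
  qed
  show "locrep (fst \<circ> trans f)"
    unfolding locrep_def
  proof (intro allI impI)
    fix s0 s1 t0 t1 :: complex assume nz: "(s0 \<noteq> 0 \<or> s1 \<noteq> 0) \<and> (t0 \<noteq> 0 \<or> t1 \<noteq> 0)"
    obtain n W where W0: "(\<forall>i. bihom n n (\<lambda>a b c e. W a b c e $ i)) \<and> W s0 s1 t0 t1 \<noteq> 0 \<and>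
      (\<forall>a b c e. (a \<noteq> 0 \<or> b \<noteq> 0) \<and> (c \<noteq> 0 \<or> e \<noteq> 0) \<longrightarrow> W a b c e \<noteq> 0 \<longrightarrow>
         qcone d (W a b c e) \<and> trans f (pt a b, pt c e) = (lf (W a b c e), rt (W a b c e)))"
      using main[OF conjunct1[OF nz] conjunct2[OF nz]] by (elim exE) (rule that)
    have W: "bihom n n (\<lambda>a b c e. W a b c e $ i)" "W s0 s1 t0 t1 \<noteq> 0" for i using W0 by simp_all
    have W3: "qcone d (W a b c e) \<and> trans f (pt a b, pt c e) = (lf (W a b c e), rt (W a b c e))"
      if "a \<noteq> 0 \<or> b \<noteq> 0" "c \<noteq> 0 \<or> e \<noteq> 0" "W a b c e \<noteq> 0" for a b c e
      using conjunct2[OF conjunct2[OF W0]] that by blast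
    have b: "bihom n n (\<lambda>a b c e. W a b c e $ 3 + \<delta> * W a b c e $ 4)" "bihom n n (\<lambda>a b c e. W a b c e $ 3 - \<delta> * W a b c e $ 4)"
      by (intro bihom_add bihom_diff bihom_cmult W(1))+
    show "\<exists>n P Q. locrep_at s0 s1 t0 t1 n P Q (fst \<circ> trans f)"
    proof (cases "W s0 s1 t0 t1 $ 1 \<noteq> 0 \<or> W s0 s1 t0 t1 $ 3 - \<delta> * W s0 s1 t0 t1 $ 4 \<noteq> 0")
      case True
      have "locrep_at s0 s1 t0 t1 n (\<lambda>a b c e. W a b c e $ 1) (\<lambda>a b c e. W a b c e $ 3 - \<delta> * W a b c e $ 4) (fst \<circ> trans f)"
        unfolding locrep_at_def
      proof (intro conjI allI impI True W(1) b)
        fix a b c e assume h: "(a \<noteq> 0 \<or> b \<noteq> 0) \<and> (c \<noteq> 0 \<or> e \<noteq> 0) \<and> (W a b c e $ 1 \<noteq> 0 \<or> W a b c e $ 3 - \<delta> * W a b c e $ 4 \<noteq> 0)"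
        then have "W a b c e \<noteq> 0" by auto
        then show "(fst \<circ> trans f) (pt a b, pt c e) = pt (W a b c e $ 1) (W a b c e $ 3 - \<delta> * W a b c e $ 4)"
          using W3[of a b c e] h by (simp add: lf_def)
      qed
      then show ?thesis by blast
    next
      case False
      then have nz': "W s0 s1 t0 t1 $ 3 + \<delta> * W s0 s1 t0 t1 $ 4 \<noteq> 0 \<or> W s0 s1 t0 t1 $ 2 \<noteq> 0"
        using vec4_nonzero[OF W(2)] by blast
      have "locrep_at s0 s1 t0 t1 n (\<lambda>a b c e. W a b c e $ 3 + \<delta> * W a b c e $ 4) (\<lambda>a b c e. W a b c e $ 2) (fst \<circ> trans f)"
        unfolding locrep_at_def
      proof (intro conjI allI impI nz' W(1) b)
        fix a b c e assume h: "(a \<noteq> 0 \<or> b \<noteq> 0) \<and> (c \<noteq> 0 \<or> e \<noteq> 0) \<and> (W a b c e $ 3 + \<delta> * W a b c e $ 4 \<noteq> 0 \<or> W a b c e $ 2 \<noteq> 0)"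
        then have "W a b c e \<noteq> 0" by auto
        then show "(fst \<circ> trans f) (pt a b, pt c e) = pt (W a b c e $ 3 + \<delta> * W a b c e $ 4) (W a b c e $ 2)"
          using W3[of a b c e] h lf_alt by simp
      qed
      then show ?thesis by blast
    qed
  qed
  show "locrep (snd \<circ> trans f)"
    unfolding locrep_def
  proof (intro allI impI)
    fix s0 s1 t0 t1 :: complex assume nz: "(s0 \<noteq> 0 \<or> s1 \<noteq> 0) \<and> (t0 \<noteq> 0 \<or> t1 \<noteq> 0)"
    obtain n W where W0: "(\<forall>i. bihom n n (\<lambda>a b c e. W a b c e $ i)) \<and> W s0 s1 t0 t1 \<noteq> 0 \<and>
      (\<forall>a b c e. (a \<noteq> 0 \<or> b \<noteq> 0) \<and> (c \<noteq> 0 \<or> e \<noteq> 0) \<longrightarrow> W a b c e \<noteq> 0 \<longrightarrow>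
         qcone d (W a b c e) \<and> trans f (pt a b, pt c e) = (lf (W a b c e), rt (W a b c e)))"
      using main[OF conjunct1[OF nz] conjunct2[OF nz]] by (elim exE) (rule that)
    have W: "bihom n n (\<lambda>a b c e. W a b c e $ i)" "W s0 s1 t0 t1 \<noteq> 0" for i using W0 by simp_all
    have W3: "qcone d (W a b c e) \<and> trans f (pt a b, pt c e) = (lf (W a b c e), rt (W a b c e))"
      if "a \<noteq> 0 \<or> b \<noteq> 0" "c \<noteq> 0 \<or> e \<noteq> 0" "W a b c e \<noteq> 0" for a b c e
      using conjunct2[OF conjunct2[OF W0]] that by blast
    have b: "bihom n n (\<lambda>a b c e. W a b c e $ 3 + \<delta> * W a b c e $ 4)" "bihom n n (\<lambda>a b c e. W a b c e $ 3 - \<delta> * W a b c e $ 4)"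
      by (intro bihom_add bihom_diff bihom_cmult W(1))+
    show "\<exists>n P Q. locrep_at s0 s1 t0 t1 n P Q (snd \<circ> trans f)"
    proof (cases "W s0 s1 t0 t1 $ 1 \<noteq> 0 \<or> W s0 s1 t0 t1 $ 3 + \<delta> * W s0 s1 t0 t1 $ 4 \<noteq> 0")
      case True
      have "locrep_at s0 s1 t0 t1 n (\<lambda>a b c e. W a b c e $ 1) (\<lambda>a b c e. W a b c e $ 3 + \<delta> * W a b c e $ 4) (snd \<circ> trans f)"
        unfolding locrep_at_def
      proof (intro conjI allI impI True W(1) b)
        fix a b c e assume h: "(a \<noteq> 0 \<or> b \<noteq> 0) \<and> (c \<noteq> 0 \<or> e \<noteq> 0) \<and> (W a b c e $ 1 \<noteq> 0 \<or> W a b c e $ 3 + \<delta> * W a b c e $ 4 \<noteq> 0)"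
        then have "W a b c e \<noteq> 0" by auto
        then show "(snd \<circ> trans f) (pt a b, pt c e) = pt (W a b c e $ 1) (W a b c e $ 3 + \<delta> * W a b c e $ 4)"
          using W3[of a b c e] h by (simp add: rt_def)
      qed
      then show ?thesis by blast
    next
      case False
      then have nz': "W s0 s1 t0 t1 $ 3 - \<delta> * W s0 s1 t0 t1 $ 4 \<noteq> 0 \<or> W s0 s1 t0 t1 $ 2 \<noteq> 0"
        using vec4_nonzero[OF W(2)] by blast
      have "locrep_at s0 s1 t0 t1 n (\<lambda>a b c e. W a b c e $ 3 - \<delta> * W a b c e $ 4) (\<lambda>a b c e. W a b c e $ 2) (snd \<circ> trans f)"
        unfolding locrep_at_def
      proof (intro conjI allI impI nz' W(1) b)
        fix a b c e assume h: "(a \<noteq> 0 \<or> b \<noteq> 0) \<and> (c \<noteq> 0 \<or> e \<noteq> 0) \<and> (W a b c e $ 3 - \<delta> * W a b c e $ 4 \<noteq> 0 \<or> W a b c e $ 2 \<noteq> 0)"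
        then have "W a b c e \<noteq> 0" by auto
        then show "(snd \<circ> trans f) (pt a b, pt c e) = pt (W a b c e $ 3 - \<delta> * W a b c e $ 4) (W a b c e $ 2)"
          using W3[of a b c e] h rt_alt by simp
      qed
      then show ?thesis by blast
    qed
  qed
qed

text \<open>If \<open>\<delta> \<notin> L\<close>, the components of an \<open>L\<close>-rational point need not be \<open>L\<close>-rational.\<close>

definition kpt :: "complex set \<Rightarrow> cp1 \<times> cp1 \<Rightarrow> bool" where
  "kpt L p \<longleftrightarrow> (\<exists>x. kvec L x \<and> x \<noteq> 0 \<and> qcone d x \<and> p = (lf x, rt x))"

text \<open>Local forms with coefficients in \<open>K\<close> take values in \<open>L\<close> at
  vectors with entries in \<open>L\<close>, and the coordinate changes \<open>T\<close> and
  \<open>T'\<close> have entries in \<open>K\<close>.\<close>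

lemma kpt_trans:
  assumes L: "subfld L" "K \<subseteq> L" and f: "regular_map K Z Z f" and p: "kpt L p"
  shows "kpt L (trans f p)"
proof -
  obtain x where x: "kvec L x" "x \<noteq> 0" "qcone d x" "p = (lf x, rt x)" using p unfolding kpt_def by blast
  let ?w = "T *v x"
  have wZ: "?w \<in> \<Union>Z" unfolding UZ using x by blast
  from wZ obtain n F where F: "\<forall>i. (\<lambda>x. F x $ i) \<in> homog_polys K n" "F ?w \<noteq> 0" "f (proj_point ?w) = proj_point (F ?w)"
    using f unfolding regular_map_def by blast
  have "proj_point ?w \<in> Z" unfolding Z using x by blast
  then have "f (proj_point ?w) \<in> Z" using f unfolding regular_map_def by blast
  then have "F ?w \<in> \<Union>Z" unfolding F(3) using proj_point_self by blast
  then obtain y where y: "F ?w = T *v y" "y \<noteq> 0" "qcone d y" unfolding UZ by blast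
  have mK: "kvec L (M *v v)" if "kvec L v" "\<And>i j. M $ i $ j \<in> K" for M :: "complex ^ 4 ^ 4" and v
    using that L unfolding kvec_def matrix_vector_mult_def by (auto intro!: subfld_sum subfldD(4))
  have "hpoly L n (\<lambda>x. F x $ i)" for i using F(1) homog_polys_hpoly[OF K] hpoly_mono[OF _ L(2)] by blast
  then have "kvec L (F ?w)" unfolding kvec_def using hpoly_val[OF L(1)] mK[OF x(1) TK(1)] unfolding kvec_def by blast
  then have "kvec L (T' *v F ?w)" by (rule mK[OF _ TK(2)])
  then have "kvec L y" using y(1) TT by simp
  moreover have "trans f p = (lf y, rt y)"
    unfolding trans_def x(4) Sg_lf_rt[OF x(3,2)] F(3) y(1) by (rule inv_Sg_proj[OF y(3,2)])
  ultimately show ?thesis unfolding kpt_def using y by blast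
qed

text \<open>All that the upper bounds use about an automorphism over \<open>K\<close>. The field
  \<open>L\<close> varies because real points are tested even when \<open>K\<close> consists of the
  rationals.\<close>

definition good :: "(cp1 \<times> cp1 \<Rightarrow> cp1 \<times> cp1) \<Rightarrow> bool" where
  "good g \<longleftrightarrow> (\<exists>a\<in>mob UNIV. \<exists>b\<in>mob UNIV. g = map_prod a b \<or> g = map_prod a b \<circ> prod.swap) \<and>
     (\<forall>L p. subfld L \<longrightarrow> K \<subseteq> L \<longrightarrow> kpt L p \<longrightarrow> kpt L (g p))"

lemma trans_id: "trans (\<lambda>x\<in>Z. x) = id"
  by (rule ext) (simp add: trans_def Sg_in inv_Sg)

lemma trans_compose:
  assumes "g \<in> Z \<rightarrow> Z" shows "trans (compose Z f g) = trans f \<circ> trans g"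
proof
  fix p
  have "g (Sg p) \<in> Z" using assms Sg_in by (rule Pi_mem)
  then show "trans (compose Z f g) p = (trans f \<circ> trans g) p"
    by (simp add: trans_def compose_def Sg_in inv_Sg)
qed

lemma aut_good:
  assumes "f \<in> carrier (aut_group K Z)"
  shows "good (trans f)"
proof -
  have f: "f \<in> Bij Z" "regular_map K Z Z f" "regular_map K Z Z (inv_into Z f)"
    using assms unfolding aut_group_def by auto
  have r: "regular_map UNIV Z Z f" "regular_map UNIV Z Z (inv_into Z f)"
    using regular_map_mono[OF K subfld_UNIV] f by auto
  have fZ: "f \<in> Z \<rightarrow> Z" "bij_betw f Z Z" using f(1) by (auto simp: Bij_def bij_betw_def)
  have "trans (inv_into Z f) \<circ> trans f = id"
  proof
    fix p
    have "f (Sg p) \<in> Z" using fZ(1) Sg_in by (rule Pi_mem)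
    then show "(trans (inv_into Z f) \<circ> trans f) p = id p"
      using bij_betw_inv_into_left[OF fZ(2) Sg_in] by (simp add: trans_def inv_Sg)
  qed
  then obtain a b where "a \<in> mob UNIV" "b \<in> mob UNIV" "trans f = map_prod a b \<or> trans f = map_prod a b \<circ> prod.swap"
    using biregular_is_product[OF locrep_trans[OF r(1)] locrep_trans[OF r(2)]] by blast
  then show ?thesis unfolding good_def using kpt_trans[OF _ _ f(2)] by blast
qed

lemma good_bij: "good g \<Longrightarrow> bij g"
proof -
  assume "good g"
  then obtain a b where ab: "a \<in> mob UNIV" "b \<in> mob UNIV" "g = map_prod a b \<or> g = map_prod a b \<circ> prod.swap"
    unfolding good_def by blast
  have "bij (map_prod a b)" using ab mob_bij bij_map_prodI by blast
  then show ?thesis using ab(3) bij_comp[OF bij_swap] by auto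
qed

lemma trans_inj: "inj_on trans (Bij Z)"
proof (rule inj_onI)
  fix f g assume f: "f \<in> Bij Z" and g: "g \<in> Bij Z" and e: "trans f = trans g"
  have "f z = g z" if z: "z \<in> Z" for z
  proof -
    have "f z \<in> Z" "g z \<in> Z" using f g z Bij_imp_funcset by (auto simp: Pi_mem)
    moreover have "finv Sg (f z) = finv Sg (g z)"
      using fun_cong[OF e, of "finv Sg z"] inv_Sg(2)[OF z] by (simp add: trans_def)
    ultimately show ?thesis using inv_Sg(2) by metis
  qed
  then show "f = g" using f g Bij_imp_extensional extensionalityI by blast
qed

lemma aut_mult:
  "f \<in> carrier (aut_group K Z) \<Longrightarrow> g \<in> carrier (aut_group K Z) \<Longrightarrow>
    f \<otimes>\<^bsub>aut_group K Z\<^esub> g = compose Z f g \<and> f \<in> Bij Z \<and> g \<in> Bij Z"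
  by (auto simp: aut_group_def BijGroup_def)

lemma aut_one: "\<one>\<^bsub>aut_group K Z\<^esub> = (\<lambda>x\<in>Z. x)"
  by (simp add: aut_group_def BijGroup_def)

text \<open>Collects the hypotheses of \<open>jordan_finite_transfer\<close> for a finite subgroup
  of the automorphism group.\<close>

lemma subgroup_setup:
  assumes H: "subgroup H (aut_group K Z)" "finite H"
  defines "M \<equiv> (aut_group K Z)\<lparr>carrier := H\<rparr>"
  shows "\<And>x y. x \<in> carrier M \<Longrightarrow> y \<in> carrier M \<Longrightarrow> x \<otimes>\<^bsub>M\<^esub> y \<in> carrier M"
    "\<And>x y. x \<in> carrier M \<Longrightarrow> y \<in> carrier M \<Longrightarrow> trans (x \<otimes>\<^bsub>M\<^esub> y) = trans x \<circ> trans y"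
    "\<one>\<^bsub>M\<^esub> \<in> carrier M" "trans \<one>\<^bsub>M\<^esub> = id" "inj_on trans (carrier M)" "fgrp (trans ` carrier M)"
proof -
  interpret H: subgroup H "aut_group K Z" by (rule H(1))
  have HB: "H \<subseteq> Bij Z" using H.subset by (auto simp: aut_group_def)
  show cl: "x \<otimes>\<^bsub>M\<^esub> y \<in> carrier M" if "x \<in> carrier M" "y \<in> carrier M" for x y
    using that H.m_closed by (simp add: M_def)
  show hom: "trans (x \<otimes>\<^bsub>M\<^esub> y) = trans x \<circ> trans y" if "x \<in> carrier M" "y \<in> carrier M" for x y
  proof -
    have "x \<in> H" "y \<in> H" using that by (auto simp: M_def)
    then have "x \<otimes>\<^bsub>aut_group K Z\<^esub> y = compose Z x y \<and> x \<in> Bij Z \<and> y \<in> Bij Z"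
      using H.subset by (intro aut_mult) auto
    then show ?thesis using trans_compose[OF Bij_imp_funcset] by (simp add: M_def)
  qed
  show one: "\<one>\<^bsub>M\<^esub> \<in> carrier M" "trans \<one>\<^bsub>M\<^esub> = id"
    using H.one_closed by (simp_all add: M_def aut_one trans_id)
  show inj: "inj_on trans (carrier M)" using inj_on_subset[OF trans_inj HB] by (simp add: M_def)
  show "fgrp (trans ` carrier M)"
    unfolding fgrp_def
  proof (intro conjI ballI)
    show "finite (trans ` carrier M)" using H(2) by (simp add: M_def)
    show "id \<in> trans ` carrier M" using one by (metis imageI)
    fix f assume "f \<in> trans ` carrier M"
    then obtain x where x: "x \<in> carrier M" "f = trans x" by blast
    show "bij f" using x aut_good good_bij H.subset by (auto simp: M_def)
    fix g assume "g \<in> trans ` carrier M"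
    then obtain y where y: "y \<in> carrier M" "g = trans y" by blast
    show "f \<circ> g \<in> trans ` carrier M" using hom[OF x(1) y(1)] cl[OF x(1) y(1)] x y by (metis imageI)
  qed
qed

lemma jordan_constant_le:
  assumes "\<And>G. fgrp G \<Longrightarrow> (\<And>g. g \<in> G \<Longrightarrow> good g) \<Longrightarrow> jordan_le G m"
  shows "jordan_constant (aut_group K Z) \<le> enat m"
  unfolding jordan_constant_def
proof (rule SUP_least)
  fix H assume "H \<in> {H. subgroup H (aut_group K Z) \<and> finite H}"
  then have H: "subgroup H (aut_group K Z)" "finite H" by auto
  have "good g" if "g \<in> trans ` H" for g using that aut_good subgroup.subset[OF H(1)] by blast
  then have "jordan_le (trans ` H) m" using assms subgroup_setup(6)[OF H] by simp
  then show "enat (jordan_finite (aut_group K Z\<lparr>carrier := H\<rparr>)) \<le> enat m"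
    using jordan_finite_transfer(1)[of "aut_group K Z\<lparr>carrier := H\<rparr>" trans, OF subgroup_setup[OF H]] by simp
qed

text \<open>The automorphisms exhibited for the lower bounds are linear in normal coordinates, so
  one global family of forms of degree one represents each of them.\<close>

definition lifts :: "(cp1 \<times> cp1 \<Rightarrow> cp1 \<times> cp1) \<Rightarrow> bool" where
  "lifts g \<longleftrightarrow> (\<exists>F. (\<forall>i. hpoly K 1 (\<lambda>x. F x $ i)) \<and>
     (\<forall>x. x \<noteq> 0 \<longrightarrow> qcone d x \<longrightarrow> F x \<noteq> 0 \<and> qcone d (F x) \<and> g (lf x, rt x) = (lf (F x), rt (F x))))"

text \<open>Restricted to \<open>Z\<close> because \<open>Bij\<close> consists of extensional
  functions.\<close>

definition untrans :: "(cp1 \<times> cp1 \<Rightarrow> cp1 \<times> cp1) \<Rightarrow> (complex ^ 4) set \<Rightarrow> (complex ^ 4) set" where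
  "untrans g = (\<lambda>z\<in>Z. Sg (g (finv Sg z)))"

lemma trans_untrans: "trans (untrans g) = g"
  by (rule ext) (simp add: trans_def untrans_def Sg_in inv_Sg)

lemma untrans_Bij: "bij g \<Longrightarrow> untrans g \<in> Bij Z"
proof -
  assume "bij g"
  then have g: "bij_betw g UNIV UNIV" by simp
  have "bij_betw (Sg \<circ> (g \<circ> finv Sg)) Z Z"
    by (rule bij_betw_trans[OF bij_betw_trans[OF bij_betw_inv_into[OF bij_Sg] g] bij_Sg])
  then have "bij_betw (untrans g) Z Z" by (rule bij_betw_cong[THEN iffD1, rotated]) (simp add: untrans_def)
  then show ?thesis by (simp add: Bij_def untrans_def)
qed

lemma untrans_regular:
  assumes "lifts g" shows "regular_map K Z Z (untrans g)"
proof -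
  obtain F where F: "\<And>i. hpoly K 1 (\<lambda>x. F x $ i)"
    "\<And>x. x \<noteq> 0 \<Longrightarrow> qcone d x \<Longrightarrow> F x \<noteq> 0 \<and> qcone d (F x) \<and> g (lf x, rt x) = (lf (F x), rt (F x))"
    using assms unfolding lifts_def by blast
  define F' where "F' x = T *v F (T' *v x)" for x
  have hpF': "(\<lambda>x. F' x $ i) \<in> homog_polys K 1" for i
  proof -
    have "hpoly K (1 * 1) (\<lambda>x. F (T' *v x) $ i)" for i by (rule hpoly_comp[OF F(1) hpoly_linear[OF TK(2)]])
    then have "hpoly K (1 * 1) (\<lambda>x. (T *v F (T' *v x)) $ i)" by (intro hpoly_comp[OF hpoly_linear[OF TK(1)]]) simp
    then show ?thesis unfolding F'_def homog_polys_hpoly[OF K] by simp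
  qed
  have val: "F' w \<noteq> 0 \<and> untrans g (proj_point w) = proj_point (F' w)" if w: "w \<in> \<Union>Z" for w
  proof -
    obtain x where x: "w = T *v x" "x \<noteq> 0" "qcone d x" using w unfolding UZ by blast
    have e: "F' w = T *v F x" by (simp add: F'_def x(1) TT)
    note Fx = F(2)[OF x(2,3)]
    have "proj_point w \<in> Z" unfolding Z x(1) using x by blast
    then have "untrans g (proj_point w) = Sg (g (lf x, rt x))"
      unfolding untrans_def x(1) using inv_Sg_proj[OF x(3,2)] by simp
    also have "\<dots> = proj_point (T *v F x)" using Fx Sg_lf_rt by simp
    finally show ?thesis using e Fx T_eq(3) by simp
  qed
  show ?thesis
    unfolding regular_map_def
  proof (intro conjI ballI)
    show "untrans g \<in> Z \<rightarrow> Z" by (simp add: untrans_def Sg_in)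
    fix v assume "v \<in> \<Union>Z"
    then show "\<exists>e F. (\<forall>i. (\<lambda>x. F x $ i) \<in> homog_polys K e) \<and> F v \<noteq> 0 \<and>
        (\<forall>w\<in>\<Union>Z. F w \<noteq> 0 \<longrightarrow> untrans g (proj_point w) = proj_point (F w))"
      using hpF' val by blast
  qed
qed

lemma inv_untrans: "bij g \<Longrightarrow> z \<in> Z \<Longrightarrow> inv_into Z (untrans g) z = untrans (finv g) z"
proof -
  assume g: "bij g" and z: "z \<in> Z"
  have b: "bij_betw (untrans g) Z Z" using untrans_Bij[OF g] by (simp add: Bij_def)
  have "untrans (finv g) z \<in> Z" using z by (simp add: untrans_def Sg_in)
  moreover have "untrans g (untrans (finv g) z) = z"
    using z g by (simp add: untrans_def Sg_in inv_Sg inv_apply_bij)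
  ultimately show ?thesis using bij_betw_inv_into_left[OF b] by metis
qed

lemma untrans_aut:
  assumes "bij g" "lifts g" "lifts (finv g)"
  shows "untrans g \<in> carrier (aut_group K Z)"
proof -
  \<comment> \<open>\<open>inv_into Z (untrans g)\<close> and \<open>untrans (finv g)\<close> are
    known to agree on \<open>Z\<close>, and regularity depends only on the values there.\<close>
  have e: "regular_map K Z Z f" if r: "regular_map K Z Z f'" and eq: "\<And>z. z \<in> Z \<Longrightarrow> f z = f' z" for f f'
  proof -
    have pZ: "proj_point w \<in> Z" if w: "w \<in> \<Union>Z" for w
    proof -
      from w obtain x where "w = T *v x" "x \<noteq> 0" "qcone d x" unfolding UZ by blast
      then show ?thesis unfolding Z by blast
    qed
    show ?thesis
      unfolding regular_map_def
    proof (intro conjI ballI)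
      show "f \<in> Z \<rightarrow> Z" using r eq unfolding regular_map_def by auto
      fix v assume "v \<in> \<Union>Z"
      then obtain e F where F: "\<forall>i. (\<lambda>x. F x $ i) \<in> homog_polys K e" "F v \<noteq> 0"
        "\<forall>w\<in>\<Union>Z. F w \<noteq> 0 \<longrightarrow> f' (proj_point w) = proj_point (F w)"
        using r unfolding regular_map_def by blast
      have "\<forall>w\<in>\<Union>Z. F w \<noteq> 0 \<longrightarrow> f (proj_point w) = proj_point (F w)"
        using F(3) eq[OF pZ] by auto
      then show "\<exists>e F. (\<forall>i. (\<lambda>x. F x $ i) \<in> homog_polys K e) \<and> F v \<noteq> 0 \<and>
          (\<forall>w\<in>\<Union>Z. F w \<noteq> 0 \<longrightarrow> f (proj_point w) = proj_point (F w))"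
        using F(1,2) by blast
    qed
  qed
  have "regular_map K Z Z (inv_into Z (untrans g))"
    by (rule e[OF untrans_regular[OF assms(3)] inv_untrans[OF assms(1)]])
  then show ?thesis using untrans_Bij[OF assms(1)] untrans_regular[OF assms(2)] by (simp add: aut_group_def)
qed

lemma jordan_constant_ge:
  assumes G: "fgrp G" and lift: "\<And>g. g \<in> G \<Longrightarrow> lifts g"
    and J: "\<And>N. normal_abelian G N \<Longrightarrow> k * card N \<le> card G"
  shows "enat k \<le> jordan_constant (aut_group K Z)"
proof -
  let ?A = "aut_group K Z"
  define H where "H = untrans ` G"
  have HA: "H \<subseteq> carrier ?A"
    unfolding H_def using untrans_aut fgrpD(4)[OF G] lift fgrp_inv[OF G] by blast
  have tH: "trans ` H = G" unfolding H_def by (simp add: image_image trans_untrans)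
  have un: "compose Z (untrans f) (untrans g) = untrans (f \<circ> g)" for f g
    by (rule ext) (simp add: compose_def untrans_def Sg_in inv_Sg)
  have HB: "H \<subseteq> Bij Z" using HA by (auto simp: aut_group_def)
  have m: "untrans f \<otimes>\<^bsub>?A\<^esub> untrans g = untrans (f \<circ> g)" if "f \<in> G" "g \<in> G" for f g
    using aut_mult[of "untrans f" "untrans g"] HA that un by (auto simp: H_def)
  have one: "\<one>\<^bsub>?A\<^esub> = untrans id"
    unfolding aut_one untrans_def by (rule restrict_ext) (simp add: inv_Sg)
  have "subgroup H ?A"
  proof
    show "H \<subseteq> carrier ?A" by (rule HA)
    show "x \<otimes>\<^bsub>?A\<^esub> y \<in> H" if "x \<in> H" "y \<in> H" for x y
      using that m fgrpD(3)[OF G] by (auto simp: H_def)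
    show "\<one>\<^bsub>?A\<^esub> \<in> H" unfolding one H_def using fgrpD(2)[OF G] by blast
    fix x assume "x \<in> H"
    then obtain g where g: "g \<in> G" "x = untrans g" by (auto simp: H_def)
    have gi: "finv g \<in> G" "bij g" using fgrp_inv[OF G g(1)] fgrpD(4)[OF G g(1)] by auto
    let ?y = "untrans (finv g)"
    have y: "?y \<in> carrier ?A" "x \<otimes>\<^bsub>?A\<^esub> ?y = \<one>\<^bsub>?A\<^esub>" "?y \<otimes>\<^bsub>?A\<^esub> x = \<one>\<^bsub>?A\<^esub>"
      using m[OF g(1) gi(1)] m[OF gi(1) g(1)] HA gi g one by (auto simp: inv_o_bij H_def)
    \<comment> \<open>Uniqueness of the inverse is checked after applying \<open>trans\<close>,
      where it becomes uniqueness of the inverse of a bijection.\<close>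
    have "inv\<^bsub>?A\<^esub> x = ?y"
      unfolding m_inv_def
    proof (rule the_equality)
      show "?y \<in> carrier ?A \<and> x \<otimes>\<^bsub>?A\<^esub> ?y = \<one>\<^bsub>?A\<^esub> \<and> ?y \<otimes>\<^bsub>?A\<^esub> x = \<one>\<^bsub>?A\<^esub>" using y by blast
      fix u assume u: "u \<in> carrier ?A \<and> x \<otimes>\<^bsub>?A\<^esub> u = \<one>\<^bsub>?A\<^esub> \<and> u \<otimes>\<^bsub>?A\<^esub> x = \<one>\<^bsub>?A\<^esub>"
      have xA: "x \<in> carrier ?A" using HA \<open>x \<in> H\<close> by blast
      have uB: "u \<in> Bij Z" "compose Z x u = (\<lambda>x\<in>Z. x)" using aut_mult[OF xA, of u] u aut_one by auto
      have "trans x \<circ> trans u = id"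
        using trans_compose[OF Bij_imp_funcset[OF uB(1)], of x] uB(2) trans_id by simp
      then have "trans u = finv g"
        unfolding g(2) trans_untrans using gi(2) by (metis comp_assoc comp_id id_comp inv_o_bij(1))
      then have "trans u = trans ?y" by (simp add: trans_untrans)
      then show "u = ?y" using inj_onD[OF trans_inj] uB(1) untrans_Bij gi fgrpD(4)[OF G gi(1)] by blast
    qed
    then show "inv\<^bsub>?A\<^esub> x \<in> H" using gi by (auto simp: H_def)
  qed
  moreover have "finite H" using fgrpD(1)[OF G] by (simp add: H_def)
  ultimately have H: "subgroup H ?A" "finite H" by auto
  have "k \<le> jordan_finite (?A\<lparr>carrier := H\<rparr>)"
    using jordan_finite_transfer(2)[of "?A\<lparr>carrier := H\<rparr>" trans, OF subgroup_setup[OF H]] J tH by simp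
  then have "enat k \<le> enat (jordan_finite (?A\<lparr>carrier := H\<rparr>))" by simp
  also have "\<dots> \<le> jordan_constant ?A"
    unfolding jordan_constant_def using H by (intro SUP_upper) auto
  finally show ?thesis .
qed

end

section \<open>Upper bounds\<close>

lemma five_dvd_square: "(5 :: int) dvd a\<^sup>2 \<Longrightarrow> 5 dvd a"
proof -
  assume d: "5 dvd a\<^sup>2"
  define r where "r = a mod 5"
  have "r = 0 \<or> r = 1 \<or> r = 2 \<or> r = 3 \<or> r = 4" unfolding r_def by presburger
  moreover have "r\<^sup>2 mod 5 = 0" using d unfolding r_def by (simp only: power_mod dvd_eq_mod_eq_0)
  ultimately have "r = 0" by auto
  then show ?thesis unfolding r_def by (simp only: dvd_eq_mod_eq_0)
qed

lemma rat_sqrt5: "(q :: rat)\<^sup>2 \<noteq> 5"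
proof
  assume q: "q\<^sup>2 = 5"
  obtain a b where ab: "quotient_of q = (a, b)" by (cases "quotient_of q")
  have b: "b > 0" "coprime a b" "q = of_int a / of_int b"
    using quotient_of_denom_pos[OF ab] quotient_of_coprime[OF ab] quotient_of_div[OF ab] by auto
  have "(of_int a)\<^sup>2 = (5 :: rat) * (of_int b)\<^sup>2" using q b by (simp add: power_divide field_simps)
  then have "of_int (a\<^sup>2) = (of_int (5 * b\<^sup>2) :: rat)" by simp
  then have e: "a\<^sup>2 = 5 * b\<^sup>2" by (simp only: of_int_eq_iff)
  have a5: "5 dvd a" by (rule five_dvd_square) (simp add: e)
  then obtain k where k: "a = 5 * k" by (auto elim: dvdE)
  have "5 * k\<^sup>2 = b\<^sup>2" using e unfolding k by (simp add: power2_eq_square)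
  then have "5 dvd b\<^sup>2" by (metis dvd_triv_left)
  then have "5 dvd b" by (rule five_dvd_square)
  then have "is_unit (5 :: int)" using a5 b(2) by (metis coprime_common_divisor)
  then show False by simp
qed

lemma complex_of_rat: "complex_of_real (of_rat q) = of_rat q"
  by (cases q) (simp add: of_rat_rat)

lemma Rats_complex: "z \<in> \<rat> \<Longrightarrow> \<exists>q. z = complex_of_real (of_rat q)"
  by (auto elim!: Rats_cases simp: complex_of_rat)

lemma subfld_Rats: "subfld \<rat>" and subfld_Reals: "subfld \<real>"
  by (auto simp: subfld_def)

definition quad_field :: "complex \<Rightarrow> complex set" where
  "quad_field w = {a + b * w | a b. a \<in> \<rat> \<and> b \<in> \<rat>}"

locale imag_quad =
  fixes w :: complex and D :: rat
  assumes w2: "w\<^sup>2 = complex_of_real (of_rat D)" and D: "D < 0"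
begin

lemma w_imag: "Re w = 0" "Im w \<noteq> 0"
proof -
  have "Re (w\<^sup>2) < 0" "Im (w\<^sup>2) = 0" using D unfolding w2 by simp_all
  then have i: "(Re w)\<^sup>2 - (Im w)\<^sup>2 < 0" "Re w * Im w = 0" by (auto simp: power2_eq_square)
  show n: "Im w \<noteq> 0"
  proof
    assume "Im w = 0"
    then show False using i(1) by simp
  qed
  then show "Re w = 0" using i(2) by simp
qed

lemma quad_norm:
  assumes "a \<in> \<rat>" "b \<in> \<rat>" "a\<^sup>2 - b\<^sup>2 * w\<^sup>2 = 0" shows "a = 0" "b = 0"
proof -
  obtain p q where pq: "a = complex_of_real (of_rat p)" "b = complex_of_real (of_rat q)"
    using assms Rats_complex by meson
  have "complex_of_real (of_rat (p\<^sup>2 - q\<^sup>2 * D)) = 0"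
    using assms(3) unfolding pq w2 by (simp add: of_rat_diff of_rat_mult of_rat_power)
  then have "p\<^sup>2 - q\<^sup>2 * D = 0" by simp
  moreover have "q\<^sup>2 * D \<le> 0" using D by (simp add: mult_nonneg_nonpos)
  ultimately have "p\<^sup>2 = 0" "q\<^sup>2 * D = 0" using zero_le_power2[of p] by linarith+
  then show "a = 0" "b = 0" using D pq by auto
qed

lemma subfld_quad: "subfld (quad_field w)"
  unfolding subfld_def
proof (intro conjI ballI)
  have R: "x + y \<in> \<rat>" "x * y \<in> \<rat>" "- x \<in> \<rat>" if "x \<in> \<rat>" "y \<in> \<rat>" for x y :: complex using that by auto
  obtain d where d: "w\<^sup>2 = d" "d \<in> \<rat>" using w2 by (metis Rats_of_rat complex_of_rat)
  show "0 \<in> quad_field w" "1 \<in> quad_field w"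
    unfolding quad_field_def using Rats_0 Rats_1 by (force intro: exI[of _ 0])+
  fix x assume "x \<in> quad_field w"
  then obtain a b where x: "x = a + b * w" "a \<in> \<rat>" "b \<in> \<rat>" unfolding quad_field_def by blast
  show "- x \<in> quad_field w" unfolding quad_field_def x(1) using x(2,3)
    by (intro CollectI exI[of _ "- a"] exI[of _ "- b"]) simp
  show "inverse x \<in> quad_field w"
  proof (cases "x = 0")
    case True
    then show ?thesis using \<open>0 \<in> quad_field w\<close> by simp
  next
    case False
    \<comment> \<open>The norm of \<open>x\<close>, which by \<open>quad_norm\<close> vanishes only
      for \<open>x = 0\<close>, as the square of \<open>w\<close> is negative.\<close>
    define n where "n = a\<^sup>2 - b\<^sup>2 * d"
    have n0: "n \<noteq> 0" using quad_norm[OF x(2,3)] False x(1) d(1) by (auto simp: n_def)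
    have nR: "n \<in> \<rat>" using x d by (simp add: n_def)
    have "(a + b * w) * (a - b * w) = n" unfolding n_def d(1)[symmetric] by Groebner_Basis.algebra
    then have "x * ((a - b * w) / n) = 1" using n0 x(1) by simp
    then have "inverse x = a / n + (- b / n) * w"
      by (metis inverse_unique add_divide_distrib diff_conv_add_uminus minus_divide_left minus_mult_left times_divide_eq_left)
    moreover have "a / n \<in> \<rat>" "- b / n \<in> \<rat>" using x(2,3) nR by (auto intro: Rats_divide)
    ultimately show ?thesis unfolding quad_field_def by blast
  qed
  fix y assume "y \<in> quad_field w"
  then obtain a' b' where y: "y = a' + b' * w" "a' \<in> \<rat>" "b' \<in> \<rat>" unfolding quad_field_def by blast
  show "x + y \<in> quad_field w" unfolding quad_field_def x(1) y(1) using x(2,3) y(2,3)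
    by (intro CollectI exI[of _ "a + a'"] exI[of _ "b + b'"]) (simp add: algebra_simps)
  have "x * y = (a * a' + b * b' * d) + (a * b' + b * a') * w"
    unfolding x(1) y(1) d(1)[symmetric] by Groebner_Basis.algebra
  then show "x * y \<in> quad_field w" unfolding quad_field_def using x(2,3) y(2,3) d(2)
    by (intro CollectI exI[of _ "a * a' + b * b' * d"] exI[of _ "a * b' + b * a'"]) simp
qed

text \<open>The imaginary part of (a + b w)^2 forces \<open>a\<close> or \<open>b\<close> to be
  zero; then 5 would be a square of a rational number or a nonpositive number.\<close>

lemma quad_no_sqrt5: "\<not> (\<exists>r\<in>quad_field w. r\<^sup>2 = 5)"
proof
  assume "\<exists>r\<in>quad_field w. r\<^sup>2 = 5"
  then obtain a b where r: "a \<in> \<rat>" "b \<in> \<rat>" "(a + b * w)\<^sup>2 = 5" unfolding quad_field_def by blast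
  obtain p q where pq: "a = complex_of_real (of_rat p)" "b = complex_of_real (of_rat q)"
    using r Rats_complex by meson
  have "(a + b * w)\<^sup>2 = a\<^sup>2 + b\<^sup>2 * w\<^sup>2 + 2 * a * b * w" by Groebner_Basis.algebra
  then have e: "a\<^sup>2 + b\<^sup>2 * w\<^sup>2 + 2 * a * b * w = 5" using r(3) by simp
  have "Im (a\<^sup>2 + b\<^sup>2 * w\<^sup>2 + 2 * a * b * w) = 2 * of_rat p * of_rat q * Im w"
    unfolding pq w2 by (simp add: power2_eq_square)
  then have "of_rat p * of_rat q = (0 :: real)" using e w_imag by simp
  then have "p = 0 \<or> q = 0" by simp
  moreover have "complex_of_real (of_rat (p\<^sup>2 + q\<^sup>2 * D + 0)) = complex_of_real (of_rat 5)" if "p = 0 \<or> q = 0"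
    using e that unfolding pq w2 by (auto simp: of_rat_add of_rat_mult of_rat_power)
  ultimately have "p\<^sup>2 + q\<^sup>2 * D = 5" by (metis add.right_neutral of_rat_eq_iff of_real_eq_iff)
  then show False using \<open>p = 0 \<or> q = 0\<close> rat_sqrt5 D mult_nonneg_nonpos[of "q\<^sup>2" D]
    by (metis add_0 less_imp_le not_numeral_le_zero add.right_neutral mult_zero_left power_zero_numeral zero_le_power2)
qed

end

lemma rat_adjoin_subfld: "subfld (rat_adjoin \<alpha>)" "\<alpha> \<in> rat_adjoin \<alpha>" "\<rat> \<subseteq> rat_adjoin \<alpha>"
  and rat_adjoin_least: "subfld L \<Longrightarrow> \<alpha> \<in> L \<Longrightarrow> \<rat> \<subseteq> L \<Longrightarrow> rat_adjoin \<alpha> \<subseteq> L"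
proof -
  let ?R = "ring_of_type_algebra :: complex ring"
  interpret R: field ?R by (rule field_from_type_algebra)
  have ops: "\<one>\<^bsub>?R\<^esub> = 1" "\<zero>\<^bsub>?R\<^esub> = 0" "x \<oplus>\<^bsub>?R\<^esub> y = x + y" "x \<otimes>\<^bsub>?R\<^esub> y = x * y" "carrier ?R = UNIV" for x y
    by (simp_all add: ring_of_type_algebra_def)
  have neg: "\<ominus>\<^bsub>?R\<^esub> x = - x" for x
    by (rule R.minus_equality) (simp_all add: ops)
  have inv: "inv\<^bsub>?R\<^esub> x = inverse x" if "x \<noteq> 0" for x
    by (rule R.comm_inv_char) (use that in \<open>simp_all add: ops\<close>)
  have g: "rat_adjoin \<alpha> = generate_field ?R (insert \<alpha> \<rat>)" by (simp add: rat_adjoin_def)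
  note gen = generate_field.intros[where R = ?R and H = "insert \<alpha> \<rat>", unfolded ops, folded g]
  show "\<alpha> \<in> rat_adjoin \<alpha>" "\<rat> \<subseteq> rat_adjoin \<alpha>" using gen(2) by auto
  then have "0 \<in> rat_adjoin \<alpha>" by auto
  then show "subfld (rat_adjoin \<alpha>)"
    unfolding subfld_def using gen neg inv by (metis inverse_zero)
  assume L: "subfld L" "\<alpha> \<in> L" "\<rat> \<subseteq> L"
  show "rat_adjoin \<alpha> \<subseteq> L"
  proof
    fix x assume "x \<in> rat_adjoin \<alpha>"
    then have "x \<in> generate_field ?R (insert \<alpha> \<rat>)" by (simp add: g)
    then show "x \<in> L"
      by (induction rule: generate_field.induct) (use L subfldD[OF L(1)] in \<open>auto simp: ops neg inv\<close>)
  qed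
qed

section \<open>Components of maps of the product\<close>

lemma mob_three_fixed:
  assumes "g \<in> mob UNIV" "g (pt 1 0) = pt 1 0" "g (pt 0 1) = pt 0 1" "g (pt 1 1) = pt 1 1"
  shows "g = id"
proof -
  obtain a b c d where m: "mobm a b c d g" using assms(1) by (rule mob_UNIVE)
  have n: "a \<noteq> 0 \<or> c \<noteq> 0" "b \<noteq> 0 \<or> d \<noteq> 0" "a + b \<noteq> 0 \<or> c + d \<noteq> 0"
    using mobm_nonzero[OF m, of 1 0] mobm_nonzero[OF m, of 0 1] mobm_nonzero[OF m, of 1 1] by auto
  have "pt 1 0 = pt a c" "pt 0 1 = pt b d" "pt 1 1 = pt (a + b) (c + d)"
    using mobm_apply[OF m, of 1 0] mobm_apply[OF m, of 0 1] mobm_apply[OF m, of 1 1] assms(2-4) by auto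
  then have "b = 0" "c = 0" "a = d" using n by (auto simp: pt_eq)
  then show ?thesis using m mobm_scalar by simp
qed

lemma map_prod_eq_id: "map_prod a b = id \<longleftrightarrow> a = id \<and> b = id"
  using map_prod_inject[of a b id id] by (simp add: map_prod.id)

lemma map_prod_fst_det:
  assumes G: "fgrp G" and inj: "\<And>b. map_prod id b \<in> G \<Longrightarrow> b = id" and m: "map_prod a b \<in> G" "map_prod a c \<in> G"
  shows "b = c"
proof -
  have bj: "bij a" "bij b" using bij_map_prodD fgrpD(4)[OF G m(1)] by blast+
  have "finv (map_prod a b) \<circ> map_prod a c = map_prod id (finv b \<circ> c)"
    by (simp add: finv_map_prod bj map_prod.comp inv_o_bij)
  then have "finv b \<circ> c = id" using inj fgrpD(3)[OF G fgrp_inv[OF G m(1)] m(2)] by simp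
  then have "b \<circ> (finv b \<circ> c) = b" by simp
  then show ?thesis using bj by (simp add: o_assoc inv_o_bij)
qed

lemma map_prod_snd_det:
  assumes G: "fgrp G" and inj: "\<And>b. map_prod b id \<in> G \<Longrightarrow> b = id" and m: "map_prod b a \<in> G" "map_prod c a \<in> G"
  shows "b = c"
proof -
  have bj: "bij b" "bij a" using bij_map_prodD fgrpD(4)[OF G m(1)] by blast+
  have "finv (map_prod b a) \<circ> map_prod c a = map_prod (finv b \<circ> c) id"
    by (simp add: finv_map_prod bj map_prod.comp inv_o_bij)
  then have "finv b \<circ> c = id" using inj fgrpD(3)[OF G fgrp_inv[OF G m(1)] m(2)] by simp
  then have "b \<circ> (finv b \<circ> c) = b" by simp
  then show ?thesis using bj by (simp add: o_assoc inv_o_bij)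
qed

lemma fst_part_inj:
  assumes G: "fgrp G" and inj: "\<And>b. map_prod id b \<in> G \<Longrightarrow> b = id"
  shows "card (preserving G) = card (fst_part G)"
proof -
  define r where "r g = (\<lambda>p. fst (g (p, undefined)))" for g :: "'a \<times> 'a \<Rightarrow> 'a \<times> 'a"
  have r: "r (map_prod a b) = a" for a b by (simp add: r_def)
  have "inj_on r (preserving G)"
  proof (rule inj_onI)
    fix f g assume "f \<in> preserving G" "g \<in> preserving G" "r f = r g"
    then obtain a b c where e: "f = map_prod a b" "g = map_prod a c" "f \<in> G" "g \<in> G"
      unfolding preserving_def using r by auto
    have "b = c" by (rule map_prod_fst_det[OF G inj]) (use e in auto)
    then show "f = g" using e by simp
  qed
  moreover have "r ` preserving G = fst_part G"
    unfolding fst_part_def preserving_def using r by (auto simp: image_iff) metis+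
  ultimately show ?thesis using card_image by metis
qed

lemma snd_part_inj:
  assumes G: "fgrp G" and inj: "\<And>b. map_prod b id \<in> G \<Longrightarrow> b = id"
  shows "card (preserving G) = card (snd_part G)"
proof -
  define r where "r g = (\<lambda>p. snd (g (undefined, p)))" for g :: "'a \<times> 'a \<Rightarrow> 'a \<times> 'a"
  have r: "r (map_prod a b) = b" for a b by (simp add: r_def)
  have "inj_on r (preserving G)"
  proof (rule inj_onI)
    fix f g assume "f \<in> preserving G" "g \<in> preserving G" "r f = r g"
    then obtain a b c where e: "f = map_prod a b" "g = map_prod c b" "f \<in> G" "g \<in> G"
      unfolding preserving_def using r by auto
    have "a = c" by (rule map_prod_snd_det[OF G inj]) (use e in auto)
    then show "f = g" using e by simp
  qed
  moreover have "r ` preserving G = snd_part G"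
    unfolding snd_part_def preserving_def using r by (auto simp: image_iff) metis+
  ultimately show ?thesis using card_image by metis
qed

section \<open>Jordan bounds for a quadric in normal form\<close>

context normalized_quadric
begin

lemma good_tp: "good g \<Longrightarrow> \<exists>a b. g = map_prod a b \<or> g = map_prod a b \<circ> prod.swap"
  unfolding good_def by blast

text \<open>If a product map were also a product map after the exchange, its components would be
  constant, against injectivity. So the two descriptions in \<open>good\<close> do not
  overlap.\<close>

lemma good_mob:
  assumes "good (map_prod a b)" shows "a \<in> mob UNIV" "b \<in> mob UNIV"
proof -
  obtain a' b' where ab: "a' \<in> mob UNIV" "b' \<in> mob UNIV"
    "map_prod a b = map_prod a' b' \<or> map_prod a b = map_prod a' b' \<circ> prod.swap"
    using assms unfolding good_def by blast
  have "map_prod a b \<noteq> map_prod a' b' \<circ> prod.swap"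
  proof
    assume e: "map_prod a b = map_prod a' b' \<circ> prod.swap"
    have "a' q = a p" for p q using fun_cong[OF e, of "(p, q)"] by simp
    then have "a' (pt 1 0) = a' (pt 0 1)" by metis
    then have "pt 1 0 = pt 0 1" using mob_bij[OF ab(1)] by (metis inv_apply_bij(1))
    then show False by (simp add: pt_eq)
  qed
  then have "map_prod a b = map_prod a' b'" using ab(3) by blast
  then have "a = a' \<and> b = b'" using map_prod_inject by blast
  then show "a \<in> mob UNIV" "b \<in> mob UNIV" using ab(1,2) by simp_all
qed

lemma parts_mob:
  assumes "\<And>g. g \<in> G \<Longrightarrow> good g"
  shows "fst_part G \<subseteq> mob UNIV" "snd_part G \<subseteq> mob UNIV"
  using assms good_mob unfolding fst_part_def snd_part_def by blast+

text \<open>On the plane section x4 = 0 the two rulings take the same value whatever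
  \<open>\<delta>\<close> is, so the diagonal carries rational points with rational
  components.\<close>

lemma kpt_standard: "subfld L \<Longrightarrow> kpt L (pt 1 0, pt 1 0)" "subfld L \<Longrightarrow> kpt L (pt 0 1, pt 0 1)" "subfld L \<Longrightarrow> kpt L (pt 1 1, pt 1 1)"
proof -
  assume L: "subfld L"
  define V :: "complex \<Rightarrow> complex \<Rightarrow> complex \<Rightarrow> complex ^ 4" where "V a b c = (\<chi> i. if i = 1 then a else if i = 2 then b else if i = 3 then c else 0)" for a b c
  have V: "V a b c $ 1 = a" "V a b c $ 2 = b" "V a b c $ 3 = c" "V a b c $ 4 = 0" for a b c by (simp_all add: V_def)
  have kV: "kvec L (V a b c)" if "a \<in> L" "b \<in> L" "c \<in> L" for a b c
    using that subfldD[OF L] by (simp add: V_def kvec_def)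
  have V0: "V a b c \<noteq> 0" if "a \<noteq> 0 \<or> b \<noteq> 0" for a b c using that V by (metis zero_index)
  show "kpt L (pt 1 0, pt 1 0)" unfolding kpt_def
    using kV[of 1 0 0] subfldD[OF L] V0[of 1 0 0] by (intro exI[of _ "V 1 0 0"]) (simp add: qcone_def lf_def rt_def V)
  show "kpt L (pt 0 1, pt 0 1)" unfolding kpt_def
    using kV[of 0 1 0] subfldD[OF L] V0[of 0 1 0] by (intro exI[of _ "V 0 1 0"]) (simp add: qcone_def lf_def rt_def V)
  show "kpt L (pt 1 1, pt 1 1)" unfolding kpt_def
    using kV[of 1 1 1] subfldD[OF L] V0[of 1 1 1] by (intro exI[of _ "V 1 1 1"]) (simp add: qcone_def lf_def rt_def V)
qed

lemma kpt_rat_pt: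
  assumes "kpt K' p" "K' \<subseteq> L" "subfld L" "\<delta> \<in> L"
  shows "rat_pt L (fst p)" "rat_pt L (snd p)"
proof -
  obtain x where x: "kvec K' x" "x \<noteq> 0" "p = (lf x, rt x)" using assms(1) unfolding kpt_def by blast
  have xL: "x $ i \<in> L" for i using x(1) assms(2) unfolding kvec_def by blast
  then have m: "x $ 3 + \<delta> * x $ 4 \<in> L" "x $ 3 - \<delta> * x $ 4 \<in> L" using subfldD[OF assms(3)] assms(4) by simp_all
  note nz = vec4_nonzero[OF x(2)]
  have r: "rat_pt L (pt a b)" if "a \<in> L" "b \<in> L" "a \<noteq> 0 \<or> b \<noteq> 0" for a b
    using that unfolding rat_pt_def by blast
  show "rat_pt L (fst p)"
  proof (cases "x $ 1 \<noteq> 0 \<or> x $ 3 - \<delta> * x $ 4 \<noteq> 0")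
    case True
    then show ?thesis using r[OF xL m(2)] by (simp add: x(3) lf_def)
  next
    case False
    then have "x $ 3 + \<delta> * x $ 4 \<noteq> 0 \<or> x $ 2 \<noteq> 0" using nz by blast
    from r[OF m(1) xL this] show ?thesis unfolding x(3) lf_def using False by simp
  qed
  show "rat_pt L (snd p)"
  proof (cases "x $ 1 \<noteq> 0 \<or> x $ 3 + \<delta> * x $ 4 \<noteq> 0")
    case True
    then show ?thesis using r[OF xL m(1)] by (simp add: x(3) rt_def)
  next
    case False
    then have "x $ 3 - \<delta> * x $ 4 \<noteq> 0 \<or> x $ 2 \<noteq> 0" using nz by blast
    from r[OF m(2) xL this] show ?thesis unfolding x(3) rt_def using False by simp
  qed
qed

text \<open>On the diagonal the exchange of the factors is invisible, so both components can be
  tested at three diagonal points over \<open>K'\<close>. The images are points over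
  \<open>K'\<close>, and since \<open>\<delta>\<close> lies in \<open>L\<close> their rulings are
  rational over \<open>L\<close>.\<close>

lemma good_mob_L:
  assumes g: "good g" and K': "subfld K'" "K \<subseteq> K'" and L: "subfld L" "K' \<subseteq> L" "\<delta> \<in> L"
    and e: "g = map_prod a b \<or> g = map_prod a b \<circ> prod.swap" and ab: "a \<in> mob UNIV" "b \<in> mob UNIV"
  shows "a \<in> mob L" "b \<in> mob L"
proof -
  have "kpt K' (a p, b p)" if "kpt K' (p, p)" for p
  proof -
    have "kpt K' (g (p, p))" using g that K' unfolding good_def by blast
    then show ?thesis using e by auto
  qed
  then have k: "kpt K' (a (pt 1 0), b (pt 1 0))" "kpt K' (a (pt 0 1), b (pt 0 1))" "kpt K' (a (pt 1 1), b (pt 1 1))"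
    using kpt_standard[OF K'(1)] by blast+
  show "a \<in> mob L"
    by (rule mob_of_rat_pts[OF L(1) ab(1)]) (use kpt_rat_pt(1)[OF k(1) L(2,1,3)] kpt_rat_pt(1)[OF k(2) L(2,1,3)]
      kpt_rat_pt(1)[OF k(3) L(2,1,3)] in simp_all)
  show "b \<in> mob L"
    by (rule mob_of_rat_pts[OF L(1) ab(2)]) (use kpt_rat_pt(2)[OF k(1) L(2,1,3)] kpt_rat_pt(2)[OF k(2) L(2,1,3)]
      kpt_rat_pt(2)[OF k(3) L(2,1,3)] in simp_all)
qed

lemma parts_mob_L:
  assumes G: "\<And>g. g \<in> G \<Longrightarrow> good g" and K': "subfld K'" "K \<subseteq> K'" and L: "subfld L" "K' \<subseteq> L" "\<delta> \<in> L"
  shows "fst_part G \<subseteq> mob L" "snd_part G \<subseteq> mob L"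
proof -
  show "fst_part G \<subseteq> mob L"
  proof
    fix a assume "a \<in> fst_part G"
    then obtain b where b: "map_prod a b \<in> G" by (auto simp: fst_part_def)
    show "a \<in> mob L" by (rule good_mob_L(1)[OF G[OF b] K' L disjI1[OF refl] good_mob[OF G[OF b]]])
  qed
  show "snd_part G \<subseteq> mob L"
  proof
    fix b assume "b \<in> snd_part G"
    then obtain a where a: "map_prod a b \<in> G" by (auto simp: snd_part_def)
    show "b \<in> mob L" by (rule good_mob_L(2)[OF G[OF a] K' L disjI1[OF refl] good_mob[OF G[OF a]]])
  qed
qed

lemma jordan_7200: "jordan_constant (aut_group K Z) \<le> enat 7200"
proof (rule jordan_constant_le)
  fix G assume G: "fgrp G" "\<And>g. g \<in> G \<Longrightarrow> good g"
  have "jordan_le G (2 * 60 * 60)"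
    by (rule jordan_le_wreath[OF G(1) good_tp[OF G(2)]])
      (use mob_jordan_60 fgrp_parts[OF G(1)] parts_mob[of G] G(2) in blast)+
  then show "jordan_le G 7200" by simp
qed

lemma jordan_8_real:
  assumes "K \<subseteq> \<real>" "\<delta> \<in> \<real>"
  shows "jordan_constant (aut_group K Z) \<le> enat 8"
proof (rule jordan_constant_le)
  fix G assume G: "fgrp G" "\<And>g. g \<in> G \<Longrightarrow> good g"
  have P: "fst_part G \<subseteq> mob \<real>" "snd_part G \<subseteq> mob \<real>"
    using parts_mob_L[OF G(2) K subset_refl subfld_Reals assms] by blast+
  have "jordan_le G (2 * 2 * 2)"
    by (rule jordan_le_wreath[OF G(1) good_tp[OF G(2)]])
      (use mob_real_jordan_2 fgrp_parts[OF G(1)] P in blast)+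
  then show "jordan_le G 8" by simp
qed

text \<open>For imaginary \<open>\<delta>\<close>, conjugation exchanges the factors x3 + \<delta>
  x4 and x3 - \<delta> x4 and with them the rulings. The real points thus form a sphere, embedded
  into the product as the graph of \<open>cj\<close>.\<close>

lemma kpt_real_iff:
  assumes \<delta>r: "\<delta> = \<i> * complex_of_real r"
  shows "kpt \<real> (p, q) \<longleftrightarrow> q = cj p"
proof
  have r0: "r \<noteq> 0" using \<delta>0 \<delta>r by auto
  assume "kpt \<real> (p, q)"
  then obtain x where x: "kvec \<real> x" "x \<noteq> 0" "qcone d x" "p = lf x" "q = rt x" unfolding kpt_def by auto
  have re: "cnj (x $ i) = x $ i" for i using x(1) unfolding kvec_def by (simp add: Reals_cnj_iff)
  have c\<delta>: "cnj (\<delta> * x $ 4) = - (\<delta> * x $ 4)" using re[of 4] by (simp add: \<delta>r)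
  have uv: "cnj (x $ 3 - \<delta> * x $ 4) = x $ 3 + \<delta> * x $ 4" "cnj (x $ 3 + \<delta> * x $ 4) = x $ 3 - \<delta> * x $ 4"
    using re[of 3] c\<delta> by simp_all
  then have "x $ 3 - \<delta> * x $ 4 \<noteq> 0 \<longleftrightarrow> x $ 3 + \<delta> * x $ 4 \<noteq> 0" by (metis complex_cnj_zero_iff)
  then show "q = cj p" unfolding x(4,5) lf_def rt_def using uv re by auto
next
  assume q: "q = cj p"
  have r0: "r \<noteq> 0" using \<delta>0 \<delta>r by auto
  obtain a b where p: "a \<noteq> 0 \<or> b \<noteq> 0" "p = pt a b" by (rule pt_surj[of p])
  let ?x = "sv a b (cnj a) (cnj b)"
  have nz: "cnj a \<noteq> 0 \<or> cnj b \<noteq> 0" using p(1) by simp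
  define t where "t = Im (a * cnj b)"
  \<comment> \<open>This difference is imaginary, so its quotient by the imaginary
    \<open>\<delta>\<close>, the fourth coordinate, is real.\<close>
  have "a * cnj b - b * cnj a = complex_of_real (2 * t) * \<i>"
    using complex_diff_cnj[of "a * cnj b"] unfolding t_def[symmetric] by (simp add: mult.commute)
  then have "(a * cnj b - b * cnj a) / (2 * \<delta>) = complex_of_real (t / r)"
    using r0 by (simp add: \<delta>r)
  moreover have "(a * cnj b + b * cnj a) / 2 = complex_of_real (Re (a * cnj b))"
    using complex_add_cnj[of "a * cnj b"] by (simp add: mult.commute)
  moreover have "a * cnj a \<in> \<real>" "b * cnj b \<in> \<real>" by (simp_all add: complex_mult_cnj)
  ultimately have "kvec \<real> ?x" unfolding kvec_def forall_4 sv_nth by (metis Reals_of_real)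
  then show "kpt \<real> (p, q)" unfolding kpt_def q p(2) cj_pt
    using sv_nonzero[OF p(1) nz] qcone_sv lf_rt_sv[OF p(1) nz] by (intro exI[of _ ?x]) simp
qed

text \<open>An automorphism acts on the sphere of real points, and \<open>\<phi>\<close> is this
  action seen in the first component: a Moebius map if the rulings are preserved, an antiholomorphic
  map if they are exchanged. The action determines the automorphism, so the bounds of
  \<open>jordan_le_mob_amob\<close> carry over. \<open>L\<close> is a field that contains
  \<open>\<delta>\<close>, hence the coefficients of the Moebius maps.\<close>

lemma jordan_nonsplit_real:
  assumes \<delta>r: "\<delta> = \<i> * complex_of_real r" and KR: "K \<subseteq> \<real>" and L: "subfld L" "K \<subseteq> L" "\<delta> \<in> L"
  shows "jordan_constant (aut_group K Z) \<le> enat 60"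
    "\<not> (\<exists>r\<in>L. r\<^sup>2 = 5) \<Longrightarrow> jordan_constant (aut_group K Z) \<le> enat 6"
proof -
  define \<phi> where "\<phi> g = (\<lambda>p. fst (g (p, cj p)))" for g :: "cp1 \<times> cp1 \<Rightarrow> cp1 \<times> cp1"
  have kp: "g (p, cj p) = (\<phi> g p, cj (\<phi> g p))" if "good g" for g p
  proof -
    have "kpt \<real> (p, cj p)" using kpt_real_iff[OF \<delta>r] by blast
    then have "kpt \<real> (g (p, cj p))" using that KR subfld_Reals unfolding good_def by blast
    then show ?thesis using kpt_real_iff[OF \<delta>r] by (metis \<phi>_def prod.collapse)
  qed
  have form: "\<exists>a. a \<in> mob L \<and> ((\<phi> g = a \<and> g = map_prod a (cj \<circ> a \<circ> cj)) \<or>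
      (\<phi> g = a \<circ> cj \<and> g = map_prod a (cj \<circ> a \<circ> cj) \<circ> prod.swap))" if g: "good g" for g
  proof -
    obtain a b where ab: "a \<in> mob UNIV" "b \<in> mob UNIV" "g = map_prod a b \<or> g = map_prod a b \<circ> prod.swap"
      using g unfolding good_def by blast
    have aL: "a \<in> mob L" by (rule good_mob_L(1)[OF g K subset_refl L ab(3) ab(1,2)])
    from ab(3) show ?thesis
    proof
      assume e: "g = map_prod a b"
      have "\<phi> g = a" by (simp add: \<phi>_def e)
      moreover have "b q = cj (a (cj q))" for q
        using kp[OF g, of "cj q"] unfolding \<open>\<phi> g = a\<close> by (simp add: e)
      then have "b = cj \<circ> a \<circ> cj" by (simp add: fun_eq_iff)
      ultimately show ?thesis using aL e by blast
    next
      assume e: "g = map_prod a b \<circ> prod.swap"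
      have "\<phi> g = a \<circ> cj" by (simp add: \<phi>_def e fun_eq_iff)
      moreover have "b q = cj (a (cj q))" for q
        using kp[OF g, of q] unfolding \<open>\<phi> g = a \<circ> cj\<close> by (simp add: e)
      then have "b = cj \<circ> a \<circ> cj" by (simp add: fun_eq_iff)
      ultimately show ?thesis using aL e by blast
    qed
  qed
  have LU: "a \<in> mob L \<Longrightarrow> a \<in> mob UNIV" for a using mob_mono[of L UNIV] by blast
  have acj: "a \<circ> cj \<in> amob" if "a \<in> mob L" for a using LU[OF that] by (simp add: amob_def comp_assoc)
  have J: "jordan_le G 60 \<and> (\<not> (\<exists>r\<in>L. r\<^sup>2 = 5) \<longrightarrow> jordan_le G 6)" if G: "fgrp G" "\<And>g. g \<in> G \<Longrightarrow> good g" for G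
  proof -
    have hom: "\<phi> (f \<circ> g) = \<phi> f \<circ> \<phi> g" if "f \<in> G" "g \<in> G" for f g
    proof
      fix p
      have "\<phi> (f \<circ> g) p = fst (f (\<phi> g p, cj (\<phi> g p)))" unfolding \<phi>_def[of "f \<circ> g"] using kp[OF G(2)[OF that(2)]] by simp
      then show "\<phi> (f \<circ> g) p = (\<phi> f \<circ> \<phi> g) p" by (simp add: \<phi>_def[of f])
    qed
    have mem: "\<phi> g \<in> mob UNIV \<union> amob" "\<phi> g \<in> mob UNIV \<Longrightarrow> \<phi> g \<in> mob L" if "g \<in> G" for g
      using form[OF G(2)[OF that]] LU acj mob_amob_disjoint by (metis UnI1 UnI2)+
    have bij: "bij (\<phi> g)" if "g \<in> G" for g using mem(1)[OF that] mob_bij amob_bij by blast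
    have inj: "f = g" if fg: "good f" "good g" "\<phi> f = \<phi> g" for f g
    proof -
      obtain a where a: "a \<in> mob L" "(\<phi> f = a \<and> f = map_prod a (cj \<circ> a \<circ> cj)) \<or> (\<phi> f = a \<circ> cj \<and> f = map_prod a (cj \<circ> a \<circ> cj) \<circ> prod.swap)"
        using form[OF fg(1)] by blast
      obtain b where b: "b \<in> mob L" "(\<phi> g = b \<and> g = map_prod b (cj \<circ> b \<circ> cj)) \<or> (\<phi> g = b \<circ> cj \<and> g = map_prod b (cj \<circ> b \<circ> cj) \<circ> prod.swap)"
        using form[OF fg(2)] by blast
      have 1: "x \<noteq> y \<circ> cj" if "x \<in> mob L" "y \<in> mob L" for x y
        using acj[OF that(2)] LU[OF that(1)] mob_amob_disjoint by blast
      have 2: "x = y" if "x \<circ> cj = y \<circ> cj" for x y :: "cp1 \<Rightarrow> cp1"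
      proof -
        have "(x \<circ> cj) \<circ> cj = (y \<circ> cj) \<circ> cj" using that by simp
        then show ?thesis by (simp add: comp_assoc)
      qed
      show ?thesis using a(2) b(2) fg(3) 1[OF a(1) b(1)] 1[OF b(1) a(1)] 2 by metis
    qed
    have comm: "f \<circ> g = g \<circ> f" if "f \<in> G" "g \<in> G" "\<phi> f \<circ> \<phi> g = \<phi> g \<circ> \<phi> f" for f g
      using that hom G(2) fgrpD(3)[OF G(1)] by (intro inj) simp_all
    have E: "fgrp (\<phi> ` G)" "\<phi> ` G \<subseteq> mob UNIV \<union> amob" using fgrp_image[of G \<phi>, OF G(1) hom bij] mem(1) by blast+
    have EL: "e \<in> mob L" if "e \<in> \<phi> ` G" "e \<in> mob UNIV" for e using that mem(2) by blast
    note JE = jordan_le_mob_amob[OF E L(1) EL]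
    show ?thesis
      using jordan_le_preimage[of G \<phi>, OF G(1) hom bij JE(1) comm]
        jordan_le_preimage[of G \<phi>, OF G(1) hom bij JE(2) comm] by blast
  qed
  show "jordan_constant (aut_group K Z) \<le> enat 60" using J by (intro jordan_constant_le) blast
  assume "\<not> (\<exists>r\<in>L. r\<^sup>2 = 5)"
  then show "jordan_constant (aut_group K Z) \<le> enat 6" using J by (intro jordan_constant_le) blast
qed

lemma split_no_sqrt5:
  assumes "\<delta> \<in> K" "\<not> (\<exists>r\<in>K. r\<^sup>2 = 5)"
  shows "jordan_constant (aut_group K Z) \<le> enat 72"
proof (rule jordan_constant_le)
  fix G assume G: "fgrp G" "\<And>g. g \<in> G \<Longrightarrow> good g"
  have P: "fst_part G \<subseteq> mob K" "snd_part G \<subseteq> mob K"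
    using parts_mob_L[OF G(2) K subset_refl K subset_refl assms(1)] by blast+
  have "jordan_le A 6" if "fgrp A" "A \<subseteq> mob K" for A
  proof (rule mob_jordan_6[OF that(1)])
    show "A \<subseteq> mob UNIV" using that(2) mob_mono[of K UNIV] by blast
    show "g = id" if "g \<in> A" "g ^^ 5 = id" for g
      using that \<open>A \<subseteq> mob K\<close> order_five_sqrt5[OF K] assms(2) by blast
  qed
  then have "jordan_le G (2 * 6 * 6)"
    by (intro jordan_le_wreath[OF G(1) good_tp[OF G(2)]]) (use fgrp_parts[OF G(1)] P in blast)+
  then show "jordan_le G 72" by simp
qed

text \<open>If one ruling of a point over \<open>K\<close> is rational over \<open>K\<close>,
  clearing denominators gives an equation u = \<delta> y with u in \<open>K\<close> and y equal to
  x4 or -x4. As \<open>\<delta>\<close> is not in \<open>K\<close>, this forces x4 = 0, where the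
  two rulings coincide.\<close>

lemma kpt_rational_diag:
  assumes \<delta>K: "\<delta> \<notin> K" and ab: "a \<in> K" "b \<in> K" "a \<noteq> 0 \<or> b \<noteq> 0"
  shows "kpt K (pt a b, q) \<Longrightarrow> q = pt a b" "kpt K (q, pt a b) \<Longrightarrow> q = pt a b"
proof -
  have lin: "y = 0" if "u \<in> K" "y \<in> K" "u = \<delta> * y" for u y
  proof (rule ccontr)
    assume "y \<noteq> 0"
    then have "\<delta> = u / y" using that(3) by (simp add: field_simps)
    then show False using \<delta>K subfldD(8)[OF K that(1,2)] by simp
  qed
  have main: "x $ 4 = 0" if x: "kvec K x" "x \<noteq> 0" "qcone d x" and e: "lf x = pt a b \<or> rt x = pt a b" for x
  proof -
    have xK: "x $ i \<in> K" for i using x(1) by (simp add: kvec_def)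
    have c: "x $ 1 * x $ 2 = (x $ 3 + \<delta> * x $ 4) * (x $ 3 - \<delta> * x $ 4)" using x(3) by (simp add: qcone_iff)
    \<comment> \<open>The sign of \<open>y\<close> allows both rulings to be treated at
      once.\<close>
    have key: "y = 0" if y: "y = x $ 4 \<or> y = - x $ 4" and
      pe: "x $ 1 \<noteq> 0 \<or> x $ 3 - \<delta> * y \<noteq> 0" "pt (x $ 1) (x $ 3 - \<delta> * y) = pt a b" for y
    proof -
      have yK: "y \<in> K" using y xK subfldD[OF K] by auto
      have cr: "x $ 1 * b = (x $ 3 - \<delta> * y) * a" using pt_eq[OF pe(1) ab(3)] pe(2) by blast
      show ?thesis
      proof (cases "a = 0")
        case False
        then have "x $ 3 - x $ 1 * b / a = \<delta> * y" using cr by (simp add: field_simps)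
        moreover have "x $ 3 - x $ 1 * b / a \<in> K"
          by (rule subfldD(7)[OF K xK subfldD(8)[OF K subfldD(4)[OF K xK ab(2)] ab(1)]])
        ultimately show ?thesis using lin yK by blast
      next
        case True
        then have x1: "x $ 1 = 0" "x $ 3 - \<delta> * y \<noteq> 0" using cr ab(3) pe(1) by auto
        have "x $ 1 * x $ 2 = (x $ 3 + \<delta> * y) * (x $ 3 - \<delta> * y)"
          using y c by (elim disjE) (simp_all add: mult.commute)
        then have "(x $ 3 + \<delta> * y) * (x $ 3 - \<delta> * y) = 0" using x1(1) by simp
        then have "x $ 3 + \<delta> * y = 0" using x1(2) by simp
        then have "- x $ 3 = \<delta> * y" by (rule minus_unique)
        then show ?thesis using lin yK subfldD(5)[OF K xK[of 3]] by blast
      qed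
    qed
    show ?thesis
    proof (cases "x $ 1 \<noteq> 0 \<or> (x $ 3 - \<delta> * x $ 4 \<noteq> 0 \<and> x $ 3 + \<delta> * x $ 4 \<noteq> 0)")
      case True
      from e show ?thesis
      proof
        assume "lf x = pt a b"
        then show ?thesis using key[of "x $ 4"] True by (auto simp: lf_def)
      next
        assume "rt x = pt a b"
        then show ?thesis using key[of "- x $ 4"] True by (auto simp: rt_def)
      qed
    next
      case False
      \<comment> \<open>Here a ruling may be given by its second ratio, but one of the linear
        factors vanishes and yields the equation directly.\<close>
      then have "x $ 3 = \<delta> * x $ 4 \<or> - x $ 3 = \<delta> * x $ 4" by (auto simp: add_eq_0_iff2 minus_equation_iff)
      then show ?thesis using lin[of "x $ 3" "x $ 4"] lin[of "- x $ 3" "x $ 4"] xK subfldD(5)[OF K xK[of 3]] by blast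
    qed
  qed
  have same: "lf x = rt x" if "x $ 4 = 0" for x using that by (simp add: lf_def rt_def)
  show "kpt K (pt a b, q) \<Longrightarrow> q = pt a b" using main same unfolding kpt_def by (metis Pair_inject)
  show "kpt K (q, pt a b) \<Longrightarrow> q = pt a b" using main same unfolding kpt_def by (metis Pair_inject)
qed

text \<open>If one component is trivial, the three standard points of the diagonal go to points with
  a rational component; so the other component fixes three points and is trivial. Hence the order of
  \<open>G\<close> is at most twice that of either projection, which gives 120 when one of these is
  at most 60. Otherwise both projections have abelian normal subgroups of index at most two, and the
  wreath bound 8 applies.\<close>

lemma jordan_120_nonsplit:
  assumes "\<delta> \<notin> K"
  shows "jordan_constant (aut_group K Z) \<le> enat 120"
proof (rule jordan_constant_le)
  fix G assume G: "fgrp G" "\<And>g. g \<in> G \<Longrightarrow> good g"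
  note U = parts_mob[of G, OF G(2)]
  note FP = fgrp_parts[OF G(1)]
  have std: "(0 :: complex) \<in> K" "(1 :: complex) \<in> K" using subfldD[OF K] by auto
  note diag = kpt_rational_diag[OF assms std(2,1)] kpt_rational_diag[OF assms std] kpt_rational_diag[OF assms std(2,2)]
  have i1: "b = id" if b: "map_prod id b \<in> G" for b
  proof -
    have k: "kpt K (p, b p)" if "kpt K (p, p)" for p
    proof -
      have "kpt K (map_prod id b (p, p))" using G(2)[OF b] that K unfolding good_def by blast
      then show ?thesis by simp
    qed
    have "b \<in> mob UNIV" using good_mob(2)[OF G(2)[OF b]] .
    then show ?thesis
      using mob_three_fixed[of b] k[OF kpt_standard(1)[OF K]] k[OF kpt_standard(2)[OF K]] k[OF kpt_standard(3)[OF K]]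
        diag(1,3,5) by simp
  qed
  have i2: "b = id" if b: "map_prod b id \<in> G" for b
  proof -
    have k: "kpt K (b p, p)" if "kpt K (p, p)" for p
    proof -
      have "kpt K (map_prod b id (p, p))" using G(2)[OF b] that K unfolding good_def by blast
      then show ?thesis by simp
    qed
    have "b \<in> mob UNIV" using good_mob(1)[OF G(2)[OF b]] .
    then show ?thesis
      using mob_three_fixed[of b] k[OF kpt_standard(1)[OF K]] k[OF kpt_standard(2)[OF K]] k[OF kpt_standard(3)[OF K]]
        diag(2,4,6) by simp
  qed
  have c: "card G \<le> 2 * card (fst_part G)" "card G \<le> 2 * card (snd_part G)"
    using card_le_preserving[OF G(1) good_tp[OF G(2)]] fst_part_inj[OF G(1) i1] snd_part_inj[OF G(1) i2] by auto
  show "jordan_le G 120"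
  proof (cases "card (fst_part G) \<le> 60 \<or> card (snd_part G) \<le> 60")
    case True
    then have "card G \<le> 120" using c by linarith
    then show ?thesis by (rule jordan_le_mono[OF jordan_le_card[OF G(1)]])
  next
    case False
    then have "jordan_le (fst_part G) 2" "jordan_le (snd_part G) 2"
      using mob_card_or_jordan_2[OF FP(1) U(1)] mob_card_or_jordan_2[OF FP(2) U(2)] by auto
    note J = this
    have "jordan_le G (2 * 2 * 2)"
      by (rule jordan_le_wreath[OF G(1) good_tp[OF G(2)]]) (use J in blast)+
    then show ?thesis by (rule jordan_le_mono) simp
  qed
qed

end

section \<open>Upper bounds over the individual fields\<close>

lemma normalized_quadric_exists:
  assumes "subfld K" "smooth_quadric_surface K Z" "rational_surface_over K Z"
  obtains T T' d where "normalized_quadric K Z T T' d (csqrt d)"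
proof -
  obtain T T' d where "normal_quadric K Z T T' d" using smooth_rational_normal_form[OF assms] .
  then show ?thesis using that assms(1) by (simp add: normalized_quadric_def)
qed

lemma upper_UNIV:
  assumes "smooth_quadric_surface (UNIV :: complex set) Z" "rational_surface_over UNIV Z"
  shows "jordan_constant (aut_group UNIV Z) \<le> enat 7200"
  using normalized_quadric_exists[OF subfld_UNIV assms] normalized_quadric.jordan_7200 by metis

lemma real_sqrt_cases:
  assumes "d \<in> \<real>"
  shows "(csqrt d \<in> \<real>) \<or> (\<exists>r. csqrt d = \<i> * complex_of_real r \<and> Re d < 0)"
proof (cases "Re d \<ge> 0")
  case True
  then show ?thesis using assms by (auto simp: csqrt_of_real_nonneg complex_is_Real_iff)
next
  case False
  then have "csqrt d = \<i> * complex_of_real (sqrt (\<bar>Re d\<bar>))"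
    using assms by (intro csqrt_of_real_nonpos) (auto simp: complex_is_Real_iff)
  then show ?thesis using False by auto
qed

lemma upper_Reals:
  assumes "smooth_quadric_surface (\<real> :: complex set) Z" "rational_surface_over \<real> Z"
  shows "jordan_constant (aut_group \<real> Z) \<le> enat 60"
proof -
  obtain T T' d where "normalized_quadric \<real> Z T T' d (csqrt d)" using normalized_quadric_exists[OF subfld_Reals assms] .
  then interpret normalized_quadric \<real> Z T T' d "csqrt d" .
  from real_sqrt_cases[OF TK(3)] show ?thesis
  proof
    assume "csqrt d \<in> \<real>"
    then have "jordan_constant (aut_group \<real> Z) \<le> enat 8" by (intro jordan_8_real) auto
    then show ?thesis by (rule order_trans) simp
  next
    assume "\<exists>r. csqrt d = \<i> * complex_of_real r \<and> Re d < 0"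
    then show ?thesis using jordan_nonsplit_real(1)[OF _ subset_refl subfld_UNIV] by blast
  qed
qed

text \<open>For positive \<open>d\<close> the square root is real, though perhaps irrational, and
  the real bound 8 applies. For negative \<open>d\<close> the quadratic field has no square root of
  5, and the sphere gives the smaller bound 6.\<close>

lemma upper_Rats:
  assumes "smooth_quadric_surface (\<rat> :: complex set) Z" "rational_surface_over \<rat> Z"
  shows "jordan_constant (aut_group \<rat> Z) \<le> enat 8"
proof -
  obtain T T' d where "normalized_quadric \<rat> Z T T' d (csqrt d)" using normalized_quadric_exists[OF subfld_Rats assms] .
  then interpret normalized_quadric \<rat> Z T T' d "csqrt d" .
  have RR: "(\<rat> :: complex set) \<subseteq> \<real>" 
  proof
    fix z :: complex assume "z \<in> \<rat>"
    then obtain q where "z = complex_of_real (of_rat q)" using Rats_complex by blast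
    then show "z \<in> \<real>" by (simp only: Reals_of_real)
  qed
  then have "d \<in> \<real>" using TK(3) by blast
  from real_sqrt_cases[OF this] show ?thesis
  proof
    assume "csqrt d \<in> \<real>"
    then show ?thesis by (rule jordan_8_real[OF RR])
  next
    assume "\<exists>r. csqrt d = \<i> * complex_of_real r \<and> Re d < 0"
    then obtain r where r: "csqrt d = \<i> * complex_of_real r" "Re d < 0" by blast
    obtain D where D: "d = complex_of_real (of_rat D)" using Rats_complex[OF TK(3)] by blast
    have "D < 0" using r(2) unfolding D by simp
    then interpret imag_quad "csqrt d" D
    proof unfold_locales
      show "(csqrt d)\<^sup>2 = complex_of_real (of_rat D)" using power2_csqrt[of d] D by (rule HOL.trans)
    qed
    have "\<rat> \<subseteq> quad_field (csqrt d)" "csqrt d \<in> quad_field (csqrt d)"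
      unfolding quad_field_def using Rats_0 Rats_1 by force+
    then have "jordan_constant (aut_group \<rat> Z) \<le> enat 6"
      by (intro jordan_nonsplit_real(2)[OF r(1) RR subfld_quad] quad_no_sqrt5)
    then show ?thesis by (rule order_trans) simp
  qed
qed

text \<open>The value 120 comes from the quadrics whose rulings are not defined over
  \<open>K\<close>; the others stay below it with 72 = 2 * 6 * 6.\<close>

lemma upper_quad:
  assumes "subfld K" "\<not> (\<exists>r\<in>K. r\<^sup>2 = 5)" "smooth_quadric_surface K Z" "rational_surface_over K Z"
  shows "jordan_constant (aut_group K Z) \<le> enat 120"
proof -
  obtain T T' d where "normalized_quadric K Z T T' d (csqrt d)" using normalized_quadric_exists[OF assms(1,3,4)] .
  then interpret normalized_quadric K Z T T' d "csqrt d" .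
  show ?thesis
  proof (cases "csqrt d \<in> K")
    case True
    then have "jordan_constant (aut_group K Z) \<le> enat 72" by (rule split_no_sqrt5[OF _ assms(2)])
    then show ?thesis by (rule order_trans) simp
  next
    case False
    then show ?thesis by (rule jordan_120_nonsplit)
  qed
qed

lemma rat_adjoin_no_sqrt5:
  assumes "\<alpha>\<^sup>2 = complex_of_real (of_rat D)" "D < 0"
  shows "\<not> (\<exists>r\<in>rat_adjoin \<alpha>. r\<^sup>2 = 5)"
proof -
  interpret imag_quad \<alpha> D using assms by unfold_locales
  have "\<rat> \<subseteq> quad_field \<alpha>" "\<alpha> \<in> quad_field \<alpha>" unfolding quad_field_def using Rats_0 Rats_1 by force+
  then have "rat_adjoin \<alpha> \<subseteq> quad_field \<alpha>" by (intro rat_adjoin_least subfld_quad)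
  then show ?thesis using quad_no_sqrt5 by blast
qed

section \<open>Lower bounds\<close>

lemma hpoly_vec_homog:
  fixes F :: "complex ^ 'n::finite \<Rightarrow> complex ^ 'm::finite"
  assumes "\<And>i. hpoly K n (\<lambda>x. F x $ i)" shows "F (c *s x) = c ^ n *s F x"
  using hpoly_homog[OF assms] by (simp add: vec_eq_iff)

text \<open>For homogeneous \<open>F\<close> the chosen representative does not influence the value,
  see the lemma of the same name.\<close>

definition proj_map :: "(complex ^ 'n \<Rightarrow> complex ^ 'm) \<Rightarrow> (complex ^ 'n) set \<Rightarrow> (complex ^ 'm) set" where
  "proj_map F p = proj_point (F (SOME v. v \<in> p))"

lemma proj_map:
  fixes F :: "complex ^ 'n::finite \<Rightarrow> complex ^ 'm::finite"
  assumes "\<And>i. hpoly K n (\<lambda>x. F x $ i)" shows "proj_map F (proj_point v) = proj_point (F v)"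
proof -
  have "(SOME w. w \<in> proj_point v) \<in> proj_point v" using proj_point_self by (rule someI)
  then obtain c where c: "c \<noteq> 0" "(SOME w. w \<in> proj_point v) = c *s v" using proj_pointD by blast
  have "F (c *s v) = c ^ n *s F v" by (rule hpoly_vec_homog[OF assms])
  then show ?thesis unfolding proj_map_def c(2) using proj_point_scale[of "c ^ n"] c(1) by simp
qed

context normalized_quadric
begin

text \<open>Stereographic projection from the point (1 : 0 : 0 : 0) of the cone. It is an
  isomorphism from the part of the quadric with nonzero second normal coordinate onto the affine
  plane in which the first coordinate is nonzero.\<close>

lemma rational: "rational_surface_over K Z"
proof -
  define F :: "complex ^ 4 \<Rightarrow> complex ^ 3" where
    "F x = (\<chi> i. if i = 1 then (T' *v x) $ 2 else if i = 2 then (T' *v x) $ 3 else (T' *v x) $ 4)" for x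
  define G0 :: "complex ^ 3 \<Rightarrow> complex ^ 4" where
    "G0 u = (\<chi> i. if i = 1 then (u $ 2)\<^sup>2 - d * (u $ 3)\<^sup>2 else if i = 2 then (u $ 1)\<^sup>2
       else if i = 3 then u $ 1 * u $ 2 else u $ 1 * u $ 3)" for u
  define G where "G u = T *v G0 u" for u
  have F: "F x $ 1 = (T' *v x) $ 2" "F x $ 2 = (T' *v x) $ 3" "F x $ 3 = (T' *v x) $ 4" for x by (simp_all add: F_def)
  have G0: "G0 u $ 1 = (u $ 2)\<^sup>2 - d * (u $ 3)\<^sup>2" "G0 u $ 2 = (u $ 1)\<^sup>2" "G0 u $ 3 = u $ 1 * u $ 2" "G0 u $ 4 = u $ 1 * u $ 3" for u
    by (simp_all add: G0_def)
  have hpT: "hpoly K 1 (\<lambda>x. (T' *v x) $ i)" for i by (rule hpoly_linear[OF TK(2)])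
  have "\<forall>i. hpoly K 1 (\<lambda>x. F x $ i)" unfolding forall_3 F using hpT by blast
  then have hpF: "hpoly K 1 (\<lambda>x. F x $ i)" for i by blast
  have co: "hpoly K 2 (\<lambda>u :: complex ^ 3. u $ i * u $ j)" for i j
    using hpoly_mult[OF hpoly_coord hpoly_coord, of K i j] by (simp add: numeral_2_eq_2)
  have "hpoly K 2 (\<lambda>u :: complex ^ 3. u $ 2 * u $ 2 - d * (u $ 3 * u $ 3))"
    by (intro hpoly_diff[OF K] hpoly_cmult TK co)
  then have "\<forall>i. hpoly K 2 (\<lambda>u. G0 u $ i)" unfolding forall_4 G0 power2_eq_square using co by blast
  then have hpG0: "hpoly K 2 (\<lambda>u. G0 u $ i)" for i by blast
  have hpG: "hpoly K 2 (\<lambda>u. G u $ i)" for i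
    unfolding G_def using hpoly_comp[OF hpoly_linear[OF TK(1)] hpG0, of i] by simp
  have coneG: "qcone d (G0 u)" for u unfolding qcone_def G0 by Groebner_Basis.algebra
  define U where "U = {p \<in> Z. \<forall>v\<in>p. (T' *v v) $ 2 \<noteq> 0}"
  define V where "V = {p \<in> (proj_space :: (complex ^ 3) set set). \<forall>v\<in>p. v $ 1 \<noteq> 0}"
  have hom2: "(T' *v (c *s v)) $ 2 = c * (T' *v v) $ 2" for c v using hpoly_homog[OF hpT, of c v 2] by simp
  have Upt: "proj_point (T *v x) \<in> U" if "x \<noteq> 0" "qcone d x" "x $ 2 \<noteq> 0" for x
    unfolding U_def Z using that TT hom2 by (auto dest!: proj_pointD)
  have Vpt: "proj_point u \<in> V" if "u $ 1 \<noteq> 0" for u :: "complex ^ 3"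
  proof -
    have "u \<noteq> 0" using that by auto
    then show ?thesis unfolding V_def proj_space_def using that by (auto dest!: proj_pointD)
  qed
  have UE: "\<exists>x. w = T *v x \<and> x \<noteq> 0 \<and> qcone d x \<and> x $ 2 \<noteq> 0" if w: "w \<in> \<Union>U" for w
  proof -
    have "w \<in> \<Union>Z" using w by (auto simp: U_def)
    then obtain x where x: "w = T *v x" "x \<noteq> 0" "qcone d x" unfolding UZ by blast
    from w have "(T' *v w) $ 2 \<noteq> 0" by (auto simp: U_def)
    then have "x $ 2 \<noteq> 0" using x(1) TT by simp
    then show ?thesis using x by blast
  qed
  have VE: "u $ 1 \<noteq> 0" if "u \<in> \<Union>V" for u using that by (auto simp: V_def)
  have FT: "F (T *v x) $ 1 = x $ 2" "F (T *v x) $ 2 = x $ 3" "F (T *v x) $ 3 = x $ 4" for x by (simp_all add: F TT)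
  have G00: "G0 u \<noteq> 0" if "u $ 1 \<noteq> 0" for u using G0(2)[of u] that by (metis zero_index power_eq_0_iff)
  let ?f = "proj_map F" and ?g = "proj_map G"
  note f = proj_map[OF hpF] and g = proj_map[OF hpG]
  have zU: "zariski_open_in K Z U"
    unfolding zariski_open_in_def
    by (rule exI[of _ "{\<lambda>x. (T' *v x) $ 2}"]) (use hpT homog_polys_hpoly[OF K] in \<open>auto simp: U_def\<close>)
  have zV: "zariski_open_in K (proj_space :: (complex ^ 3) set set) V"
    unfolding zariski_open_in_def
    by (rule exI[of _ "{\<lambda>x. x $ 1}"]) (use hpoly_coord[of K 1] homog_polys_hpoly[OF K] in \<open>auto simp: V_def\<close>)
  have Uform: "\<exists>x. p = proj_point (T *v x) \<and> x \<noteq> 0 \<and> qcone d x \<and> x $ 2 \<noteq> 0" if p: "p \<in> U" for p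
  proof -
    obtain x where x: "p = proj_point (T *v x)" "x \<noteq> 0" "qcone d x" using p by (auto simp: U_def Z)
    have "T *v x \<in> p" using x(1) proj_point_self by simp
    then have "x $ 2 \<noteq> 0" using p TT(2)[of x] by (auto simp: U_def)
    then show ?thesis using x by blast
  qed
  have Vform: "\<exists>u. p = proj_point u \<and> u $ 1 \<noteq> 0" if p: "p \<in> V" for p
  proof -
    obtain u where "p = proj_point u" using p by (auto simp: V_def proj_space_def)
    then show ?thesis using p proj_point_self[of u] by (auto simp: V_def)
  qed
  have fU: "?f p \<in> V" if "p \<in> U" for p
  proof -
    from Uform[OF that] obtain x where x: "p = proj_point (T *v x)" "x $ 2 \<noteq> 0" by blast
    show ?thesis unfolding x(1) f using x(2) by (intro Vpt) (simp add: FT)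
  qed
  have gV: "?g p \<in> U" if "p \<in> V" for p
  proof -
    from Vform[OF that] obtain u where u: "p = proj_point u" "u $ 1 \<noteq> 0" by blast
    show ?thesis unfolding u(1) g G_def using u(2) G00 coneG by (intro Upt) (auto simp: G0)
  qed
  have regf: "regular_map K U V ?f"
    unfolding regular_map_def
  proof (intro conjI ballI)
    show "?f \<in> U \<rightarrow> V" using fU by blast
    fix v assume "v \<in> \<Union>U"
    then obtain x where x: "v = T *v x" "x $ 2 \<noteq> 0" using UE by blast
    then have "F v \<noteq> 0" using FT(1)[of x] by (metis zero_index)
    then show "\<exists>e H. (\<forall>i. (\<lambda>x. H x $ i) \<in> homog_polys K e) \<and> H v \<noteq> 0 \<and>
        (\<forall>w\<in>\<Union>U. H w \<noteq> 0 \<longrightarrow> ?f (proj_point w) = proj_point (H w))"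
      using hpF homog_polys_hpoly[OF K] f by (intro exI[of _ 1] exI[of _ F]) blast
  qed
  have regg: "regular_map K V U ?g"
    unfolding regular_map_def
  proof (intro conjI ballI)
    show "?g \<in> V \<rightarrow> U" using gV by blast
    fix v assume "v \<in> \<Union>V"
    then have "G v \<noteq> 0" unfolding G_def using VE G00 T_eq(3) by blast
    then show "\<exists>e H. (\<forall>i. (\<lambda>x. H x $ i) \<in> homog_polys K e) \<and> H v \<noteq> 0 \<and>
        (\<forall>w\<in>\<Union>V. H w \<noteq> 0 \<longrightarrow> ?g (proj_point w) = proj_point (H w))"
      using hpG homog_polys_hpoly[OF K] g by (intro exI[of _ 2] exI[of _ G]) blast
  qed
  have gf: "?g (?f p) = p" if "p \<in> U" for p
  proof -
    from Uform[OF that] obtain x where x: "p = proj_point (T *v x)" "qcone d x" "x $ 2 \<noteq> 0" by blast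
    have "G0 (F (T *v x)) = x $ 2 *s x"
      using x(2) unfolding vec_eq_iff forall_4 G0 FT qcone_def by (simp add: power2_eq_square mult.commute)
    then have "G (F (T *v x)) = x $ 2 *s (T *v x)" unfolding G_def by (simp add: T_scale)
    then show ?thesis unfolding x(1) f g using x(3) by (simp add: proj_point_scale)
  qed
  have fg: "?f (?g p) = p" if "p \<in> V" for p
  proof -
    from Vform[OF that] obtain u where u: "p = proj_point u" "u $ 1 \<noteq> 0" by blast
    have "F (G u) = u $ 1 *s u"
      unfolding vec_eq_iff forall_3 G_def FT G0 by (simp add: power2_eq_square)
    then show ?thesis unfolding u(1) f g using u(2) by (simp add: proj_point_scale)
  qed
  have "U \<noteq> {}" using gV[OF Vpt[of "\<chi> i. 1"]] by auto
  moreover have "V \<noteq> {}" using Vpt[of "\<chi> i. 1"] by auto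
  ultimately show ?thesis
    unfolding rational_surface_over_def birational_over_def
    using zU zV regf regg gf fg by (intro exI[of _ U] exI[of _ V] exI[of _ ?f] exI[of _ ?g]) blast
qed

lemma lifts_sv:
  assumes F: "\<And>i. hpoly K 1 (\<lambda>x. F x $ i)"
    and sv: "\<And>s0 s1 t0 t1. s0 \<noteq> 0 \<or> s1 \<noteq> 0 \<Longrightarrow> t0 \<noteq> 0 \<or> t1 \<noteq> 0 \<Longrightarrow>
      \<exists>u0 u1 v0 v1. (u0 \<noteq> 0 \<or> u1 \<noteq> 0) \<and> (v0 \<noteq> 0 \<or> v1 \<noteq> 0) \<and> F (sv s0 s1 t0 t1) = sv u0 u1 v0 v1 \<and>
        g (pt s0 s1, pt t0 t1) = (pt u0 u1, pt v0 v1)"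
  shows "lifts g"
  unfolding lifts_def
proof (intro exI[of _ F] conjI allI impI F)
  fix x assume x: "x \<noteq> 0" "qcone d x"
  obtain s0 s1 t0 t1 where s: "s0 \<noteq> 0 \<or> s1 \<noteq> 0" "t0 \<noteq> 0 \<or> t1 \<noteq> 0" "x = sv s0 s1 t0 t1" using sv_ex[OF x(2,1)] .
  obtain u0 u1 v0 v1 where u: "u0 \<noteq> 0 \<or> u1 \<noteq> 0" "v0 \<noteq> 0 \<or> v1 \<noteq> 0" "F x = sv u0 u1 v0 v1"
    "g (pt s0 s1, pt t0 t1) = (pt u0 u1, pt v0 v1)" using sv[OF s(1,2)] s(3) by blast
  show "F x \<noteq> 0" unfolding u(3) by (rule sv_nonzero[OF u(1,2)])
  show "qcone d (F x)" unfolding u(3) by (rule qcone_sv)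
  show "g (lf x, rt x) = (lf (F x), rt (F x))"
    unfolding u(3) lf_rt_sv[OF u(1,2)] unfolding s(3) lf_rt_sv[OF s(1,2)] by (rule u(4))
qed

lemma lifts_comp: "lifts f \<Longrightarrow> lifts g \<Longrightarrow> lifts (f \<circ> g)"
proof -
  assume "lifts f" "lifts g"
  then obtain F G where F: "\<And>i. hpoly K 1 (\<lambda>x. F x $ i)"
      "\<And>x. x \<noteq> 0 \<Longrightarrow> qcone d x \<Longrightarrow> F x \<noteq> 0 \<and> qcone d (F x) \<and> f (lf x, rt x) = (lf (F x), rt (F x))"
    and G: "\<And>i. hpoly K 1 (\<lambda>x. G x $ i)"
      "\<And>x. x \<noteq> 0 \<Longrightarrow> qcone d x \<Longrightarrow> G x \<noteq> 0 \<and> qcone d (G x) \<and> g (lf x, rt x) = (lf (G x), rt (G x))"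
    unfolding lifts_def by blast
  have "hpoly K 1 (\<lambda>x. F (G x) $ i)" for i using hpoly_comp[OF F(1) G(1), of i] by simp
  then show ?thesis unfolding lifts_def using F(2) G(2) by (intro exI[of _ "\<lambda>x. F (G x)"]) simp
qed

lemma hpoly_vec4:
  assumes "hpoly K n a" "hpoly K n b" "hpoly K n c" "hpoly K n e"
  shows "hpoly K n (\<lambda>x. (\<chi> i. if i = (1::4) then a x else if i = 2 then b x else if i = 3 then c x else e x) $ i)"
proof -
  have "\<forall>i. hpoly K n (\<lambda>x. (\<chi> i. if i = (1::4) then a x else if i = 2 then b x else if i = 3 then c x else e x) $ i)"
    unfolding forall_4 using assms by simp
  then show ?thesis by blast
qed

lemma hpoly_coord1: "hpoly K 1 (\<lambda>x. x $ i)" by (rule hpoly_coord)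

text \<open>Changing the sign of x4 exchanges the products s0 t1 and s1 t0.\<close>

lemma lifts_swap: "lifts prod.swap"
proof (rule lifts_sv)
  let ?F = "\<lambda>x :: complex ^ 4. (\<chi> i. if i = (1::4) then x $ 1 else if i = 2 then x $ 2 else if i = 3 then x $ 3 else - 1 * x $ 4)"
  show "hpoly K 1 (\<lambda>x. ?F x $ i)" for i
    by (intro hpoly_vec4 hpoly_coord1 hpoly_cmult) (simp add: subfldD[OF K])
  fix s0 s1 t0 t1 :: complex assume nz: "s0 \<noteq> 0 \<or> s1 \<noteq> 0" "t0 \<noteq> 0 \<or> t1 \<noteq> 0"
  have "?F (sv s0 s1 t0 t1) = sv t0 t1 s0 s1" by (intro vec4_eqI) (simp_all add: field_simps)
  then show "\<exists>u0 u1 v0 v1. (u0 \<noteq> 0 \<or> u1 \<noteq> 0) \<and> (v0 \<noteq> 0 \<or> v1 \<noteq> 0) \<and> ?F (sv s0 s1 t0 t1) = sv u0 u1 v0 v1 \<and>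
        prod.swap (pt s0 s1, pt t0 t1) = (pt u0 u1, pt v0 v1)" using nz by (metis swap_simp)
qed

lemma lifts_left:
  assumes \<delta>K: "\<delta> \<in> K" and g: "g \<in> mob K"
  shows "lifts (map_prod g id)"
proof -
  obtain a b c e where m: "a \<in> K" "b \<in> K" "c \<in> K" "e \<in> K" "mobm a b c e g" using g unfolding mob_def by blast
  define u v where "u x = x $ 3 + \<delta> * x $ 4" and "v x = x $ 3 - \<delta> * x $ 4" for x :: "complex ^ 4"
  have hu: "hpoly K 1 u" "hpoly K 1 v" unfolding u_def v_def
    by (intro hpoly_add hpoly_diff[OF K] hpoly_cmult \<delta>K hpoly_coord1)+
  \<comment> \<open>On the Segre image \<open>u\<close> and \<open>v\<close> are the products s0 t1
    and s1 t0. The matrix of \<open>g\<close> is applied to the index of s in all four products,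
    which are then converted back to normal coordinates.\<close>
  let ?F = "\<lambda>x :: complex ^ 4. (\<chi> i. if i = (1::4) then a * x $ 1 + b * v x else if i = 2 then c * u x + e * x $ 2
    else if i = 3 then inverse 2 * ((a * u x + b * x $ 2) + (c * x $ 1 + e * v x))
    else inverse (2 * \<delta>) * ((a * u x + b * x $ 2) - (c * x $ 1 + e * v x)))"
  have svu: "u (sv s0 s1 t0 t1) = s0 * t1" "v (sv s0 s1 t0 t1) = s1 * t0" for s0 s1 t0 t1
    unfolding u_def v_def sv_nth sv_off by simp_all
  show ?thesis
  proof (rule lifts_sv)
    show "hpoly K 1 (\<lambda>x. ?F x $ i)" for i
      by (intro hpoly_vec4 hpoly_add hpoly_diff[OF K] hpoly_cmult m hpoly_coord1 hu) (simp_all add: subfldD[OF K] \<delta>K)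
    fix s0 s1 t0 t1 :: complex assume nz: "s0 \<noteq> 0 \<or> s1 \<noteq> 0" "t0 \<noteq> 0 \<or> t1 \<noteq> 0"
    have "?F (sv s0 s1 t0 t1) = sv (a * s0 + b * s1) (c * s0 + e * s1) t0 t1"
      by (intro vec4_eqI) (simp_all add: svu field_simps)
    then show "\<exists>u0 u1 v0 v1. (u0 \<noteq> 0 \<or> u1 \<noteq> 0) \<and> (v0 \<noteq> 0 \<or> v1 \<noteq> 0) \<and> ?F (sv s0 s1 t0 t1) = sv u0 u1 v0 v1 \<and>
        map_prod g id (pt s0 s1, pt t0 t1) = (pt u0 u1, pt v0 v1)"
      using nz mobm_nonzero[OF m(5) nz(1)] mobm_apply[OF m(5) nz(1)] by (metis map_prod_simp id_apply)
  qed
qed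

lemma lifts_mob:
  assumes \<delta>K: "\<delta> \<in> K" and g: "a \<in> mob K" "b \<in> mob K"
  shows "lifts (map_prod a b)" "lifts (map_prod a b \<circ> prod.swap)"
proof -
  have "map_prod a b = map_prod a id \<circ> (prod.swap \<circ> (map_prod b id \<circ> prod.swap))" by (auto simp: fun_eq_iff)
  then show 1: "lifts (map_prod a b)"
    using lifts_comp lifts_left[OF \<delta>K] lifts_swap g by metis
  then show "lifts (map_prod a b \<circ> prod.swap)" using lifts_comp lifts_swap by blast
qed

text \<open>The four products of s0, s1 with t0, t1 form a 2 x 2 matrix X, and the map sends X to
  the matrix M of \<open>g\<close> times X times the conjugate transpose of M. Written in normal
  coordinates, its coefficients are invariant under conjugation because
  \<open>cnj \<delta> = - \<delta>\<close>, hence they are real.\<close>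

lemma lifts_conj:
  assumes KR: "K = \<real>" and \<delta>r: "cnj \<delta> = - \<delta>" and g: "g \<in> mob UNIV"
  shows "lifts (map_prod g (cj \<circ> g \<circ> cj))"
proof -
  obtain a b c e where m: "mobm a b c e g" using g by (rule mob_UNIVE)
  have RI: "z \<in> K" if "cnj z = z" for z using that by (simp add: KR Reals_cnj_iff)
  let ?F = "\<lambda>x :: complex ^ 4. (\<chi> i. if i = (1::4) then
      (a * cnj a) * x $ 1 + (b * cnj b) * x $ 2 + (a * cnj b + b * cnj a) * x $ 3 + ((a * cnj b - b * cnj a) * \<delta>) * x $ 4
    else if i = 2 then
      (c * cnj c) * x $ 1 + (e * cnj e) * x $ 2 + (c * cnj e + e * cnj c) * x $ 3 + ((c * cnj e - e * cnj c) * \<delta>) * x $ 4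
    else if i = 3 then
      ((a * cnj c + c * cnj a) / 2) * x $ 1 + ((b * cnj e + e * cnj b) / 2) * x $ 2 +
      ((a * cnj e + b * cnj c + c * cnj b + e * cnj a) / 2) * x $ 3 + ((a * cnj e - b * cnj c + c * cnj b - e * cnj a) * \<delta> / 2) * x $ 4
    else
      ((a * cnj c - c * cnj a) / (2 * \<delta>)) * x $ 1 + ((b * cnj e - e * cnj b) / (2 * \<delta>)) * x $ 2 +
      ((a * cnj e + b * cnj c - c * cnj b - e * cnj a) / (2 * \<delta>)) * x $ 3 + ((a * cnj e - b * cnj c - c * cnj b + e * cnj a) / 2) * x $ 4)"
  show ?thesis
  proof (rule lifts_sv)
    show "hpoly K 1 (\<lambda>x. ?F x $ i)" for i
    proof (intro hpoly_vec4 hpoly_add hpoly_cmult hpoly_coord1 RI)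
    qed (simp_all add: \<delta>r \<delta>0 field_simps)
    fix s0 s1 t0 t1 :: complex assume nz: "s0 \<noteq> 0 \<or> s1 \<noteq> 0" "t0 \<noteq> 0 \<or> t1 \<noteq> 0"
    have "?F (sv s0 s1 t0 t1) = sv (a * s0 + b * s1) (c * s0 + e * s1) (cnj a * t0 + cnj b * t1) (cnj c * t0 + cnj e * t1)"
      using \<delta>0 by (intro vec4_eqI) (simp_all add: field_simps)
    then show "\<exists>u0 u1 v0 v1. (u0 \<noteq> 0 \<or> u1 \<noteq> 0) \<and> (v0 \<noteq> 0 \<or> v1 \<noteq> 0) \<and> ?F (sv s0 s1 t0 t1) = sv u0 u1 v0 v1 \<and>
        map_prod g (cj \<circ> g \<circ> cj) (pt s0 s1, pt t0 t1) = (pt u0 u1, pt v0 v1)"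
      using mobm_nonzero[OF m nz(1)] mobm_apply[OF m nz(1)] mobm_nonzero[OF mobm_cj[OF m] nz(2)] mobm_apply[OF mobm_cj[OF m] nz(2)]
      by (metis map_prod_simp)
  qed
qed

end

lemma standard_quadric:
  assumes K: "subfld K" and d: "d \<in> K" "d \<noteq> 0" and \<delta>: "\<delta>\<^sup>2 = d"
  obtains Z where "smooth_quadric_surface K Z" "normalized_quadric K Z (mat 1) (mat 1) d \<delta>"
proof -
  define A :: "complex ^ 4 ^ 4" where "A = (\<chi> i j. if i = 1 \<and> j = 2 then 1 else if i = 3 \<and> j = 3 then - 1
    else if i = 4 \<and> j = 4 then d else 0)"
  have An: "A $ 1 $ 2 = 1" "A $ 3 $ 3 = - 1" "A $ 4 $ 4 = d" "A $ 1 $ 1 = 0" "A $ 1 $ 3 = 0" "A $ 1 $ 4 = 0"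
    "A $ 2 $ 1 = 0" "A $ 2 $ 2 = 0" "A $ 2 $ 3 = 0" "A $ 2 $ 4 = 0" "A $ 3 $ 1 = 0" "A $ 3 $ 2 = 0" "A $ 3 $ 4 = 0"
    "A $ 4 $ 1 = 0" "A $ 4 $ 2 = 0" "A $ 4 $ 3 = 0" by (simp_all add: A_def)
  have q: "quad_form A x = x $ 1 * x $ 2 - (x $ 3)\<^sup>2 + d * (x $ 4)\<^sup>2" for x
    by (simp add: quad_form_def sum_4 An power2_eq_square)
  have p: "quad_form_partial A 1 x = x $ 2" "quad_form_partial A 2 x = x $ 1" "quad_form_partial A 3 x = - 2 * x $ 3"
    "quad_form_partial A 4 x = 2 * d * x $ 4" for x
    by (simp_all add: quad_form_partial_def sum_4 An)
  have qc: "quad_form A x = 0 \<longleftrightarrow> qcone d x" for x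
    unfolding q qcone_def by (auto simp: algebra_simps)
  have sm: "\<exists>k. quad_form_partial A k v \<noteq> 0" if "v \<noteq> 0" for v
  proof (rule ccontr)
    assume "\<not> ?thesis"
    then have "quad_form_partial A k v = 0" for k by blast
    from this[of 1] this[of 2] this[of 3] this[of 4] have "\<forall>i. v $ i = 0" unfolding p forall_4 using d by simp
    then show False using that by (simp add: vec_eq_iff)
  qed
  have AK: "A $ i $ j \<in> K" for i j unfolding A_def using subfldD[OF K] d by simp
  have "smooth_quadric_surface K (quadric A)"
    unfolding smooth_quadric_surface_def using AK sm by blast
  moreover have "normalized_quadric K (quadric A) (mat 1) (mat 1) d \<delta>"
  proof
    show "subfld K" by fact
    have "(mat 1 :: complex ^ 4 ^ 4) $ i $ j \<in> K" for i j using subfldD[OF K] by (simp add: mat_def)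
    then show "normal_quadric K (quadric A) (mat 1) (mat 1) d"
      unfolding normal_quadric_def quadric_def using d by (simp add: qc)
  qed (rule \<delta>)
  ultimately show ?thesis by (rule that)
qed

subsection \<open>Wreath products\<close>

definition wreath :: "('p \<Rightarrow> 'p) set \<Rightarrow> ('p \<times> 'p \<Rightarrow> 'p \<times> 'p) set" where
  "wreath G = {map_prod a b | a b. a \<in> G \<and> b \<in> G} \<union> {map_prod a b \<circ> prod.swap | a b. a \<in> G \<and> b \<in> G}"

lemma wreathI: "a \<in> G \<Longrightarrow> b \<in> G \<Longrightarrow> map_prod a b \<in> wreath G" "a \<in> G \<Longrightarrow> b \<in> G \<Longrightarrow> map_prod a b \<circ> prod.swap \<in> wreath G"
  unfolding wreath_def by blast+

lemma wreathE:
  assumes "f \<in> wreath G"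
  obtains a b where "a \<in> G" "b \<in> G" "f = map_prod a b" | a b where "a \<in> G" "b \<in> G" "f = map_prod a b \<circ> prod.swap"
  using assms unfolding wreath_def by blast

lemma wreath_comp:
  "map_prod a b \<circ> map_prod a' b' = map_prod (a \<circ> a') (b \<circ> b')"
  "map_prod a b \<circ> (map_prod a' b' \<circ> prod.swap) = map_prod (a \<circ> a') (b \<circ> b') \<circ> prod.swap"
  "(map_prod a b \<circ> prod.swap) \<circ> map_prod a' b' = map_prod (a \<circ> b') (b \<circ> a') \<circ> prod.swap"
  "(map_prod a b \<circ> prod.swap) \<circ> (map_prod a' b' \<circ> prod.swap) = map_prod (a \<circ> b') (b \<circ> a')"
  by (auto simp: fun_eq_iff)

lemma fgrp_wreath:
  assumes G: "fgrp G" shows "fgrp (wreath G)"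
  unfolding fgrp_def
proof (intro conjI ballI)
  have "wreath G = (\<lambda>(a, b). map_prod a b) ` (G \<times> G) \<union> (\<lambda>(a, b). map_prod a b \<circ> prod.swap) ` (G \<times> G)"
    unfolding wreath_def by auto
  then show "finite (wreath G)" using fgrpD(1)[OF G] by simp
  show "id \<in> wreath G" using fgrpD(2)[OF G] unfolding wreath_def by (auto intro!: exI[of _ id])
  fix f assume f: "f \<in> wreath G"
  show "bij f" using f bij_map_prodI fgrpD(4)[OF G] bij_comp[OF bij_swap] unfolding wreath_def by blast
  fix g assume g: "g \<in> wreath G"
  show "f \<circ> g \<in> wreath G"
    using f g by (elim wreathE) (simp_all only: wreath_comp, intro wreathI fgrpD(3)[OF G]; assumption)+
qed

text \<open>Two distinct points are what tells an exchange of factors from a product map.\<close>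

lemma card_wreath:
  fixes G :: "('p \<Rightarrow> 'p) set"
  assumes G: "fgrp G" and two: "\<exists>x y :: 'p. x \<noteq> y"
  shows "card (wreath G) = 2 * card G * card G"
proof -
  let ?A = "(\<lambda>(a, b). map_prod a b) ` (G \<times> G)" and ?B = "(\<lambda>(a, b). map_prod a b \<circ> prod.swap) ` (G \<times> G)"
  have w: "wreath G = ?A \<union> ?B" unfolding wreath_def by auto
  have iA: "inj_on (\<lambda>(a, b). map_prod a b) (G \<times> G)"
    by (rule inj_onI) (auto simp: map_prod_inject)
  have swap_cancel: "f = g" if "f \<circ> prod.swap = g \<circ> prod.swap" for f g :: "'p \<times> 'p \<Rightarrow> 'p \<times> 'p"
  proof -
    have "f \<circ> prod.swap \<circ> prod.swap = g \<circ> prod.swap \<circ> prod.swap" using that by simp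
    then show ?thesis by (simp add: comp_assoc)
  qed
  have iB: "inj_on (\<lambda>(a, b). map_prod a b \<circ> prod.swap) (G \<times> G)"
  proof (rule inj_onI)
    fix x y :: "('p \<Rightarrow> 'p) \<times> ('p \<Rightarrow> 'p)"
    assume "(case x of (a, b) \<Rightarrow> map_prod a b \<circ> prod.swap) = (case y of (a, b) \<Rightarrow> map_prod a b \<circ> prod.swap)"
    then have "map_prod (fst x) (snd x) = map_prod (fst y) (snd y)"
      using swap_cancel by (simp add: case_prod_beta)
    then show "x = y" by (simp add: map_prod_inject prod_eq_iff)
  qed
  have "?A \<inter> ?B = {}"
  proof (rule ccontr)
    assume "?A \<inter> ?B \<noteq> {}"
    then obtain f where f: "f \<in> ?A" "f \<in> ?B" by blast
    from f(1) obtain a b where a: "a \<in> G" "f = map_prod a b" by auto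
    from f(2) obtain a' b' where "f = map_prod a' b' \<circ> prod.swap" by auto
    with a have e: "map_prod a b = map_prod a' b' \<circ> prod.swap" "a \<in> G" by simp_all
    obtain x y :: 'p where xy: "x \<noteq> y" using two by blast
    have "a x = a' q" "a y = a' q" for q using fun_cong[OF e(1), of "(x, q)"] fun_cong[OF e(1), of "(y, q)"] by simp_all
    then have "a x = a y" by metis
    then show False using fgrpD(4)[OF G e(2)] xy by (metis inv_apply_bij(1))
  qed
  then have "card (wreath G) = card ?A + card ?B"
    unfolding w using fgrpD(1)[OF G] by (intro card_Un_disjoint) auto
  then show ?thesis using card_image[OF iA] card_image[OF iB] by (simp add: card_cartesian_product)
qed

text \<open>An element (x, y) of \<open>N\<close> commutes with its conjugates by (t, id) and (id,
  t), so x and y commute with all their conjugates in \<open>G\<close> and lie in \<open>A\<close>.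
  An exchanging element cannot occur: its commutator with (t, id), for some t outside
  \<open>A\<close>, would be an element of \<open>N\<close> with first component t.\<close>

lemma wreath_normal_abelian:
  fixes G :: "('p \<Rightarrow> 'p) set"
  assumes G: "fgrp G" and N: "normal_abelian (wreath G) N"
    and A: "A \<subseteq> G" "A \<noteq> G" "\<And>x. x \<in> G \<Longrightarrow> (\<And>t. t \<in> G \<Longrightarrow> x \<circ> (t \<circ> x \<circ> finv t) = (t \<circ> x \<circ> finv t) \<circ> x) \<Longrightarrow> x \<in> A"
  shows "card N \<le> card A * card A"
proof -
  note N' = normal_abelianD[OF N]
  have mem: "map_prod a b \<in> wreath G" if "a \<in> G" "b \<in> G" for a b using that unfolding wreath_def by blast
  have idG: "id \<in> G" using fgrpD(2)[OF G] .
  have bijG: "bij t" if "t \<in> G" for t using fgrpD(4)[OF G that] .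
  have pres: "x \<in> A \<and> y \<in> A" if n: "map_prod x y \<in> N" and xy: "x \<in> G" "y \<in> G" for x y
  proof
    show "x \<in> A"
    proof (rule A(3)[OF xy(1)])
      fix t assume t: "t \<in> G"
      have "map_prod t id \<circ> map_prod x y \<circ> finv (map_prod t id) \<in> N" by (rule N'(5)[OF mem[OF t idG] n])
      then have "map_prod (t \<circ> x \<circ> finv t) y \<in> N"
        using bijG[OF t] by (simp add: finv_map_prod map_prod.comp)
      from N'(4)[OF n this] show "x \<circ> (t \<circ> x \<circ> finv t) = (t \<circ> x \<circ> finv t) \<circ> x"
        by (simp add: map_prod.comp map_prod_inject)
    qed
    show "y \<in> A"
    proof (rule A(3)[OF xy(2)])
      fix t assume t: "t \<in> G"
      have "map_prod id t \<circ> map_prod x y \<circ> finv (map_prod id t) \<in> N" by (rule N'(5)[OF mem[OF idG t] n])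
      then have "map_prod x (t \<circ> y \<circ> finv t) \<in> N"
        using bijG[OF t] by (simp add: finv_map_prod map_prod.comp)
      from N'(4)[OF n this] show "y \<circ> (t \<circ> y \<circ> finv t) = (t \<circ> y \<circ> finv t) \<circ> y"
        by (simp add: map_prod.comp map_prod_inject)
    qed
  qed
  have FN: "fgrp N" by (rule normal_abelian_fgrp[OF fgrp_wreath[OF G] N])
  have noswap: "map_prod x y \<circ> prod.swap \<notin> N" if xy: "x \<in> G" "y \<in> G" for x y
  proof
    assume n: "map_prod x y \<circ> prod.swap \<in> N"
    obtain t where t: "t \<in> G" "t \<notin> A" using A(1,2) by blast
    let ?n = "map_prod x y \<circ> prod.swap"
    have b: "bij x" "bij y" "bij t" using bijG xy t by auto
    have bn: "bij ?n" using fgrpD(4)[OF FN n] .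
    have "map_prod t id \<circ> ?n \<circ> finv (map_prod t id) \<in> N" by (rule N'(5)[OF mem[OF t(1) idG] n])
    then have "(map_prod t id \<circ> ?n \<circ> finv (map_prod t id)) \<circ> finv ?n \<in> N"
      using fgrp_inv[OF FN n] N'(3) by blast
    moreover have "(map_prod t id \<circ> ?n \<circ> finv (map_prod t id)) \<circ> finv ?n = map_prod t (y \<circ> finv t \<circ> finv y)"
    proof -
      have fi: "finv ?n = prod.swap \<circ> map_prod (finv x) (finv y)"
        using b by (intro inv_unique_comp) (auto simp: fun_eq_iff inv_apply_bij)
      show ?thesis unfolding fi finv_map_prod[OF b(3) bij_id] using b by (auto simp: fun_eq_iff inv_apply_bij)
    qed
    ultimately have "map_prod t (y \<circ> finv t \<circ> finv y) \<in> N" by simp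
    moreover have "y \<circ> finv t \<circ> finv y \<in> G" by (intro fgrpD(3)[OF G] fgrp_inv[OF G] xy t)
    ultimately show False using pres t by blast
  qed
  have "N \<subseteq> (\<lambda>(a, b). map_prod a b) ` (A \<times> A)"
  proof
    fix n assume n: "n \<in> N"
    then have "n \<in> wreath G" using N'(1) by blast
    then consider a b where "a \<in> G" "b \<in> G" "n = map_prod a b" | a b where "a \<in> G" "b \<in> G" "n = map_prod a b \<circ> prod.swap"
      unfolding wreath_def by blast
    then show "n \<in> (\<lambda>(a, b). map_prod a b) ` (A \<times> A)"
    proof cases
      case 1 then show ?thesis using pres n by blast
    next
      case 2 then show ?thesis using noswap n by blast
    qed
  qed
  moreover have finA: "finite A" using fgrpD(1)[OF G] A(1) finite_subset by blast
  ultimately have "card N \<le> card ((\<lambda>(a, b). map_prod a b) ` (A \<times> A))" by (intro card_mono) auto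
  also have "\<dots> \<le> card (A \<times> A)" using finA by (intro card_image_le) auto
  finally show ?thesis by (simp add: card_cartesian_product)
qed

subsection \<open>A symmetric group of degree three\<close>

text \<open>The Moebius maps that permute infinity, 0 and 1, with \<open>E\<close> the even ones. A
  transposition does not commute with its conjugate by the three-cycle \<open>\<rho>\<close>, so
  only even elements commute with all their conjugates.\<close>

lemma s3_group:
  obtains G E where "fgrp G" "G \<subseteq> mob \<rat>" "E \<subseteq> G" "E \<noteq> G" "card G = 2 * card E"
    "\<And>x. x \<in> G \<Longrightarrow> (\<And>t. t \<in> G \<Longrightarrow> x \<circ> (t \<circ> x \<circ> finv t) = (t \<circ> x \<circ> finv t) \<circ> x) \<Longrightarrow> x \<in> E"
proof -
  let ?o = "None :: cp1" and ?z = "Some 0 :: cp1" and ?u = "Some 1 :: cp1"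
  have pts: "pt 1 0 = ?o" "pt 0 1 = ?z" "pt 1 1 = ?u" by (simp_all add: pt_def)
  let ?P = "{?o, ?z, ?u}"
  define G where "G = {g \<in> mob \<rat>. g ` ?P \<subseteq> ?P}"
  have QU: "g \<in> mob UNIV" if "g \<in> mob \<rat>" for g using that mob_mono[of \<rat> UNIV] by blast
  have det: "f = g" if "f \<in> mob \<rat>" "g \<in> mob \<rat>" "f ?o = g ?o" "f ?z = g ?z" "f ?u = g ?u" for f g
  proof -
    have b: "bij g" using mob_bij that(2) by blast
    have "finv g \<circ> f \<in> mob UNIV" using mob_comp[OF subfld_UNIV] mob_inv[OF subfld_UNIV] QU that by blast
    then have "finv g \<circ> f = id"
      by (rule mob_three_fixed) (use that b in \<open>simp_all add: pts inv_apply_bij\<close>)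
    then have "g \<circ> (finv g \<circ> f) = g" by simp
    then show ?thesis using b by (simp add: o_assoc inv_o_bij)
  qed
  define v where "v g = (g ?o, g ?z, g ?u)" for g :: "cp1 \<Rightarrow> cp1"
  have injv: "inj_on v G" by (rule inj_onI) (use det in \<open>auto simp: v_def G_def\<close>)
  have GM: "g \<in> mob \<rat>" if "g \<in> G" for g using that unfolding G_def by (rule CollectE) (erule conjunct1)
  have GI: "g \<in> G" if "g \<in> mob \<rat>" "g ` ?P \<subseteq> ?P" for g unfolding G_def by (intro CollectI conjI that)
  have GQ: "g x \<in> ?P" if "g \<in> G" "x \<in> ?P" for g x
  proof -
    have "g ` ?P \<subseteq> ?P" using that(1) unfolding G_def by (rule CollectE) (erule conjunct2)
    then show ?thesis using that(2) by (rule image_subset_iff[THEN iffD1, THEN bspec])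
  qed
  have GP: "g ?o \<in> ?P" "g ?z \<in> ?P" "g ?u \<in> ?P" if "g \<in> G" for g by (rule GQ[OF that], simp)+
  have "v ` G \<subseteq> ?P \<times> ?P \<times> ?P" unfolding v_def by (rule image_subsetI) (intro SigmaI GP)
  then have "finite (v ` G)" by (rule finite_subset) simp
  then have finG: "finite G" using injv by (rule finite_imageD)
  have F: "fgrp G"
    unfolding fgrp_def
  proof (intro conjI ballI)
    show "finite G" by fact
    show "id \<in> G" using mob_id[OF subfld_Rats] by (simp add: G_def)
    fix f assume f: "f \<in> G"
    show "bij f" by (rule mob_bij[OF GM[OF f]])
    fix g assume g: "g \<in> G"
    have "f \<circ> g \<in> mob \<rat>" by (intro mob_comp[OF subfld_Rats] GM f g)
    moreover have "(f \<circ> g) ` ?P \<subseteq> ?P" by (rule image_subsetI, unfold o_apply) (rule GQ[OF f GQ[OF g]])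
    ultimately show "f \<circ> g \<in> G" by (rule GI)
  qed
  have ex: "\<exists>g\<in>mob \<rat>. mobm a b c d g" if "a \<in> \<rat>" "b \<in> \<rat>" "c \<in> \<rat>" "d \<in> \<rat>" "a * d - b * c \<noteq> 0" for a b c d
    using mobm_ex[OF that(5)] that unfolding mob_def by blast
  \<comment> \<open>\<open>\<rho>\<close> is the map 1/(1 - t), which cycles infinity, 0 and 1;
    \<open>\<tau>\<close> is 1/t, which exchanges infinity and 0.\<close>
  obtain \<rho> where \<rho>: "\<rho> \<in> mob \<rat>" "mobm 0 1 (- 1) 1 \<rho>" using ex[of 0 1 "- 1" 1] by auto
  obtain \<tau> where \<tau>: "\<tau> \<in> mob \<rat>" "mobm 0 1 1 0 \<tau>" using ex[of 0 1 1 0] by auto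
  have \<rho>v: "\<rho> ?o = ?z" "\<rho> ?z = ?u" "\<rho> ?u = ?o"
    using mobm_apply[OF \<rho>(2), of 1 0] mobm_apply[OF \<rho>(2), of 0 1] mobm_apply[OF \<rho>(2), of 1 1] by (simp_all add: pts pt_def)
  have \<tau>v: "\<tau> ?o = ?z" "\<tau> ?z = ?o" "\<tau> ?u = ?u"
    using mobm_apply[OF \<tau>(2), of 1 0] mobm_apply[OF \<tau>(2), of 0 1] mobm_apply[OF \<tau>(2), of 1 1] by (simp_all add: pts pt_def)
  have \<rho>G: "\<rho> \<in> G" and \<tau>G: "\<tau> \<in> G" using \<rho>(1) \<tau>(1) \<rho>v \<tau>v by (simp_all add: G_def)
  let ?ev = "{(?o, ?z, ?u), (?z, ?u, ?o), (?u, ?o, ?z)}"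
  let ?od = "{(?z, ?o, ?u), (?u, ?z, ?o), (?o, ?u, ?z)}"
  \<comment> \<open>A map in \<open>G\<close> is determined by its triple of values at infinity, 0
    and 1; these are the triples of the even and of the odd permutations.\<close>
  define ev od where "ev g \<longleftrightarrow> v g \<in> ?ev" and "od g \<longleftrightarrow> v g \<in> ?od" for g
  have six: "ev g \<or> od g" if "g \<in> G" for g
  proof -
    have "inj g" by (rule bij_is_inj[OF mob_bij[OF GM[OF that]]])
    then have "g ?o \<noteq> g ?z" "g ?o \<noteq> g ?u" "g ?z \<noteq> g ?u" by (simp_all add: inj_eq)
    moreover note GP[OF that]
    ultimately show ?thesis unfolding ev_def od_def v_def by (elim insertE emptyE) simp_all
  qed
  define E where "E = {g\<in>G. ev g}"
  have ED: "g \<in> G" "ev g" if "g \<in> E" for g using that by (simp_all only: E_def mem_Collect_eq)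
  have EI: "g \<in> E" if "g \<in> G" "ev g" for g using that by (simp only: E_def mem_Collect_eq simp_thms)
  have tE: "\<tau> \<circ> g \<in> G" "ev (\<tau> \<circ> g) \<longleftrightarrow> od g" if "g \<in> G" for g
  proof -
    show "\<tau> \<circ> g \<in> G" using fgrpD(3)[OF F \<tau>G that] .
    show "ev (\<tau> \<circ> g) \<longleftrightarrow> od g"
      using six[OF that] \<tau>v unfolding ev_def od_def v_def o_apply by (elim disjE insertE emptyE) simp_all
  qed
  have tt: "\<tau> \<circ> (\<tau> \<circ> g) = g" if "g \<in> G" for g
  proof -
    have "\<tau> \<circ> \<tau> = id" by (rule det) (use mob_comp[OF subfld_Rats] mob_id[OF subfld_Rats] \<tau> \<tau>v in auto)
    then show ?thesis by (simp add: o_assoc)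
  qed
  have disj: "\<not> od g" if "ev g" for g using that unfolding ev_def od_def by (elim insertE emptyE) simp_all
  have im: "(\<lambda>g. \<tau> \<circ> g) ` E = G - E"
  proof
    show "(\<lambda>g. \<tau> \<circ> g) ` E \<subseteq> G - E" 
    proof (rule image_subsetI)
      fix g assume g: "g \<in> E"
      have "\<tau> \<circ> g \<notin> E"
        using ED(2) tE(2)[OF ED(1)[OF g]] disj[OF ED(2)[OF g]] by metis
      then show "\<tau> \<circ> g \<in> G - E" using tE(1)[OF ED(1)[OF g]] by (rule DiffI[rotated])
    qed
    show "G - E \<subseteq> (\<lambda>g. \<tau> \<circ> g) ` E"
    proof
      fix g assume g: "g \<in> G - E"
      then have gG: "g \<in> G" by simp
      have "od g" using six[OF gG] EI[OF gG] g by blast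
      then have "\<tau> \<circ> g \<in> E" using EI[OF tE(1)[OF gG]] tE(2)[OF gG] by metis
      then show "g \<in> (\<lambda>g. \<tau> \<circ> g) ` E" using tt[of g] g by (intro rev_image_eqI[of "\<tau> \<circ> g"]) auto
    qed
  qed
  have "inj_on (\<lambda>g. \<tau> \<circ> g) E" by (rule inj_on_inverseI[where g = "\<lambda>g. \<tau> \<circ> g"]) (rule tt[OF ED(1)])
  then have "card (G - E) = card E" using im card_image by metis
  moreover have EG: "E \<subseteq> G" using ED(1) by (rule subsetI)
  ultimately have cG: "card G = 2 * card E" using card_Diff_subset[of E G] finG finite_subset[OF EG finG] card_mono[OF finG EG] by simp
  have "id \<in> E" by (rule EI[OF fgrpD(2)[OF F]]) (simp add: ev_def v_def)
  then have "card E > 0" using finite_subset[OF EG finG] by (auto simp: card_gt_0_iff)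
  then have "E \<noteq> G" using cG by auto
  moreover have "x \<in> E" if x: "x \<in> G" and c: "\<And>t. t \<in> G \<Longrightarrow> x \<circ> (t \<circ> x \<circ> finv t) = (t \<circ> x \<circ> finv t) \<circ> x" for x
  proof (rule ccontr)
    assume "x \<notin> E"
    then have o: "od x" using six[OF x] EI[OF x] by metis
    have b: "bij \<rho>" by (rule mob_bij[OF \<rho>(1)])
    have r: "finv \<rho> ?z = ?o" "finv \<rho> ?u = ?z" "finv \<rho> ?o = ?u"
      using inv_apply_bij(1)[OF b, of ?o] inv_apply_bij(1)[OF b, of ?z] inv_apply_bij(1)[OF b, of ?u] \<rho>v by simp_all
    have "x (\<rho> (x (finv \<rho> p))) = \<rho> (x (finv \<rho> (x p)))" for p
      using fun_cong[OF c[OF \<rho>G], of p] by simp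
    from this[of ?o] this[of ?z] this[of ?u] show False
      using o \<rho>v r unfolding ev_def od_def v_def by (elim insertE emptyE) simp_all
  qed
  moreover have "G \<subseteq> mob \<rat>" using GM by (rule subsetI)
  ultimately show ?thesis using that[OF F _ EG _ cG] by blast
qed

subsection \<open>Permutations of five points\<close>

definition cyc3 :: "'a \<Rightarrow> 'a \<Rightarrow> 'a \<Rightarrow> 'a \<Rightarrow> 'a" where
  "cyc3 u v w x = (if x = u then v else if x = v then w else if x = w then u else x)"

text \<open>Three-cycles are squares, which is how they are recognised as members of a subgroup that
  contains all squares.\<close>

lemma cyc3_square:
  assumes "u \<noteq> v" "u \<noteq> w" "v \<noteq> w"
  shows "bij (cyc3 u w v)" "cyc3 u v w = cyc3 u w v \<circ> cyc3 u w v"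
proof -
  have "cyc3 u v w \<circ> cyc3 u w v = id" "cyc3 u w v \<circ> cyc3 u v w = id"
    using assms by (auto simp: cyc3_def fun_eq_iff)
  then show "bij (cyc3 u w v)" by (rule o_bij)
  show "cyc3 u v w = cyc3 u w v \<circ> cyc3 u w v" using assms by (auto simp: cyc3_def fun_eq_iff)
qed

lemma fresh_elem:
  fixes A :: "'a::finite set"
  assumes "CARD('a) = 5" "A = set xs" "length xs < 5"
  obtains z where "z \<notin> A"
proof -
  have "card A < 5" unfolding assms(2) using card_length[of xs] assms(3) by linarith
  then have "A \<noteq> UNIV" using assms(1) by auto
  then show ?thesis using that by blast
qed

text \<open>\<open>Q\<close> stands for the permutations that preserve the rulings. Containing all
  squares, it contains all three-cycles and is transitive on ordered pairs of distinct points. If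
  \<open>y\<close> commuted with every conjugate of \<open>x\<close> by \<open>Q\<close>, matching
  suitable pairs would show that neither of the two has a fixed point and that \<open>x\<close> is
  an involution, which is impossible on five points.\<close>

lemma conjugates_not_commuting:
  fixes x y :: "'a::finite \<Rightarrow> 'a"
  assumes five: "CARD('a) = 5" and xy: "bij x" "bij y" "x \<noteq> id" "y \<noteq> id"
    and Q: "\<And>f g. f \<in> Q \<Longrightarrow> g \<in> Q \<Longrightarrow> f \<circ> g \<in> Q" "\<And>f. f \<in> Q \<Longrightarrow> bij f" "\<And>f :: 'a \<Rightarrow> 'a. bij f \<Longrightarrow> f \<circ> f \<in> Q"
  shows "\<exists>\<rho>\<in>Q. y \<circ> (\<rho> \<circ> x \<circ> finv \<rho>) \<noteq> (\<rho> \<circ> x \<circ> finv \<rho>) \<circ> y"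
proof (rule ccontr)
  assume "\<not> ?thesis"
  then have "y (\<rho> (x (finv \<rho> p))) = \<rho> (x (finv \<rho> (y p)))" if "\<rho> \<in> Q" for \<rho> p
    using that by (auto simp: fun_eq_iff)
  then have comm: "y (\<rho> (x q)) = \<rho> (x r)" if "\<rho> \<in> Q" "\<rho> r = y (\<rho> q)" for \<rho> q r
    using that Q(2) by (metis inv_apply_bij(1))
  have c3: "cyc3 u v w \<in> Q" if "u \<noteq> v" "u \<noteq> w" "v \<noteq> w" for u v w
    using Q(3) cyc3_square[OF that] by metis
  have idQ: "id \<in> Q" using Q(3)[OF bij_id] by simp
  have tr: "\<exists>\<rho>\<in>Q. \<rho> a = c \<and> \<rho> b = d" if "a \<noteq> b" "c \<noteq> d" for a b c d
  proof -
    have "\<exists>\<rho>\<in>Q. \<rho> a = c"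
    proof (cases "a = c")
      case False
      obtain w where "w \<notin> {a, c}" by (rule fresh_elem[OF five, of _ "[a, c]"]) auto
      then show ?thesis using c3[of a c w] False by (intro bexI[of _ "cyc3 a c w"]) (auto simp: cyc3_def)
    qed (rule bexI[OF _ idQ], simp)
    then obtain \<rho> where \<rho>: "\<rho> \<in> Q" "\<rho> a = c" by blast
    have ne: "\<rho> b \<noteq> c" using \<rho> Q(2) that(1) by (metis inv_apply_bij(1))
    show ?thesis
    proof (cases "\<rho> b = d")
      case False
      obtain w where w: "w \<notin> {\<rho> b, d, c}" by (rule fresh_elem[OF five, of _ "[\<rho> b, d, c]"]) auto
      have "cyc3 (\<rho> b) d w \<circ> \<rho> \<in> Q" using c3[of "\<rho> b" d w] False w Q(1) \<rho>(1) by auto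
      moreover have "(cyc3 (\<rho> b) d w \<circ> \<rho>) a = c" "(cyc3 (\<rho> b) d w \<circ> \<rho>) b = d"
        using ne w that(2) \<rho>(2) by (auto simp: cyc3_def)
      ultimately show ?thesis by blast
    qed (use \<rho> in blast)
  qed
  obtain a where a: "x a \<noteq> a" using xy(3) by (auto simp: fun_eq_iff)
  obtain c where c: "y c \<noteq> c" using xy(4) by (auto simp: fun_eq_iff)
  have nofixy: "y e \<noteq> e" for e
  proof
    assume e: "y e = e"
    then have "e \<noteq> c" using c by auto
    \<comment> \<open>The conjugate of \<open>x\<close> by \<open>\<rho>\<close> moves the fixed
      point \<open>e\<close> of \<open>y\<close> to \<open>c\<close>, which would then be fixed by
      \<open>y\<close> as well.\<close>
    then obtain \<rho> where r: "\<rho> \<in> Q" "\<rho> a = e" "\<rho> (x a) = c" using tr[OF a[symmetric]] by blast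
    show False using comm[OF r(1), of a a] r e c by simp
  qed
  have nofixx: "x e \<noteq> e" for e
  proof
    assume e: "x e = e"
    then have "e \<noteq> a" using a by auto
    then obtain \<rho> where r: "\<rho> \<in> Q" "\<rho> e = c" "\<rho> a = y c" using tr[OF _ c[symmetric]] by blast
    have "\<rho> (x a) = y c" using comm[OF r(1), of a e] comm[OF r(1), of e a] r e by simp
    then have "\<rho> (x a) = \<rho> a" using r by simp
    then show False using a Q(2)[OF r(1)] by (metis inv_apply_bij(1))
  qed
  have invol: "x (x a) = a" for a
  proof (rule ccontr)
    assume xx: "x (x a) \<noteq> a"
    \<comment> \<open>Commutation makes the values of \<open>\<rho>\<close> at \<open>a\<close> and
      \<open>x a\<close> force its value at \<open>x (x a)\<close>. A three-cycle on fresh points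
      changes this last value and leaves the other two, while the product stays in
      \<open>Q\<close>.\<close>
    obtain \<rho> where r: "\<rho> \<in> Q" "\<rho> a = c" "\<rho> (x a) = y c" using tr[OF nofixx[symmetric] nofixy[symmetric]] by blast
    have z: "\<rho> (x (x a)) = y (y c)" using comm[OF r(1), of "x a" a] r by simp
    have b: "bij \<rho>" by (rule Q(2)[OF r(1)])
    have ne: "\<rho> (x (x a)) \<noteq> c" "\<rho> (x (x a)) \<noteq> y c"
      using xx nofixx[of "x a"] r(2,3) b by (metis inv_apply_bij(1))+
    obtain u where u: "u \<notin> {c, y c, y (y c)}" by (rule fresh_elem[OF five, of _ "[c, y c, y (y c)]"]) auto
    obtain w where w: "w \<notin> {c, y c, y (y c), u}" by (rule fresh_elem[OF five, of _ "[c, y c, y (y c), u]"]) auto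
    define \<tau> where "\<tau> = cyc3 (y (y c)) u w \<circ> \<rho>"
    have tQ: "\<tau> \<in> Q" unfolding \<tau>_def using c3[of "y (y c)" u w] u w Q(1) r(1) by auto
    have "\<tau> a = c" "\<tau> (x a) = y c" "\<tau> (x (x a)) = u"
      unfolding \<tau>_def using r z ne u w by (auto simp: cyc3_def)
    then have "u = y (y c)" using comm[OF tQ, of "x a" a] by simp
    then show False using u by simp
  qed
  have inj: "x p = x q \<longleftrightarrow> p = q" for p q using bij_is_inj[OF xy(1)] by (simp add: inj_eq)
  obtain e where e: "e \<notin> {a, x a}" by (rule fresh_elem[OF five, of _ "[a, x a]"]) auto
  obtain f where f: "f \<notin> {a, x a, e, x e}" by (rule fresh_elem[OF five, of _ "[a, x a, e, x e]"]) auto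
  \<comment> \<open>Three disjoint two-cycles would need six points.\<close>
  have "distinct [a, x a, e, x e, f, x f]"
    using e f inj nofixx[of a] nofixx[of e] nofixx[of f] invol[of a] invol[of e] invol[of f] by simp metis
  then have "card (set [a, x a, e, x e, f, x f]) = 6" by (subst distinct_card) simp_all
  moreover have "card (set [a, x a, e, x e, f, x f]) \<le> CARD('a)" by (rule card_mono) auto
  ultimately show False using five by simp
qed

subsection \<open>The quadric with symmetric group of degree five\<close>

text \<open>Five coordinates with sum zero, stored by the first four; \<open>None\<close> is the
  index of the dependent one.\<close>

definition ext5 :: "complex ^ 4 \<Rightarrow> 4 option \<Rightarrow> complex" where
  "ext5 x j = (case j of None \<Rightarrow> - (\<Sum>i\<in>UNIV. x $ i) | Some i \<Rightarrow> x $ i)"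

definition perm_act :: "(4 option \<Rightarrow> 4 option) \<Rightarrow> complex ^ 4 \<Rightarrow> complex ^ 4" where
  "perm_act \<sigma> x = (\<chi> i. ext5 x (finv \<sigma> (Some i)))"

text \<open>On the hyperplane this is the sum of the squares of all five coordinates, see
  \<open>quad_form_perm_form\<close>.\<close>

definition perm_form :: "complex ^ 4 ^ 4" where
  "perm_form = (\<chi> i j. if i = j then 2 else 1)"

lemma sum_option: "(\<Sum>j\<in>UNIV. f j) = f None + (\<Sum>i\<in>UNIV. f (Some i))" for f :: "'a::finite option \<Rightarrow> complex"
proof -
  have "(\<Sum>j\<in>UNIV. f j) = f None + (\<Sum>j\<in>range Some. f j)"
    unfolding UNIV_option_conv by (subst sum.insert) auto
  then show ?thesis by (simp add: sum.reindex)
qed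

lemma ext5_Some: "ext5 x (Some i) = x $ i" by (simp add: ext5_def)

lemma ext5_sum: "(\<Sum>j\<in>UNIV. ext5 x j) = 0"
  by (simp add: sum_option ext5_def)

lemma quad_form_perm_form: "quad_form perm_form x = (\<Sum>j\<in>UNIV. (ext5 x j)\<^sup>2)"
  by (simp add: quad_form_def perm_form_def sum_option ext5_def sum_4 power2_eq_square algebra_simps)

text \<open>The point is the dependent coordinate: a permutation keeps the sum of the five
  coordinates equal to zero.\<close>

lemma ext5_perm_act:
  assumes "bij \<sigma>" shows "ext5 (perm_act \<sigma> x) j = ext5 x (finv \<sigma> j)"
proof (cases j)
  case (Some i)
  then show ?thesis by (simp add: ext5_Some perm_act_def)
next
  case None
  have "(\<Sum>j\<in>UNIV. ext5 x (finv \<sigma> j)) = (\<Sum>j\<in>UNIV. ext5 x j)"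
    by (rule sum.reindex_bij_betw[OF bij_imp_bij_inv[OF assms]])
  then have "(\<Sum>j\<in>UNIV. ext5 x (finv \<sigma> j)) = 0" by (simp only: ext5_sum)
  then have "ext5 x (finv \<sigma> None) + (\<Sum>i\<in>UNIV. ext5 x (finv \<sigma> (Some i))) = 0"
    by (simp only: sum_option)
  moreover have "ext5 (perm_act \<sigma> x) None = - (\<Sum>i\<in>UNIV. ext5 x (finv \<sigma> (Some i)))"
    by (simp add: ext5_def[of "perm_act \<sigma> x"]) (simp add: perm_act_def)
  ultimately show ?thesis unfolding None by (metis eq_neg_iff_add_eq_0)
qed

lemma vec_ext5I: "(\<And>j. ext5 x j = ext5 y j) \<Longrightarrow> x = y"
  by (metis ext5_Some vec_eq_iff)

lemma perm_act_comp: "bij \<sigma> \<Longrightarrow> bij \<tau> \<Longrightarrow> perm_act (\<sigma> \<circ> \<tau>) x = perm_act \<sigma> (perm_act \<tau> x)"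
  by (rule vec_ext5I) (simp add: ext5_perm_act bij_comp o_inv_distrib)

lemma perm_act_id: "perm_act id x = x"
  by (rule vec_ext5I) (simp add: ext5_perm_act)

lemma ext5_scale: "ext5 (c *s x) j = c * ext5 x j"
  by (simp add: ext5_def sum_distrib_left split: option.split)

lemma perm_act_scale: "bij \<sigma> \<Longrightarrow> perm_act \<sigma> (c *s x) = c *s perm_act \<sigma> x"
  by (rule vec_ext5I) (simp add: ext5_perm_act ext5_scale)

lemma perm_act_nonzero: "bij \<sigma> \<Longrightarrow> x \<noteq> 0 \<Longrightarrow> perm_act \<sigma> x \<noteq> 0"
proof
  assume b: "bij \<sigma>" and x: "x \<noteq> 0" and z: "perm_act \<sigma> x = 0"
  have "ext5 x j = 0" for j
    using ext5_perm_act[OF b, of x "\<sigma> j"] b unfolding z by (simp add: inv_apply_bij ext5_def split: option.splits)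
  then have "x = 0" by (metis ext5_Some vec_eq_iff zero_index)
  then show False using x by simp
qed

lemma quad_form_perm_act: "bij \<sigma> \<Longrightarrow> quad_form perm_form (perm_act \<sigma> x) = quad_form perm_form x"
  unfolding quad_form_perm_form using sum.reindex_bij_betw[OF bij_imp_bij_inv, of \<sigma> "\<lambda>j. (ext5 x j)\<^sup>2"]
  by (simp add: ext5_perm_act)

lemma perm_form_smooth:
  assumes "v \<noteq> 0" shows "\<exists>k. quad_form_partial perm_form k v \<noteq> 0"
proof (rule ccontr)
  assume "\<not> ?thesis"
  then have "quad_form_partial perm_form k v = 0" for k by blast
  then have "(perm_form $ k $ 1 + perm_form $ 1 $ k) * v $ 1 + (perm_form $ k $ 2 + perm_form $ 2 $ k) * v $ 2 +
    (perm_form $ k $ 3 + perm_form $ 3 $ k) * v $ 3 + (perm_form $ k $ 4 + perm_form $ 4 $ k) * v $ 4 = 0" for k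
    unfolding quad_form_partial_def sum_4 .
  from this[of 1] this[of 2] this[of 3] this[of 4]
  have "4 * v $ 1 + 2 * v $ 2 + 2 * v $ 3 + 2 * v $ 4 = 0" "2 * v $ 1 + 4 * v $ 2 + 2 * v $ 3 + 2 * v $ 4 = 0"
    "2 * v $ 1 + 2 * v $ 2 + 4 * v $ 3 + 2 * v $ 4 = 0" "2 * v $ 1 + 2 * v $ 2 + 2 * v $ 3 + 4 * v $ 4 = 0"
    by (simp_all add: perm_form_def)
  then have "v $ 1 = 0 \<and> v $ 2 = 0 \<and> v $ 3 = 0 \<and> v $ 4 = 0" by Groebner_Basis.algebra
  then have "v = 0" by (simp add: vec_eq_iff forall_4)
  then show False using assms by simp
qed

lemma perm_form_K: "subfld K \<Longrightarrow> perm_form $ i $ j \<in> K"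
  using subfldD[of K] by (simp add: perm_form_def)

lemma smooth_perm_form: "subfld K \<Longrightarrow> smooth_quadric_surface K (quadric perm_form)"
  unfolding smooth_quadric_surface_def using perm_form_K perm_form_smooth by blast

lemma perm_form_normal:
  assumes K: "subfld K" and p: "p1 \<in> K" "p2 \<in> K" "p3 \<in> K" "p4 \<in> K" "p1 \<noteq> 0"
    "p1\<^sup>2 + p2\<^sup>2 + p3\<^sup>2 + p4\<^sup>2 + (p1 + p2 + p3 + p4)\<^sup>2 = 0"
  obtains T T' d where "normalized_quadric K (quadric perm_form) T T' d (csqrt d)"
proof -
  define v :: "complex ^ 4" where "v = (\<chi> i. if i = 1 then p1 else if i = 2 then p2 else if i = 3 then p3 else p4)"
  have v: "v $ 1 = p1" "v $ 2 = p2" "v $ 3 = p3" "v $ 4 = p4" by (simp_all add: v_def)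
  have "kvec K v" unfolding kvec_def forall_4 v using p by simp
  moreover have "v \<noteq> 0" using v(1) p(5) by auto
  moreover have "quad_form perm_form v = p1\<^sup>2 + p2\<^sup>2 + p3\<^sup>2 + p4\<^sup>2 + (p1 + p2 + p3 + p4)\<^sup>2"
    by (simp add: quad_form_perm_form sum_option ext5_def sum_4 v power2_eq_square algebra_simps)
  ultimately obtain T T' d where "normal_quadric K (quadric perm_form) T T' d"
    using normal_form[OF K perm_form_K[OF K] perm_form_smooth, of v] p(6) by metis
  then show ?thesis using that K by (simp add: normalized_quadric_def)
qed

context normalized_quadric
begin

definition perm_map :: "(4 option \<Rightarrow> 4 option) \<Rightarrow> cp1 \<times> cp1 \<Rightarrow> cp1 \<times> cp1" where
  "perm_map \<sigma> p = finv Sg (perm_act \<sigma> ` Sg p)"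

lemma perm_act_proj_point:
  assumes "bij \<sigma>" shows "perm_act \<sigma> ` proj_point x = proj_point (perm_act \<sigma> x)"
  unfolding proj_point_def using perm_act_scale[OF assms] by (auto simp: image_iff) metis+

lemma perm_form_qcone:
  assumes Z5: "Z = quadric perm_form" and w: "w \<noteq> 0" "quad_form perm_form w = 0"
  shows "qcone d (T' *v w)" "T' *v w \<noteq> 0"
proof -
  have "w \<in> \<Union>Z" unfolding Z5 quadric_def using w proj_point_self by blast
  then obtain x where "w = T *v x" "x \<noteq> 0" "qcone d x" unfolding UZ by blast
  then show "qcone d (T' *v w)" "T' *v w \<noteq> 0" using TT by auto
qed

lemma perm_form_quad_form:
  assumes Z5: "Z = quadric perm_form" and w: "w \<in> \<Union>Z"
  shows "w \<noteq> 0" "quad_form perm_form w = 0"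
proof -
  obtain u where u: "w \<in> proj_point u" "u \<noteq> 0" "quad_form perm_form u = 0" using w unfolding Z5 quadric_def by blast
  then obtain c where "c \<noteq> 0" "w = c *s u" using proj_pointD by blast
  then show "w \<noteq> 0" "quad_form perm_form w = 0" using u by (simp_all add: quad_form_scale)
qed

lemma perm_map_apply:
  assumes Z5: "Z = quadric perm_form" and \<sigma>: "bij \<sigma>" and x: "x \<noteq> 0" "qcone d x"
  shows "T' *v perm_act \<sigma> (T *v x) \<noteq> 0" "qcone d (T' *v perm_act \<sigma> (T *v x))"
    "perm_map \<sigma> (lf x, rt x) = (lf (T' *v perm_act \<sigma> (T *v x)), rt (T' *v perm_act \<sigma> (T *v x)))"
proof -
  let ?y = "T' *v perm_act \<sigma> (T *v x)"
  have "T *v x \<in> \<Union>Z" using UZ x by blast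
  from perm_form_quad_form[OF Z5 this] have w: "T *v x \<noteq> 0" "quad_form perm_form (T *v x) = 0" .
  have w': "perm_act \<sigma> (T *v x) \<noteq> 0" "quad_form perm_form (perm_act \<sigma> (T *v x)) = 0"
    using perm_act_nonzero[OF \<sigma> w(1)] quad_form_perm_act[OF \<sigma>] w(2) by simp_all
  show y: "?y \<noteq> 0" "qcone d ?y" using perm_form_qcone[OF Z5 w'] by blast+
  show "perm_map \<sigma> (lf x, rt x) = (lf ?y, rt ?y)"
    unfolding perm_map_def Sg_lf_rt[OF x(2,1)] perm_act_proj_point[OF \<sigma>] using inv_Sg_proj[OF y(2,1)] by (simp add: TT)
qed

lemma lf_rt_surj: obtains x where "x \<noteq> 0" "qcone d x" "p = (lf x, rt x)"
proof -
  have "Sg p \<in> Z" by (rule Sg_in)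
  then obtain x where x: "Sg p = proj_point (T *v x)" "x \<noteq> 0" "qcone d x" unfolding Z by blast
  have "p = (lf x, rt x)" using inv_Sg(1)[of p] inv_Sg_proj[OF x(3,2)] x(1) by simp
  then show ?thesis using that x by blast
qed

lemma perm_map_comp:
  assumes Z5: "Z = quadric perm_form" and b: "bij \<sigma>" "bij \<tau>"
  shows "perm_map (\<sigma> \<circ> \<tau>) = perm_map \<sigma> \<circ> perm_map \<tau>"
proof
  fix p
  obtain x where x: "x \<noteq> 0" "qcone d x" "p = (lf x, rt x)" by (rule lf_rt_surj)
  note g = perm_map_apply[OF Z5]
  show "perm_map (\<sigma> \<circ> \<tau>) p = (perm_map \<sigma> \<circ> perm_map \<tau>) p"
    unfolding x(3) o_apply g(3)[OF b(2) x(1,2)] g(3)[OF b(1) g(1,2)[OF b(2) x(1,2)]]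
      g(3)[OF bij_comp[OF b(2,1)] x(1,2)] perm_act_comp[OF b] TT ..
qed

lemma perm_map_id: "Z = quadric perm_form \<Longrightarrow> perm_map id = id"
  by (rule ext) (simp add: perm_map_def perm_act_id[abs_def] inv_Sg)

lemma perm_map_bij:
  assumes Z5: "Z = quadric perm_form" and b: "bij \<sigma>"
  shows "bij (perm_map \<sigma>)" "finv (perm_map \<sigma>) = perm_map (finv \<sigma>)"
proof -
  note bi = bij_imp_bij_inv[OF b]
  have e: "perm_map \<sigma> \<circ> perm_map (finv \<sigma>) = id" "perm_map (finv \<sigma>) \<circ> perm_map \<sigma> = id"
    using perm_map_comp[OF Z5 b bi] perm_map_comp[OF Z5 bi b] perm_map_id[OF Z5] inv_o_bij[OF b] by simp_all
  show "bij (perm_map \<sigma>)" using o_bij[OF e(2,1)] .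
  show "finv (perm_map \<sigma>) = perm_map (finv \<sigma>)" using inv_unique_comp[OF e] .
qed

text \<open>An element acting trivially fixes every coordinate, because some point of the quadric has
  that coordinate as its only vanishing one.\<close>

lemma perm_map_kernel:
  assumes Z5: "Z = quadric perm_form" and b: "bij \<sigma>" and g: "perm_map \<sigma> = id"
  shows "\<sigma> = id"
proof -
  \<comment> \<open>The fourth roots of unity together with 0: their sum and the sum of their
    squares both vanish.\<close>
  define v :: "complex ^ 4" where "v = (\<chi> i. if i = 1 then 1 else if i = 2 then \<i> else if i = 3 then - 1 else - \<i>)"
  have v: "v $ 1 = 1" "v $ 2 = \<i>" "v $ 3 = - 1" "v $ 4 = - \<i>" by (simp_all add: v_def)
  have ev: "ext5 v j = 0 \<longleftrightarrow> j = None" for j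
  proof (cases j)
    case (Some i)
    have "\<forall>i. v $ i \<noteq> 0" unfolding forall_4 v by simp
    then show ?thesis using Some by (simp add: ext5_Some)
  qed (simp add: ext5_def sum_4 v)
  have "v \<noteq> 0" using v(1) by (metis zero_index one_neq_zero)
  moreover have "quad_form perm_form v = 0" by (simp add: quad_form_perm_form sum_option ext5_def sum_4 v)
  ultimately have v0: "v \<noteq> 0" "quad_form perm_form v = 0" by blast+
  have "finv \<sigma> j = j" for j
  proof -
    define \<tau> :: "4 option \<Rightarrow> 4 option" where "\<tau> = Transposition.transpose None j"
    have \<tau>: "bij \<tau>" by (simp add: \<tau>_def)
    define w where "w = perm_act \<tau> v"
    have tt: "\<tau> \<circ> \<tau> = id" by (simp add: \<tau>_def)
    have ew: "ext5 w k = 0 \<longleftrightarrow> k = j" for k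
    proof -
      have "finv \<tau> = \<tau>" using inv_unique_comp[OF tt tt] .
      then have "ext5 w k = ext5 v (\<tau> k)" unfolding w_def by (simp add: ext5_perm_act[OF \<tau>])
      then have "ext5 w k = 0 \<longleftrightarrow> \<tau> k = None" using ev by simp
      then show ?thesis unfolding \<tau>_def by (auto simp: Transposition.transpose_def)
    qed
    have w: "w \<noteq> 0" "quad_form perm_form w = 0" unfolding w_def using perm_act_nonzero[OF \<tau> v0(1)] quad_form_perm_act[OF \<tau>] v0(2) by simp_all
    define x where "x = T' *v w"
    have x: "x \<noteq> 0" "qcone d x" "T *v x = w" unfolding x_def using perm_form_qcone[OF Z5 w] TT by simp_all
    have "finv Sg (perm_act \<sigma> ` Sg (lf x, rt x)) = (lf x, rt x)" using g by (simp add: perm_map_def fun_eq_iff)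
    then have e: "finv Sg (proj_point (perm_act \<sigma> w)) = (lf x, rt x)"
      unfolding Sg_lf_rt[OF x(2,1)] perm_act_proj_point[OF b] x(3) .
    have "proj_point (perm_act \<sigma> w) \<in> Z"
      unfolding Z5 quadric_def using perm_act_nonzero[OF b w(1)] quad_form_perm_act[OF b] w(2) by auto
    then have "proj_point (perm_act \<sigma> w) = Sg (lf x, rt x)" unfolding e[symmetric] by (rule inv_Sg(2)[symmetric])
    then have "proj_point (perm_act \<sigma> w) = proj_point w" unfolding Sg_lf_rt[OF x(2,1)] x(3) .
    then obtain c where c: "c \<noteq> 0" "perm_act \<sigma> w = c *s w" using proj_point_eqD by blast
    have "ext5 w (finv \<sigma> j) = c * ext5 w j" using ext5_perm_act[OF b, of w j] by (simp add: c(2) ext5_scale)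
    then show ?thesis using ew[of "finv \<sigma> j"] ew[of j] by simp
  qed
  then have "finv \<sigma> = id" by (simp add: fun_eq_iff)
  then show ?thesis using inv_inv_eq[OF b] inv_id by metis
qed

lemma perm_map_lifts:
  assumes Z5: "Z = quadric perm_form" and b: "bij \<sigma>" shows "lifts (perm_map \<sigma>)"
  unfolding lifts_def
proof (intro exI[of _ "\<lambda>x. T' *v perm_act \<sigma> (T *v x)"] conjI allI impI)
  have c: "hpoly K 1 (\<lambda>x. ext5 x j)" for j
  proof (cases j)
    case None
    have "hpoly K 1 (\<lambda>x. (- 1) * (\<Sum>i\<in>UNIV. x $ i))"
      by (intro hpoly_cmult hpoly_sum hpoly_coord1) (simp add: subfldD[OF K])
    then show ?thesis using None by (simp add: ext5_def)
  qed (simp only: ext5_Some hpoly_coord1)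
  have 1: "hpoly K 1 (\<lambda>x. perm_act \<sigma> x $ i)" for i unfolding perm_act_def using c by simp
  have 2: "hpoly K 1 (\<lambda>x. perm_act \<sigma> (T *v x) $ i)" for i
    using hpoly_comp[OF 1 hpoly_linear[OF TK(1)], of i] by simp
  show "hpoly K 1 (\<lambda>x. (T' *v perm_act \<sigma> (T *v x)) $ i)" for i
    using hpoly_comp[OF hpoly_linear[OF TK(2)] 2, of i] by simp
qed (use perm_map_apply[OF Z5 b] in blast)+

lemma lifts_good:
  assumes "bij g" "lifts g" "lifts (finv g)" shows "good g"
  using aut_good[OF untrans_aut[OF assms]] by (simp add: trans_untrans)

end

lemma card_bij_five: "card {\<sigma> :: 4 option \<Rightarrow> 4 option. bij \<sigma>} = 120" "CARD(4 option) = 5"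
proof -
  show five: "CARD(4 option) = 5" by (simp add: card_UNIV_option)
  have "{\<sigma> :: 4 option \<Rightarrow> 4 option. bij \<sigma>} = {\<sigma>. \<sigma> permutes UNIV}"
    by (auto intro: bij_imp_permutes simp: permutes_bij)
  then show "card {\<sigma> :: 4 option \<Rightarrow> 4 option. bij \<sigma>} = 120"
    using card_permutations[of "UNIV :: 4 option set"] by (simp add: five fact_numeral)
qed

section \<open>Groups in which no nontrivial element commutes with all its conjugates\<close>

definition rigid :: "('p \<Rightarrow> 'p) set \<Rightarrow> bool" where
  "rigid G \<longleftrightarrow> (\<forall>x\<in>G. x \<noteq> id \<longrightarrow> (\<exists>t\<in>G. x \<circ> (t \<circ> x \<circ> finv t) \<noteq> (t \<circ> x \<circ> finv t) \<circ> x))"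

text \<open>In an abelian normal subgroup every element commutes with its conjugates.\<close>

lemma rigid_normal_abelian:
  assumes r: "rigid G" and N: "normal_abelian G N" shows "card N \<le> 1"
proof -
  have "N \<subseteq> {id}"
  proof
    fix x assume x: "x \<in> N"
    show "x \<in> {id}"
    proof (rule ccontr)
      assume "x \<notin> {id}"
      then obtain t where "t \<in> G" "x \<circ> (t \<circ> x \<circ> finv t) \<noteq> (t \<circ> x \<circ> finv t) \<circ> x"
        using r x normal_abelianD(1)[OF N] unfolding rigid_def by blast
      then show False using normal_abelianD(4,5)[OF N] x by blast
    qed
  qed
  then show ?thesis using card_mono[of "{id}" N] by simp
qed

definition birigid :: "('p \<times> 'p \<Rightarrow> 'p \<times> 'p) set \<Rightarrow> bool" where
  "birigid G \<longleftrightarrow> (\<forall>x\<in>G. \<forall>y\<in>G. x \<noteq> id \<longrightarrow> y \<noteq> id \<longrightarrow>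
     (\<exists>t\<in>preserving G. y \<circ> (t \<circ> x \<circ> finv t) \<noteq> (t \<circ> x \<circ> finv t) \<circ> y))"

lemma birigidE:
  assumes "birigid G" "x \<in> G" "y \<in> G" "x \<noteq> id" "y \<noteq> id"
  obtains s c where "map_prod s c \<in> G" "y \<circ> (map_prod s c \<circ> x \<circ> finv (map_prod s c)) \<noteq> (map_prod s c \<circ> x \<circ> finv (map_prod s c)) \<circ> y"
  using assms unfolding birigid_def preserving_def by blast

text \<open>Elements with equal first components are equal. Hence, if the first components of an
  element and of its conjugate commute, so do the two elements themselves, against
  \<open>birigid\<close>.\<close>

lemma rigid_fst_part:
  assumes G: "fgrp G" and r: "birigid G" and inj: "\<And>b. map_prod id b \<in> G \<Longrightarrow> b = id"
  shows "rigid (fst_part G)"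
  unfolding rigid_def
proof (intro ballI impI)
  fix u assume "u \<in> fst_part G" and u1: "u \<noteq> id"
  then obtain b where x: "map_prod u b \<in> G" unfolding fst_part_def by blast
  have "map_prod u b \<noteq> id" using u1 by (simp add: map_prod_eq_id)
  from birigidE[OF r x x this this] obtain s c where t: "map_prod s c \<in> G"
    "map_prod u b \<circ> (map_prod s c \<circ> map_prod u b \<circ> finv (map_prod s c)) \<noteq> (map_prod s c \<circ> map_prod u b \<circ> finv (map_prod s c)) \<circ> map_prod u b" .
  have bj: "bij s" "bij c" using bij_map_prodD fgrpD(4)[OF G t(1)] by blast+
  let ?u = "s \<circ> u \<circ> finv s" and ?b = "c \<circ> b \<circ> finv c"
  have c: "map_prod s c \<circ> map_prod u b \<circ> finv (map_prod s c) = map_prod ?u ?b"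
    by (simp add: finv_map_prod bj map_prod.comp)
  have x': "map_prod ?u ?b \<in> G" unfolding c[symmetric] by (intro fgrpD(3)[OF G] fgrp_inv[OF G] t x)
  have m: "map_prod (u \<circ> ?u) (b \<circ> ?b) \<in> G" "map_prod (?u \<circ> u) (?b \<circ> b) \<in> G"
    using fgrpD(3)[OF G x x'] fgrpD(3)[OF G x' x] by (simp_all only: map_prod.comp)
  have "u \<circ> ?u \<noteq> ?u \<circ> u"
  proof
    assume e: "u \<circ> ?u = ?u \<circ> u"
    have "b \<circ> ?b = ?b \<circ> b" by (rule map_prod_fst_det[OF G inj m(1)]) (use m(2) e in simp_all)
    then show False using t(2) e unfolding c by (simp only: map_prod.comp simp_thms)
  qed
  moreover have "s \<in> fst_part G" using t(1) unfolding fst_part_def by blast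
  ultimately show "\<exists>t\<in>fst_part G. u \<circ> (t \<circ> u \<circ> finv t) \<noteq> (t \<circ> u \<circ> finv t) \<circ> u" by blast
qed

lemma rigid_snd_part:
  assumes G: "fgrp G" and r: "birigid G" and inj: "\<And>b. map_prod b id \<in> G \<Longrightarrow> b = id"
  shows "rigid (snd_part G)"
  unfolding rigid_def
proof (intro ballI impI)
  fix u assume "u \<in> snd_part G" and u1: "u \<noteq> id"
  then obtain b where x: "map_prod b u \<in> G" unfolding snd_part_def by blast
  have "map_prod b u \<noteq> id" using u1 by (simp add: map_prod_eq_id)
  from birigidE[OF r x x this this] obtain c s where t: "map_prod c s \<in> G"
    "map_prod b u \<circ> (map_prod c s \<circ> map_prod b u \<circ> finv (map_prod c s)) \<noteq> (map_prod c s \<circ> map_prod b u \<circ> finv (map_prod c s)) \<circ> map_prod b u" .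
  have bj: "bij c" "bij s" using bij_map_prodD fgrpD(4)[OF G t(1)] by blast+
  let ?u = "s \<circ> u \<circ> finv s" and ?b = "c \<circ> b \<circ> finv c"
  have c: "map_prod c s \<circ> map_prod b u \<circ> finv (map_prod c s) = map_prod ?b ?u"
    by (simp add: finv_map_prod bj map_prod.comp)
  have x': "map_prod ?b ?u \<in> G" unfolding c[symmetric] by (intro fgrpD(3)[OF G] fgrp_inv[OF G] t x)
  have m: "map_prod (b \<circ> ?b) (u \<circ> ?u) \<in> G" "map_prod (?b \<circ> b) (?u \<circ> u) \<in> G"
    using fgrpD(3)[OF G x x'] fgrpD(3)[OF G x' x] by (simp_all only: map_prod.comp)
  have "u \<circ> ?u \<noteq> ?u \<circ> u"
  proof
    assume e: "u \<circ> ?u = ?u \<circ> u"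
    have "b \<circ> ?b = ?b \<circ> b" by (rule map_prod_snd_det[OF G inj m(1)]) (use m(2) e in simp_all)
    then show False using t(2) e unfolding c by (simp only: map_prod.comp simp_thms)
  qed
  moreover have "s \<in> snd_part G" using t(1) unfolding snd_part_def by blast
  ultimately show "\<exists>t\<in>snd_part G. u \<circ> (t \<circ> u \<circ> finv t) \<noteq> (t \<circ> u \<circ> finv t) \<circ> u" by blast
qed

text \<open>The two kernels commute elementwise, so they cannot both be nontrivial.\<close>

lemma birigid_part:
  assumes G: "fgrp G" and r: "birigid G"
  shows "(fgrp (fst_part G) \<and> rigid (fst_part G) \<and> card (fst_part G) = card (preserving G)) \<or>
    (fgrp (snd_part G) \<and> rigid (snd_part G) \<and> card (snd_part G) = card (preserving G))"
proof (cases "\<exists>b. map_prod id b \<in> G \<and> b \<noteq> id")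
  case True
  then obtain b where b: "map_prod id b \<in> G" "b \<noteq> id" by blast
  have "a = id" if a: "map_prod a id \<in> G" for a
  proof (rule ccontr)
    assume "a \<noteq> id"
    then have n: "map_prod id b \<noteq> id" "map_prod a id \<noteq> id"
      using b(2) by (simp_all add: map_prod_eq_id)
    from birigidE[OF r b(1) a n] obtain s c where t: "map_prod s c \<in> G"
      "map_prod a id \<circ> (map_prod s c \<circ> map_prod id b \<circ> finv (map_prod s c)) \<noteq> (map_prod s c \<circ> map_prod id b \<circ> finv (map_prod s c)) \<circ> map_prod a id" .
    have bj: "bij s" "bij c" using bij_map_prodD fgrpD(4)[OF G t(1)] by blast+
    show False using t(2) by (simp add: finv_map_prod bj map_prod.comp inv_o_bij)
  qed
  then show ?thesis using rigid_snd_part[OF G r] snd_part_inj[OF G] fgrp_parts(2)[OF G] by auto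
next
  case False
  then show ?thesis using rigid_fst_part[OF G r] fst_part_inj[OF G] fgrp_parts(1)[OF G] by auto
qed

context normalized_quadric
begin

text \<open>Faithfulness comes from \<open>perm_map_kernel\<close>. For \<open>birigid\<close>, the
  square of any element preserves the rulings, whether or not the element does; so the permutations
  that preserve them contain all squares, as \<open>conjugates_not_commuting\<close>
  demands.\<close>

lemma perm_map_group:
  assumes Z5: "Z = quadric perm_form"
  defines "G \<equiv> perm_map ` {\<sigma>. bij \<sigma>}"
  shows "fgrp G" "card G = 120" "\<And>g. g \<in> G \<Longrightarrow> lifts g" "\<And>g. g \<in> G \<Longrightarrow> good g" "birigid G"
proof -
  note cm = perm_map_comp[OF Z5] and bi = perm_map_bij[OF Z5] and li = perm_map_lifts[OF Z5]
  have inj: "inj_on perm_map {\<sigma>. bij \<sigma>}"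
  proof (rule inj_onI)
    fix \<sigma> \<tau> assume b: "\<sigma> \<in> {\<sigma>. bij \<sigma>}" "\<tau> \<in> {\<sigma>. bij \<sigma>}" and e: "perm_map \<sigma> = perm_map \<tau>"
    have "perm_map (finv \<tau> \<circ> \<sigma>) = id"
      using b e bi[of \<tau>] by (simp add: cm bij_imp_bij_inv inv_o_bij flip: bi(2))
    then have "finv \<tau> \<circ> \<sigma> = id" using b by (intro perm_map_kernel[OF Z5]) (auto intro: bij_comp bij_imp_bij_inv)
    then have "\<tau> \<circ> (finv \<tau> \<circ> \<sigma>) = \<tau>" by simp
    then show "\<sigma> = \<tau>" using b by (simp add: o_assoc inv_o_bij)
  qed
  then show "card G = 120" unfolding G_def using card_bij_five(1) by (simp add: card_image)
  show F: "fgrp G"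
    unfolding fgrp_def
  proof (intro conjI ballI)
    have "finite {\<sigma> :: 4 option \<Rightarrow> 4 option. bij \<sigma>}" using card_bij_five(1) by (metis card.infinite zero_neq_numeral)
    then show "finite G" unfolding G_def by simp
    have "id = perm_map id" using perm_map_id[OF Z5] by simp
    then show "id \<in> G" unfolding G_def by blast
    fix f assume "f \<in> G" then obtain \<sigma> where f: "f = perm_map \<sigma>" "bij \<sigma>" unfolding G_def by blast
    show "bij f" unfolding f(1) by (rule bi(1)[OF f(2)])
    fix g assume "g \<in> G" then obtain \<tau> where g: "g = perm_map \<tau>" "bij \<tau>" unfolding G_def by blast
    have "f \<circ> g = perm_map (\<sigma> \<circ> \<tau>)" unfolding f(1) g(1) by (rule cm[OF f(2) g(2), symmetric])
    then show "f \<circ> g \<in> G" unfolding G_def using bij_comp[OF g(2) f(2)] by blast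
  qed
  show L: "lifts g" if "g \<in> G" for g using that li unfolding G_def by blast
  show good: "good g" if "g \<in> G" for g
    using lifts_good fgrpD(4)[OF F that] L[OF that] L[OF fgrp_inv[OF F that]] by blast
  define Q where "Q = {\<sigma>. bij \<sigma> \<and> perm_map \<sigma> \<in> preserving G}"
  show "birigid G"
    unfolding birigid_def
  proof (intro ballI impI)
    fix x y assume "x \<in> G" "y \<in> G" and n: "x \<noteq> id" "y \<noteq> id"
    then obtain \<xi> \<eta> where x: "x = perm_map \<xi>" "bij \<xi>" and y: "y = perm_map \<eta>" "bij \<eta>" unfolding G_def by blast
    have "\<exists>\<rho>\<in>Q. \<eta> \<circ> (\<rho> \<circ> \<xi> \<circ> finv \<rho>) \<noteq> (\<rho> \<circ> \<xi> \<circ> finv \<rho>) \<circ> \<eta>"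
    proof (rule conjugates_not_commuting[OF card_bij_five(2) x(2) y(2)])
      show "\<xi> \<noteq> id" "\<eta> \<noteq> id" using n x y perm_map_id[OF Z5] by auto
      show "f \<circ> g \<in> Q" if fg: "f \<in> Q" "g \<in> Q" for f g
      proof -
        have b: "bij f" "bij g" and p: "perm_map f \<in> preserving G" "perm_map g \<in> preserving G" using fg by (auto simp: Q_def)
        have "perm_map f \<circ> perm_map g \<in> preserving G" by (rule fgrpD(3)[OF fgrp_preserving[OF F] p])
        then show ?thesis unfolding Q_def using cm[OF b] bij_comp[OF b(2,1)] by simp
      qed
      show "bij f" if "f \<in> Q" for f using that by (simp add: Q_def)
      show "f \<circ> f \<in> Q" if b: "bij f" for f
      proof -
        have g: "perm_map f \<in> G" using b unfolding G_def by blast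
        obtain a c where "perm_map f = map_prod a c \<or> perm_map f = map_prod a c \<circ> prod.swap" using good_tp[OF good[OF g]] by blast
        then have "perm_map f \<circ> perm_map f = map_prod (a \<circ> a) (c \<circ> c) \<or> perm_map f \<circ> perm_map f = map_prod (a \<circ> c) (c \<circ> a)"
          by (elim disjE) (simp_all only: wreath_comp simp_thms)
        then have "perm_map f \<circ> perm_map f \<in> preserving G" using fgrpD(3)[OF F g g] unfolding preserving_def by blast
        then show ?thesis unfolding Q_def using cm[OF b b] bij_comp[OF b b] by simp
      qed
    qed
    then obtain \<rho> where r: "\<rho> \<in> Q" and ne: "\<eta> \<circ> (\<rho> \<circ> \<xi> \<circ> finv \<rho>) \<noteq> (\<rho> \<circ> \<xi> \<circ> finv \<rho>) \<circ> \<eta>" by blast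
    have b: "bij \<rho>" "perm_map \<rho> \<in> preserving G" using r by (auto simp: Q_def)
    note bs = bij_comp bij_imp_bij_inv b(1) x(2) y(2)
    have bb: "bij (\<rho> \<circ> \<xi> \<circ> finv \<rho>)" by (intro bs)
    have c: "perm_map \<rho> \<circ> x \<circ> finv (perm_map \<rho>) = perm_map (\<rho> \<circ> \<xi> \<circ> finv \<rho>)"
      unfolding x(1) bi(2)[OF b(1)] by (simp add: cm bs)
    have "perm_map (\<eta> \<circ> (\<rho> \<circ> \<xi> \<circ> finv \<rho>)) \<noteq> perm_map ((\<rho> \<circ> \<xi> \<circ> finv \<rho>) \<circ> \<eta>)"
    proof
      assume "perm_map (\<eta> \<circ> (\<rho> \<circ> \<xi> \<circ> finv \<rho>)) = perm_map ((\<rho> \<circ> \<xi> \<circ> finv \<rho>) \<circ> \<eta>)"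
      then have "\<eta> \<circ> (\<rho> \<circ> \<xi> \<circ> finv \<rho>) = (\<rho> \<circ> \<xi> \<circ> finv \<rho>) \<circ> \<eta>"
        by (rule inj_onD[OF inj]) (simp_all only: mem_Collect_eq bij_comp[OF bb y(2)] bij_comp[OF y(2) bb])
      then show False using ne by blast
    qed
    then have "y \<circ> (perm_map \<rho> \<circ> x \<circ> finv (perm_map \<rho>)) \<noteq> (perm_map \<rho> \<circ> x \<circ> finv (perm_map \<rho>)) \<circ> y"
      unfolding c y(1) cm[OF y(2) bb, symmetric] cm[OF bb y(2), symmetric] .
    then show "\<exists>t\<in>preserving G. y \<circ> (t \<circ> x \<circ> finv t) \<noteq> (t \<circ> x \<circ> finv t) \<circ> y" using b(2) by blast
  qed
qed

lemma birigid_rigid: "birigid G \<Longrightarrow> rigid G"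
  unfolding birigid_def rigid_def preserving_def by blast

lemma perm_form_lower:
  assumes Z5: "Z = quadric perm_form" shows "enat 120 \<le> jordan_constant (aut_group K Z)"
proof (rule jordan_constant_ge[OF perm_map_group(1)[OF Z5] perm_map_group(3)[OF Z5]])
  fix N assume "normal_abelian (perm_map ` {\<sigma>. bij \<sigma>}) N"
  from rigid_normal_abelian[OF birigid_rigid[OF perm_map_group(5)[OF Z5]] this]
  show "120 * card N \<le> card (perm_map ` {\<sigma>. bij \<sigma>})" using perm_map_group(2)[OF Z5] by simp
qed

end

section \<open>Quadrics that attain the values\<close>

lemma perm_form_attained:
  assumes K: "subfld K" and p: "p1 \<in> K" "p2 \<in> K" "p3 \<in> K" "p4 \<in> K" "p1 \<noteq> 0"
    "p1\<^sup>2 + p2\<^sup>2 + p3\<^sup>2 + p4\<^sup>2 + (p1 + p2 + p3 + p4)\<^sup>2 = 0"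
  shows "\<exists>Z. smooth_quadric_surface K Z \<and> rational_surface_over K Z \<and> enat 120 \<le> jordan_constant (aut_group K Z)"
proof -
  obtain T T' d where "normalized_quadric K (quadric perm_form) T T' d (csqrt d)" by (rule perm_form_normal[OF K p])
  then interpret normalized_quadric K "quadric perm_form" T T' d "csqrt d" .
  show ?thesis using smooth_perm_form[OF K] rational perm_form_lower[OF refl] by blast
qed

lemma icosahedral_group:
  obtains G where "fgrp G" "G \<subseteq> mob UNIV" "60 \<le> card G" "rigid G"
proof -
  obtain T T' d where "normalized_quadric UNIV (quadric perm_form) T T' d (csqrt d)"
    by (rule perm_form_normal[OF subfld_UNIV, of 1 \<i> "- 1" "- \<i>"]) simp_all
  then interpret normalized_quadric UNIV "quadric perm_form" T T' d "csqrt d" .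
  define G where "G = perm_map ` {\<sigma>. bij \<sigma>}"
  note G = perm_map_group[OF refl, folded G_def]
  have "120 \<le> 2 * card (preserving G)" using card_le_preserving[OF G(1)] good_tp[OF G(4)] G(2) by simp
  then show ?thesis using birigid_part[OF G(1,5)] parts_mob[OF G(4)] that by auto
qed

lemma lower_UNIV:
  "\<exists>Z. smooth_quadric_surface UNIV Z \<and> rational_surface_over UNIV Z \<and> enat 7200 \<le> jordan_constant (aut_group (UNIV :: complex set) Z)"
proof -
  obtain Z :: "(complex ^ 4) set set" where SZ: "smooth_quadric_surface UNIV Z" "normalized_quadric UNIV Z (mat 1) (mat 1) 1 1"
    by (rule standard_quadric[OF subfld_UNIV, of 1 1]) simp_all
  interpret normalized_quadric UNIV Z "mat 1" "mat 1" 1 1 by (rule SZ(2))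
  obtain G where G: "fgrp G" "G \<subseteq> mob UNIV" "60 \<le> card G" "rigid G" by (rule icosahedral_group)
  have "(None :: cp1) \<noteq> Some 0" by simp
  then have cW: "card (wreath G) = 2 * card G * card G" by (intro card_wreath[OF G(1)]) blast
  have "enat 7200 \<le> jordan_constant (aut_group UNIV Z)"
  proof (rule jordan_constant_ge[OF fgrp_wreath[OF G(1)]])
    show "lifts g" if "g \<in> wreath G" for g
      using that by (rule wreathE) (use lifts_mob[OF UNIV_I] G(2) in blast)+
    fix N assume N: "normal_abelian (wreath G) N"
    \<comment> \<open>Rigidity allows the trivial group in the role of \<open>A\<close>, so
      \<open>N\<close> is trivial and the order of the wreath product counts in full.\<close>
    have "card N \<le> card {id :: cp1 \<Rightarrow> cp1} * card {id :: cp1 \<Rightarrow> cp1}"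
    proof (rule wreath_normal_abelian[OF G(1) N])
      show "{id} \<subseteq> G" using fgrpD(2)[OF G(1)] by blast
      show "{id} \<noteq> G" using G(3) by auto
      show "x \<in> {id}" if "x \<in> G" "\<And>t. t \<in> G \<Longrightarrow> x \<circ> (t \<circ> x \<circ> finv t) = (t \<circ> x \<circ> finv t) \<circ> x" for x
        using G(4) that unfolding rigid_def by blast
    qed
    then have "card N \<le> 1" by simp
    moreover have "60 * 60 \<le> card G * card G" by (intro mult_le_mono G(3))
    ultimately show "7200 * card N \<le> card (wreath G)" unfolding cW by linarith
  qed
  then show ?thesis using SZ(1) rational by blast
qed

text \<open>With \<open>\<i>\<close> in the role of \<open>\<delta>\<close> the quadric is a sphere,
  so all of PGL_2(C) acts on it although the base field is real.\<close>

lemma lower_Reals: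
  "\<exists>Z. smooth_quadric_surface \<real> Z \<and> rational_surface_over \<real> Z \<and> enat 60 \<le> jordan_constant (aut_group (\<real> :: complex set) Z)"
proof -
  obtain Z :: "(complex ^ 4) set set" where SZ: "smooth_quadric_surface \<real> Z" "normalized_quadric \<real> Z (mat 1) (mat 1) (- 1) \<i>"
    by (rule standard_quadric[OF subfld_Reals, of "- 1" \<i>]) simp_all
  interpret normalized_quadric \<real> Z "mat 1" "mat 1" "- 1" \<i> by (rule SZ(2))
  obtain G where G: "fgrp G" "G \<subseteq> mob UNIV" "60 \<le> card G" "rigid G" by (rule icosahedral_group)
  define \<phi> where "\<phi> a = map_prod a (cj \<circ> a \<circ> cj)" for a
  have cm: "\<phi> a \<circ> \<phi> b = \<phi> (a \<circ> b)" for a b by (auto simp: \<phi>_def fun_eq_iff)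
  have bj: "bij (\<phi> a)" if "bij a" for a unfolding \<phi>_def using that by (intro bij_map_prodI bij_comp bij_cj)
  have eq: "\<phi> a = \<phi> b \<longleftrightarrow> a = b" for a b unfolding \<phi>_def using map_prod_inject by blast
  have id: "\<phi> id = id" by (auto simp: \<phi>_def fun_eq_iff)
  have inv: "finv (\<phi> a) = \<phi> (finv a)" if "bij a" for a
    by (rule inv_unique_comp) (simp_all add: cm inv_o_bij that id)
  have F: "fgrp (\<phi> ` G)"
    unfolding fgrp_def using fgrpD[OF G(1)] cm bj id by (auto simp: image_iff) metis+
  have R: "rigid (\<phi> ` G)"
    unfolding rigid_def
  proof (intro ballI impI)
    fix x assume "x \<in> \<phi> ` G" "x \<noteq> id"
    then obtain u where u: "x = \<phi> u" "u \<in> G" "u \<noteq> id" using id by auto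
    then obtain t where t: "t \<in> G" "u \<circ> (t \<circ> u \<circ> finv t) \<noteq> (t \<circ> u \<circ> finv t) \<circ> u" using G(4) unfolding rigid_def by blast
    have "x \<circ> (\<phi> t \<circ> x \<circ> finv (\<phi> t)) \<noteq> (\<phi> t \<circ> x \<circ> finv (\<phi> t)) \<circ> x"
      using t(2) unfolding u(1) inv[OF fgrpD(4)[OF G(1) t(1)]] cm eq .
    then show "\<exists>t\<in>\<phi> ` G. x \<circ> (t \<circ> x \<circ> finv t) \<noteq> (t \<circ> x \<circ> finv t) \<circ> x" using t(1) by blast
  qed
  have "card (\<phi> ` G) = card G" by (rule card_image) (simp add: inj_on_def eq)
  have "enat 60 \<le> jordan_constant (aut_group \<real> Z)"
  proof (rule jordan_constant_ge[OF F])
    show "lifts g" if "g \<in> \<phi> ` G" for g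
    proof -
      from that obtain a where "a \<in> G" "g = \<phi> a" by blast
      then show ?thesis unfolding \<phi>_def using lifts_conj[OF refl, of a] G(2) by auto
    qed
    fix N assume "normal_abelian (\<phi> ` G) N"
    from rigid_normal_abelian[OF R this] show "60 * card N \<le> card (\<phi> ` G)"
      using \<open>card (\<phi> ` G) = card G\<close> G(3) by linarith
  qed
  then show ?thesis using SZ(1) rational by blast
qed

lemma lower_Rats:
  "\<exists>Z. smooth_quadric_surface \<rat> Z \<and> rational_surface_over \<rat> Z \<and> enat 8 \<le> jordan_constant (aut_group (\<rat> :: complex set) Z)"
proof -
  obtain Z :: "(complex ^ 4) set set" where SZ: "smooth_quadric_surface \<rat> Z" "normalized_quadric \<rat> Z (mat 1) (mat 1) 1 1"
    by (rule standard_quadric[OF subfld_Rats, of 1 1]) simp_all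
  interpret normalized_quadric \<rat> Z "mat 1" "mat 1" 1 1 by (rule SZ(2))
  obtain G E where G: "fgrp G" "G \<subseteq> mob \<rat>" "E \<subseteq> G" "E \<noteq> G" "card G = 2 * card E"
    "\<And>x. x \<in> G \<Longrightarrow> (\<And>t. t \<in> G \<Longrightarrow> x \<circ> (t \<circ> x \<circ> finv t) = (t \<circ> x \<circ> finv t) \<circ> x) \<Longrightarrow> x \<in> E"
    by (rule s3_group) blast
  have "(None :: cp1) \<noteq> Some 0" by simp
  then have cW: "card (wreath G) = 2 * card G * card G" by (intro card_wreath[OF G(1)]) blast
  have "enat 8 \<le> jordan_constant (aut_group \<rat> Z)"
  proof (rule jordan_constant_ge[OF fgrp_wreath[OF G(1)]])
    show "lifts g" if "g \<in> wreath G" for g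
      using that by (rule wreathE) (use lifts_mob[OF Rats_1] G(2) in blast)+
    fix N assume N: "normal_abelian (wreath G) N"
    have "card N \<le> card E * card E" by (rule wreath_normal_abelian[OF G(1) N G(3,4,6)])
    \<comment> \<open>With e the order of \<open>E\<close>, the wreath product has order 2 * (2 e) *
      (2 e), which is 8 times e * e.\<close>
    then show "8 * card N \<le> card (wreath G)" unfolding cW G(5) by simp
  qed
  then show ?thesis using SZ(1) rational by blast
qed

lemma is_max_jordanI:
  assumes "\<And>Z. smooth_quadric_surface K Z \<Longrightarrow> rational_surface_over K Z \<Longrightarrow> jordan_constant (aut_group K Z) \<le> m"
    "\<exists>Z. smooth_quadric_surface K Z \<and> rational_surface_over K Z \<and> m \<le> jordan_constant (aut_group K Z)"
  shows "is_max_jordan K m"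
  unfolding is_max_jordan_def using assms by (meson order_antisym)

lemma is_max_jordan_quadratic:
  assumes "\<alpha>\<^sup>2 = complex_of_real (of_rat D)" "D < 0"
    and "p1 \<in> rat_adjoin \<alpha>" "p2 \<in> rat_adjoin \<alpha>" "p3 \<in> rat_adjoin \<alpha>" "p4 \<in> rat_adjoin \<alpha>" "p1 \<noteq> 0"
      "p1\<^sup>2 + p2\<^sup>2 + p3\<^sup>2 + p4\<^sup>2 + (p1 + p2 + p3 + p4)\<^sup>2 = 0"
  shows "is_max_jordan (rat_adjoin \<alpha>) (enat 120)"
  using upper_quad[OF rat_adjoin_subfld(1) rat_adjoin_no_sqrt5[OF assms(1,2)]]
    perm_form_attained[OF rat_adjoin_subfld(1) assms(3-8)] by (rule is_max_jordanI)

theorem corollary1p3: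
  shows "is_max_jordan (\<rat> :: complex set) 8 \<and>
    is_max_jordan (\<real> :: complex set) 60 \<and>
    is_max_jordan (rat_adjoin \<i>) 120 \<and>
    is_max_jordan (rat_adjoin (csqrt (-7))) 120 \<and>
    is_max_jordan (UNIV :: complex set) 7200"
proof -
  note a = subfldD[OF rat_adjoin_subfld(1)] rat_adjoin_subfld(2)
  \<comment> \<open>The rational point on the quadric is (1, i, -1, -i), with fifth coordinate
    0.\<close>
  have "is_max_jordan (rat_adjoin \<i>) (enat 120)"
    by (rule is_max_jordan_quadratic[of _ "- 1" 1 \<i> "- 1" "- \<i>"]) (simp_all add: a of_rat_minus)
  moreover define w where "w = csqrt (-7)"
  have w: "w\<^sup>2 = -7" unfolding w_def by (rule power2_csqrt)
  \<comment> \<open>The rational point is (1 + w, 1 - w, 2, -2) with fifth coordinate -2: the first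
    two squares add up to 2 + 2 w^2 = -12, the other three to 12.\<close>
  have "is_max_jordan (rat_adjoin w) (enat 120)"
  proof (rule is_max_jordan_quadratic[of _ "- 7" "1 + w" "1 - w" 2 "- 2"])
    show "w\<^sup>2 = complex_of_real (of_rat (- 7))" using w by (simp add: of_rat_minus)
    show "1 + w \<noteq> 0"
    proof
      assume "1 + w = 0"
      then have "w = - 1" by (simp add: add_eq_0_iff)
      then show False using w by simp
    qed
    show "(1 + w)\<^sup>2 + (1 - w)\<^sup>2 + 2\<^sup>2 + (- 2)\<^sup>2 + (1 + w + (1 - w) + 2 + - 2)\<^sup>2 = 0"
      using w by Groebner_Basis.algebra
  qed (simp_all add: a)
  moreover have "is_max_jordan (\<rat> :: complex set) (enat 8)" using upper_Rats lower_Rats by (rule is_max_jordanI)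
  moreover have "is_max_jordan (\<real> :: complex set) (enat 60)" using upper_Reals lower_Reals by (rule is_max_jordanI)
  moreover have "is_max_jordan (UNIV :: complex set) (enat 7200)" using upper_UNIV lower_UNIV by (rule is_max_jordanI)
  ultimately show ?thesis unfolding w_def by (simp add: numeral_eq_enat)
qed

end
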